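(* Let $K$ be a field, let $A$ be a central simple somewhat commutative infinite dimensional $K$-algebra which is a domain, and let $D$ be its quotient division algebra. Let $L$ be a (commutative) subfield of $D$ that contains $K$. Then $$\mathrm{tr.deg}_K(L)\leq \mathrm{GK}(A)\left(1-\frac{1}{f_A+\max\{f_A,1\}}\right),$$ where $f_A:=\max\{\mathrm{d}_{Q_m}(Q_m\otimes_K A)\mid 0\leq m\leq \mathrm{GK}(A)\}$ ($m$ an integer), $Q_0:=K$, and $Q_m:=K(x_1,\ldots,x_m)$ is the rational function field in $m$ indeterminates.
   Context: Algebras are associative with $1$. A $K$-algebra $A$ is central if its centre is $Z(A)=K$. A $K$-algebra $A$ is somewhat commutative if it has a finite dimensional filtration $A=\bigcup_{i\geq 0}A_i$ such that the associated graded algebra $\mathrm{gr}(A)=\bigoplus_{i\geq 0}A_i/A_{i-1}$ is a commutative finitely generated algebra. Such an algebra is Noetherian and finitely generated, with finite Gelfand-Kirillov dimension; if it is a domain, its quotient division algebra is $D=S^{-1}A$ with $S=A\setminus\{0\}$. For $f:\mathbb{N}\to\mathbb{N}$ put $\gamma(f):=\inf\{r\in\mathbb{R}\mid f(i)\leq i^r \text{ for } i\gg 0\}\in[0,\infty]$. For a finitely generated algebra $A=k\langle a_1,\ldots,a_s\rangle$ over a field $k$, the standard filtration associated with the generators is $A_0=k$, $A_1=k+\sum_j ka_j$, $A_i=A_1^i$; $\mathrm{GK}_k(A)=\gamma(i\mapsto\dim_kA_i)$ is the Gelfand-Kirillov dimension, and $\mathrm{GK}=\mathrm{GK}_K$.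 Filter dimensions: let $A$ be a simple finitely generated algebra over a field $k$ whose centre is algebraic over $k$, and let $F=\{A_i\}$ be a standard filtration. Define $\nu_F(i):=\min\{j\in\mathbb{N}\mid 1\in A_jaA_j \text{ for all } 0\neq a\in A_i\}$ and $\lambda_F(i):=\min\{j\in\mathbb{N}\mid 1\in AaA_j\text{ for all }0\neq a\in A_i\}$, where $A_jaA_j$ is the $k$-span of all $xay$ with $x,y\in A_j$, and $AaA_j$ is the left ideal of $A$ generated by $aA_j$. Then $\mathrm{fd}_k(A):=\gamma(\nu_F)$ and $\mathrm{lfd}_k(A):=\gamma(\lambda_F)$ (both independent of $F$). The symbol $\mathrm{d}_k$ denotes either $\mathrm{fd}_k$ or $\mathrm{lfd}_k$ (one fixed choice; the statement is asserted for each choice). Here $Q_m\otimes_K A$ is regarded as a $Q_m$-algebra, so $k=Q_m$. If $f_A=\infty$, the fraction $1/(f_A+\max\{f_A,1\})$ is read as $0$. *)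

theory Defs
  imports
    "HOL-Library.Poly_Mapping"
    "HOL-Library.Extended_Real"
    "HOL-Computational_Algebra.Fraction_Field"
    "HOL-Algebra.Embedded_Algebras"
    "HOL-Algebra.Generated_Rings"
    "HOL-Algebra.QuotRing"
    "HOL-Algebra.Algebraic_Closure_Type"
begin

text \<open>
  An algebra over a field is given by a (possibly noncommutative) ring \<open>R\<close> together with the
  central subfield \<open>k\<close> of \<open>R\<close> that consists of the scalar multiples of \<open>1\<close>; a nonzero algebra is
  determined by these data. Linear algebra over \<open>k\<close> is the one of
  \<^theory>\<open>HOL-Algebra.Embedded_Algebras\<close>, where \<open>subalgebra k V R\<close> says that \<open>V\<close> is a
  \<open>k\<close>-linear subspace of \<open>R\<close> (closure under multiplication is not demanded).
\<close>

definition centre :: "('a, 'b) ring_scheme \<Rightarrow> 'a set" where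
  "centre R = {z \<in> carrier R. \<forall>x \<in> carrier R. z \<otimes>\<^bsub>R\<^esub> x = x \<otimes>\<^bsub>R\<^esub> z}"

definition simple_ring :: "('a, 'b) ring_scheme \<Rightarrow> bool" where
  "simple_ring R \<longleftrightarrow> ring R \<and> carrier R \<noteq> {\<zero>\<^bsub>R\<^esub>} \<and>
     (\<forall>I. ideal I R \<longrightarrow> I = {\<zero>\<^bsub>R\<^esub>} \<or> I = carrier R)"

definition lin_span :: "('a, 'b) ring_scheme \<Rightarrow> 'a set \<Rightarrow> 'a set \<Rightarrow> 'a set" where
  "lin_span R k S = \<Inter>{V. subalgebra k V R \<and> S \<subseteq> V}"

definition left_ideal :: "'a set \<Rightarrow> ('a, 'b) ring_scheme \<Rightarrow> bool" where
  "left_ideal I R \<longleftrightarrow> subgroup I (add_monoid R) \<and> (\<forall>x \<in> carrier R. \<forall>y \<in> I. x \<otimes>\<^bsub>R\<^esub> y \<in> I)"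

definition left_ideal_gen :: "('a, 'b) ring_scheme \<Rightarrow> 'a set \<Rightarrow> 'a set" where
  "left_ideal_gen R S = \<Inter>{I. left_ideal I R \<and> S \<subseteq> I}"


section \<open>Standard filtrations and growth\<close>

definition alg_generators :: "('a, 'b) ring_scheme \<Rightarrow> 'a set \<Rightarrow> 'a set \<Rightarrow> bool" where
  "alg_generators R k G \<longleftrightarrow>
     finite G \<and> G \<subseteq> carrier R \<and> generate_ring R (k \<union> G) = carrier R"

definition fin_gen_algebra :: "('a, 'b) ring_scheme \<Rightarrow> 'a set \<Rightarrow> bool" where
  "fin_gen_algebra R k \<longleftrightarrow> (\<exists>G. alg_generators R k G)"

fun std_filt :: "('a, 'b) ring_scheme \<Rightarrow> 'a set \<Rightarrow> 'a set \<Rightarrow> nat \<Rightarrow> 'a set" where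
  "std_filt R k G 0 = k"
| "std_filt R k G (Suc i) =
     lin_span R k {x \<otimes>\<^bsub>R\<^esub> y | x y. x \<in> std_filt R k G i \<and> y \<in> lin_span R k (insert \<one>\<^bsub>R\<^esub> G)}"

text \<open>
  The infimum is formed in \<open>[0,\<infinity>]\<close>. Dropping the condition \<open>0 \<le> r\<close> would only matter for
  functions that vanish for all large arguments, whose value would become \<open>-\<infinity>\<close> instead of \<open>0\<close>.
\<close>

definition growth :: "(nat \<Rightarrow> nat) \<Rightarrow> ereal" where
  "growth f = (INF r \<in> {r::real. 0 \<le> r \<and> (\<forall>\<^sub>F i in sequentially. real (f i) \<le> real i powr r)}. ereal r)"

definition nu :: "('a, 'b) ring_scheme \<Rightarrow> 'a set \<Rightarrow> 'a set \<Rightarrow> nat \<Rightarrow> nat" where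
  "nu R k G i = (LEAST j. \<forall>a \<in> std_filt R k G i - {\<zero>\<^bsub>R\<^esub>}.
     \<one>\<^bsub>R\<^esub> \<in> lin_span R k {x \<otimes>\<^bsub>R\<^esub> a \<otimes>\<^bsub>R\<^esub> y | x y. x \<in> std_filt R k G j \<and> y \<in> std_filt R k G j})"

definition lam :: "('a, 'b) ring_scheme \<Rightarrow> 'a set \<Rightarrow> 'a set \<Rightarrow> nat \<Rightarrow> nat" where
  "lam R k G i = (LEAST j. \<forall>a \<in> std_filt R k G i - {\<zero>\<^bsub>R\<^esub>}.
     \<one>\<^bsub>R\<^esub> \<in> left_ideal_gen R {a \<otimes>\<^bsub>R\<^esub> y | y. y \<in> std_filt R k G j})"

text \<open>
  The three dimensions below do not depend on the finite generating set that defines the standard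
  filtration; one such set is chosen.
\<close>

definition some_generators :: "('a, 'b) ring_scheme \<Rightarrow> 'a set \<Rightarrow> 'a set" where
  "some_generators R k = (SOME G. alg_generators R k G)"

definition gk_dim :: "('a, 'b) ring_scheme \<Rightarrow> 'a set \<Rightarrow> ereal" where
  "gk_dim R k = growth (\<lambda>i. ring.dim R k (std_filt R k (some_generators R k) i))"

definition filter_dim :: "'a ring \<Rightarrow> 'a set \<Rightarrow> ereal" where
  "filter_dim R k = growth (nu R k (some_generators R k))"

definition left_filter_dim :: "'a ring \<Rightarrow> 'a set \<Rightarrow> ereal" where
  "left_filter_dim R k = growth (lam R k (some_generators R k))"


section \<open>Somewhat commutative algebras\<close>

definition fin_dim_filtration :: "('a, 'b) ring_scheme \<Rightarrow> 'a set \<Rightarrow> (nat \<Rightarrow> 'a set) \<Rightarrow> bool" where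
  "fin_dim_filtration R k F \<longleftrightarrow>
     (\<forall>i. subalgebra k (F i) R \<and> ring.finite_dimension R k (F i)) \<and>
     (\<forall>i. F i \<subseteq> F (Suc i)) \<and>
     (\<forall>i j. \<forall>x \<in> F i. \<forall>y \<in> F j. x \<otimes>\<^bsub>R\<^esub> y \<in> F (i + j)) \<and>
     \<one>\<^bsub>R\<^esub> \<in> F 0 \<and> (\<Union>i. F i) = carrier R"

text \<open>\<open>prev R F i\<close> is \<open>F (i - 1)\<close>, with \<open>F (-1) = 0\<close>.\<close>

definition prev :: "('a, 'b) ring_scheme \<Rightarrow> (nat \<Rightarrow> 'a set) \<Rightarrow> nat \<Rightarrow> 'a set" where
  "prev R F i = (case i of 0 \<Rightarrow> {\<zero>\<^bsub>R\<^esub>} | Suc j \<Rightarrow> F j)"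

definition gr_scalar :: "('a, 'b) ring_scheme \<Rightarrow> (nat \<Rightarrow> 'a set) \<Rightarrow> 'a \<Rightarrow> nat \<Rightarrow> 'a set" where
  "gr_scalar R F c = (\<lambda>i. prev R F i +>\<^bsub>R\<^esub> (if i = 0 then c else \<zero>\<^bsub>R\<^esub>))"

text \<open>
  An element of the direct sum of the quotients \<open>F i / F (i - 1)\<close> is the family of its components,
  which are cosets of \<open>prev R F i\<close>, almost all of them zero. The \<open>n\<close>-th component of a product is
  the coset of the sum of the products \<open>a i \<otimes> b (n - i)\<close> for arbitrary representatives.
\<close>

definition gr_ring :: "('a, 'b) ring_scheme \<Rightarrow> (nat \<Rightarrow> 'a set) \<Rightarrow> (nat \<Rightarrow> 'a set) ring" where
  "gr_ring R F =
     \<lparr>carrier = {g. (\<forall>i. \<exists>x \<in> F i. g i = prev R F i +>\<^bsub>R\<^esub> x) \<and> finite {i. g i \<noteq> prev R F i}},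
      monoid.mult = (\<lambda>g h n. \<Union>{prev R F n +>\<^bsub>R\<^esub> (\<Oplus>\<^bsub>R\<^esub>i\<in>{..n}. a i \<otimes>\<^bsub>R\<^esub> b (n - i)) | a b.
                          \<forall>i. a i \<in> g i \<and> b i \<in> h i}),
      one = gr_scalar R F \<one>\<^bsub>R\<^esub>,
      zero = prev R F,
      add = (\<lambda>g h n. g n <+>\<^bsub>R\<^esub> h n)\<rparr>"

definition somewhat_commutative :: "('a, 'b) ring_scheme \<Rightarrow> 'a set \<Rightarrow> bool" where
  "somewhat_commutative R k \<longleftrightarrow>
     (\<exists>F. fin_dim_filtration R k F \<and> cring (gr_ring R F) \<and>
          fin_gen_algebra (gr_ring R F) (gr_scalar R F ` k))"


section \<open>Tensor product of algebras\<close>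

text \<open>
  For homomorphisms \<open>\<alpha> : K \<rightarrow> Q\<close> and \<open>\<beta> : K \<rightarrow> A\<close> with central images, the tensor product of
  \<open>Q\<close> and \<open>A\<close> over \<open>K\<close> is the free abelian group on \<open>Q \<times> A\<close> modulo the usual bilinearity and
  balancing relations, with \<open>(q, a) (q', a') = (q q', a a')\<close>. The relations form a two-sided ideal
  for this product.
\<close>

definition free_ring :: "'q ring \<Rightarrow> 'a ring \<Rightarrow> ('q \<times> 'a \<Rightarrow>\<^sub>0 int) ring" where
  "free_ring Q A =
     \<lparr>carrier = {f. Poly_Mapping.keys f \<subseteq> carrier Q \<times> carrier A},
      monoid.mult = (\<lambda>f g. frag_extend (\<lambda>(q, a). frag_extend (\<lambda>(q', a').
                 frag_of (q \<otimes>\<^bsub>Q\<^esub> q', a \<otimes>\<^bsub>A\<^esub> a')) g) f),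
      one = frag_of (\<one>\<^bsub>Q\<^esub>, \<one>\<^bsub>A\<^esub>),
      zero = 0,
      add = (+)\<rparr>"

definition tensor_relations ::
  "'k ring \<Rightarrow> 'q ring \<Rightarrow> 'a ring \<Rightarrow> ('k \<Rightarrow> 'q) \<Rightarrow> ('k \<Rightarrow> 'a) \<Rightarrow> ('q \<times> 'a \<Rightarrow>\<^sub>0 int) set" where
  "tensor_relations K Q A \<alpha> \<beta> = generate (add_monoid (free_ring Q A))
     ({frag_of (q \<oplus>\<^bsub>Q\<^esub> q', a) - frag_of (q, a) - frag_of (q', a) | q q' a.
         q \<in> carrier Q \<and> q' \<in> carrier Q \<and> a \<in> carrier A}
    \<union> {frag_of (q, a \<oplus>\<^bsub>A\<^esub> a') - frag_of (q, a) - frag_of (q, a') | q a a'.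
         q \<in> carrier Q \<and> a \<in> carrier A \<and> a' \<in> carrier A}
    \<union> {frag_of (q \<otimes>\<^bsub>Q\<^esub> \<alpha> c, a) - frag_of (q, \<beta> c \<otimes>\<^bsub>A\<^esub> a) | q c a.
         q \<in> carrier Q \<and> c \<in> carrier K \<and> a \<in> carrier A})"

definition tensor_algebra ::
  "'k ring \<Rightarrow> 'q ring \<Rightarrow> 'a ring \<Rightarrow> ('k \<Rightarrow> 'q) \<Rightarrow> ('k \<Rightarrow> 'a) \<Rightarrow> ('q \<times> 'a \<Rightarrow>\<^sub>0 int) set ring" where
  "tensor_algebra K Q A \<alpha> \<beta> = free_ring Q A Quot tensor_relations K Q A \<alpha> \<beta>"

definition tensor_scalars ::
  "'k ring \<Rightarrow> 'q ring \<Rightarrow> 'a ring \<Rightarrow> ('k \<Rightarrow> 'q) \<Rightarrow> ('k \<Rightarrow> 'a) \<Rightarrow> ('q \<times> 'a \<Rightarrow>\<^sub>0 int) set set" where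
  "tensor_scalars K Q A \<alpha> \<beta> =
     (\<lambda>q. tensor_relations K Q A \<alpha> \<beta> +>\<^bsub>free_ring Q A\<^esub> frag_of (q, \<one>\<^bsub>A\<^esub>)) ` carrier Q"


section \<open>Rational functions\<close>

text \<open>
  Polynomials over \<open>'k\<close> in the indeterminates \<open>x\<^sub>0, x\<^sub>1, \<dots>\<close>: finitely supported functions on
  monomials, which are finitely supported exponent functions.
\<close>

type_synonym 'k mpoly = "(nat \<Rightarrow>\<^sub>0 nat) \<Rightarrow>\<^sub>0 'k"

definition in_vars :: "nat \<Rightarrow> 'k::zero mpoly \<Rightarrow> bool" where
  "in_vars m p \<longleftrightarrow> (\<forall>e \<in> Poly_Mapping.keys p. Poly_Mapping.keys e \<subseteq> {..<m})"

text \<open>The field \<open>K(x\<^sub>0,\<dots>,x\<^sub>m\<^sub>-\<^sub>1)\<close>, inside the field of rational functions in all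
  indeterminates. For \<open>m = 0\<close> it is the image of \<open>'k\<close> under the map \<open>rat_const\<close> below.\<close>

definition rat_fun_field :: "nat \<Rightarrow> 'k::field mpoly fract ring" where
  "rat_fun_field m = ring_of_type_algebra
     \<lparr>carrier := {Fract p q | p q. in_vars m p \<and> in_vars m q \<and> q \<noteq> 0}\<rparr>"

definition rat_const :: "'k::field \<Rightarrow> 'k mpoly fract" where
  "rat_const c = Fract (Poly_Mapping.single 0 c) 1"

definition rat_tensor ::
  "nat \<Rightarrow> ('k::field \<Rightarrow> 'a::ring_1) \<Rightarrow> ('k mpoly fract \<times> 'a \<Rightarrow>\<^sub>0 int) set ring" where
  "rat_tensor m \<phi> =
     tensor_algebra ring_of_type_algebra (rat_fun_field m) ring_of_type_algebra rat_const \<phi>"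

definition rat_tensor_scalars ::
  "nat \<Rightarrow> ('k::field \<Rightarrow> 'a::ring_1) \<Rightarrow> ('k mpoly fract \<times> 'a \<Rightarrow>\<^sub>0 int) set set" where
  "rat_tensor_scalars m \<phi> =
     tensor_scalars ring_of_type_algebra (rat_fun_field m) ring_of_type_algebra rat_const \<phi>"

text \<open>
  The maximum of the values \<open>d\<close> of the \<open>K(x\<^sub>0,\<dots>,x\<^sub>m\<^sub>-\<^sub>1)\<close>-algebras obtained from the algebra \<open>'a\<close>
  with structure map \<open>\<phi>\<close> by extension of scalars.
\<close>

definition max_dim ::
  "(('k mpoly fract \<times> 'a \<Rightarrow>\<^sub>0 int) set ring \<Rightarrow> ('k mpoly fract \<times> 'a \<Rightarrow>\<^sub>0 int) set set \<Rightarrow> ereal)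
     \<Rightarrow> ('k::field \<Rightarrow> 'a::ring_1) \<Rightarrow> ereal" where
  "max_dim d \<phi> = Max {d (rat_tensor m \<phi>) (rat_tensor_scalars m \<phi>) | m :: nat.
     ereal (real m) \<le> gk_dim ring_of_type_algebra (range \<phi>)}"


section \<open>Transcendence degree and quotient division rings\<close>

text \<open>Evaluation at \<open>x\<^sub>i = xs ! i\<close>; it is only used for pairwise commuting \<open>xs\<close>.\<close>

definition eval_mpoly :: "('k::zero \<Rightarrow> 'd::ring_1) \<Rightarrow> 'd list \<Rightarrow> 'k mpoly \<Rightarrow> 'd" where
  "eval_mpoly \<psi> xs p = (\<Sum>e \<in> Poly_Mapping.keys p. \<psi> (Poly_Mapping.lookup p e) *
     prod_list (map (\<lambda>i. xs ! i ^ Poly_Mapping.lookup e i) [0..<length xs]))"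

definition alg_independent :: "('k::zero \<Rightarrow> 'd::ring_1) \<Rightarrow> 'd list \<Rightarrow> bool" where
  "alg_independent \<psi> xs \<longleftrightarrow>
     (\<forall>p. in_vars (length xs) p \<and> eval_mpoly \<psi> xs p = 0 \<longrightarrow> p = 0)"

definition trdeg :: "('k::zero \<Rightarrow> 'd::ring_1) \<Rightarrow> 'd set \<Rightarrow> ereal" where
  "trdeg \<psi> L = (SUP xs \<in> {xs. set xs \<subseteq> L \<and> alg_independent \<psi> xs}. ereal (real (length xs)))"

text \<open>
  \<open>\<iota>\<close> exhibits the division ring \<open>'d\<close> as the localisation \<open>S\<^sup>-\<^sup>1 A\<close> of the domain \<open>A = 'a\<close> at the
  set \<open>S\<close> of its nonzero elements.
\<close>

definition quotient_division_ring ::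
  "('a::ring_1_no_zero_divisors \<Rightarrow> 'd::division_ring) \<Rightarrow> bool" where
  "quotient_division_ring \<iota> \<longleftrightarrow>
     \<iota> \<in> ring_hom ring_of_type_algebra ring_of_type_algebra \<and> inj \<iota> \<and>
     (\<forall>d. \<exists>s a. s \<noteq> 0 \<and> d = inverse (\<iota> s) * \<iota> a)"

end

theory Submission
  imports Defs
begin

text \<open>
  Let \<open>A\<close> be the given algebra, \<open>D\<close> its division ring, \<open>n\<close> its Gelfand--Kirillov dimension, and
  let \<open>x\<^sub>1, \<dots>, x\<^sub>m\<close> be algebraically independent elements of the subfield \<open>L\<close>. The theorem follows
  from the inequality \<open>n \<le> (n - m) (\<delta> + max \<delta> 1)\<close>, where \<open>\<delta>\<close> is the filter dimension (or left
  filter dimension) of the algebra \<open>B\<close> obtained from \<open>A\<close> by extension of scalars to the rational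
  functions in \<open>m\<close> indeterminates: one solves for \<open>m\<close> and replaces \<open>\<delta>\<close> by the maximum in the
  statement.

  The algebra \<open>B\<close> acts on \<open>D\<close>. Elements of \<open>A\<close> act by left multiplication and the indeterminates
  by right multiplication with the \<open>x\<^sub>j\<close>, which commute with each other. The proof plays two
  facts about this module against each other.

  The module is small. There is some \<open>u \<noteq> 0\<close> in \<open>D\<close> for which the products \<open>a u x\<^sup>\<beta>\<close>, with \<open>a\<close> of
  filtration degree \<open>l\<close> and \<open>l + |\<beta>| \<le> i\<close>, span a space of dimension \<open>O(i\<^sup>n)\<close> over the ground
  field; so commuting elements can be adjoined without raising the order of growth (theorem
  \<open>bounded_growth_with_commuting_elements\<close>). Consequently, the rank of \<open>F\<^sub>l u\<close> over the rational
  functions is \<open>O(l\<^sup>n\<^sup>-\<^sup>m)\<close>. The core of the construction of \<open>u\<close>, lemma \<open>extension_step\<close>, passes to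
  a nonzero submodule of minimal multiplicity in dimension \<open>n\<close>: its quotients by nonzero
  submodules have smaller dimension. Dimension and multiplicity are read off from leading
  exponents: since the associated graded algebra of \<open>A\<close> is commutative, ordered monomials in
  generators of \<open>A\<close> multiply like commutative ones up to smaller terms, so that submodules have
  staircases of exponents and standard bases as ideals of a polynomial ring do.

  The module is faithful in a quantitative sense. By definition of the filter dimensions, \<open>1\<close>
  lies in the left ideal generated by \<open>b B\<^sub>j\<close> for every \<open>b \<noteq> 0\<close> in the \<open>i\<close>-th piece of the
  standard filtration of \<open>B\<close>, where \<open>j = \<nu> i\<close> grows like \<open>i\<close> to the power \<open>\<delta>\<close>; hence \<open>b\<close> cannot
  annihilate \<open>B\<^sub>j u\<close> (lemma \<open>faithful\<close>). That such a \<open>j\<close> exists at all comes from density of the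
  left and right multiplications in a central simple algebra (theorem \<open>density\<close>).

  Theorem \<open>filter_inequality\<close> compares the two by counting coefficients. An element of \<open>B\<close> with
  coefficients of degree at most \<open>d\<close> with respect to a basis of \<open>A\<^sub>i\<close> that annihilates \<open>F\<^sub>l u\<close>,
  for \<open>l\<close> proportional to \<open>\<nu> i\<close>, must be zero; the rank estimate bounds the number of equations
  that express the annihilation. The outcome is that the dimension of \<open>A\<^sub>i\<close> is \<open>O(l\<^sup>n\<^sup>-\<^sup>m d\<^sup>n\<^sup>-\<^sup>m)\<close>
  with \<open>d\<close> of the order of \<open>i + l\<close>. As \<open>dim A\<^sub>i\<close> grows like \<open>i\<^sup>n\<close>, comparison of exponents gives
  the inequality above.
\<close>

section \<open>Orthants and down-closed sets of exponents\<close>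

text \<open>
  Exponents of monomials in \<open>p\<close> variables are functions on all of \<open>nat\<close>, so that a further
  variable can be adjoined within the same type.
\<close>

definition exps :: "nat \<Rightarrow> (nat \<Rightarrow> nat) set" where
  "exps p = {\<alpha>. \<forall>i\<ge>p. \<alpha> i = 0}"

definition wt :: "nat \<Rightarrow> (nat \<Rightarrow> nat) \<Rightarrow> (nat \<Rightarrow> nat) \<Rightarrow> nat" where
  "wt p w \<alpha> = (\<Sum>i<p. w i * \<alpha> i)"

definition down_closed :: "nat \<Rightarrow> (nat \<Rightarrow> nat) set \<Rightarrow> bool" where
  "down_closed p E \<longleftrightarrow> E \<subseteq> exps p \<and> (\<forall>\<alpha>\<in>E. \<forall>\<beta>. \<beta> \<le> \<alpha> \<longrightarrow> \<beta> \<in> E)"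

text \<open>
  The orthant with corner \<open>\<beta>\<close> and free directions \<open>S\<close>. Differences of down-closed sets are
  finite unions of such orthants, and the number of free directions is the dimension of a piece.
\<close>

definition orthant :: "(nat \<Rightarrow> nat) \<Rightarrow> nat set \<Rightarrow> (nat \<Rightarrow> nat) set" where
  "orthant \<beta> S = {\<alpha>. \<forall>i. \<beta> i \<le> \<alpha> i \<and> (i \<notin> S \<longrightarrow> \<alpha> i = \<beta> i)}"

text \<open>
  The coordinates are treated one after the other. A sequence of natural numbers has a monotone
  subsequence, and a decreasing one is constant from some point on.
\<close>

lemma dickson_subsequence:
  fixes f :: "nat \<Rightarrow> nat \<Rightarrow> nat"
  shows "\<exists>r::nat \<Rightarrow> nat. strict_mono r \<and> (\<forall>l<p. mono (\<lambda>i. f (r i) l))"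
proof (induction p)
  case 0
  show ?case by (rule exI[of _ "\<lambda>x. x"]) (auto intro: strict_monoI)
next
  case (Suc p)
  then obtain r :: "nat \<Rightarrow> nat" where r: "strict_mono r" "\<forall>l<p. mono (\<lambda>i. f (r i) l)" by blast
  obtain t where t: "strict_mono t" "monoseq (\<lambda>i. f (r (t i)) p)"
    using seq_monosub[of "\<lambda>i. f (r i) p"] by (auto simp: o_def)
  have "\<exists>m. mono (\<lambda>i. f (r (t (m + i))) p)"
  proof (cases "\<forall>m n. m \<le> n \<longrightarrow> f (r (t m)) p \<le> f (r (t n)) p")
    case True
    then show ?thesis by (intro exI[of _ 0] monoI) auto
  next
    case False
    with t(2) have dec: "\<And>m n. m \<le> n \<Longrightarrow> f (r (t n)) p \<le> f (r (t m)) p"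
      unfolding monoseq_def by metis
    define v where "v = (LEAST v. \<exists>i. f (r (t i)) p = v)"
    have "\<exists>i. f (r (t i)) p = v" unfolding v_def by (rule LeastI_ex) blast
    then obtain m where m: "f (r (t m)) p = v" by blast
    have "f (r (t (m + i))) p = v" for i
    proof (rule antisym)
      show "f (r (t (m + i))) p \<le> v" using dec[of m "m + i"] m by simp
      show "v \<le> f (r (t (m + i))) p" unfolding v_def by (rule Least_le) blast
    qed
    then show ?thesis by (intro exI[of _ m] monoI) auto
  qed
  then obtain m where m: "mono (\<lambda>i. f (r (t (m + i))) p)" by blast
  have "strict_mono (\<lambda>i. r (t (m + i)))"
    using r(1) t(1) by (auto intro!: strict_monoI simp: strict_mono_less)
  moreover have "mono (\<lambda>i. f (r (t (m + i))) l)" if "l < Suc p" for l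
  proof (cases "l = p")
    case True then show ?thesis using m by simp
  next
    case False
    then have "mono (\<lambda>i. f (r i) l)" using r(2) that by auto
    moreover have "mono (\<lambda>i. t (m + i))"
      using t(1) by (auto intro!: monoI simp: strict_mono_less_eq)
    ultimately show ?thesis by (intro monoI) (metis monoD)
  qed
  ultimately show ?case by blast
qed

text \<open>
  Dickson's lemma, which is behind the finiteness statements about monomials below.
\<close>

lemma dickson:
  fixes f :: "nat \<Rightarrow> nat \<Rightarrow> nat"
  assumes "\<And>i. f i \<in> exps p"
  shows "\<exists>i j. i < j \<and> f i \<le> f j"
proof -
  obtain r :: "nat \<Rightarrow> nat" where r: "strict_mono r" "\<forall>l<p. mono (\<lambda>i. f (r i) l)"
    using dickson_subsequence by blast
  have "f (r 0) l \<le> f (r 1) l" for l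
  proof (cases "l < p")
    case True
    then show ?thesis using r(2) by (auto dest!: monoD[of _ 0 1])
  next
    case False
    then show ?thesis using assms by (auto simp: exps_def)
  qed
  moreover have "r 0 < r 1" using r(1) by (simp add: strict_mono_less)
  ultimately show ?thesis by (auto simp: le_fun_def)
qed

text \<open>
  Elements that are dropped at later and later stages would form a sequence in which no term
  lies below a later one, against Dickson's lemma.
\<close>

lemma down_closed_chain_stabilises:
  assumes dc: "\<And>k. down_closed p (E k)" and dec: "\<And>k l. k \<le> l \<Longrightarrow> E l \<subseteq> E k"
  shows "\<exists>k0. \<forall>k\<ge>k0. E k = E (k0::nat)"
proof (rule ccontr)
  assume "\<not> ?thesis"
  then have "\<forall>k. \<exists>l>k. E l \<noteq> E k" by (metis order_le_less)
  then have "\<forall>k. \<exists>l. l > k \<and> (\<exists>\<alpha>. \<alpha> \<in> E k - E l)"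
    by (metis dec Diff_iff less_imp_le subsetI subset_antisym)
  then obtain nx where nx: "\<And>k. nx k > k" "\<And>k. \<exists>\<alpha>. \<alpha> \<in> E k - E (nx k)"
    by metis
  then obtain g where g: "\<And>k. g k \<in> E k - E (nx k)" by metis
  define s where "s i = (nx ^^ i) 0" for i
  have s: "s (Suc i) = nx (s i)" for i by (simp add: s_def)
  have sm: "strict_mono s" by (rule strict_mono_Suc_iff[THEN iffD2]) (use s nx in auto)
  obtain i j where ij: "i < j" "g (s i) \<le> g (s j)"
    using dickson[of "\<lambda>i. g (s i)" p] g dc unfolding down_closed_def by blast
  have "s (Suc i) \<le> s j" using ij sm by (simp add: strict_mono_less_eq Suc_leI)
  then have "g (s j) \<in> E (nx (s i))" using g[of "s j"] dec s by fastforce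
  then have "g (s i) \<in> E (nx (s i))" using dc ij(2) unfolding down_closed_def by blast
  then show False using g by blast
qed

lemma orthant_empty: "orthant \<beta> {} = {\<beta>}"
  by (auto simp: orthant_def)

lemma orthant_slice:
  assumes "\<beta> p = 0" "p \<notin> S"
  shows "orthant (\<beta>(p := k)) S = {\<alpha>. \<alpha> p = k \<and> \<alpha>(p := 0) \<in> orthant \<beta> S}"
    and "orthant (\<beta>(p := k)) (insert p S) = {\<alpha>. k \<le> \<alpha> p \<and> \<alpha>(p := 0) \<in> orthant \<beta> S}"
  using assms by (auto simp: orthant_def fun_upd_def split: if_splits)

text \<open>
  The sets are cut along the last coordinate. The slices decrease with the value of that
  coordinate, so they are constant from some value \<open>m\<close> on. A slice below \<open>m\<close> contributes
  orthants on which the last coordinate is fixed, and the stable slice contributes orthants on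
  which it is free.
\<close>

lemma down_closed_diff_decomposition:
  assumes "down_closed p E" "down_closed p E'"
  shows "\<exists>C. finite C \<and> (\<forall>(\<beta>,S)\<in>C. \<beta> \<in> exps p \<and> S \<subseteq> {..<p}) \<and>
     E - E' = (\<Union>(\<beta>,S)\<in>C. orthant \<beta> S)"
  using assms
proof (induction p arbitrary: E E')
  case 0
  have "E - E' \<subseteq> {\<lambda>_. 0}" using 0 by (auto simp: down_closed_def exps_def fun_eq_iff)
  then consider "E - E' = {}" | "E - E' = {\<lambda>_. 0}" by blast
  then show ?case
  proof cases
    case 1 then show ?thesis by (intro exI[of _ "{}"]) auto
  next
    case 2 then show ?thesis
      by (intro exI[of _ "{(\<lambda>_. 0, {})}"]) (auto simp: orthant_empty exps_def)
  qed
next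
  case (Suc p)
  define sl where "sl E k = {\<alpha> \<in> exps p. \<alpha>(p := k) \<in> E}" for E k
  have dc: "down_closed p (sl E k)" if "down_closed (Suc p) E" for E k
    unfolding down_closed_def
  proof (intro conjI ballI allI impI)
    show "sl E k \<subseteq> exps p" by (auto simp: sl_def)
    fix \<alpha> \<beta> assume a: "\<alpha> \<in> sl E k" and b: "\<beta> \<le> \<alpha>"
    then have "\<beta>(p := k) \<le> \<alpha>(p := k)" by (auto simp: le_fun_def)
    moreover have "\<beta> \<in> exps p" using a b
      by (auto simp: sl_def exps_def le_fun_def) (metis bot_nat_0.extremum_uniqueI)
    ultimately show "\<beta> \<in> sl E k" using a that by (auto simp: sl_def down_closed_def)
  qed
  have dec: "sl E l \<subseteq> sl E k" if "down_closed (Suc p) E" "k \<le> l" for E k l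
  proof
    fix \<alpha> assume a: "\<alpha> \<in> sl E l"
    have "\<alpha>(p := k) \<le> \<alpha>(p := l)" using that by (auto simp: le_fun_def)
    then show "\<alpha> \<in> sl E k" using a that by (auto simp: sl_def down_closed_def)
  qed
  obtain k1 where k1: "\<forall>k\<ge>k1. sl E k = sl E k1"
    using down_closed_chain_stabilises[of p "sl E"] dc dec Suc.prems by blast
  obtain k2 where k2: "\<forall>k\<ge>k2. sl E' k = sl E' k2"
    using down_closed_chain_stabilises[of p "sl E'"] dc dec Suc.prems by blast
  define m where "m = max k1 k2"
  have m: "sl E k - sl E' k = sl E m - sl E' m" if "k \<ge> m" for k
  proof -
    have "sl E k = sl E k1" "sl E m = sl E k1" "sl E' k = sl E' k2" "sl E' m = sl E' k2"
      using k1[rule_format, of k] k1[rule_format, of m] k2[rule_format, of k] k2[rule_format, of m] that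
      by (auto simp: m_def)
    then show ?thesis by simp
  qed
  have "\<exists>C. finite C \<and> (\<forall>(\<beta>,S)\<in>C. \<beta> \<in> exps p \<and> S \<subseteq> {..<p}) \<and>
     sl E k - sl E' k = (\<Union>(\<beta>,S)\<in>C. orthant \<beta> S)" for k
    by (rule Suc.IH[OF dc[OF Suc.prems(1)] dc[OF Suc.prems(2)]])
  then obtain C where C0: "\<And>k. finite (C k) \<and> (\<forall>(\<beta>,S)\<in>C k. \<beta> \<in> exps p \<and> S \<subseteq> {..<p}) \<and>
     sl E k - sl E' k = (\<Union>(\<beta>,S)\<in>C k. orthant \<beta> S)"
    by (rule that[OF someI_ex])
  then have C: "\<And>k. finite (C k)"
     "\<And>k \<beta> S. (\<beta>,S) \<in> C k \<Longrightarrow> \<beta> \<in> exps p \<and> S \<subseteq> {..<p}"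
     "\<And>k. sl E k - sl E' k = (\<Union>(\<beta>,S)\<in>C k. orthant \<beta> S)"
    by (blast, blast, simp)
  define CC where "CC = (\<Union>k<m. (\<lambda>(\<beta>,S). (\<beta>(p := k), S)) ` C k) \<union> (\<lambda>(\<beta>,S). (\<beta>(p := m), insert p S)) ` C m"
  have mem: "\<alpha> \<in> E - E' \<longleftrightarrow> \<alpha> \<in> exps (Suc p) \<and> \<alpha>(p := 0) \<in> sl E (\<alpha> p) - sl E' (\<alpha> p)" for \<alpha>
    using Suc.prems by (auto simp: sl_def down_closed_def exps_def not_less_eq_eq)
  have cs1: "orthant (\<beta>(p := j)) S = {\<alpha>. \<alpha> p = j \<and> \<alpha>(p := 0) \<in> orthant \<beta> S}"
    and cs2: "orthant (\<beta>(p := j)) (insert p S) = {\<alpha>. j \<le> \<alpha> p \<and> \<alpha>(p := 0) \<in> orthant \<beta> S}"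
    if "(\<beta>, S) \<in> C k" for \<beta> S k j
  proof -
    have "\<beta> p = 0" "p \<notin> S" using C(2)[OF that] by (auto simp: exps_def)
    then show "orthant (\<beta>(p := j)) S = {\<alpha>. \<alpha> p = j \<and> \<alpha>(p := 0) \<in> orthant \<beta> S}"
      "orthant (\<beta>(p := j)) (insert p S) = {\<alpha>. j \<le> \<alpha> p \<and> \<alpha>(p := 0) \<in> orthant \<beta> S}"
      using orthant_slice[where \<beta> = \<beta> and p = p and S = S and k = j] by simp_all
  qed
  have cexp: "\<alpha> \<in> exps (Suc p)" if "(\<beta>, S) \<in> C k" "\<alpha>(p := 0) \<in> orthant \<beta> S" for \<alpha> \<beta> S k
  proof -
    have "\<alpha> i = 0" if "i \<ge> Suc p" for i
    proof -
      have "i \<noteq> p" "i \<notin> S" "\<beta> i = 0" using that C(2)[OF \<open>(\<beta>, S) \<in> C k\<close>] by (auto simp: exps_def)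
      then show ?thesis using \<open>\<alpha>(p := 0) \<in> orthant \<beta> S\<close> by (auto simp: orthant_def fun_upd_def split: if_splits)
    qed
    then show ?thesis by (auto simp: exps_def)
  qed
  have "finite CC" unfolding CC_def using C(1) by auto
  moreover have "\<forall>(\<beta>,S)\<in>CC. \<beta> \<in> exps (Suc p) \<and> S \<subseteq> {..<Suc p}"
    unfolding CC_def using C(2) by (fastforce simp: exps_def)
  moreover have "E - E' = (\<Union>(\<beta>,S)\<in>CC. orthant \<beta> S)"
  proof (intro Set.set_eqI iffI)
    fix \<alpha> assume "\<alpha> \<in> E - E'"
    then have a: "\<alpha>(p := 0) \<in> sl E (\<alpha> p) - sl E' (\<alpha> p)" using mem by blast
    show "\<alpha> \<in> (\<Union>(\<beta>,S)\<in>CC. orthant \<beta> S)"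
    proof (cases "\<alpha> p < m")
      case True
      obtain \<beta> S where bs: "(\<beta>,S) \<in> C (\<alpha> p)" "\<alpha>(p := 0) \<in> orthant \<beta> S" using a unfolding C(3) by blast
      then have "(\<beta>(p := \<alpha> p), S) \<in> CC" unfolding CC_def using True by force
      moreover have "\<alpha> \<in> orthant (\<beta>(p := \<alpha> p)) S" using bs(2) by (simp add: cs1[OF bs(1)])
      ultimately show ?thesis by blast
    next
      case False
      then have "\<alpha>(p := 0) \<in> sl E m - sl E' m" using a m[of "\<alpha> p"] by auto
      then obtain \<beta> S where bs: "(\<beta>,S) \<in> C m" "\<alpha>(p := 0) \<in> orthant \<beta> S" unfolding C(3) by blast
      then have "(\<beta>(p := m), insert p S) \<in> CC" unfolding CC_def by force
      moreover have "\<alpha> \<in> orthant (\<beta>(p := m)) (insert p S)" using bs(2) False by (simp add: cs2[OF bs(1)])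
      ultimately show ?thesis by blast
    qed
  next
    fix \<alpha> assume "\<alpha> \<in> (\<Union>(\<beta>,S)\<in>CC. orthant \<beta> S)"
    then obtain \<beta> S where "(\<beta>,S) \<in> CC" and al: "\<alpha> \<in> orthant \<beta> S" by blast
    then consider \<beta>' k where "k < m" "(\<beta>', S) \<in> C k" "\<beta> = \<beta>'(p := k)"
      | \<beta>' S' where "(\<beta>', S') \<in> C m" "\<beta> = \<beta>'(p := m)" "S = insert p S'"
      unfolding CC_def by auto
    then show "\<alpha> \<in> E - E'"
    proof cases
      case 1
      have a: "\<alpha> p = k" "\<alpha>(p := 0) \<in> orthant \<beta>' S" using al by (simp_all add: 1(3) cs1[OF 1(2)])
      have "\<alpha>(p := 0) \<in> sl E k - sl E' k" unfolding C(3) using a 1(2) by blast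
      then show ?thesis using mem[of \<alpha>] a(1) cexp[OF 1(2) a(2)] by simp
    next
      case 2
      have a: "\<alpha> p \<ge> m" "\<alpha>(p := 0) \<in> orthant \<beta>' S'" using al by (simp_all add: 2(2,3) cs2[OF 2(1)])
      have "\<alpha>(p := 0) \<in> sl E m - sl E' m" unfolding C(3) using a 2(1) by blast
      then have "\<alpha>(p := 0) \<in> sl E (\<alpha> p) - sl E' (\<alpha> p)" using m[OF a(1)] by simp
      then show ?thesis using mem[of \<alpha>] cexp[OF 2(1) a(2)] by simp
    qed
  qed
  ultimately show ?case by blast
qed

lemma down_closed_diff_orthants:
  assumes "down_closed p E" "down_closed p E'"
  obtains C where "finite C" "\<And>\<beta> S. (\<beta>,S) \<in> C \<Longrightarrow> S \<subseteq> {..<p}" "E - E' = (\<Union>(\<beta>,S)\<in>C. orthant \<beta> S)"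
proof -
  obtain C where C: "finite C \<and> (\<forall>(\<beta>,S)\<in>C. \<beta> \<in> exps p \<and> S \<subseteq> {..<p}) \<and>
     E - E' = (\<Union>(\<beta>,S)\<in>C. orthant \<beta> S)"
    using down_closed_diff_decomposition[OF assms] by (rule exE)
  have "S \<subseteq> {..<p}" if "(\<beta>,S) \<in> C" for \<beta> S using conjunct1[OF conjunct2[OF C]] that by auto
  then show thesis using C by (intro that[of C]) simp_all
qed

lemma wt_add: "wt p w (\<lambda>i. \<alpha> i + \<beta> i) = wt p w \<alpha> + wt p w \<beta>"
  by (simp add: wt_def algebra_simps sum.distrib)

lemma wt_component: "i < p \<Longrightarrow> w i * \<alpha> i \<le> wt p w \<alpha>"
  unfolding wt_def by (rule member_le_sum) auto

lemma component_le_wt: "i < p \<Longrightarrow> w i \<ge> 1 \<Longrightarrow> \<alpha> i \<le> wt p w \<alpha>"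
  using wt_component[of i p w \<alpha>] by (metis dual_order.trans le_square mult_le_mono1 mult_1 nat_mult_1)

lemma orthant_eqI:
  assumes "\<alpha> \<in> orthant \<beta> S" "\<alpha>' \<in> orthant \<beta> S" "\<And>i. i \<in> S \<Longrightarrow> \<alpha> i = \<alpha>' i"
  shows "\<alpha> = \<alpha>'"
  using assms by (auto simp: orthant_def fun_eq_iff) metis

text \<open>
  A point of the orthant is determined by its coordinates in \<open>S\<close>, which are bounded by the
  weight as the weights of these variables are positive.
\<close>

lemma orthant_count:
  assumes S: "S \<subseteq> {..<p}" and w: "\<And>s. s \<in> S \<Longrightarrow> w s \<ge> 1"
  shows "finite {\<alpha>\<in>orthant \<beta> S. wt p w \<alpha> \<le> i}"
    and "card {\<alpha>\<in>orthant \<beta> S. wt p w \<alpha> \<le> i} \<le> (i+1) ^ card S"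
proof -
  let ?Z = "{\<alpha>\<in>orthant \<beta> S. wt p w \<alpha> \<le> i}"
  have fS: "finite S" using S finite_subset by blast
  have inj: "inj_on (\<lambda>\<alpha>. restrict \<alpha> S) ?Z"
    by (rule inj_onI) (metis (no_types, lifting) orthant_eqI mem_Collect_eq restrict_apply)
  have sub: "(\<lambda>\<alpha>. restrict \<alpha> S) ` ?Z \<subseteq> PiE S (\<lambda>_. {..i})"
  proof (rule image_subsetI)
    fix \<alpha> assume "\<alpha> \<in> ?Z"
    then have "\<alpha> s \<le> i" if "s \<in> S" for s
      using component_le_wt[of s p w \<alpha>] that S w by force
    then show "restrict \<alpha> S \<in> PiE S (\<lambda>_. {..i})" by auto
  qed
  have fin: "finite (PiE S (\<lambda>_. {..i}))" using fS by (simp add: finite_PiE)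
  show "finite ?Z" using inj_on_finite[OF inj sub fin] .
  have "card ?Z \<le> card (PiE S (\<lambda>_. {..i}))" using card_inj_on_le[OF inj sub fin] .
  also have "\<dots> = (i+1) ^ card S" using fS by (simp add: card_PiE)
  finally show "card ?Z \<le> (i+1) ^ card S" .
qed

text \<open>
  Inside a band of weights of fixed width, the weight and all free coordinates but one determine
  the point. This saves one power of \<open>i\<close> against the count of all points of bounded weight.
\<close>

lemma orthant_band_count:
  assumes S: "S \<subseteq> {..<p}" and w: "\<And>s. s \<in> S \<Longrightarrow> w s \<ge> 1"
  shows "card {\<alpha>\<in>orthant \<beta> S. i < wt p w \<alpha> \<and> wt p w \<alpha> \<le> i + c} \<le> (c+1) * (i+c+1) ^ (card S - 1)"
proof (cases "S = {}")
  case True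
  have "card {\<alpha>\<in>orthant \<beta> S. i < wt p w \<alpha> \<and> wt p w \<alpha> \<le> i + c} \<le> card {\<beta>}"
    by (rule card_mono) (auto simp: True orthant_empty)
  then show ?thesis using True by simp
next
  case False
  then obtain s where s: "s \<in> S" by blast
  let ?Z = "{\<alpha>\<in>orthant \<beta> S. i < wt p w \<alpha> \<and> wt p w \<alpha> \<le> i + c}"
  let ?T = "S - {s}"
  let ?Y = "{i<..i+c} \<times> PiE ?T (\<lambda>_. {..i+c})"
  have fS: "finite S" using S finite_subset by blast
  have inj: "inj_on (\<lambda>\<alpha>. (wt p w \<alpha>, restrict \<alpha> ?T)) ?Z"
  proof (rule inj_onI)
    fix \<alpha> \<alpha>' assume a: "\<alpha> \<in> ?Z" "\<alpha>' \<in> ?Z" and eq: "(wt p w \<alpha>, restrict \<alpha> ?T) = (wt p w \<alpha>', restrict \<alpha>' ?T)"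
    have e: "\<alpha> j = \<alpha>' j" if "j \<noteq> s" for j
    proof (cases "j \<in> S")
      case True
      then have "restrict \<alpha> ?T j = restrict \<alpha>' ?T j" using eq by simp
      then show ?thesis using True that by simp
    next
      case False then show ?thesis using a by (auto simp: orthant_def)
    qed
    have "s \<in> {..<p}" using s S by blast
    then have "wt p w \<gamma> = w s * \<gamma> s + (\<Sum>j\<in>{..<p} - {s}. w j * \<gamma> j)" for \<gamma>
      unfolding wt_def by (intro sum.remove) auto
    moreover have "(\<Sum>j\<in>{..<p} - {s}. w j * \<alpha> j) = (\<Sum>j\<in>{..<p} - {s}. w j * \<alpha>' j)"
      by (rule sum.cong) (auto simp: e)
    ultimately have "w s * \<alpha> s = w s * \<alpha>' s" using eq by simp
    then have "\<alpha> s = \<alpha>' s" using w[OF s] by simp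
    then show "\<alpha> = \<alpha>'" using e by (metis ext)
  qed
  have sub: "(\<lambda>\<alpha>. (wt p w \<alpha>, restrict \<alpha> ?T)) ` ?Z \<subseteq> ?Y"
  proof (rule image_subsetI)
    fix \<alpha> assume a: "\<alpha> \<in> ?Z"
    then have "\<alpha> s \<le> i + c" if "s \<in> S" for s
      using component_le_wt[of s p w \<alpha>] that S w by force
    then show "(wt p w \<alpha>, restrict \<alpha> ?T) \<in> ?Y" using a by auto
  qed
  have fin: "finite ?Y" using fS by (simp add: finite_PiE)
  have "card ?Z \<le> card ?Y" using card_inj_on_le[OF inj sub fin] .
  also have "\<dots> = c * (i+c+1) ^ (card S - 1)"
    using fS s by (simp add: card_PiE card_cartesian_product)
  finally show ?thesis by (simp add: trans_le_add2)
qed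

text \<open>
  The translate of a cube into the orthant, for lower bounds on growth.
\<close>

lemma orthant_box:
  assumes S: "S \<subseteq> {..<p}"
  shows "\<exists>c. \<forall>k. \<exists>Z \<subseteq> {\<alpha>\<in>orthant \<beta> S. wt p w \<alpha> \<le> c * (k+1)}. finite Z \<and> card Z = (k+1) ^ card S"
proof (rule exI, rule allI)
  fix k :: nat
  have fS: "finite S" using S finite_subset by blast
  define c where "c = wt p w \<beta> + (\<Sum>i<p. w i)"
  let ?g = "\<lambda>\<gamma> i. \<beta> i + (if i \<in> S then \<gamma> i else 0)"
  let ?P = "PiE S (\<lambda>_. {..k})"
  have fin: "finite ?P" using fS by (intro finite_PiE) auto
  have inj: "inj_on ?g ?P"
  proof (rule inj_onI)
    fix x y assume xy: "x \<in> ?P" "y \<in> ?P" "?g x = ?g y"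
    have "x i = y i" for i
      using fun_cong[OF xy(3), of i] xy(1,2) by (cases "i \<in> S") (auto simp: PiE_def extensional_def)
    then show "x = y" by blast
  qed
  have "wt p w (?g \<gamma>) \<le> c * (k+1)" if "\<gamma> \<in> ?P" for \<gamma>
  proof -
    have "wt p w (\<lambda>i. if i \<in> S then \<gamma> i else 0) \<le> (\<Sum>i<p. w i * k)"
      unfolding wt_def by (rule sum_mono) (use that in \<open>auto simp: PiE_iff\<close>)
    also have "\<dots> = (\<Sum>i<p. w i) * k" by (simp add: sum_distrib_right)
    finally have "wt p w (?g \<gamma>) \<le> wt p w \<beta> + (\<Sum>i<p. w i) * k" by (simp add: wt_add)
    also have "\<dots> \<le> c * (k+1)" by (simp add: c_def algebra_simps)
    finally show ?thesis .
  qed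
  then have "?g ` ?P \<subseteq> {\<alpha>\<in>orthant \<beta> S. wt p w \<alpha> \<le> c * (k+1)}"
    by (auto simp: orthant_def)
  moreover have "card (?g ` ?P) = (k+1) ^ card S"
    using card_image[OF inj] fS by (simp add: card_PiE)
  ultimately show "\<exists>Z \<subseteq> {\<alpha>\<in>orthant \<beta> S. wt p w \<alpha> \<le> (wt p w \<beta> + (\<Sum>i<p. w i)) * (k+1)}.
      finite Z \<and> card Z = (k+1) ^ card S"
    using fin by (intro exI[of _ "?g ` ?P"]) (auto simp: c_def)
qed

text \<open>
  Along a free direction of weight \<open>0\<close> there would be infinitely many points of one weight.
\<close>

lemma orthant_weights_pos:
  assumes sub: "orthant \<beta> S \<subseteq> E" and S: "S \<subseteq> {..<p}"
    and fin: "\<And>i. finite {\<alpha>\<in>E. wt p w \<alpha> \<le> i}" and s: "s \<in> S"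
  shows "w s \<ge> 1"
proof (rule ccontr)
  assume "\<not> w s \<ge> 1"
  then have w0: "w s = 0" by simp
  let ?f = "\<lambda>t i. \<beta> i + (if i = s then t else 0)"
  have "wt p w (?f t) = wt p w \<beta>" for t
  proof -
    have "wt p w (\<lambda>i. if i = s then t else 0) = 0" unfolding wt_def
      by (rule sum.neutral) (auto simp: w0)
    then show ?thesis using wt_add[of p w \<beta> "\<lambda>i. if i = s then t else 0"] by simp
  qed
  moreover have "?f t \<in> E" for t using sub s by (auto simp: orthant_def)
  ultimately have "range ?f \<subseteq> {\<alpha>\<in>E. wt p w \<alpha> \<le> wt p w \<beta>}" by auto
  then have "finite (range ?f)" using fin finite_subset by blast
  moreover have "inj ?f"
  proof (rule injI)
    fix x y assume "?f x = ?f y"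
    from fun_cong[OF this, of s] show "x = y" by simp
  qed
  ultimately show False using finite_imageD infinite_UNIV_nat by blast
qed

lemma orthant_dim_le:
  assumes sub: "orthant \<beta> S \<subseteq> E" and S: "S \<subseteq> {..<p}"
    and fin: "\<And>i. finite {\<alpha>\<in>E. wt p w \<alpha> \<le> i}"
    and cnt: "\<And>i. card {\<alpha>\<in>E. wt p w \<alpha> \<le> i} \<le> C * (i+1)^n"
  shows "card S \<le> n"
proof (rule ccontr)
  assume "\<not> card S \<le> n"
  obtain c where c: "\<And>k. \<exists>Z \<subseteq> {\<alpha>\<in>orthant \<beta> S. wt p w \<alpha> \<le> c * (k+1)}. finite Z \<and> card Z = (k+1) ^ card S"
    using orthant_box[OF S, of \<beta> w] by blast
  define k where "k = C * (c+1)^n"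
  obtain Z where Z: "Z \<subseteq> {\<alpha>\<in>orthant \<beta> S. wt p w \<alpha> \<le> c * (k+1)}" "card Z = (k+1) ^ card S"
    using c by blast
  have "(k+1) ^ Suc n \<le> (k+1) ^ card S"
    using \<open>\<not> card S \<le> n\<close> by (intro power_increasing) auto
  also have "\<dots> = card Z" using Z by simp
  also have "\<dots> \<le> card {\<alpha>\<in>E. wt p w \<alpha> \<le> c * (k+1)}"
    using Z sub by (intro card_mono fin) blast
  also have "\<dots> \<le> C * (c * (k+1) + 1)^n" by (rule cnt)
  also have "\<dots> \<le> C * ((c+1) * (k+1))^n" by (intro mult_left_mono power_mono) auto
  also have "\<dots> = k * (k+1)^n" using k_def by (metis power_mult_distrib mult.assoc)
  finally have "(k+1) * (k+1)^n \<le> k * (k+1)^n" by simp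
  then show False by simp
qed

lemma card_Union_orthants_le:
  assumes "finite C" "Z \<subseteq> (\<Union>c\<in>C. f c)" "\<And>c. c \<in> C \<Longrightarrow> finite {\<alpha> \<in> f c. P \<alpha>}"
    "\<And>c. c \<in> C \<Longrightarrow> card {\<alpha> \<in> f c. P \<alpha>} \<le> b"
  shows "finite {\<alpha>\<in>Z. P \<alpha>} \<and> card {\<alpha>\<in>Z. P \<alpha>} \<le> card C * b"
proof -
  have sub: "{\<alpha>\<in>Z. P \<alpha>} \<subseteq> (\<Union>c\<in>C. {\<alpha> \<in> f c. P \<alpha>})" using assms(2) by blast
  have fin: "finite (\<Union>c\<in>C. {\<alpha> \<in> f c. P \<alpha>})" using assms by blast
  have "card {\<alpha>\<in>Z. P \<alpha>} \<le> card (\<Union>c\<in>C. {\<alpha> \<in> f c. P \<alpha>})" by (rule card_mono[OF fin sub])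
  also have "\<dots> \<le> (\<Sum>c\<in>C. card {\<alpha> \<in> f c. P \<alpha>})" by (rule card_UN_le[OF assms(1)])
  also have "\<dots> \<le> card C * b" using sum_bounded_above[of C "\<lambda>c. card {\<alpha> \<in> f c. P \<alpha>}" b] assms(4) by simp
  finally have "card {\<alpha>\<in>Z. P \<alpha>} \<le> card C * b" .
  with finite_subset[OF sub fin] show ?thesis by (rule conjI)
qed

text \<open>
  The corner of an orthant with \<open>n\<close> free directions is pushed to \<open>0\<close> along these directions. For
  a down-closed set of dimension \<open>n\<close> there are only finitely many such orthants; their number
  plays the role of the multiplicity of a module.
\<close>

definition free_orthants :: "nat \<Rightarrow> nat \<Rightarrow> (nat \<Rightarrow> nat) set \<Rightarrow> ((nat \<Rightarrow> nat) \<times> nat set) set" where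
  "free_orthants p n E = {(\<beta>,S). S \<subseteq> {..<p} \<and> card S = n \<and> (\<forall>s\<in>S. \<beta> s = 0) \<and> orthant \<beta> S \<subseteq> E}"

lemma down_closed_empty: "down_closed p {}"
  by (simp add: down_closed_def)

text \<open>
  Variables of weight \<open>0\<close> occur, because generators of a filtered algebra may lie in the bottom
  piece of the filtration; the set \<open>E\<close> has nevertheless finitely many points of bounded weight.
\<close>

locale staircase =
  fixes p :: nat and w :: "nat \<Rightarrow> nat" and E :: "(nat \<Rightarrow> nat) set"
  assumes dc: "down_closed p E" and fin: "\<And>i. finite {\<alpha>\<in>E. wt p w \<alpha> \<le> i}"
begin

text \<open>
  The growth of a difference of down-closed sets is governed by the largest orthant that it
  contains.
\<close>

lemma diff_count:
  assumes E': "down_closed p E'"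
    and no: "\<And>\<beta> S. S \<subseteq> {..<p} \<Longrightarrow> orthant \<beta> S \<subseteq> E - E' \<Longrightarrow> card S \<le> r"
  shows "\<exists>C. \<forall>i. card {\<alpha>\<in>E - E'. wt p w \<alpha> \<le> i} \<le> C * (i+1)^r"
    and "\<exists>C. \<forall>i. card {\<alpha>\<in>E - E'. i < wt p w \<alpha> \<and> wt p w \<alpha> \<le> i + c} \<le> C * (i+1)^(r-1)"
proof -
  obtain C where C: "finite C" "\<And>\<beta> S. (\<beta>,S)\<in>C \<Longrightarrow> S \<subseteq> {..<p}"
     "E - E' = (\<Union>(\<beta>,S)\<in>C. orthant \<beta> S)"
    using down_closed_diff_orthants[OF dc E'] by metis
  have sub: "orthant \<beta> S \<subseteq> E - E'" if "(\<beta>,S)\<in>C" for \<beta> S using C(3) that by blast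
  have le: "card S \<le> r" if "(\<beta>,S)\<in>C" for \<beta> S using no C(2) sub that by blast
  have pos: "w s \<ge> 1" if "(\<beta>,S)\<in>C" "s \<in> S" for \<beta> S s
    using orthant_weights_pos[of \<beta> S E p w s] sub C(2) that fin by blast
  have "card {\<alpha>\<in>E - E'. wt p w \<alpha> \<le> i} \<le> card C * (i+1)^r" for i
  proof -
    have "finite {\<alpha>\<in>E - E'. wt p w \<alpha> \<le> i} \<and> card {\<alpha>\<in>E - E'. wt p w \<alpha> \<le> i} \<le> card C * (i+1)^r"
    proof (rule card_Union_orthants_le[where f = "\<lambda>(\<beta>,S). orthant \<beta> S", OF C(1)])
      show "E - E' \<subseteq> (\<Union>(\<beta>,S)\<in>C. orthant \<beta> S)" using C(3) by simp
      fix c assume c: "c \<in> C"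
      obtain \<beta> S where cc: "c = (\<beta>,S)" by fastforce
      show "finite {\<alpha> \<in> case c of (\<beta>, S) \<Rightarrow> orthant \<beta> S. wt p w \<alpha> \<le> i}"
        using orthant_count(1)[of S p w \<beta> i] c cc C(2) pos by auto
      have "card {\<alpha> \<in> orthant \<beta> S. wt p w \<alpha> \<le> i} \<le> (i+1)^card S"
        using orthant_count(2)[of S p w \<beta> i] c cc C(2) pos by auto
      also have "\<dots> \<le> (i+1)^r" using le c cc by (intro power_increasing) auto
      finally show "card {\<alpha> \<in> case c of (\<beta>, S) \<Rightarrow> orthant \<beta> S. wt p w \<alpha> \<le> i} \<le> (i+1)^r"
        using cc by simp
    qed
    then show ?thesis by blast
  qed
  then show "\<exists>C. \<forall>i. card {\<alpha>\<in>E - E'. wt p w \<alpha> \<le> i} \<le> C * (i+1)^r" by blast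
  have "card {\<alpha>\<in>E - E'. i < wt p w \<alpha> \<and> wt p w \<alpha> \<le> i + c} \<le> (card C * ((c+1) * (c+1)^(r-1))) * (i+1)^(r-1)" for i
  proof -
    have "finite {\<alpha>\<in>E - E'. i < wt p w \<alpha> \<and> wt p w \<alpha> \<le> i + c} \<and>
        card {\<alpha>\<in>E - E'. i < wt p w \<alpha> \<and> wt p w \<alpha> \<le> i + c} \<le> card C * ((c+1) * (i+c+1)^(r-1))"
    proof (rule card_Union_orthants_le[where f = "\<lambda>(\<beta>,S). orthant \<beta> S", OF C(1)])
      show "E - E' \<subseteq> (\<Union>(\<beta>,S)\<in>C. orthant \<beta> S)" using C(3) by simp
      fix b assume c: "b \<in> C"
      obtain \<beta> S where cc: "b = (\<beta>,S)" by fastforce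
      have "finite {\<alpha> \<in> orthant \<beta> S. wt p w \<alpha> \<le> i + c}"
        using orthant_count(1)[of S p w \<beta> "i+c"] c cc C(2) pos by auto
      then show "finite {\<alpha> \<in> case b of (\<beta>, S) \<Rightarrow> orthant \<beta> S. i < wt p w \<alpha> \<and> wt p w \<alpha> \<le> i + c}"
        by (rule rev_finite_subset) (auto simp: cc)
      have "card {\<alpha> \<in> orthant \<beta> S. i < wt p w \<alpha> \<and> wt p w \<alpha> \<le> i + c} \<le> (c+1) * (i+c+1)^(card S - 1)"
        using orthant_band_count[of S p w \<beta> i c] c cc C(2) pos by auto
      also have "\<dots> \<le> (c+1) * (i+c+1)^(r-1)"
        using le[of \<beta> S] c cc by (intro mult_left_mono power_increasing) auto
      finally show "card {\<alpha> \<in> case b of (\<beta>, S) \<Rightarrow> orthant \<beta> S. i < wt p w \<alpha> \<and> wt p w \<alpha> \<le> i + c} \<le> (c+1) * (i+c+1)^(r-1)"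
        using cc by simp
    qed
    moreover have "(i+c+1)^(r-1) \<le> ((c+1)*(i+1))^(r-1)" by (intro power_mono) auto
    then have "card C * ((c+1) * (i+c+1)^(r-1)) \<le> card C * ((c+1) * ((c+1)*(i+1))^(r-1))"
      by (intro mult_left_mono) auto
    ultimately have "card {\<alpha>\<in>E - E'. i < wt p w \<alpha> \<and> wt p w \<alpha> \<le> i + c} \<le>
        card C * ((c+1) * ((c+1)*(i+1))^(r-1))" by (meson le_trans)
    then show ?thesis by (simp only: power_mult_distrib mult.assoc)
  qed
  then show "\<exists>C. \<forall>i. card {\<alpha>\<in>E - E'. i < wt p w \<alpha> \<and> wt p w \<alpha> \<le> i + c} \<le> C * (i+1)^(r-1)" by blast
qed

lemma orthant_normalise:
  assumes "orthant \<beta> S \<subseteq> E"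
  shows "orthant (\<lambda>i. if i \<in> S then 0 else \<beta> i) S \<subseteq> E"
proof
  fix \<alpha> assume a: "\<alpha> \<in> orthant (\<lambda>i. if i \<in> S then 0 else \<beta> i) S"
  have "(\<lambda>i. max (\<alpha> i) (\<beta> i)) \<in> orthant \<beta> S" using a by (auto simp: orthant_def)
  then have "(\<lambda>i. max (\<alpha> i) (\<beta> i)) \<in> E" using assms by blast
  moreover have "\<alpha> \<le> (\<lambda>i. max (\<alpha> i) (\<beta> i))" by (auto simp: le_fun_def)
  ultimately show "\<alpha> \<in> E" using dc unfolding down_closed_def by blast
qed

text \<open>
  Infinitely many points of the diagonal of such an orthant lie in one piece of a finite
  decomposition of \<open>E\<close>. This piece is free in all directions of the orthant, and as \<open>n\<close> is the
  maximal dimension, it is the orthant up to its corner.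
\<close>

lemma finite_free_orthants:
  assumes le: "\<And>\<beta> S. S \<subseteq> {..<p} \<Longrightarrow> orthant \<beta> S \<subseteq> E \<Longrightarrow> card S \<le> n"
  shows "finite (free_orthants p n E)"
proof -
  obtain C where C: "finite C" "\<And>\<beta> S. (\<beta>,S)\<in>C \<Longrightarrow> S \<subseteq> {..<p}"
     "E = (\<Union>(\<beta>,S)\<in>C. orthant \<beta> S)"
    using down_closed_diff_orthants[OF dc down_closed_empty, unfolded Diff_empty] by metis
  have "free_orthants p n E \<subseteq> (\<lambda>(\<beta>,S). (\<lambda>i. if i \<in> S then 0 else \<beta> i, S)) ` C"
  proof (rule subrelI)
    fix \<beta> S assume "(\<beta>,S) \<in> free_orthants p n E"
    then have S: "S \<subseteq> {..<p}" "card S = n" "\<And>s. s\<in>S \<Longrightarrow> \<beta> s = 0" "orthant \<beta> S \<subseteq> E"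
      by (auto simp: free_orthants_def)
    let ?g = "\<lambda>t i. \<beta> i + (if i \<in> S then t else (0::nat))"
    have "?g t \<in> E" for t using S(4) by (auto simp: orthant_def)
    then have "\<forall>t. \<exists>c\<in>C. ?g t \<in> (case c of (\<gamma>,T) \<Rightarrow> orthant \<gamma> T)" using C(3) by blast
    then obtain h where h: "\<And>t. h t \<in> C" "\<And>t. ?g t \<in> (case h t of (\<gamma>,T) \<Rightarrow> orthant \<gamma> T)" by metis
    have "\<exists>c\<in>C. infinite {t\<in>UNIV. h t = c}"
      by (rule pigeonhole_infinite_rel) (use C(1) h in auto)
    then obtain c where c: "c \<in> C" "infinite {t. h t = c}" by auto
    obtain \<gamma> T where cc: "c = (\<gamma>,T)" by fastforce
    obtain t0 where t0: "h t0 = c" using c(2) by (metis (mono_tags, lifting) empty_Collect_eq finite.emptyI)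
    obtain t1 where t1: "h t1 = c" "t1 > t0" using c(2) by (metis (mono_tags, lifting) finite_nat_set_iff_bounded_le mem_Collect_eq not_le_imp_less)
    have g0: "?g t0 \<in> orthant \<gamma> T" and g1: "?g t1 \<in> orthant \<gamma> T" using h(2)[of t0] h(2)[of t1] t0 t1 cc by auto
    have "S \<subseteq> T"
    proof
      fix s assume s: "s \<in> S"
      show "s \<in> T"
      proof (rule ccontr)
        assume "s \<notin> T"
        then have "?g t0 s = \<gamma> s" "?g t1 s = \<gamma> s" using g0 g1 unfolding orthant_def by blast+
        then show False using s t1 by simp
      qed
    qed
    moreover have "card T \<le> n" "finite T"
      using le[of T \<gamma>] C(2,3) c(1) cc finite_subset by blast+
    ultimately have "S = T" using S(2) by (simp add: card_seteq)
    moreover have "\<beta> = (\<lambda>i. if i \<in> T then 0 else \<gamma> i)"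
    proof
      fix i show "\<beta> i = (if i \<in> T then 0 else \<gamma> i)"
        using S(3) g0 \<open>S = T\<close> by (cases "i \<in> T") (auto simp: orthant_def)
    qed
    ultimately show "(\<beta>,S) \<in> (\<lambda>(\<beta>,S). (\<lambda>i. if i \<in> S then 0 else \<beta> i, S)) ` C"
      using c(1) cc by force
  qed
  then show ?thesis using C(1) finite_subset by blast
qed

text \<open>
  Moved to the boundary, an \<open>n\<close>-dimensional orthant in \<open>E1 - E2\<close> would count for \<open>E1\<close> but not
  for \<open>E2\<close>. In other words, if the multiplicities agree, then the difference has smaller
  dimension.
\<close>

lemma no_free_orthant_diff:
  assumes le: "\<And>\<beta> S. S \<subseteq> {..<p} \<Longrightarrow> orthant \<beta> S \<subseteq> E \<Longrightarrow> card S \<le> n" and n: "n \<ge> 1"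
    and E1: "E1 \<subseteq> E" "down_closed p E1" and E2: "E2 \<subseteq> E1"
    and eq: "free_orthants p n E1 \<subseteq> free_orthants p n E2"
    and S: "S \<subseteq> {..<p}" "orthant \<beta> S \<subseteq> E1 - E2"
  shows "card S \<le> n - 1"
proof (rule ccontr)
  assume "\<not> card S \<le> n - 1"
  with le[OF S(1)] S(2) E1 n have cS: "card S = n" by fastforce
  interpret E1: staircase p w E1
    using E1 fin by unfold_locales (auto intro: rev_finite_subset)
  define \<gamma> where "\<gamma> = (\<lambda>i. if i \<in> S then 0 else \<beta> i)"
  have "orthant \<gamma> S \<subseteq> E1" unfolding \<gamma>_def using S(2) by (intro E1.orthant_normalise) blast
  then have "(\<gamma>, S) \<in> free_orthants p n E1" using cS S(1) by (auto simp: free_orthants_def \<gamma>_def)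
  then have "orthant \<gamma> S \<subseteq> E2" using eq by (auto simp: free_orthants_def)
  moreover have "\<beta> \<in> orthant \<gamma> S" "\<beta> \<in> orthant \<beta> S" by (auto simp: orthant_def \<gamma>_def)
  ultimately show False using S(2) by blast
qed

text \<open>
  The order of growth of \<open>E\<close> is the largest dimension of an orthant contained in it, so it is an
  integer. An infinite set contains an infinite orthant, which gives \<open>n \<ge> 1\<close>.
\<close>

lemma dimension_exists:
  assumes "E \<noteq> {}"
  shows "\<exists>n C \<beta> S. S \<subseteq> {..<p} \<and> card S = n \<and> orthant \<beta> S \<subseteq> E \<and>
    (\<forall>i. card {\<alpha>\<in>E. wt p w \<alpha> \<le> i} \<le> C * (i+1)^n) \<and> (infinite E \<longrightarrow> n \<ge> 1)"
proof -
  let ?P = "\<lambda>n. \<exists>\<beta> S. S \<subseteq> {..<p} \<and> card S = n \<and> orthant \<beta> S \<subseteq> E"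
  define n where "n = (GREATEST n. ?P n)"
  have bound: "n \<le> p" if "?P n" for n
    using that card_mono[of "{..<p}"] by (metis card_lessThan finite_lessThan)
  have P0: "?P 0"
  proof -
    obtain \<beta> where "\<beta> \<in> E" using assms by blast
    then show ?thesis by (intro exI[of _ \<beta>] exI[of _ "{}"]) (auto simp: orthant_empty)
  qed
  have Pn: "?P n" unfolding n_def by (rule GreatestI_nat[of ?P, OF P0]) (use bound in blast)
  have le: "card S \<le> n" if "S \<subseteq> {..<p}" "orthant \<beta> S \<subseteq> E" for \<beta> S
    unfolding n_def by (rule Greatest_le_nat[of ?P _ p]) (use bound that in blast)+
  obtain C where C: "\<forall>i. card {\<alpha>\<in>E - {}. wt p w \<alpha> \<le> i} \<le> C * (i+1)^n"
    using diff_count(1)[OF down_closed_empty, of n] le by auto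
  have "n \<ge> 1" if inf: "infinite E"
  proof -
    obtain D where D: "finite D" "\<And>\<beta> S. (\<beta>,S)\<in>D \<Longrightarrow> S \<subseteq> {..<p}"
      "E = (\<Union>(\<beta>,S)\<in>D. orthant \<beta> S)"
      using down_closed_diff_orthants[OF dc down_closed_empty, unfolded Diff_empty] by metis
    have "\<exists>\<beta> S. (\<beta>,S) \<in> D \<and> infinite (orthant \<beta> S)"
    proof (rule ccontr)
      assume "\<not> ?thesis"
      then have "\<And>c. c \<in> D \<Longrightarrow> finite (case c of (\<beta>,S) \<Rightarrow> orthant \<beta> S)" by auto
      then show False using D(1,3) inf by (simp add: finite_UN_I)
    qed
    then obtain \<beta> S where bs: "(\<beta>,S) \<in> D" "infinite (orthant \<beta> S)" by blast
    then have "S \<noteq> {}" by (auto simp: orthant_empty)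
    then have "card S \<ge> 1" using D(2)[OF bs(1)] finite_subset by (simp add: Suc_leI card_gt_0_iff finite_subset)
    moreover have "card S \<le> n" using le[of S \<beta>] D bs by blast
    ultimately show ?thesis by simp
  qed
  then have inf: "infinite E \<longrightarrow> n \<ge> 1" by blast
  obtain \<beta> S where "S \<subseteq> {..<p}" "card S = n" "orthant \<beta> S \<subseteq> E" using Pn by blast
  then show ?thesis using inf C[unfolded Diff_empty]
    by (intro exI[of _ n] exI[of _ C] exI[of _ \<beta>] exI[of _ S] conjI)
qed

end

section \<open>A monomial order\<close>

text \<open>
  Weight first, then lexicographic: reordering a product of generators of a filtered algebra
  only produces monomials of smaller weight, which are then smaller in this order.
\<close>

definition mless :: "nat \<Rightarrow> (nat \<Rightarrow> nat) \<Rightarrow> (nat \<Rightarrow> nat) \<Rightarrow> (nat \<Rightarrow> nat) \<Rightarrow> bool" where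
  "mless p w \<alpha> \<beta> \<longleftrightarrow> wt p w \<alpha> < wt p w \<beta> \<or>
     wt p w \<alpha> = wt p w \<beta> \<and> (\<exists>i. \<alpha> i < \<beta> i \<and> (\<forall>j<i. \<alpha> j = \<beta> j))"

abbreviation eadd :: "(nat \<Rightarrow> nat) \<Rightarrow> (nat \<Rightarrow> nat) \<Rightarrow> nat \<Rightarrow> nat" (infixl "\<oplus>\<^sub>e" 65) where
  "\<alpha> \<oplus>\<^sub>e \<beta> \<equiv> (\<lambda>i. \<alpha> i + \<beta> i)"

lemma exps_add: "\<alpha> \<in> exps p \<Longrightarrow> \<beta> \<in> exps p \<Longrightarrow> \<alpha> \<oplus>\<^sub>e \<beta> \<in> exps p"
  by (simp add: exps_def)

lemma exps_zero: "(\<lambda>_. 0) \<in> exps p"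
  by (simp add: exps_def)

lemma wt_zero: "wt p w (\<lambda>_. 0) = 0"
  by (simp add: wt_def)

lemma down_closed_exps: "down_closed p (exps p)"
  by (auto simp: down_closed_def exps_def le_fun_def) (metis le_zero_eq)

lemma mless_trans: "mless p w \<alpha> \<beta> \<Longrightarrow> mless p w \<beta> \<gamma> \<Longrightarrow> mless p w \<alpha> \<gamma>"
  unfolding mless_def
proof (elim disjE conjE exE)
  fix i j assume a: "wt p w \<alpha> = wt p w \<beta>" "wt p w \<beta> = wt p w \<gamma>" "\<alpha> i < \<beta> i" "\<forall>j<i. \<alpha> j = \<beta> j"
    "\<beta> j < \<gamma> j" "\<forall>k<j. \<beta> k = \<gamma> k"
  have "\<alpha> (min i j) < \<gamma> (min i j) \<and> (\<forall>k<min i j. \<alpha> k = \<gamma> k)"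
    using a(3-6) by (cases i j rule: linorder_cases) (auto simp: min_def)
  then show "wt p w \<alpha> < wt p w \<gamma> \<or> wt p w \<alpha> = wt p w \<gamma> \<and> (\<exists>i. \<alpha> i < \<gamma> i \<and> (\<forall>j<i. \<alpha> j = \<gamma> j))"
    using a(1,2) by auto
qed auto

lemma mless_total: "\<alpha> = \<beta> \<or> mless p w \<alpha> \<beta> \<or> mless p w \<beta> \<alpha>"
proof (cases "\<alpha> = \<beta>")
  case False
  then have ex: "\<exists>i. \<alpha> i \<noteq> \<beta> i" by auto
  define i where "i = (LEAST i. \<alpha> i \<noteq> \<beta> i)"
  have i: "\<alpha> i \<noteq> \<beta> i" "\<And>j. j < i \<Longrightarrow> \<alpha> j = \<beta> j"
    using LeastI_ex[OF ex] not_less_Least[of _ "\<lambda>i. \<alpha> i \<noteq> \<beta> i"] unfolding i_def by blast+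
  show ?thesis
  proof (cases "wt p w \<alpha> = wt p w \<beta>")
    case True
    then show ?thesis using i unfolding mless_def by (metis linorder_neqE_nat)
  next
    case False
    then show ?thesis unfolding mless_def by auto
  qed
qed auto

lemma mless_add_mono: "mless p w \<alpha> \<beta> \<Longrightarrow> mless p w (\<gamma> \<oplus>\<^sub>e \<alpha>) (\<gamma> \<oplus>\<^sub>e \<beta>)"
  unfolding mless_def wt_add by auto

lemma not_mless_of_le:
  assumes "\<alpha> \<le> \<beta>" shows "\<not> mless p w \<beta> \<alpha>"
proof -
  have "wt p w \<alpha> \<le> wt p w \<beta>" unfolding wt_def
    by (intro sum_mono mult_left_mono) (use assms in \<open>auto simp: le_fun_def\<close>)
  moreover have "\<not> \<beta> i < \<alpha> i" for i using assms by (simp add: le_fun_def not_less)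
  ultimately show ?thesis unfolding mless_def by auto
qed

text \<open>
  In an infinite descending sequence some term would lie coordinatewise below a later one, by
  Dickson's lemma, and the order extends the coordinatewise one.
\<close>

lemma wf_mless: "wf {(\<alpha>, \<beta>). \<alpha> \<in> exps p \<and> mless p w \<alpha> \<beta>}"
proof -
  have False if s: "\<forall>i. (s (Suc i), s i) \<in> {(\<alpha>, \<beta>). \<alpha> \<in> exps p \<and> mless p w \<alpha> \<beta>}" for s
  proof -
    define t where "t i = s (Suc i)" for i
    have t: "t i \<in> exps p" "mless p w (t (Suc i)) (t i)" for i using s by (auto simp: t_def)
    have lt: "mless p w (t (Suc (i + k))) (t i)" for i k
      by (induction k) (use t mless_trans in \<open>auto\<close>, blast intro: mless_trans)
    obtain i j where ij: "i < j" "t i \<le> t j" using dickson[of t p] t by blast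
    obtain k where "j = Suc (i + k)" using ij(1) less_imp_Suc_add by blast
    then show False using lt not_mless_of_le ij(2) by blast
  qed
  then show ?thesis unfolding wf_iff_no_infinite_down_chain by blast
qed

lemma mless_max_exists:
  assumes "finite F" "F \<noteq> {}"
  shows "\<exists>m\<in>F. \<forall>\<beta>\<in>F. \<beta> = m \<or> mless p w \<beta> m"
  using assms
proof (induction F rule: finite_ne_induct)
  case (insert x F)
  then obtain m where m: "m \<in> F" "\<forall>\<beta>\<in>F. \<beta> = m \<or> mless p w \<beta> m" by blast
  consider "mless p w x m \<or> x = m" | "mless p w m x" using mless_total by blast
  then show ?case
  proof cases
    case 1 then show ?thesis using m by (intro bexI[of _ m]) auto
  next
    case 2
    then have "\<forall>\<beta>\<in>F. mless p w \<beta> x" using m(2) by (metis mless_trans)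
    then show ?thesis by (intro bexI[of _ x]) auto
  qed
qed auto

context vector_space
begin

lemma span_finite_subset:
  assumes "v \<in> span S"
  obtains F where "finite F" "F \<subseteq> S" "v \<in> span F"
proof -
  from assms have "\<exists>F. finite F \<and> F \<subseteq> S \<and> v \<in> span F"
  proof (induction rule: span_induct_alt)
    case base then show ?case by (intro exI[of _ "{}"]) auto
  next
    case (step c x y)
    then obtain F where F: "finite F" "F \<subseteq> S" "y \<in> span F" by blast
    have "scale c x + y \<in> span (insert x F)"
      using F(3) by (intro span_add span_scale) (auto intro: span_base span_mono[THEN subsetD, rotated])
    then show ?case using F step(1) by (intro exI[of _ "insert x F"]) auto
  qed
  then show ?thesis using that by blast
qed

lemma span_Un_subspace:
  assumes "subspace Z" "v \<in> span (Z \<union> S)"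
  obtains x l where "v = x + l" "x \<in> Z" "l \<in> span S"
proof -
  have "span Z = Z" using assms(1) by (rule span_eq_iff[THEN iffD2])
  then have "v \<in> {x + y | x y. x \<in> Z \<and> y \<in> span S}" using assms(2) by (simp only: span_Un)
  then show ?thesis using that by blast
qed

text \<open>
  The finite spanning set \<open>B\<close> excludes the value \<open>0\<close> that \<open>dim\<close> takes on infinite-dimensional
  spaces.
\<close>

lemma dim_le_of_subset:
  assumes "V \<subseteq> span W" "W \<subseteq> span B" "finite B"
  shows "dim V \<le> dim W"
proof -
  obtain C where C: "C \<subseteq> W" "independent C" "W \<subseteq> span C" using maximal_independent_subset by blast
  have "C \<subseteq> span B" using C(1) assms(2) by blast
  then have "finite C" using independent_span_bound[OF assms(3) C(2)] by blast
  moreover have "V \<subseteq> span C" using assms(1) C(3) by (meson span_minimal subspace_span subset_trans)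
  ultimately have "dim V \<le> card C" using dim_le_card by blast
  also have "\<dots> = dim W" using C by (simp add: basis_card_eq_dim)
  finally show ?thesis .
qed

lemma card_le_dim_of_independent:
  assumes "independent S" "S \<subseteq> span W" "W \<subseteq> span B" "finite B"
  shows "finite S \<and> card S \<le> dim W"
proof
  have "S \<subseteq> span B" using assms(2,3) by (meson span_minimal subspace_span subset_trans)
  then show "finite S" using independent_span_bound[OF assms(4,1)] by blast
  have "card S = dim S" using assms(1) by (simp add: dim_eq_card_independent)
  also have "\<dots> \<le> dim W" using dim_le_of_subset[OF assms(2-4)] .
  finally show "card S \<le> dim W" .
qed

end

section \<open>Leading exponents in filtered modules\<close>

text \<open>
  Operators \<open>mop \<alpha>\<close> that compose like the monomials of a commutative polynomial ring up to terms
  of smaller weight. The ordered monomials in generators of an algebra with commutative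
  associated graded algebra act in this way on every module.
\<close>

locale monomial_action = vector_space scale
  for scale :: "'k::field \<Rightarrow> 'v::ab_group_add \<Rightarrow> 'v" +
  fixes p :: nat and w :: "nat \<Rightarrow> nat" and mop :: "(nat \<Rightarrow> nat) \<Rightarrow> 'v \<Rightarrow> 'v"
  assumes mon_zero: "mop (\<lambda>_. 0) v = v"
    and mon_add: "mop \<alpha> (u + v) = mop \<alpha> u + mop \<alpha> v"
    and mon_scale: "mop \<alpha> (scale c v) = scale c (mop \<alpha> v)"
    and mon_mon: "\<alpha> \<in> exps p \<Longrightarrow> \<beta> \<in> exps p \<Longrightarrow>
      mop \<alpha> (mop \<beta> v) - mop (\<alpha> \<oplus>\<^sub>e \<beta>) v \<in> span {mop \<gamma> v | \<gamma>. \<gamma> \<in> exps p \<and> wt p w \<gamma> < wt p w \<alpha> + wt p w \<beta>}"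
begin

definition low :: "'v \<Rightarrow> (nat \<Rightarrow> nat) \<Rightarrow> 'v set" where
  "low u \<alpha> = {mop \<beta> u | \<beta>. \<beta> \<in> exps p \<and> mless p w \<beta> \<alpha>}"

text \<open>
  The exponents that are not leading exponents of \<open>Z\<close>: \<open>\<alpha>\<close> is missing if and only if the
  monomial \<open>\<alpha>\<close> applied to \<open>u\<close> is congruent modulo \<open>Z\<close> to a combination of smaller ones, that is,
  if and only if some element of \<open>Z\<close> is a combination of monomials applied to \<open>u\<close> with leading
  exponent \<open>\<alpha>\<close>.
\<close>

definition stair :: "'v set \<Rightarrow> 'v \<Rightarrow> (nat \<Rightarrow> nat) set" where
  "stair Z u = {\<alpha> \<in> exps p. mop \<alpha> u \<notin> span (Z \<union> low u \<alpha>)}"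

definition filt :: "'v \<Rightarrow> nat \<Rightarrow> 'v set" where
  "filt u i = span {mop \<alpha> u | \<alpha>. \<alpha> \<in> exps p \<and> wt p w \<alpha> \<le> i}"

definition stable :: "'v set \<Rightarrow> bool" where
  "stable Z \<longleftrightarrow> subspace Z \<and> (\<forall>\<alpha>\<in>exps p. \<forall>v\<in>Z. mop \<alpha> v \<in> Z)"

lemma mon_diff: "mop \<alpha> (u - v) = mop \<alpha> u - mop \<alpha> v"
  using mon_add[of \<alpha> "u - v" v] by simp

lemma mon_0: "mop \<alpha> 0 = 0"
  using mon_add[of \<alpha> 0 0] by simp

lemma mon_span:
  assumes "v \<in> span S" "\<And>x. x \<in> S \<Longrightarrow> mop \<alpha> x \<in> W" "subspace W"
  shows "mop \<alpha> v \<in> W"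
  using assms(1)
proof (induction rule: span_induct_alt)
  case base then show ?case using mon_0 assms(3) by (simp add: subspace_0)
next
  case (step c x y)
  then show ?case using assms(2,3) by (simp add: mon_add mon_scale subspace_add subspace_scale)
qed

lemma mon_mon_low:
  assumes "\<alpha> \<in> exps p" "\<beta> \<in> exps p"
  shows "mop \<alpha> (mop \<beta> v) - mop (\<alpha> \<oplus>\<^sub>e \<beta>) v \<in> span (low v (\<alpha> \<oplus>\<^sub>e \<beta>))"
  using mon_mon[OF assms, of v] by (rule span_mono[THEN subsetD, rotated]) (auto simp: low_def mless_def wt_add)

lemma low_mono: "mless p w \<beta> \<alpha> \<Longrightarrow> low u \<beta> \<subseteq> low u \<alpha>"
  using mless_trans by (auto simp: low_def)

lemma mon_low:
  assumes "\<gamma> \<in> exps p" "v \<in> span (low u \<beta>)"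
  shows "mop \<gamma> v \<in> span (low u (\<gamma> \<oplus>\<^sub>e \<beta>))"
proof (rule mon_span[OF assms(2)])
  fix x assume "x \<in> low u \<beta>"
  then obtain \<delta> where d: "\<delta> \<in> exps p" "mless p w \<delta> \<beta>" "x = mop \<delta> u" by (auto simp: low_def)
  have l: "mless p w (\<gamma> \<oplus>\<^sub>e \<delta>) (\<gamma> \<oplus>\<^sub>e \<beta>)" using d(2) by (rule mless_add_mono)
  have 1: "mop \<gamma> x - mop (\<gamma> \<oplus>\<^sub>e \<delta>) u \<in> span (low u (\<gamma> \<oplus>\<^sub>e \<beta>))"
    using mon_mon_low[OF assms(1) d(1), of u] span_mono[OF low_mono[OF l]] d(3) by blast
  have "mop (\<gamma> \<oplus>\<^sub>e \<delta>) u \<in> span (low u (\<gamma> \<oplus>\<^sub>e \<beta>))"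
    using l exps_add[OF assms(1) d(1)] by (intro span_base) (auto simp: low_def)
  from span_add[OF 1 this] show "mop \<gamma> x \<in> span (low u (\<gamma> \<oplus>\<^sub>e \<beta>))" by simp
qed auto

lemma stable_subspace: "stable Z \<Longrightarrow> subspace Z"
  by (simp add: stable_def)

text \<open>
  If the monomial \<open>\<beta>\<close> can be rewritten by smaller ones modulo \<open>Z\<close>, then so can its multiples,
  since the order is compatible with multiplication.
\<close>

lemma stair_down_closed:
  assumes Z: "stable Z"
  shows "down_closed p (stair Z u)"
  unfolding down_closed_def
proof (intro conjI ballI allI impI)
  show "stair Z u \<subseteq> exps p" by (auto simp: stair_def)
  fix \<alpha> \<beta> assume a: "\<alpha> \<in> stair Z u" and b: "\<beta> \<le> \<alpha>"
  then have ae: "\<alpha> \<in> exps p" by (simp add: stair_def)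
  then have be: "\<beta> \<in> exps p" using b down_closed_exps unfolding down_closed_def by blast
  show "\<beta> \<in> stair Z u"
  proof (rule ccontr)
    assume "\<beta> \<notin> stair Z u"
    then have "mop \<beta> u \<in> span (Z \<union> low u \<beta>)" using be by (simp add: stair_def)
    then obtain x l where xl: "mop \<beta> u = x + l" "x \<in> Z" "l \<in> span (low u \<beta>)"
      by (rule span_Un_subspace[OF stable_subspace[OF Z]])
    define \<gamma> where "\<gamma> i = \<alpha> i - \<beta> i" for i
    have g: "\<gamma> \<in> exps p" "\<gamma> \<oplus>\<^sub>e \<beta> = \<alpha>"
      using ae b by (auto simp: \<gamma>_def exps_def le_fun_def)
    have 1: "mop \<gamma> (mop \<beta> u) - mop \<alpha> u \<in> span (Z \<union> low u \<alpha>)"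
      using mon_mon_low[OF g(1) be, of u] span_mono[of "low u \<alpha>" "Z \<union> low u \<alpha>"] g(2) by auto
    have "mop \<gamma> x \<in> span (Z \<union> low u \<alpha>)" using Z xl(2) g(1) by (intro span_base) (auto simp: stable_def)
    moreover have "mop \<gamma> l \<in> span (Z \<union> low u \<alpha>)"
      using mon_low[OF g(1) xl(3)] span_mono[of "low u \<alpha>" "Z \<union> low u \<alpha>"] g(2) by auto
    ultimately have 2: "mop \<gamma> (mop \<beta> u) \<in> span (Z \<union> low u \<alpha>)" by (simp add: xl(1) mon_add span_add)
    from span_diff[OF 2 1] have "mop \<alpha> u \<in> span (Z \<union> low u \<alpha>)" by simp
    then show False using a by (simp add: stair_def)
  qed
qed

lemma stair_antimono: "Z \<subseteq> Y \<Longrightarrow> stair Y u \<subseteq> stair Z u"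
  unfolding stair_def using span_mono[of "Z \<union> low u _" "Y \<union> low u _"] by blast

lemma subspace_filt: "subspace (filt u i)"
  by (simp add: filt_def)

lemma filt_mono: "i \<le> j \<Longrightarrow> filt u i \<subseteq> filt u j"
  unfolding filt_def by (rule span_mono) auto

lemma mon_in_filt: "\<alpha> \<in> exps p \<Longrightarrow> wt p w \<alpha> \<le> i \<Longrightarrow> mop \<alpha> u \<in> filt u i"
  unfolding filt_def by (rule span_base) auto

lemma mon_filt:
  assumes "\<alpha> \<in> exps p" "v \<in> filt u i"
  shows "mop \<alpha> v \<in> filt u (wt p w \<alpha> + i)"
  using assms(2) unfolding filt_def[of u i]
proof (rule mon_span)
  fix x assume "x \<in> {mop \<alpha> u |\<alpha>. \<alpha> \<in> exps p \<and> wt p w \<alpha> \<le> i}"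
  then obtain \<beta> where b: "x = mop \<beta> u" "\<beta> \<in> exps p" "wt p w \<beta> \<le> i" by blast
  have 1: "mop \<alpha> x - mop (\<alpha> \<oplus>\<^sub>e \<beta>) u \<in> filt u (wt p w \<alpha> + i)"
    using mon_mon[OF assms(1) b(2), of u] b(1) unfolding filt_def
    by (auto intro: span_mono[THEN subsetD, rotated] simp: b(3) order_trans[OF less_imp_le])
       (rule span_mono[THEN subsetD, rotated], use b(3) in auto)
  have 2: "mop (\<alpha> \<oplus>\<^sub>e \<beta>) u \<in> filt u (wt p w \<alpha> + i)"
    using exps_add[OF assms(1) b(2)] b(3) by (intro mon_in_filt) (auto simp: wt_add)
  from subspace_add[OF subspace_filt 1 2] show "mop \<alpha> x \<in> filt u (wt p w \<alpha> + i)" by simp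
qed (rule subspace_filt)

lemma filt_filt:
  assumes "v \<in> filt u c" shows "filt v i \<subseteq> filt u (i + c)"
  unfolding filt_def[of v]
proof (rule span_minimal[OF _ subspace_filt], safe)
  fix \<alpha> assume a: "\<alpha> \<in> exps p" "wt p w \<alpha> \<le> i"
  show "mop \<alpha> v \<in> filt u (i + c)"
    using mon_filt[OF a(1) assms] filt_mono[of "wt p w \<alpha> + c" "i + c" u] a(2) by auto
qed

lemma stable_Union_filt: "stable (\<Union>i. filt u i)"
proof -
  have "subspace (\<Union>i. filt u i)"
  proof (rule subspaceI)
    show "0 \<in> (\<Union>i. filt u i)" using subspace_0[OF subspace_filt] by blast
    fix x y assume "x \<in> (\<Union>i. filt u i)" "y \<in> (\<Union>i. filt u i)"
    then obtain i j where "x \<in> filt u i" "y \<in> filt u j" by blast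
    then have "x \<in> filt u (max i j)" "y \<in> filt u (max i j)"
      using filt_mono[of _ "max i j"] by (meson max.cobounded1 max.cobounded2 subsetD)+
    then show "x + y \<in> (\<Union>i. filt u i)" using subspace_add[OF subspace_filt] by blast
  next
    fix c x assume "x \<in> (\<Union>i. filt u i)"
    then show "scale c x \<in> (\<Union>i. filt u i)" using subspace_scale[OF subspace_filt] by blast
  qed
  moreover have "mop \<alpha> v \<in> (\<Union>i. filt u i)" if "\<alpha> \<in> exps p" "v \<in> (\<Union>i. filt u i)" for \<alpha> v
    using mon_filt[OF that(1)] that(2) by blast
  ultimately show ?thesis by (auto simp: stable_def)
qed

lemma stair_independent:
  assumes Z: "subspace Z" and B: "independent B" "B \<subseteq> Z" "finite B"
    and F: "finite F" "F \<subseteq> stair Z u"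
  shows "independent (B \<union> (\<lambda>\<alpha>. mop \<alpha> u) ` F) \<and> card (B \<union> (\<lambda>\<alpha>. mop \<alpha> u) ` F) = card B + card F"
  using F
proof (induction "card F" arbitrary: F)
  case 0
  then show ?case using B by simp
next
  case (Suc n)
  then have "F \<noteq> {}" by auto
  then obtain m where m: "m \<in> F" "\<forall>\<beta>\<in>F. \<beta> = m \<or> mless p w \<beta> m" using mless_max_exists Suc.prems(1) by blast
  define G where "G = F - {m}"
  have G: "F = insert m G" "m \<notin> G" "finite G" "card G = n" "G \<subseteq> stair Z u"
    using m(1) Suc by (auto simp: G_def)
  have IH: "independent (B \<union> (\<lambda>\<alpha>. mop \<alpha> u) ` G)" "card (B \<union> (\<lambda>\<alpha>. mop \<alpha> u) ` G) = card B + card G"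
    using Suc.hyps(1)[of G] G by auto
  have "B \<union> (\<lambda>\<alpha>. mop \<alpha> u) ` G \<subseteq> Z \<union> low u m"
    using B(2) m(2) G by (auto simp: low_def stair_def)
  then have "span (B \<union> (\<lambda>\<alpha>. mop \<alpha> u) ` G) \<subseteq> span (Z \<union> low u m)" by (rule span_mono)
  then have nin: "mop m u \<notin> span (B \<union> (\<lambda>\<alpha>. mop \<alpha> u) ` G)" using m(1) Suc.prems(2) by (auto simp: stair_def)
  have nin2: "mop m u \<notin> B \<union> (\<lambda>\<alpha>. mop \<alpha> u) ` G" using nin span_base[of "mop m u"] by metis
  have "B \<union> (\<lambda>\<alpha>. mop \<alpha> u) ` F = insert (mop m u) (B \<union> (\<lambda>\<alpha>. mop \<alpha> u) ` G)" using G(1) by simp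
  moreover have "finite (B \<union> (\<lambda>\<alpha>. mop \<alpha> u) ` G)" using G(3) B(3) by simp
  moreover have "card F = Suc (card G)" using G by simp
  ultimately show ?case using independent_insertI[OF nin IH(1)] IH(2) nin2 by simp
qed

lemma stair_spans:
  assumes Z: "subspace Z" and a: "\<alpha> \<in> exps p" "wt p w \<alpha> \<le> i"
  shows "mop \<alpha> u \<in> span (Z \<union> (\<lambda>\<alpha>. mop \<alpha> u) ` {\<beta> \<in> stair Z u. wt p w \<beta> \<le> i})"
  using a
proof (induction \<alpha> rule: wf_induct_rule[OF wf_mless[of p w]])
  case (1 \<alpha>)
  let ?S = "Z \<union> (\<lambda>\<alpha>. mop \<alpha> u) ` {\<beta> \<in> stair Z u. wt p w \<beta> \<le> i}"
  show ?case
  proof (cases "\<alpha> \<in> stair Z u")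
    case True
    then show ?thesis using 1 by (intro span_base) auto
  next
    case False
    have "low u \<alpha> \<subseteq> span ?S"
    proof
      fix x assume "x \<in> low u \<alpha>"
      then obtain \<beta> where b: "x = mop \<beta> u" "\<beta> \<in> exps p" "mless p w \<beta> \<alpha>" by (auto simp: low_def)
      moreover have "wt p w \<beta> \<le> i" using b(3) 1(3) by (auto simp: mless_def)
      ultimately show "x \<in> span ?S" using 1(1)[of \<beta>] by simp
    qed
    moreover have "Z \<subseteq> span ?S" using span_superset[of ?S] by blast
    ultimately have "span (Z \<union> low u \<alpha>) \<subseteq> span ?S" by (intro span_minimal) auto
    then show ?thesis using False 1(2) by (auto simp: stair_def)
  qed
qed

text \<open>
  The monomials in the staircase of \<open>Z\<close> form a basis of a complement of \<open>Z\<close> in every piece of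
  the filtration, so the Hilbert functions of \<open>Z\<close> and of its staircase add up to that of the
  module.
\<close>

lemma filt_dim:
  assumes Z: "subspace Z" and fin: "finite B0" "filt u i \<subseteq> span B0"
  shows "finite {\<alpha> \<in> stair Z u. wt p w \<alpha> \<le> i}"
    and "dim (filt u i) = dim (Z \<inter> filt u i) + card {\<alpha> \<in> stair Z u. wt p w \<alpha> \<le> i}"
proof -
  let ?St = "{\<alpha> \<in> stair Z u. wt p w \<alpha> \<le> i}"
  obtain B where B: "B \<subseteq> Z \<inter> filt u i" "independent B" "Z \<inter> filt u i \<subseteq> span B"
    using maximal_independent_subset by blast
  have finB: "finite B" using independent_span_bound[OF fin(1) B(2)] B(1) fin(2) by blast
  have sub: "(\<lambda>\<alpha>. mop \<alpha> u) ` ?St \<subseteq> filt u i" by (auto simp: stair_def intro: mon_in_filt)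
  have bound: "card F \<le> card B0" if "finite F" "F \<subseteq> ?St" for F
  proof -
    have ind: "independent (B \<union> (\<lambda>\<alpha>. mop \<alpha> u) ` F)" "card (B \<union> (\<lambda>\<alpha>. mop \<alpha> u) ` F) = card B + card F"
      using stair_independent[OF Z B(2) _ finB that(1)] B(1) that(2) by blast+
    have "B \<union> (\<lambda>\<alpha>. mop \<alpha> u) ` F \<subseteq> span B0" using B(1) sub that(2) fin(2) by blast
    then show ?thesis using independent_span_bound[OF fin(1) ind(1)] ind(2) by simp
  qed
  show finS: "finite ?St"
  proof (rule ccontr)
    assume "infinite ?St"
    then obtain F where "F \<subseteq> ?St" "card F = Suc (card B0)" "finite F"
      using infinite_arbitrarily_large by blast
    then show False using bound by fastforce
  qed
  let ?C = "B \<union> (\<lambda>\<alpha>. mop \<alpha> u) ` ?St"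
  have C: "independent ?C" "card ?C = card B + card ?St"
    using stair_independent[OF Z B(2) _ finB finS] B(1) by blast+
  have "filt u i \<subseteq> span ?C"
  proof
    fix v assume v: "v \<in> filt u i"
    have "filt u i \<subseteq> span (Z \<union> (\<lambda>\<alpha>. mop \<alpha> u) ` ?St)"
      unfolding filt_def by (rule span_minimal) (use stair_spans[OF Z] in auto)
    then have "v \<in> span (Z \<union> (\<lambda>\<alpha>. mop \<alpha> u) ` ?St)" using v by blast
    then obtain x s where xs: "v = x + s" "x \<in> Z" "s \<in> span ((\<lambda>\<alpha>. mop \<alpha> u) ` ?St)"
      by (rule span_Un_subspace[OF Z])
    have "s \<in> filt u i" using xs(3) span_minimal[OF sub subspace_filt] by blast
    then have "x \<in> filt u i" using subspace_diff[OF subspace_filt v, of s] xs(1) by simp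
    then have "x \<in> span ?C" using xs(2) B(3) span_mono[of B ?C] by blast
    moreover have "s \<in> span ?C" using xs(3) span_mono[of "(\<lambda>\<alpha>. mop \<alpha> u) ` ?St" ?C] by blast
    ultimately show "v \<in> span ?C" using xs(1) by (simp add: span_add)
  qed
  moreover have "?C \<subseteq> filt u i" using B(1) sub by blast
  ultimately have "card ?C = dim (filt u i)" using C(1) by (intro basis_card_eq_dim)
  moreover have "card B = dim (Z \<inter> filt u i)" using B by (intro basis_card_eq_dim)
  ultimately show "dim (filt u i) = dim (Z \<inter> filt u i) + card ?St" using C(2) by simp
qed

text \<open>
  The leading exponents of \<open>Z\<close> fill finitely many orthants, and \<open>G\<close> contains for the corner \<open>\<mu>\<close>
  of each of them an element \<open>n\<close> of \<open>Z\<close> with leading exponent \<open>\<mu>\<close>. Cancelling leading terms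
  never raises the weight. Hence every element of \<open>Z\<close> of filtration degree \<open>i\<close> is a combination
  of multiples of the \<open>n\<close> that involve only exponents of weight at most \<open>i\<close>; it is this control
  of degrees that is used later.
\<close>

lemma standard_basis:
  assumes Z: "stable Z"
  shows "\<exists>G. finite G \<and> (\<forall>(\<mu>,n)\<in>G. n \<in> Z) \<and>
    (\<forall>i. Z \<inter> filt u i \<subseteq> span {mop \<gamma> n | \<gamma> \<mu> n. \<gamma> \<in> exps p \<and> (\<mu>,n) \<in> G \<and> wt p w \<gamma> + wt p w \<mu> \<le> i})"
proof -
  obtain C where C: "finite C" "\<And>\<beta> S. (\<beta>,S) \<in> C \<Longrightarrow> S \<subseteq> {..<p}"
    "exps p - stair Z u = (\<Union>(\<beta>,S)\<in>C. orthant \<beta> S)"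
    by (rule down_closed_diff_orthants[OF down_closed_exps stair_down_closed[OF Z, of u]]) (rule that)
  have "\<exists>n\<in>Z. mop \<mu> u - n \<in> span (low u \<mu>)" if "(\<mu>,S) \<in> C" for \<mu> S
  proof -
    have "\<mu> \<in> orthant \<mu> S" by (simp add: orthant_def)
    then have "\<mu> \<in> exps p - stair Z u" using that C(3) by blast
    then have "mop \<mu> u \<in> span (Z \<union> low u \<mu>)" by (simp add: stair_def)
    then obtain x l where xl: "mop \<mu> u = x + l" "x \<in> Z" "l \<in> span (low u \<mu>)"
      by (rule span_Un_subspace[OF stable_subspace[OF Z]])
    then show ?thesis by (intro bexI[of _ x]) auto
  qed
  then have ex: "\<exists>n. n \<in> Z \<and> mop \<mu> u - n \<in> span (low u \<mu>)" if "(\<mu>,S) \<in> C" for \<mu> S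
    using that by blast
  define n where "n \<mu> = (SOME n. n \<in> Z \<and> mop \<mu> u - n \<in> span (low u \<mu>))" for \<mu>
  have n: "n \<mu> \<in> Z \<and> mop \<mu> u - n \<mu> \<in> span (low u \<mu>)" if "(\<mu>,S) \<in> C" for \<mu> S
    unfolding n_def by (rule someI_ex) (rule ex[OF that])
  define G where "G = (\<lambda>(\<mu>,S). (\<mu>, n \<mu>)) ` C"
  let ?T = "\<lambda>i. {mop \<gamma> n | \<gamma> \<mu> n. \<gamma> \<in> exps p \<and> (\<mu>,n) \<in> G \<and> wt p w \<gamma> + wt p w \<mu> \<le> i}"
  have claim: "v \<in> span (?T i)"
    if "finite F" "F \<subseteq> exps p" "\<forall>\<beta>\<in>F. \<beta> = \<alpha> \<or> mless p w \<beta> \<alpha>" "\<alpha> \<in> F" "wt p w \<alpha> \<le> i"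
       "v \<in> Z" "v \<in> span ((\<lambda>\<beta>. mop \<beta> u) ` F)" for F \<alpha> i v
    using that
  proof (induction \<alpha> arbitrary: F v rule: wf_induct_rule[OF wf_mless[of p w]])
    case (1 \<alpha>)
    have lower: "y \<in> span (?T i)" if y: "y \<in> Z" "y \<in> span (low u \<alpha>)" for y
    proof -
      obtain F0 where F0: "finite F0" "F0 \<subseteq> low u \<alpha>" "y \<in> span F0" using span_finite_subset[OF y(2)] by blast
      have "F0 \<subseteq> (\<lambda>\<beta>. mop \<beta> u) ` {\<beta> \<in> exps p. mless p w \<beta> \<alpha>}" using F0(2) by (auto simp: low_def)
      then obtain F' where F': "F' \<subseteq> {\<beta> \<in> exps p. mless p w \<beta> \<alpha>}" "finite F'" "F0 = (\<lambda>\<beta>. mop \<beta> u) ` F'"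
        using finite_subset_image[OF F0(1)] by meson
      show ?thesis
      proof (cases "F' = {}")
        case True
        then have "y = 0" using F0(3) F'(3) by simp
        then show ?thesis by (simp add: span_zero)
      next
        case False
        then obtain m where m: "m \<in> F'" "\<forall>\<beta>\<in>F'. \<beta> = m \<or> mless p w \<beta> m"
          using mless_max_exists F'(2) by blast
        have me: "m \<in> exps p" "mless p w m \<alpha>" using m(1) F'(1) by auto
        moreover have "wt p w m \<le> i" using me(2) 1(6) by (auto simp: mless_def)
        moreover have "(m, \<alpha>) \<in> {(\<alpha>, \<beta>). \<alpha> \<in> exps p \<and> mless p w \<alpha> \<beta>}" using me by simp
        moreover have "F' \<subseteq> exps p" using F'(1) by blast
        moreover have "y \<in> span ((\<lambda>\<beta>. mop \<beta> u) ` F')" using F0(3) F'(3) by simp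
        ultimately show ?thesis
          using 1(1)[of m F' y] m F'(2) y(1) by blast
      qed
    qed
    have "v \<in> span (insert (mop \<alpha> u) (low u \<alpha>))"
      using 1(8) by (rule span_mono[THEN subsetD, rotated]) (use 1(3,4) in \<open>auto simp: low_def\<close>)
    then obtain c where c: "v - scale c (mop \<alpha> u) \<in> span (low u \<alpha>)" by (auto simp: span_breakdown_eq)
    show ?case
    proof (cases "c = 0")
      case True
      then show ?thesis using lower 1(7) c by simp
    next
      case False
      have ae: "\<alpha> \<in> exps p" using 1(3,5) by blast
      have "mop \<alpha> u \<in> span (Z \<union> low u \<alpha>)"
      proof -
        have 1: "v \<in> span (Z \<union> low u \<alpha>)" using 1(7) by (intro span_base) simp
        have 2: "v - scale c (mop \<alpha> u) \<in> span (Z \<union> low u \<alpha>)"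
          using c span_mono[of "low u \<alpha>" "Z \<union> low u \<alpha>"] by blast
        from span_diff[OF 1 2] have "scale c (mop \<alpha> u) \<in> span (Z \<union> low u \<alpha>)" by simp
        then have "scale (inverse c) (scale c (mop \<alpha> u)) \<in> span (Z \<union> low u \<alpha>)" by (rule span_scale)
        then show ?thesis using False by simp
      qed
      then have "\<alpha> \<in> exps p - stair Z u" using ae by (simp add: stair_def)
      then obtain \<mu> S where mS: "(\<mu>,S) \<in> C" "\<alpha> \<in> orthant \<mu> S" unfolding C(3) by blast
      have "\<mu> \<in> orthant \<mu> S" by (simp add: orthant_def)
      then have mue: "\<mu> \<in> exps p" using mS(1) C(3) by blast
      define \<gamma> where "\<gamma> i = \<alpha> i - \<mu> i" for i
      have g: "\<gamma> \<in> exps p" "\<gamma> \<oplus>\<^sub>e \<mu> = \<alpha>"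
        using ae mS(2) by (auto simp: \<gamma>_def exps_def orthant_def)
      have nn: "n \<mu> \<in> Z" "mop \<mu> u - n \<mu> \<in> span (low u \<mu>)" using n mS(1) by auto
      have gnX: "mop \<gamma> (n \<mu>) \<in> Z" using Z nn(1) g(1) by (auto simp: stable_def)
      have "mop \<alpha> u - mop \<gamma> (n \<mu>) = mop \<gamma> (mop \<mu> u - n \<mu>) - (mop \<gamma> (mop \<mu> u) - mop \<alpha> u)"
        by (simp add: mon_diff)
      also have "\<dots> \<in> span (low u \<alpha>)"
        by (rule span_diff[OF mon_low[OF g(1) nn(2), unfolded g(2)] mon_mon_low[OF g(1) mue, of u, unfolded g(2)]])
      finally have "mop \<alpha> u - mop \<gamma> (n \<mu>) \<in> span (low u \<alpha>)" .
      from span_add[OF c span_scale[OF this, of c]]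
      have "(v - scale c (mop \<alpha> u)) + scale c (mop \<alpha> u - mop \<gamma> (n \<mu>)) \<in> span (low u \<alpha>)" .
      then have "v - scale c (mop \<gamma> (n \<mu>)) \<in> span (low u \<alpha>)" by (simp add: scale_right_diff_distrib)
      moreover have "v - scale c (mop \<gamma> (n \<mu>)) \<in> Z"
        using stable_subspace[OF Z] 1(7) gnX by (simp add: subspace_diff subspace_scale)
      ultimately have 2: "v - scale c (mop \<gamma> (n \<mu>)) \<in> span (?T i)" using lower by blast
      have "(\<mu>, n \<mu>) \<in> G" unfolding G_def using mS(1) by force
      moreover have "wt p w \<gamma> + wt p w \<mu> \<le> i" using g(2) 1(6) wt_add[of p w \<gamma> \<mu>] by simp
      ultimately have "mop \<gamma> (n \<mu>) \<in> ?T i" using g(1) by blast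
      then have "scale c (mop \<gamma> (n \<mu>)) \<in> span (?T i)" by (intro span_scale span_base)
      from span_add[OF 2 this] show ?thesis by simp
    qed
  qed
  have "Z \<inter> filt u i \<subseteq> span (?T i)" for i
  proof
    fix v assume v: "v \<in> Z \<inter> filt u i"
    then obtain F0 where F0: "finite F0" "F0 \<subseteq> {mop \<alpha> u |\<alpha>. \<alpha> \<in> exps p \<and> wt p w \<alpha> \<le> i}" "v \<in> span F0"
      unfolding filt_def using span_finite_subset by blast
    have "F0 \<subseteq> (\<lambda>\<beta>. mop \<beta> u) ` {\<beta> \<in> exps p. wt p w \<beta> \<le> i}" using F0(2) by auto
    then obtain F where F: "F \<subseteq> {\<beta> \<in> exps p. wt p w \<beta> \<le> i}" "finite F" "F0 = (\<lambda>\<beta>. mop \<beta> u) ` F"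
      using finite_subset_image[OF F0(1)] by meson
    show "v \<in> span (?T i)"
    proof (cases "F = {}")
      case True
      then have "v = 0" using F0(3) F(3) by simp
      then show ?thesis by (simp add: span_zero)
    next
      case False
      then obtain m where m: "m \<in> F" "\<forall>\<beta>\<in>F. \<beta> = m \<or> mless p w \<beta> m"
        using mless_max_exists F(2) by blast
      have "F \<subseteq> exps p" "wt p w m \<le> i" using F(1) m(1) by auto
      moreover have "v \<in> span ((\<lambda>\<beta>. mop \<beta> u) ` F)" using F0(3) F(3) by simp
      ultimately show ?thesis using claim[of F m i v] F(2) m v by blast
    qed
  qed
  moreover have "finite G" "\<forall>(\<mu>,n)\<in>G. n \<in> Z" unfolding G_def using C(1) n by auto
  ultimately show ?thesis by blast
qed

end

section \<open>Adjoining commuting operators\<close>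

lemma wt_Suc: "wt (Suc p) (w(p := 1)) \<alpha> = wt p w \<alpha> + \<alpha> p"
  by (simp add: wt_def)

lemmas wt_Suc' = wt_Suc[unfolded One_nat_def]

lemma wt_upd: "wt p w (\<alpha>(p := k)) = wt p w \<alpha>"
  by (simp add: wt_def)

lemma exps_Suc: "\<alpha> \<in> exps (Suc p) \<Longrightarrow> \<alpha>(p := 0) \<in> exps p"
  by (auto simp: exps_def)

context vector_space
begin

lemma linear_funpow:
  assumes "Vector_Spaces.linear scale scale R" shows "Vector_Spaces.linear scale scale (R ^^ l)"
proof (induction l)
  case 0 then show ?case by (simp add: Vector_Spaces.linear_iff vector_space_axioms)
next
  case (Suc l) then show ?case using assms by (simp add: Vector_Spaces.linear_iff)
qed

text \<open>
  Each application of \<open>R\<close> adds to \<open>U\<close> and the vectors collected so far only the images of the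
  \<open>q\<close> vectors that complete a basis of \<open>U\<close> to one of \<open>W\<close>.
\<close>

lemma finite_span_extend_iterates:
  assumes R: "Vector_Spaces.linear scale scale R"
    and U: "U \<subseteq> W" "R ` U \<subseteq> W" "finite B0" "W \<subseteq> span B0" and q: "dim W \<le> dim U + q"
  shows "\<exists>B. finite B \<and> card B \<le> dim U + k * q \<and> (\<forall>l\<le>k. (R ^^ l) ` U \<subseteq> span B)"
proof -
  interpret R: Vector_Spaces.linear scale scale R by (rule R)
  obtain BU where BU: "BU \<subseteq> U" "independent BU" "U \<subseteq> span BU"
    using maximal_independent_subset by blast
  have "BU \<subseteq> W" using BU U by blast
  then obtain BW where BW: "BU \<subseteq> BW" "BW \<subseteq> W" "independent BW" "W \<subseteq> span BW"
    using maximal_independent_subset_extend[OF _ BU(2)] by blast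
  have finW: "finite BW" using independent_span_bound[OF U(3) BW(3)] BW(2) U(4) by blast
  have finU: "finite BU" using finW BW(1) finite_subset by blast
  define Q where "Q = BW - BU"
  have cU: "card BU = dim U" using BU by (intro basis_card_eq_dim)
  have cW: "card BW = dim W" using BW by (intro basis_card_eq_dim)
  have cQ: "card Q \<le> q" unfolding Q_def using card_Diff_subset[OF finU BW(1)] cU cW q by simp
  have WQ: "W \<subseteq> span (BU \<union> Q)" using BW(1,4) by (simp add: Q_def Un_absorb1)
  have finQ: "finite Q" using finW by (simp add: Q_def)
  define Bk where "Bk k = BU \<union> (\<Union>l<k. (R ^^ l) ` Q)" for k
  have Bk_mono: "Bk l \<subseteq> Bk m" if "l \<le> m" for l m
    unfolding Bk_def using that by (intro Un_mono UN_mono) auto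
  have sp: "(R ^^ l) ` U \<subseteq> span (Bk l)" for l
  proof (induction l)
    case 0
    then show ?case using BU by (simp add: Bk_def)
  next
    case (Suc l)
    interpret L: Vector_Spaces.linear scale scale "R ^^ l" by (rule linear_funpow[OF R])
    have "(R ^^ Suc l) ` U = (R ^^ l) ` (R ` U)" by (simp add: funpow_swap1 image_image)
    also have "\<dots> \<subseteq> (R ^^ l) ` span (BU \<union> Q)" using U(2) WQ by blast
    also have "\<dots> = span ((R ^^ l) ` (BU \<union> Q))" using L.span_image by simp
    also have "\<dots> \<subseteq> span (Bk (Suc l))"
    proof (rule span_minimal)
      have "(R ^^ l) ` BU \<subseteq> span (Bk l)" using Suc BU(1) by blast
      moreover have "span (Bk l) \<subseteq> span (Bk (Suc l))" by (intro span_mono Bk_mono) simp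
      moreover have "(R ^^ l) ` Q \<subseteq> span (Bk (Suc l))" using span_superset[of "Bk (Suc l)"] by (auto simp: Bk_def)
      ultimately show "(R ^^ l) ` (BU \<union> Q) \<subseteq> span (Bk (Suc l))" unfolding image_Un by blast
    qed simp
    finally show ?case .
  qed
  have mono: "span (Bk l) \<subseteq> span (Bk k)" if "l \<le> k" for l
    using that by (intro span_mono Bk_mono)
  have "card (Bk k) \<le> dim U + k * q"
  proof -
    have "card (Bk k) \<le> card BU + card (\<Union>l<k. (R ^^ l) ` Q)" unfolding Bk_def by (rule card_Un_le)
    also have "card (\<Union>l<k. (R ^^ l) ` Q) \<le> (\<Sum>l<k. card ((R ^^ l) ` Q))" by (rule card_UN_le) simp
    also have "\<dots> \<le> (\<Sum>l<k. q)" by (rule sum_mono) (use card_image_le[OF finQ] cQ le_trans in blast)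
    finally show ?thesis using cU by simp
  qed
  moreover have "finite (Bk k)" using finU finQ by (simp add: Bk_def)
  ultimately show ?thesis using sp mono by (intro exI[of _ "Bk k"]) blast
qed

end

text \<open>
  The new variable, with index \<open>p\<close>, acts by \<open>R\<close>.
\<close>

definition ext_mon :: "nat \<Rightarrow> ((nat \<Rightarrow> nat) \<Rightarrow> 'v \<Rightarrow> 'v) \<Rightarrow> ('v \<Rightarrow> 'v) \<Rightarrow> (nat \<Rightarrow> nat) \<Rightarrow> 'v \<Rightarrow> 'v" where
  "ext_mon p mop R \<alpha> v = (R ^^ \<alpha> p) (mop (\<alpha>(p := 0)) v)"

context monomial_action
begin

lemma funpow_mon: "(\<And>\<alpha> v. R (mop \<alpha> v) = mop \<alpha> (R v)) \<Longrightarrow> (R ^^ k) (mop \<alpha> v) = mop \<alpha> ((R ^^ k) v)"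
  by (induction k) auto

lemma ext_action:
  assumes R: "Vector_Spaces.linear scale scale R" and comm: "\<And>\<alpha> v. R (mop \<alpha> v) = mop \<alpha> (R v)"
  shows "monomial_action scale (Suc p) (w(p := 1)) (ext_mon p mop R)"
proof unfold_locales
  fix \<alpha> u v c
  interpret L: Vector_Spaces.linear scale scale "R ^^ k" for k by (rule linear_funpow[OF R])
  have "(\<lambda>_. 0::nat)(p := 0) = (\<lambda>_. 0)" by auto
  then show "ext_mon p mop R (\<lambda>_. 0) v = v" by (simp add: ext_mon_def mon_zero)
  show "ext_mon p mop R \<alpha> (u + v) = ext_mon p mop R \<alpha> u + ext_mon p mop R \<alpha> v"
    by (simp add: ext_mon_def mon_add L.add)
  show "ext_mon p mop R \<alpha> (scale c v) = scale c (ext_mon p mop R \<alpha> v)"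
    by (simp add: ext_mon_def mon_scale L.scale)
  fix \<beta> assume a: "\<alpha> \<in> exps (Suc p)" and b: "\<beta> \<in> exps (Suc p)"
  define \<alpha>0 where "\<alpha>0 = \<alpha>(p := 0)"
  define \<beta>0 where "\<beta>0 = \<beta>(p := 0)"
  have e0: "(\<lambda>i. \<alpha> i + \<beta> i)(p := 0) = \<alpha>0 \<oplus>\<^sub>e \<beta>0" by (auto simp: \<alpha>0_def \<beta>0_def)
  have 1: "ext_mon p mop R \<alpha> (ext_mon p mop R \<beta> v) = (R ^^ (\<alpha> p + \<beta> p)) (mop \<alpha>0 (mop \<beta>0 v))"
    by (simp add: ext_mon_def \<alpha>0_def \<beta>0_def funpow_add funpow_mon[OF comm])
  have 2: "ext_mon p mop R (\<alpha> \<oplus>\<^sub>e \<beta>) v = (R ^^ (\<alpha> p + \<beta> p)) (mop (\<alpha>0 \<oplus>\<^sub>e \<beta>0) v)"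
    using e0 by (simp add: ext_mon_def)
  have ab: "\<alpha>0 \<in> exps p" "\<beta>0 \<in> exps p" using a b exps_Suc by (auto simp: \<alpha>0_def \<beta>0_def)
  have w0: "wt p w \<alpha>0 = wt p w \<alpha>" "wt p w \<beta>0 = wt p w \<beta>" by (simp_all add: \<alpha>0_def \<beta>0_def wt_upd)
  let ?S = "{mop \<gamma> v |\<gamma>. \<gamma> \<in> exps p \<and> wt p w \<gamma> < wt p w \<alpha>0 + wt p w \<beta>0}"
  let ?T = "{ext_mon p mop R \<gamma> v |\<gamma>. \<gamma> \<in> exps (Suc p) \<and>
          wt (Suc p) (w(p := 1)) \<gamma> < wt (Suc p) (w(p := 1)) \<alpha> + wt (Suc p) (w(p := 1)) \<beta>}"
  have "ext_mon p mop R \<alpha> (ext_mon p mop R \<beta> v) - ext_mon p mop R (\<alpha> \<oplus>\<^sub>e \<beta>) v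
      = (R ^^ (\<alpha> p + \<beta> p)) (mop \<alpha>0 (mop \<beta>0 v) - mop (\<alpha>0 \<oplus>\<^sub>e \<beta>0) v)"
    unfolding 1 2 by (simp only: L.diff)
  also have "\<dots> \<in> (R ^^ (\<alpha> p + \<beta> p)) ` span ?S" using mon_mon[OF ab, of v] by (rule imageI)
  also have "\<dots> = span ((R ^^ (\<alpha> p + \<beta> p)) ` ?S)" by (rule L.span_image[symmetric])
  also have "\<dots> \<subseteq> span ?T"
  proof (rule span_mono, clarify)
    fix \<gamma> assume g: "\<gamma> \<in> exps p" "wt p w \<gamma> < wt p w \<alpha>0 + wt p w \<beta>0"
    have "\<gamma>(p := 0) = \<gamma>" using g(1) by (auto simp: exps_def)
    then have "(R ^^ (\<alpha> p + \<beta> p)) (mop \<gamma> v) = ext_mon p mop R (\<gamma>(p := \<alpha> p + \<beta> p)) v"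
      by (simp add: ext_mon_def)
    moreover have "\<gamma>(p := \<alpha> p + \<beta> p) \<in> exps (Suc p)" using g(1) by (auto simp: exps_def)
    moreover have "wt (Suc p) (w(p := 1)) (\<gamma>(p := \<alpha> p + \<beta> p)) < wt (Suc p) (w(p := 1)) \<alpha> + wt (Suc p) (w(p := 1)) \<beta>"
      using g(2) w0 by (simp add: wt_Suc' wt_upd)
    ultimately show "\<exists>\<gamma>'. (R ^^ (\<alpha> p + \<beta> p)) (mop \<gamma> v) = ext_mon p mop R \<gamma>' v \<and> \<gamma>' \<in> exps (Suc p) \<and>
          wt (Suc p) (w(p := 1)) \<gamma>' < wt (Suc p) (w(p := 1)) \<alpha> + wt (Suc p) (w(p := 1)) \<beta>" by blast
  qed
  finally show "ext_mon p mop R \<alpha> (ext_mon p mop R \<beta> v) - ext_mon p mop R (\<alpha> \<oplus>\<^sub>e \<beta>) v \<in> span ?T" .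
qed

lemma stable_zero: "stable {0}"
  by (auto simp: stable_def mon_0)

text \<open>
  The key step: an operator \<open>R\<close> that commutes with the action can be adjoined to it without
  raising the order \<open>n\<close> of growth, at the price of passing from \<open>u\<close> to another vector \<open>u'\<close>.

  Among the nonzero stable subspaces of the module generated by \<open>u\<close>, let \<open>N\<close> be one whose
  staircase contains the largest number of \<open>n\<close>-dimensional orthants, that is, a quotient by \<open>N\<close>
  of the largest multiplicity. The subspace \<open>N'\<close> of all \<open>v\<close> in \<open>N\<close> with \<open>R v\<close> in \<open>N\<close> is stable
  and, by the assumption \<open>ore\<close>, nonzero. By maximality the staircases of \<open>N\<close> and \<open>N'\<close> differ
  only by orthants of dimension less than \<open>n\<close>. A standard basis of \<open>N'\<close> shows that \<open>R\<close> maps the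
  piece of degree \<open>j\<close> of \<open>N'\<close> into the piece of degree \<open>j + c\<close> of \<open>N\<close>, for a constant \<open>c\<close>, and
  the dimensions of these two pieces differ by \<open>O(j\<^sup>n\<^sup>-\<^sup>1)\<close>. Therefore \<open>i\<close> applications of \<open>R\<close> to
  the piece of \<open>N'\<close> enlarge its dimension by at most \<open>i\<close> times this bound, which is again
  \<open>O(i\<^sup>n)\<close>. Any nonzero \<open>u'\<close> in \<open>N'\<close> will do.
\<close>

lemma extension_step:
  assumes n: "n \<ge> 1" and u: "u \<noteq> 0"
    and fd: "\<And>i. \<exists>B. finite B \<and> card B \<le> C * (i+1)^n \<and> filt u i \<subseteq> span B"
    and R: "Vector_Spaces.linear scale scale R" and comm: "\<And>\<alpha> v. R (mop \<alpha> v) = mop \<alpha> (R v)"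
    and ore: "\<And>Z. stable Z \<Longrightarrow> Z \<noteq> {0} \<Longrightarrow> \<exists>v\<in>Z. v \<noteq> 0 \<and> R v \<in> Z"
  shows "\<exists>u' C'. u' \<noteq> 0 \<and> (\<forall>i. \<exists>B. finite B \<and> card B \<le> C' * (i+1)^n \<and>
     monomial_action.filt scale (Suc p) (w(p := 1)) (ext_mon p mop R) u' i \<subseteq> span B)"
proof -
  interpret R: Vector_Spaces.linear scale scale R by (rule R)
  interpret ext: monomial_action scale "Suc p" "w(p := 1)" "ext_mon p mop R"
    by (rule ext_action[OF R comm])
  have fs: "\<exists>B. finite B \<and> filt u i \<subseteq> span B" for i using fd by blast
  have dle: "dim (filt u i) \<le> C * (i+1)^n" for i
    using fd[of i] dim_le_card le_trans by blast
  have finst: "finite {\<alpha> \<in> stair Z u. wt p w \<alpha> \<le> i}" if "subspace Z" for Z i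
    using filt_dim(1)[OF that] fs[of i] by blast
  have dimf: "dim (filt u i) = dim (Z \<inter> filt u i) + card {\<alpha> \<in> stair Z u. wt p w \<alpha> \<le> i}" if "subspace Z" for Z i
    using filt_dim(2)[OF that] fs[of i] by blast
  define E where "E = stair {0} u"
  interpret E: staircase p w E
    unfolding E_def by unfold_locales (use stair_down_closed[OF stable_zero] finst in auto)
  have "card {\<alpha> \<in> E. wt p w \<alpha> \<le> i} \<le> C * (i+1)^n" for i
    using dimf[of "{0}" i] dle[of i] by (simp add: E_def)
  then have dimE: "card S \<le> n" if "S \<subseteq> {..<p}" "orthant \<beta> S \<subseteq> E" for \<beta> S
    using orthant_dim_le[OF that(2,1) E.fin] by blast
  define M where "M = (\<Union>i. filt u i)"
  have uM: "u \<in> M" unfolding M_def using mon_in_filt[OF exps_zero, of 0 u] by (auto simp: wt_zero mon_zero)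
  let ?P = "\<lambda>Z. stable Z \<and> Z \<subseteq> M \<and> Z \<noteq> {0}"
  let ?f = "\<lambda>Z. card (free_orthants p n (stair Z u))"
  have subE: "stair Z u \<subseteq> E" if "stable Z" for Z
    unfolding E_def using stable_subspace[OF that] by (intro stair_antimono) (simp add: subspace_0)
  have finE: "finite (free_orthants p n E)" by (rule E.finite_free_orthants[OF dimE])
  have fsub: "free_orthants p n Z \<subseteq> free_orthants p n Y" if "Z \<subseteq> Y" for Z Y
    using that by (auto simp: free_orthants_def)
  have PM: "?P M" using stable_Union_filt uM u by (auto simp: M_def)
  have bd: "\<forall>Z. ?P Z \<longrightarrow> ?f Z < Suc (card (free_orthants p n E))"
    using card_mono[OF finE fsub[OF subE]] by (simp add: less_Suc_eq_le)
  have "\<exists>N. ?P N \<and> (\<forall>Z. ?P Z \<longrightarrow> ?f Z \<le> ?f N)"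
    by (rule Lattices_Big.ex_has_greatest_nat[of ?P M ?f, OF PM bd])
  then obtain N where N: "?P N" "\<forall>Z. ?P Z \<longrightarrow> ?f Z \<le> ?f N" by (elim exE conjE) (rule that, simp_all)
  \<comment> \<open>the part of \<open>N\<close> that \<open>R\<close> keeps inside \<open>N\<close>; it has the same multiplicity by
    maximality\<close>
  define N' where "N' = {v \<in> N. R v \<in> N}"
  have subN: "subspace N" using N(1) stable_subspace by blast
  have stN': "stable N'"
  proof -
    have "subspace N'" unfolding N'_def
      by (rule subspaceI) (use subN in \<open>auto simp: R.add R.scale R.zero subspace_0 subspace_add subspace_scale\<close>)
    moreover have "mop \<alpha> v \<in> N'" if "\<alpha> \<in> exps p" "v \<in> N'" for \<alpha> v
      using N(1) that by (auto simp: N'_def stable_def comm)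
    ultimately show ?thesis by (auto simp: stable_def)
  qed
  obtain u' where u': "u' \<in> N" "u' \<noteq> 0" "R u' \<in> N" using ore N(1) by blast
  then have u'N: "u' \<in> N'" by (simp add: N'_def)
  have N'N: "N' \<subseteq> N" by (auto simp: N'_def)
  have PN': "?P N'" using stN' N'N N(1) u'N u'(2) by blast
  have subN': "subspace N'" using stN' stable_subspace by blast
  have stsub: "stair N u \<subseteq> stair N' u" using N'N by (rule stair_antimono)
  have eq: "free_orthants p n (stair N u) = free_orthants p n (stair N' u)"
  proof (rule card_subset_eq)
    show "finite (free_orthants p n (stair N' u))" using fsub[OF subE[OF stN']] finE finite_subset by blast
    then have "?f N \<le> ?f N'" by (intro card_mono fsub stsub)
    then show "?f N = ?f N'" using N(2) PN' by (simp add: le_antisym)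
  qed (rule fsub[OF stsub])
  have nofree: "card S \<le> n - 1" if "S \<subseteq> {..<p}" "orthant \<beta> S \<subseteq> stair N' u - stair N u" for \<beta> S
    by (rule E.no_free_orthant_diff[OF _ n subE[OF stN'] stair_down_closed[OF stN'] stsub _ that])
      (use dimE eq in auto)
  interpret E': staircase p w "stair N' u"
    by unfold_locales (use stair_down_closed[OF stN'] finst[OF subN'] in auto)
  obtain C1 where C1: "\<And>i. card {\<alpha>\<in>stair N' u - stair N u. wt p w \<alpha> \<le> i} \<le> C1 * (i+1)^(n-1)"
    using E'.diff_count(1)[OF stair_down_closed, of N u "n-1"] N(1) nofree by blast
  obtain G where G0: "finite G \<and> (\<forall>(\<mu>,n)\<in>G. n \<in> N') \<and>
    (\<forall>i. N' \<inter> filt u i \<subseteq> span {mop \<gamma> n | \<gamma> \<mu> n. \<gamma> \<in> exps p \<and> (\<mu>,n) \<in> G \<and> wt p w \<gamma> + wt p w \<mu> \<le> i})"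
    using standard_basis[OF stN', of u] by (rule exE)
  have G: "finite G" "\<And>\<mu> n. (\<mu>,n)\<in>G \<Longrightarrow> n \<in> N'"
     "\<And>i. N' \<inter> filt u i \<subseteq> span {mop \<gamma> n | \<gamma> \<mu> n. \<gamma> \<in> exps p \<and> (\<mu>,n) \<in> G \<and> wt p w \<gamma> + wt p w \<mu> \<le> i}"
    using conjunct1[OF G0] conjunct1[OF conjunct2[OF G0]] conjunct2[OF conjunct2[OF G0]] by auto
  \<comment> \<open>finitely many generators, so \<open>R\<close> raises degrees on \<open>N'\<close> by a bounded amount\<close>
  have "\<exists>c. \<forall>(\<mu>,n)\<in>G. R n \<in> filt u c"
  proof -
    have "\<forall>g\<in>G. \<exists>c. R (snd g) \<in> filt u c" using G(2) N(1) by (fastforce simp: N'_def M_def)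
    then obtain h where h: "\<And>g. g \<in> G \<Longrightarrow> R (snd g) \<in> filt u (h g)" by metis
    have "R (snd g) \<in> filt u (Max (h ` G))" if "g \<in> G" for g
      using h[OF that] filt_mono[of "h g" "Max (h ` G)" u] G(1) that by auto
    then show ?thesis by (intro exI[of _ "Max (h ` G)"]) auto
  qed
  then obtain c where c: "\<And>\<mu> n. (\<mu>,n) \<in> G \<Longrightarrow> R n \<in> filt u c" by blast
  have Rf: "R v \<in> N \<inter> filt u (i + c)" if v: "v \<in> N' \<inter> filt u i" for v i
  proof
    show "R v \<in> N" using v by (simp add: N'_def)
    have "R v \<in> R ` span {mop \<gamma> n | \<gamma> \<mu> n. \<gamma> \<in> exps p \<and> (\<mu>,n) \<in> G \<and> wt p w \<gamma> + wt p w \<mu> \<le> i}"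
      using v G(3) by blast
    also have "\<dots> = span (R ` {mop \<gamma> n | \<gamma> \<mu> n. \<gamma> \<in> exps p \<and> (\<mu>,n) \<in> G \<and> wt p w \<gamma> + wt p w \<mu> \<le> i})"
      by (rule R.span_image[symmetric])
    also have "\<dots> \<subseteq> filt u (i + c)"
    proof (rule span_minimal[OF _ subspace_filt], clarify)
      fix \<gamma> \<mu> n assume a: "\<gamma> \<in> exps p" "(\<mu>,n) \<in> G" "wt p w \<gamma> + wt p w \<mu> \<le> i"
      have "mop \<gamma> (R n) \<in> filt u (wt p w \<gamma> + c)" using mon_filt[OF a(1) c[OF a(2)]] .
      then show "R (mop \<gamma> n) \<in> filt u (i + c)" using filt_mono[of "wt p w \<gamma> + c" "i + c" u] a(3) by (auto simp: comm)
    qed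
    finally show "R v \<in> filt u (i + c)" .
  qed
  obtain C2 where C2: "\<And>i. card {\<alpha>\<in>E - {}. i < wt p w \<alpha> \<and> wt p w \<alpha> \<le> i + c} \<le> C2 * (i+1)^(n-1)"
    using E.diff_count(2)[OF down_closed_empty, of n c] dimE by auto
  obtain c' where c': "u' \<in> filt u c'" using u'(1) N(1) by (auto simp: M_def)
  define C' where "C' = C * (c'+1)^n + (C1 + C2) * (c'+1)^(n-1)"
  have "dim {0} = 0" using dim_le_card[of "{0}" "{}"] by simp
  then have d: "dim (filt u i) = card {\<alpha> \<in> E. wt p w \<alpha> \<le> i}" for i
    using dimf[of "{0}" i] subspace_0[OF subspace_filt, of u i] by (simp add: E_def)
  have main: "\<exists>B. finite B \<and> card B \<le> C' * (i+1)^n \<and> ext.filt u' i \<subseteq> span B" for i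
  proof -
    \<comment> \<open>\<open>c'\<close> is the degree of \<open>u'\<close> with respect to \<open>u\<close>\<close>
    define j where "j = i + c'"
    define U where "U = N' \<inter> filt u j"
    define W where "W = N \<inter> filt u (j + c)"
    define q where "q = (C1 + C2) * (j+1)^(n-1)"
    obtain B0 where B0: "finite B0" "filt u (j + c) \<subseteq> span B0" using fs by blast
    have UW: "U \<subseteq> W" using N'N filt_mono[of j "j + c" u] by (auto simp: U_def W_def)
    have RU: "R ` U \<subseteq> W" using Rf by (auto simp: U_def W_def)
    have WB: "W \<subseteq> span B0" using B0 by (auto simp: W_def)
    have q: "dim W \<le> dim U + q"
    proof -
      let ?e = "\<lambda>i. card {\<alpha> \<in> E. wt p w \<alpha> \<le> i}"
      let ?a = "\<lambda>i. card {\<alpha> \<in> stair N u. wt p w \<alpha> \<le> i}"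
      let ?b = "\<lambda>i. card {\<alpha> \<in> stair N' u. wt p w \<alpha> \<le> i}"
      have 1: "?e (j + c) = dim W + ?a (j + c)" using dimf[OF subN, of "j+c"] d by (simp add: W_def)
      have 2: "?e j = dim U + ?b j" using dimf[OF subN', of j] d by (simp add: U_def)
      have "?e (j + c) \<le> ?e j + card {\<alpha>\<in>E. j < wt p w \<alpha> \<and> wt p w \<alpha> \<le> j + c}"
      proof -
        have "{\<alpha> \<in> E. wt p w \<alpha> \<le> j + c} = {\<alpha> \<in> E. wt p w \<alpha> \<le> j} \<union> {\<alpha>\<in>E. j < wt p w \<alpha> \<and> wt p w \<alpha> \<le> j + c}" by auto
        then show ?thesis by (simp only: card_Un_le)
      qed
      then have 3: "?e (j + c) \<le> ?e j + C2 * (j+1)^(n-1)" using C2[of j] by simp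
      have "?b j \<le> ?a j + card {\<alpha>\<in>stair N' u - stair N u. wt p w \<alpha> \<le> j}"
      proof -
        have "{\<alpha> \<in> stair N' u. wt p w \<alpha> \<le> j} = {\<alpha> \<in> stair N u. wt p w \<alpha> \<le> j} \<union> {\<alpha>\<in>stair N' u - stair N u. wt p w \<alpha> \<le> j}"
          using stsub by auto
        then show ?thesis by (simp only: card_Un_le)
      qed
      then have 4: "?b j \<le> ?a j + C1 * (j+1)^(n-1)" using C1[of j] by simp
      have 5: "?a j \<le> ?a (j + c)" by (rule card_mono[OF finst[OF subN]]) auto
      show ?thesis using 1 2 3 4 5 unfolding q_def distrib_right by linarith
    qed
    obtain B where B: "finite B" "card B \<le> dim U + i * q" "\<forall>l\<le>i. (R ^^ l) ` U \<subseteq> span B"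
      using finite_span_extend_iterates[OF R UW RU B0(1) WB q, of i] by blast
    have "ext.filt u' i \<subseteq> span B"
      unfolding ext.filt_def
    proof (rule span_minimal, clarify)
      fix \<alpha> assume a: "\<alpha> \<in> exps (Suc p)" "wt (Suc p) (w(p := 1)) \<alpha> \<le> i"
      then have le: "wt p w (\<alpha>(p := 0)) \<le> i" "\<alpha> p \<le> i" by (auto simp: wt_Suc' wt_upd)
      have ae: "\<alpha>(p := 0) \<in> exps p" using a(1) by (rule exps_Suc)
      have "mop (\<alpha>(p := 0)) u' \<in> N'" using stN' u'N ae by (auto simp: stable_def)
      moreover have "mop (\<alpha>(p := 0)) u' \<in> filt u j"
        using mon_in_filt[OF ae le(1), of u'] filt_filt[OF c', of i] unfolding j_def by blast
      ultimately have "mop (\<alpha>(p := 0)) u' \<in> U" by (simp add: U_def)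
      then show "ext_mon p mop R \<alpha> u' \<in> span B" unfolding ext_mon_def using B(3) le(2) by blast
    qed simp
    moreover have "card B \<le> C' * (i+1)^n"
    proof -
      obtain Bj where Bj: "finite Bj" "filt u j \<subseteq> span Bj" using fs by blast
      have "dim U \<le> dim (filt u j)"
        by (rule dim_le_of_subset[OF _ Bj(2,1)]) (use span_superset[of "filt u j"] in \<open>auto simp: U_def\<close>)
      also have "\<dots> \<le> C * (j+1)^n" by (rule dle)
      finally have U: "dim U \<le> C * (j+1)^n" .
      have j: "j + 1 \<le> (c'+1) * (i+1)" by (simp add: j_def)
      have "i * q \<le> (i+1) * q" by simp
      also have "\<dots> \<le> (i+1) * ((C1 + C2) * ((c'+1)*(i+1))^(n-1))"
        unfolding q_def by (intro mult_left_mono power_mono j) auto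
      also have "\<dots> = (C1 + C2) * (c'+1)^(n-1) * ((i+1) * (i+1)^(n-1))" by (simp only: power_mult_distrib mult_ac)
      also have "(i+1) * (i+1)^(n-1) = (i+1)^n" using n by (cases n) auto
      finally have 1: "i * q \<le> (C1 + C2) * (c'+1)^(n-1) * (i+1)^n" .
      have "C * (j+1)^n \<le> C * ((c'+1)*(i+1))^n" by (intro mult_left_mono power_mono j) auto
      also have "\<dots> = C * (c'+1)^n * (i+1)^n" by (simp only: power_mult_distrib mult_ac)
      finally show ?thesis using B(2) U 1 unfolding C'_def distrib_right by linarith
    qed
    ultimately show ?thesis using B(1) by blast
  qed
  show ?thesis using u'(2) main by blast
qed

end

text \<open>
  The monomial with exponent \<open>e\<close> in the operators of a list, the head of which is applied first.
\<close>

fun rpow :: "('v \<Rightarrow> 'v) list \<Rightarrow> (nat \<Rightarrow> nat) \<Rightarrow> 'v \<Rightarrow> 'v" where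
  "rpow [] e v = v"
| "rpow (R # Rs) e v = rpow Rs (\<lambda>j. e (Suc j)) ((R ^^ e 0) v)"

theorem iterated_extension:
  fixes scale :: "'k::field \<Rightarrow> 'v::ab_group_add \<Rightarrow> 'v"
  assumes "monomial_action scale p w mop" and n: "n \<ge> 1" and u: "u \<noteq> 0"
    and fd: "\<And>i. \<exists>B. finite B \<and> card B \<le> C * (i+1)^n \<and> monomial_action.filt scale p w mop u i \<subseteq> module.span scale B"
    and R: "\<And>R. R \<in> set Rs \<Longrightarrow> Vector_Spaces.linear scale scale R"
    and comm: "\<And>R \<alpha> v. R \<in> set Rs \<Longrightarrow> R (mop \<alpha> v) = mop \<alpha> (R v)"
    and pair: "\<And>R R' v. R \<in> set Rs \<Longrightarrow> R' \<in> set Rs \<Longrightarrow> R (R' v) = R' (R v)"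
    and ore: "\<And>R Z. R \<in> set Rs \<Longrightarrow> monomial_action.stable scale p mop Z \<Longrightarrow> Z \<noteq> {0} \<Longrightarrow> \<exists>v\<in>Z. v \<noteq> 0 \<and> R v \<in> Z"
  shows "\<exists>u' C'. u' \<noteq> 0 \<and> (\<forall>i. \<exists>B. finite B \<and> card B \<le> C' * (i+1)^n \<and>
     (\<forall>\<alpha> e. \<alpha> \<in> exps p \<and> wt p w \<alpha> + (\<Sum>j<length Rs. e j) \<le> i \<longrightarrow> rpow Rs e (mop \<alpha> u') \<in> module.span scale B))"
  using assms
proof (induction Rs arbitrary: p w mop u C)
  case Nil
  interpret monomial_action scale p w mop by (rule Nil)
  show ?case
  proof (intro exI[of _ u] exI[of _ C] conjI allI)
    show "u \<noteq> 0" by (rule Nil)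
    fix i
    obtain B where B: "finite B" "card B \<le> C * (i+1)^n" "filt u i \<subseteq> span B" using Nil(4) by blast
    have "rpow [] e (mop \<alpha> u) \<in> span B"
      if "\<alpha> \<in> exps p \<and> wt p w \<alpha> + (\<Sum>j<length ([] :: ('v \<Rightarrow> 'v) list). e j) \<le> i" for \<alpha> e
      using mon_in_filt[of \<alpha> i u] that B(3) by auto
    then show "\<exists>B. finite B \<and> card B \<le> C * (i+1)^n \<and> (\<forall>\<alpha> e. \<alpha> \<in> exps p \<and>
        wt p w \<alpha> + (\<Sum>j<length ([] :: ('v \<Rightarrow> 'v) list). e j) \<le> i \<longrightarrow> rpow [] e (mop \<alpha> u) \<in> span B)"
      using B(1,2) by blast
  qed
next
  case (Cons R Rs)
  interpret monomial_action scale p w mop by (rule Cons)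
  have linR: "Vector_Spaces.linear scale scale R" and commR: "\<And>\<alpha> v. R (mop \<alpha> v) = mop \<alpha> (R v)"
    using Cons.prems by auto
  let ?mop = "ext_mon p mop R"
  interpret ext: monomial_action scale "Suc p" "w(p := 1)" ?mop by (rule ext_action[OF linR commR])
  have "\<exists>u' C'. u' \<noteq> 0 \<and> (\<forall>i. \<exists>B. finite B \<and> card B \<le> C' * (i+1)^n \<and> ext.filt u' i \<subseteq> span B)"
    by (rule extension_step[OF Cons.prems(2,3,4) linR commR]) (use Cons.prems(8)[of R] in auto)
  then obtain u1 C1 where u1: "u1 \<noteq> 0" "\<And>i. \<exists>B. finite B \<and> card B \<le> C1 * (i+1)^n \<and> ext.filt u1 i \<subseteq> span B"
    by blast
  have st: "stable Z" if "ext.stable Z" for Z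
    unfolding stable_def
  proof (intro conjI ballI)
    show "subspace Z" using that by (simp add: ext.stable_def)
    fix \<alpha> v assume a: "\<alpha> \<in> exps p" "v \<in> Z"
    then have "?mop \<alpha> v \<in> Z" using that by (auto simp: ext.stable_def exps_def)
    moreover have "\<alpha> p = 0" "\<alpha>(p := 0) = \<alpha>" using a(1) by (auto simp: exps_def)
    ultimately show "mop \<alpha> v \<in> Z" by (simp add: ext_mon_def)
  qed
  have pw: "R' ((R ^^ k) v) = (R ^^ k) (R' v)" if "R' \<in> set Rs" for R' k v
    using Cons.prems(7)[of R' R] that by (induction k) auto
  have "\<exists>u' C'. u' \<noteq> 0 \<and> (\<forall>i. \<exists>B. finite B \<and> card B \<le> C' * (i+1)^n \<and>
     (\<forall>\<alpha> e. \<alpha> \<in> exps (Suc p) \<and> wt (Suc p) (w(p := 1)) \<alpha> + (\<Sum>j<length Rs. e j) \<le> i \<longrightarrow> rpow Rs e (?mop \<alpha> u') \<in> span B))"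
  proof (rule Cons.IH[OF ext.monomial_action_axioms n u1])
    fix R' assume R': "R' \<in> set Rs"
    show "Vector_Spaces.linear scale scale R'" using Cons.prems(5) R' by simp
    show "R' (?mop \<alpha> v) = ?mop \<alpha> (R' v)" for \<alpha> v
      using Cons.prems(6)[of R'] R' by (simp add: ext_mon_def pw)
    show "R' (R'' v) = R'' (R' v)" if "R'' \<in> set Rs" for R'' v using Cons.prems(7)[of R' R''] R' that by simp
    show "\<exists>v\<in>Z. v \<noteq> 0 \<and> R' v \<in> Z" if "ext.stable Z" "Z \<noteq> {0}" for Z
      using Cons.prems(8)[of R' Z] st[OF that(1)] that(2) R' by simp
  qed
  then obtain u' C' where u': "u' \<noteq> 0" "\<And>i. \<exists>B. finite B \<and> card B \<le> C' * (i+1)^n \<and>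
     (\<forall>\<alpha> e. \<alpha> \<in> exps (Suc p) \<and> wt (Suc p) (w(p := 1)) \<alpha> + (\<Sum>j<length Rs. e j) \<le> i \<longrightarrow> rpow Rs e (?mop \<alpha> u') \<in> span B)"
    by blast
  have "\<exists>B. finite B \<and> card B \<le> C' * (i+1)^n \<and>
     (\<forall>\<alpha> e. \<alpha> \<in> exps p \<and> wt p w \<alpha> + (\<Sum>j<length (R # Rs). e j) \<le> i \<longrightarrow> rpow (R # Rs) e (mop \<alpha> u') \<in> span B)" for i
  proof -
    obtain B where B: "finite B" "card B \<le> C' * (i+1)^n"
      "\<And>\<alpha> e. \<alpha> \<in> exps (Suc p) \<Longrightarrow> wt (Suc p) (w(p := 1)) \<alpha> + (\<Sum>j<length Rs. e j) \<le> i \<Longrightarrow> rpow Rs e (?mop \<alpha> u') \<in> span B"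
      using u'(2)[of i] by blast
    have "rpow (R # Rs) e (mop \<alpha> u') \<in> span B"
      if a: "\<alpha> \<in> exps p" and le: "wt p w \<alpha> + (\<Sum>j<length (R # Rs). e j) \<le> i" for \<alpha> e
    proof -
      have "\<alpha>(p := e 0) \<in> exps (Suc p)" using a by (auto simp: exps_def)
      moreover have "wt (Suc p) (w(p := 1)) (\<alpha>(p := e 0)) + (\<Sum>j<length Rs. e (Suc j)) \<le> i"
        using le by (simp add: wt_Suc' wt_upd sum.lessThan_Suc_shift[of _ "length Rs"] del: sum.lessThan_Suc)
      moreover have "\<alpha>(p := 0) = \<alpha>" using a by (auto simp: exps_def)
      then have "?mop (\<alpha>(p := e 0)) u' = (R ^^ e 0) (mop \<alpha> u')" by (simp add: ext_mon_def)
      ultimately show ?thesis using B(3)[of "\<alpha>(p := e 0)" "\<lambda>j. e (Suc j)"] by simp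
    qed
    then show ?thesis using B(1,2) by blast
  qed
  then show ?case using u'(1) by blast
qed

section \<open>Algebras over a field\<close>

lemma rta_simps [simp]:
  "carrier ring_of_type_algebra = UNIV"
  "x \<otimes>\<^bsub>ring_of_type_algebra\<^esub> y = x * y"
  "\<one>\<^bsub>ring_of_type_algebra\<^esub> = 1"
  "\<zero>\<^bsub>ring_of_type_algebra\<^esub> = 0"
  "x \<oplus>\<^bsub>ring_of_type_algebra\<^esub> y = x + y"
  by (simp_all add: ring_of_type_algebra_def)

lemma ring_rta: "ring (ring_of_type_algebra :: 'a::ring_1 ring)"
proof -
  have "\<exists>y. x + y = 0" for x :: 'a using add.right_inverse by blast
  then show ?thesis
    unfolding ring_of_type_algebra_def using add.right_inverse
    by unfold_locales (auto simp: algebra_simps Units_def)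
qed

lemma rta_uminus [simp]: "\<ominus>\<^bsub>ring_of_type_algebra\<^esub> x = - (x :: 'a::ring_1)"
proof -
  interpret ring "ring_of_type_algebra :: 'a ring" by (rule ring_rta)
  show ?thesis using minus_equality[of "-x" x] by simp
qed

lemma rta_finsum: "finite S \<Longrightarrow> finsum ring_of_type_algebra f S = (\<Sum>i\<in>S. f i :: 'a::ring_1)"
proof (induction S rule: finite_induct)
  case empty
  interpret ring "ring_of_type_algebra :: 'a ring" by (rule ring_rta)
  show ?case by simp
next
  case (insert x S)
  interpret ring "ring_of_type_algebra :: 'a ring" by (rule ring_rta)
  show ?case using insert by simp
qed

text \<open>
  The scalars act through a homomorphism into the centre. Linear algebra is done with the
  type-based theory of vector spaces; the lemmas of this locale translate the record-based
  notions into it.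
\<close>

locale central_algebra =
  fixes \<phi> :: "'k::field \<Rightarrow> 'a::ring_1"
  assumes \<phi>_add: "\<phi> (c + d) = \<phi> c + \<phi> d" and \<phi>_mult: "\<phi> (c * d) = \<phi> c * \<phi> d"
    and \<phi>_one: "\<phi> 1 = 1" and \<phi>_central: "\<phi> c * a = a * \<phi> c"
begin

sublocale vector_space "\<lambda>c a. \<phi> c * a"
  by unfold_locales (simp_all add: \<phi>_add \<phi>_mult \<phi>_one algebra_simps)

abbreviation AA :: "'a ring" where "AA \<equiv> ring_of_type_algebra"

lemma \<phi>_zero: "\<phi> 0 = 0" using \<phi>_add[of 0 0] by simp

lemma subalgebra_iff_subspace: "subalgebra (range \<phi>) V AA \<longleftrightarrow> subspace V"
proof
  assume a: "subalgebra (range \<phi>) V AA"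
  interpret subalgebra "range \<phi>" V AA by (rule a)
  show "subspace V"
    by (rule subspaceI) (use subgroup.one_closed[OF subgroup_axioms] subgroup.m_closed[OF subgroup_axioms] smult_closed in auto)
next
  assume s: "subspace V"
  interpret R: ring AA by (rule ring_rta)
  show "subalgebra (range \<phi>) V AA"
  proof (intro subalgebra.intro subgroup.intro subalgebra_axioms.intro)
    show "inv\<^bsub>add_monoid AA\<^esub> x \<in> V" if "x \<in> V" for x
      using subspace_neg[OF s that] rta_uminus[of x] unfolding a_inv_def by simp
  qed (use s in \<open>auto simp: subspace_add subspace_0 subspace_scale\<close>)
qed

lemma subfield_range: "subfield (range \<phi>) AA"
proof -
  interpret R: ring AA by (rule ring_rta)
  have "cring (ring_of_type_algebra :: 'k ring)" "field (ring_of_type_algebra :: 'k ring)"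
    by (rule cring_from_type_algebra, rule field_from_type_algebra)
  interpret K: field "ring_of_type_algebra :: 'k ring" by (rule field_from_type_algebra)
  have hom: "ring_hom_ring (ring_of_type_algebra :: 'k ring) AA \<phi>"
    by (intro ring_hom_ring.intro ring_hom_ring_axioms.intro K.ring_axioms R.ring_axioms)
      (auto simp: ring_hom_def \<phi>_add \<phi>_mult \<phi>_one)
  then have "subfield (\<phi> ` carrier ring_of_type_algebra) AA"
    by (intro ring_hom_ring.img_is_subfield(2)[OF hom] K.carrier_is_subfield) auto
  then show ?thesis by simp
qed

lemma Span_eq_span: "ring.Span AA (range \<phi>) Us = span (set Us)"
proof (induction Us)
  case Nil
  interpret R: ring AA by (rule ring_rta)
  show ?case by simp
next
  case (Cons u Us)
  interpret R: ring AA by (rule ring_rta)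
  have "R.Span (range \<phi>) (u # Us) = R.line_extension (range \<phi>) u (span (set Us))" using Cons by simp
  also have "\<dots> = span (insert u (set Us))"
    unfolding set_eq_iff R.line_extension_mem_iff span_breakdown_eq
    by (auto simp: algebra_simps intro!: bexI[of _ "_ - _"]) (metis add_diff_cancel_left' add_diff_cancel_right')
  finally show ?case by simp
qed

lemma independent_list: "ring.independent AA (range \<phi>) Us \<Longrightarrow> independent (set Us) \<and> distinct Us"
proof (induction Us)
  case Nil then show ?case by (simp add: independent_empty)
next
  case (Cons u Us)
  interpret R: ring AA by (rule ring_rta)
  have "u \<notin> span (set Us)" "R.independent (range \<phi>) Us"
    using R.independent_backwards[OF Cons.prems] Span_eq_span by auto
  then show ?case using Cons.IH span_base[of u "set Us"] by (auto simp: independent_insert)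
qed

lemma finite_dimension_D:
  assumes "ring.finite_dimension AA (range \<phi>) V"
  shows "\<exists>B. finite B \<and> V \<subseteq> span B"
proof -
  interpret R: ring AA by (rule ring_rta)
  obtain n where "R.dimension n (range \<phi>) V" using R.finite_dimensionE[OF subfield_range] assms
    by (auto simp: R.finite_dimension_def)
  from R.exists_base[OF subfield_range this] obtain Vs where "R.Span (range \<phi>) Vs = V" by blast
  then show ?thesis using Span_eq_span by (intro exI[of _ "set Vs"]) auto
qed

lemma dim_eq:
  assumes V: "subspace V" and B: "finite B" "V \<subseteq> span B"
  shows "ring.dim AA (range \<phi>) V = dim V" and "ring.finite_dimension AA (range \<phi>) V"
proof -
  interpret R: ring AA by (rule ring_rta)
  obtain C where C: "C \<subseteq> V" "independent C" "V \<subseteq> span C"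
    using maximal_independent_subset by blast
  have "finite C" using independent_span_bound[OF B(1) C(2)] C(1) B(2) by blast
  then obtain Cs where Cs: "set Cs = C" using finite_list by blast
  have sp: "R.Span (range \<phi>) Cs = V" using Span_eq_span[of Cs] Cs C(1,3) V by (simp add: span_subspace)
  show fd: "R.finite_dimension (range \<phi>) V"
    using R.Span_finite_dimension[OF subfield_range, of Cs] sp by simp
  then have "R.dimension (ring.dim AA (range \<phi>) V) (range \<phi>) V"
    using R.finite_dimensionE[OF subfield_range fd] by (simp add: over_def)
  from R.exists_base[OF subfield_range this] obtain Vs where
    Vs: "R.independent (range \<phi>) Vs" "length Vs = ring.dim AA (range \<phi>) V" "R.Span (range \<phi>) Vs = V"
    by blast
  have "independent (set Vs)" "distinct Vs" using independent_list[OF Vs(1)] by auto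
  then have "dim (span (set Vs)) = length Vs" using dim_eq_card_independent distinct_card by simp
  moreover have "span (set Vs) = V" using Vs(3) by (simp only: Span_eq_span)
  ultimately show "ring.dim AA (range \<phi>) V = dim V" using Vs(2) by simp
qed

lemma span_mult:
  assumes "x \<in> span S" "y \<in> span T" "subspace W" "\<And>s t. s \<in> S \<Longrightarrow> t \<in> T \<Longrightarrow> s * t \<in> W"
  shows "x * y \<in> W"
  using assms(1)
proof (induction rule: span_induct_alt)
  case base then show ?case using assms(3) by (simp add: subspace_0)
next
  case (step c s x)
  have "s * y \<in> W" using assms(2)
  proof (induction rule: span_induct_alt)
    case base then show ?case using assms(3) by (simp add: subspace_0)
  next
    case (step d t y)
    have "s * (\<phi> d * t + y) = \<phi> d * (s * t) + s * y"
      by (metis distrib_left mult.assoc \<phi>_central)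
    then show ?case using step assms(3,4) \<open>s \<in> S\<close> by (simp add: subspace_add subspace_scale)
  qed
  then show ?case using step assms(3) by (simp add: distrib_right mult.assoc subspace_add subspace_scale)
qed

end

section \<open>Algebras with commutative associated graded algebra\<close>

lemma rta_coset: "y \<in> H +>\<^bsub>ring_of_type_algebra\<^esub> x \<longleftrightarrow> (\<exists>h\<in>H. y = h + (x :: 'a::ring_1))"
  by (auto simp: a_r_coset_def r_coset_def)

lemma rta_set_add: "y \<in> H <+>\<^bsub>ring_of_type_algebra\<^esub> K \<longleftrightarrow> (\<exists>h\<in>H. \<exists>k\<in>K. y = h + (k :: 'a::ring_1))"
  by (auto simp: set_add_def set_mult_def)

locale filtered_algebra = central_algebra +
  fixes F :: "nat \<Rightarrow> 'b::ring_1 set"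
  assumes filtration: "fin_dim_filtration ring_of_type_algebra (range \<phi>) F"
begin

abbreviation P :: "nat \<Rightarrow> 'b set" where "P \<equiv> prev ring_of_type_algebra F"
abbreviation G :: "(nat \<Rightarrow> 'b set) ring" where "G \<equiv> gr_ring ring_of_type_algebra F"

lemma subspace_F: "subspace (F i)"
  using filtration by (simp add: fin_dim_filtration_def subalgebra_iff_subspace)

lemma F_fin: "\<exists>B. finite B \<and> F i \<subseteq> span B"
  using filtration finite_dimension_D by (simp add: fin_dim_filtration_def)

lemma F_Suc: "F i \<subseteq> F (Suc i)"
  using filtration by (simp add: fin_dim_filtration_def)

lemma F_mono: "i \<le> j \<Longrightarrow> F i \<subseteq> F j"
  using lift_Suc_mono_le[of F i j] F_Suc by blast

lemma F_mult: "x \<in> F i \<Longrightarrow> y \<in> F j \<Longrightarrow> x * y \<in> F (i + j)"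
  using filtration by (simp add: fin_dim_filtration_def)

lemma F_one: "1 \<in> F 0"
  using filtration by (simp add: fin_dim_filtration_def)

lemma F_UN: "\<exists>i. x \<in> F i"
  using filtration by (auto simp: fin_dim_filtration_def)

lemma subspace_P: "subspace (P i)"
  by (cases i) (simp_all add: prev_def subspace_F subspace_single_0)

lemma P_F_mult: "x \<in> P i \<Longrightarrow> y \<in> F j \<Longrightarrow> x * y \<in> P (i + j)"
proof (cases i)
  case 0
  assume "x \<in> P i"
  then have "x = 0" using 0 by (simp add: prev_def)
  then show ?thesis by (simp only: mult_zero_left subspace_0[OF subspace_P])
qed (use F_mult in \<open>auto simp: prev_def\<close>)

lemma F_P_mult: "x \<in> F i \<Longrightarrow> y \<in> P j \<Longrightarrow> x * y \<in> P (i + j)"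
proof (cases j)
  case 0
  assume "y \<in> P j"
  then have "y = 0" using 0 by (simp add: prev_def)
  then show ?thesis by (simp only: mult_zero_right subspace_0[OF subspace_P])
qed (use F_mult in \<open>auto simp: prev_def\<close>)

lemma coset_iff: "y \<in> P i +>\<^bsub>AA\<^esub> x \<longleftrightarrow> y - x \<in> P i"
  unfolding rta_coset by (metis add_diff_cancel_right' diff_add_cancel)

lemma coset_zero: "P i +>\<^bsub>AA\<^esub> 0 = P i"
  using coset_iff[of _ i 0] by auto

text \<open>
  The homogeneous element of degree \<open>i\<close> of the associated graded algebra that \<open>x\<close> represents.
\<close>

definition hom_elt :: "'b \<Rightarrow> nat \<Rightarrow> nat \<Rightarrow> 'b set" where
  "hom_elt x i = (\<lambda>l. P l +>\<^bsub>AA\<^esub> (if l = i then x else 0))"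

lemma hom_elt_carrier: "x \<in> F i \<Longrightarrow> hom_elt x i \<in> carrier G"
proof -
  assume x: "x \<in> F i"
  have "{l. hom_elt x i l \<noteq> P l} \<subseteq> {i}" by (auto simp: hom_elt_def coset_zero)
  then have "finite {l. hom_elt x i l \<noteq> P l}" using finite_subset by blast
  moreover have "\<exists>y\<in>F l. hom_elt x i l = P l +>\<^bsub>AA\<^esub> y" for l
    using x subspace_0[OF subspace_F] by (intro bexI[of _ "if l = i then x else 0"]) (auto simp: hom_elt_def)
  ultimately show ?thesis by (simp add: gr_ring_def)
qed

lemma gr_mult_mem:
  assumes "\<And>i. a i \<in> g i" "\<And>i. b i \<in> h i"
  shows "(\<Sum>i\<le>n. a i * b (n - i)) \<in> (g \<otimes>\<^bsub>G\<^esub> h) n"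
proof -
  have "(\<Sum>i\<le>n. a i * b (n - i)) \<in> P n +>\<^bsub>AA\<^esub> (\<Oplus>\<^bsub>AA\<^esub>i\<in>{..n}. a i \<otimes>\<^bsub>AA\<^esub> b (n - i))"
    unfolding coset_iff using subspace_0[OF subspace_P] by (simp add: rta_finsum)
  then show ?thesis using assms by (simp add: gr_ring_def) blast
qed

lemma gr_component: "g \<in> carrier G \<Longrightarrow> \<exists>x\<in>F i. g i = P i +>\<^bsub>AA\<^esub> x"
  by (simp add: gr_ring_def)

lemma gr_same_component:
  assumes "g \<in> carrier G" "x \<in> g i" "y \<in> g i" shows "x - y \<in> P i"
proof -
  obtain t where "g i = P i +>\<^bsub>AA\<^esub> t" using gr_component[OF assms(1)] by blast
  then have "x - t \<in> P i" "y - t \<in> P i" using assms(2,3) coset_iff by auto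
  from subspace_diff[OF subspace_P this] show ?thesis by simp
qed

lemma gr_mem_shift:
  assumes "g \<in> carrier G" "x \<in> g i" "y - x \<in> P i" shows "y \<in> g i"
proof -
  obtain t where t: "g i = P i +>\<^bsub>AA\<^esub> t" using gr_component[OF assms(1)] by blast
  then have "x - t \<in> P i" using assms(2) coset_iff by auto
  from subspace_add[OF subspace_P assms(3) this] show ?thesis using t coset_iff by simp
qed

lemma gr_nonempty: "g \<in> carrier G \<Longrightarrow> \<exists>x\<in>F i. x \<in> g i"
  using gr_component[of g i] coset_iff subspace_0[OF subspace_P] by force

lemma hom_product:
  assumes x: "x \<in> F i" and y: "y \<in> F j"
  shows "x * y \<in> (hom_elt x i \<otimes>\<^bsub>G\<^esub> hom_elt y j) (i + j)"
proof -
  let ?a = "\<lambda>l. if l = i then x else 0" and ?b = "\<lambda>l. if l = j then y else 0"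
  have "(\<Sum>l\<le>i+j. ?a l * ?b (i + j - l)) = (\<Sum>l\<le>i+j. if l = i then x * y else 0)"
    by (rule sum.cong) auto
  also have "\<dots> = x * y" by simp
  finally have "(\<Sum>l\<le>i+j. ?a l * ?b (i + j - l)) = x * y" .
  moreover have "(\<Sum>l\<le>i+j. ?a l * ?b (i + j - l)) \<in> (hom_elt x i \<otimes>\<^bsub>G\<^esub> hom_elt y j) (i + j)"
    by (rule gr_mult_mem) (simp_all only: hom_elt_def coset_iff, simp_all add: subspace_0[OF subspace_P])
  ultimately show ?thesis by simp
qed

lemma commutator:
  assumes "cring G" and x: "x \<in> F i" and y: "y \<in> F j"
  shows "x * y - y * x \<in> P (i + j)"
proof -
  interpret G: cring G by (rule assms)
  have c: "hom_elt x i \<in> carrier G" "hom_elt y j \<in> carrier G" using x y hom_elt_carrier by auto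
  have "y * x \<in> (hom_elt y j \<otimes>\<^bsub>G\<^esub> hom_elt x i) (i + j)" using hom_product[OF y x] by (simp add: add.commute)
  then have "y * x \<in> (hom_elt x i \<otimes>\<^bsub>G\<^esub> hom_elt y j) (i + j)" using G.m_comm[OF c] by simp
  then show ?thesis using gr_same_component[OF G.m_closed[OF c] hom_product[OF x y]] by blast
qed

definition words :: "('b \<times> nat) set \<Rightarrow> nat \<Rightarrow> 'b set" where
  "words Z i = {prod_list (map fst ws) | ws. set ws \<subseteq> Z \<and> sum_list (map snd ws) = i}"

lemma words_mult: "x \<in> span (words Z i) \<Longrightarrow> y \<in> span (words Z j) \<Longrightarrow> x * y \<in> span (words Z (i + j))"
proof (erule span_mult, assumption)
  fix s t assume "s \<in> words Z i" "t \<in> words Z j"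
  then obtain v w where "s = prod_list (map fst v)" "set v \<subseteq> Z" "sum_list (map snd v) = i"
    "t = prod_list (map fst w)" "set w \<subseteq> Z" "sum_list (map snd w) = j" by (auto simp: words_def)
  then have "s * t \<in> words Z (i + j)" unfolding words_def by (intro CollectI exI[of _ "v @ w"]) simp
  then show "s * t \<in> span (words Z (i + j))" by (rule span_base)
qed simp

text \<open>
  \<open>Z\<close> consists of representatives of the nonzero homogeneous components of generators of the
  associated graded algebra. That every component of an element is represented by a combination
  of words in \<open>Z\<close> is preserved by sums, negatives and products, hence passes from the generators
  to all elements.
\<close>

lemma graded_generators:
  assumes ring: "cring G" and fg: "fin_gen_algebra G (gr_scalar AA F ` range \<phi>)"
  shows "\<exists>Z. finite Z \<and> (\<forall>(z,d)\<in>Z. z \<in> F d) \<and> (\<forall>i. \<forall>x\<in>F i. \<exists>m\<in>span (words Z i). x - m \<in> P i)"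
proof -
  interpret G: cring G by (rule ring)
  obtain S where S: "finite S" "S \<subseteq> carrier G" "generate_ring G (gr_scalar AA F ` range \<phi> \<union> S) = carrier G"
    using fg by (auto simp: fin_gen_algebra_def alg_generators_def)
  define r where "r g i = (SOME x. x \<in> F i \<and> x \<in> g i)" for g i
  have r: "r g i \<in> F i \<and> r g i \<in> g i" if "g \<in> carrier G" for g i
    unfolding r_def by (rule someI_ex) (use gr_nonempty[OF that, of i] in blast)
  define Z where "Z = (\<Union>g\<in>S. (\<lambda>i. (r g i, i)) ` {i. g i \<noteq> P i})"
  have finZ: "finite Z" unfolding Z_def using S(1,2) by (auto simp: gr_ring_def)
  have ZF: "\<forall>(z,d)\<in>Z. z \<in> F d" unfolding Z_def using r S(2) by auto
  have "1 \<in> words Z 0" unfolding words_def by (intro CollectI exI[of _ "[]"]) simp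
  then have c0: "\<phi> c \<in> span (words Z 0)" for c using span_scale[OF span_base, of 1 "words Z 0" c] by simp
  have sc: "\<exists>m\<in>span (words Z i). m \<in> gr_scalar AA F (\<phi> c) i" for c i
  proof (cases i)
    case 0
    then show ?thesis using c0[of c] subspace_0[OF subspace_P]
      by (intro bexI[of _ "\<phi> c"]) (auto simp: gr_scalar_def coset_iff)
  next
    case (Suc j)
    then show ?thesis using span_zero subspace_0[OF subspace_P]
      by (intro bexI[of _ 0]) (auto simp: gr_scalar_def coset_iff)
  qed
  have "\<forall>i. \<exists>m\<in>span (words Z i). m \<in> g i" if "g \<in> generate_ring G (gr_scalar AA F ` range \<phi> \<union> S)" for g
    using that
  proof (induction rule: generate_ring.induct)
    case one
    have "\<one>\<^bsub>G\<^esub> = gr_scalar AA F (\<phi> 1)" by (simp add: gr_ring_def \<phi>_one)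
    then show ?case using sc[of _ 1] by simp
  next
    case (incl h)
    show ?case
    proof
      fix i show "\<exists>m\<in>span (words Z i). m \<in> h i"
      proof (cases "h \<in> S")
        case True
        then have hc: "h \<in> carrier G" using S(2) by blast
        show ?thesis
        proof (cases "h i = P i")
          case True
          then show ?thesis using subspace_0[OF subspace_P] span_zero by (intro bexI[of _ 0]) auto
        next
          case False
          then have "(r h i, i) \<in> Z" using \<open>h \<in> S\<close> by (auto simp: Z_def)
          then have "r h i \<in> words Z i" unfolding words_def by (intro CollectI exI[of _ "[(r h i, i)]"]) simp
          then show ?thesis using r[OF hc, of i] span_base by blast
        qed
      next
        case False
        then obtain c where "h = gr_scalar AA F (\<phi> c)" using incl by auto
        then show ?thesis using sc by simp
      qed
    qed
  next
    case (a_inv h)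
    then have hc: "h \<in> carrier G" using S(3) by simp
    show ?case
    proof
      fix i
      obtain m where m: "m \<in> span (words Z i)" "m \<in> h i" using a_inv by blast
      have nc: "\<ominus>\<^bsub>G\<^esub> h \<in> carrier G" using hc by simp
      obtain y where y: "y \<in> (\<ominus>\<^bsub>G\<^esub> h) i" using gr_nonempty[OF nc] by blast
      have "h \<oplus>\<^bsub>G\<^esub> \<ominus>\<^bsub>G\<^esub> h = \<zero>\<^bsub>G\<^esub>" using hc G.r_neg by simp
      then have "(h \<oplus>\<^bsub>G\<^esub> \<ominus>\<^bsub>G\<^esub> h) i = P i" by (simp add: gr_ring_def)
      moreover have "(h \<oplus>\<^bsub>G\<^esub> \<ominus>\<^bsub>G\<^esub> h) i = h i <+>\<^bsub>AA\<^esub> (\<ominus>\<^bsub>G\<^esub> h) i" by (simp add: gr_ring_def)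
      ultimately have "m + y \<in> P i" using m(2) y by (metis rta_set_add)
      then have "- m - y \<in> P i" using subspace_neg[OF subspace_P] by fastforce
      then have "- m \<in> (\<ominus>\<^bsub>G\<^esub> h) i" using gr_mem_shift[OF nc y] by blast
      then show "\<exists>m\<in>span (words Z i). m \<in> (\<ominus>\<^bsub>G\<^esub> h) i" using span_neg[OF m(1)] by blast
    qed
  next
    case (eng_add h1 h2)
    show ?case
    proof
      fix i
      obtain m1 m2 where m: "m1 \<in> span (words Z i)" "m1 \<in> h1 i" "m2 \<in> span (words Z i)" "m2 \<in> h2 i"
        using eng_add by blast
      have "(h1 \<oplus>\<^bsub>G\<^esub> h2) i = h1 i <+>\<^bsub>AA\<^esub> h2 i" by (simp add: gr_ring_def)
      then have "m1 + m2 \<in> (h1 \<oplus>\<^bsub>G\<^esub> h2) i" using m rta_set_add by blast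
      then show "\<exists>m\<in>span (words Z i). m \<in> (h1 \<oplus>\<^bsub>G\<^esub> h2) i" using span_add[OF m(1,3)] by blast
    qed
  next
    case (eng_mult h1 h2)
    obtain a where a: "\<And>i. a i \<in> span (words Z i)" "\<And>i. a i \<in> h1 i" using eng_mult by metis
    obtain b where b: "\<And>i. b i \<in> span (words Z i)" "\<And>i. b i \<in> h2 i" using eng_mult by metis
    show ?case
    proof
      fix n
      have "(\<Sum>i\<le>n. a i * b (n - i)) \<in> span (words Z n)"
      proof (rule span_sum)
        fix i assume "i \<in> {..n}"
        then show "a i * b (n - i) \<in> span (words Z n)" using words_mult[OF a(1)[of i] b(1)[of "n - i"]] by simp
      qed
      then show "\<exists>m\<in>span (words Z n). m \<in> (h1 \<otimes>\<^bsub>G\<^esub> h2) n" using gr_mult_mem[of a h1 b h2 n, OF a(2) b(2)] by blast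
    qed
  qed
  then have T: "\<exists>m\<in>span (words Z i). m \<in> g i" if "g \<in> carrier G" for g i using that S(3) by blast
  have "\<exists>m\<in>span (words Z i). x - m \<in> P i" if x: "x \<in> F i" for x i
  proof -
    obtain m where "m \<in> span (words Z i)" "m \<in> hom_elt x i i" using T[OF hom_elt_carrier[OF x]] by blast
    moreover have "x \<in> hom_elt x i i" using coset_iff[of x i x] subspace_0[OF subspace_P] by (simp add: hom_elt_def)
    ultimately show ?thesis using gr_same_component[OF hom_elt_carrier[OF x]] by blast
  qed
  then show ?thesis using finZ ZF by blast
qed

end

text \<open>
  Somewhat commutativity in concrete terms: the elements \<open>z j\<close>, of degree \<open>w j\<close>, generate the
  algebra up to terms of lower degree, and commutators drop in degree.
\<close>

locale commutatively_filtered = filtered_algebra +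
  fixes N :: nat and z :: "nat \<Rightarrow> 'b::ring_1" and w :: "nat \<Rightarrow> nat"
  assumes comm: "x \<in> F i \<Longrightarrow> y \<in> F j \<Longrightarrow> x * y - y * x \<in> P (i + j)"
    and z_F: "j < N \<Longrightarrow> z j \<in> F (w j)"
    and gen: "x \<in> F i \<Longrightarrow> \<exists>m\<in>span (words ((\<lambda>j. (z j, w j)) ` {..<N}) i). x - m \<in> P i"
begin

definition zmon :: "(nat \<Rightarrow> nat) \<Rightarrow> 'b" where
  "zmon \<alpha> = prod_list (map (\<lambda>j. z j ^ \<alpha> j) [0..<N])"

lemma power_F: "x \<in> F i \<Longrightarrow> x ^ k \<in> F (i * k)"
  by (induction k) (use F_one F_mult in \<open>auto simp: algebra_simps\<close>)

lemma segment_F: "b \<le> N \<Longrightarrow> prod_list (map (\<lambda>j. z j ^ \<alpha> j) [a..<b]) \<in> F (\<Sum>j\<in>{a..<b}. w j * \<alpha> j)"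
proof (induction b)
  case 0 then show ?case using F_one by simp
next
  case (Suc b)
  show ?case
  proof (cases "a \<le> b")
    case True
    then have "prod_list (map (\<lambda>j. z j ^ \<alpha> j) [a..<b]) * z b ^ \<alpha> b \<in> F ((\<Sum>j\<in>{a..<b}. w j * \<alpha> j) + w b * \<alpha> b)"
      using Suc power_F z_F by (intro F_mult) auto
    then show ?thesis using True by simp
  next
    case False then show ?thesis using F_one by simp
  qed
qed

lemma zmon_F: "zmon \<alpha> \<in> F (wt N w \<alpha>)"
  using segment_F[of N \<alpha> 0] by (simp add: zmon_def wt_def atLeast0LessThan)

lemma zmon_zero: "zmon (\<lambda>_. 0) = 1"
proof -
  have "prod_list (map (\<lambda>j. 1) xs) = (1::'b)" for xs :: "nat list" by (induction xs) auto
  then show ?thesis by (simp add: zmon_def)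
qed

lemma zmon_split:
  assumes "j < N"
  shows "zmon \<alpha> = prod_list (map (\<lambda>j. z j ^ \<alpha> j) [0..<j]) * (z j ^ \<alpha> j * prod_list (map (\<lambda>j. z j ^ \<alpha> j) [Suc j..<N]))"
proof -
  have "[0..<N] = [0..<j] @ j # [Suc j..<N]"
    using assms by (metis less_imp_le_nat upt_add_eq_append upt_conv_Cons zero_le le_add_diff_inverse)
  then show ?thesis by (simp add: zmon_def mult.assoc)
qed

text \<open>
  Moving \<open>z j\<close> to its place in an ordered monomial costs only a commutator, of lower degree.
\<close>

lemma z_zmon:
  assumes j: "j < N"
  shows "z j * zmon \<alpha> - zmon (\<alpha>(j := Suc (\<alpha> j))) \<in> P (w j + wt N w \<alpha>)"
proof -
  let ?A = "prod_list (map (\<lambda>j. z j ^ \<alpha> j) [0..<j])"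
  let ?B = "prod_list (map (\<lambda>j. z j ^ \<alpha> j) [Suc j..<N])"
  let ?\<beta> = "\<alpha>(j := Suc (\<alpha> j))"
  let ?a = "\<Sum>i\<in>{0..<j}. w i * \<alpha> i" and ?b = "\<Sum>i\<in>{Suc j..<N}. w i * \<alpha> i"
  have A: "prod_list (map (\<lambda>j. z j ^ ?\<beta> j) [0..<j]) = ?A" by (rule arg_cong[of _ _ prod_list], rule map_cong) auto
  have B: "prod_list (map (\<lambda>j. z j ^ ?\<beta> j) [Suc j..<N]) = ?B" by (rule arg_cong[of _ _ prod_list], rule map_cong) auto
  have eq: "z j * zmon \<alpha> - zmon ?\<beta> = (z j * ?A - ?A * z j) * (z j ^ \<alpha> j * ?B)"
    unfolding zmon_split[OF j, of \<alpha>] zmon_split[OF j, of ?\<beta>] A B by (simp add: algebra_simps)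
  have 1: "z j * ?A - ?A * z j \<in> P (w j + ?a)"
    using segment_F[of j \<alpha> 0] j by (intro comm z_F) auto
  have 2: "z j ^ \<alpha> j * ?B \<in> F (w j * \<alpha> j + ?b)"
    using segment_F[of N \<alpha> "Suc j"] j by (intro F_mult power_F z_F) auto
  have "z j * zmon \<alpha> - zmon ?\<beta> \<in> P (w j + ?a + (w j * \<alpha> j + ?b))"
    unfolding eq by (rule P_F_mult[OF 1 2])
  moreover have "wt N w \<alpha> = ?a + (w j * \<alpha> j + ?b)"
  proof -
    have "wt N w \<alpha> = (\<Sum>i\<in>{0..<N}. w i * \<alpha> i)" by (simp add: wt_def atLeast0LessThan)
    also have "\<dots> = ?a + (\<Sum>i\<in>{j..<N}. w i * \<alpha> i)" using j by (intro sum.atLeastLessThan_concat[symmetric]) auto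
    also have "(\<Sum>i\<in>{j..<N}. w i * \<alpha> i) = w j * \<alpha> j + ?b" using j by (simp add: sum.atLeast_Suc_lessThan)
    finally show ?thesis .
  qed
  ultimately show ?thesis by (simp add: add.assoc)
qed

text \<open>
  The exponent of the ordered monomial obtained by sorting a word.
\<close>

fun cnt :: "nat list \<Rightarrow> nat \<Rightarrow> nat" where
  "cnt [] = (\<lambda>_. 0)"
| "cnt (j # js) = (cnt js)(j := Suc (cnt js j))"

lemma wt_cnt: "set js \<subseteq> {..<N} \<Longrightarrow> wt N w (cnt js) = sum_list (map w js)"
proof (induction js)
  case Nil then show ?case by (simp add: wt_zero)
next
  case (Cons j js)
  have "cnt (j # js) = (\<lambda>i. (if i = j then 1 else 0) + cnt js i)" by auto
  then have "wt N w (cnt (j # js)) = wt N w (\<lambda>i. if i = j then 1 else 0) + wt N w (cnt js)"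
    by (metis wt_add)
  moreover have "wt N w (\<lambda>i. if i = j then 1 else 0) = (\<Sum>i<N. if i = j then w j else 0)"
    unfolding wt_def by (rule sum.cong) auto
  ultimately show ?case using Cons by (simp del: cnt.simps)
qed

lemma cnt_exps: "set js \<subseteq> {..<N} \<Longrightarrow> cnt js \<in> exps N"
  by (induction js) (auto simp: exps_def)

lemma word_zmon:
  assumes "set js \<subseteq> {..<N}"
  shows "prod_list (map z js) * zmon \<beta> - zmon (cnt js \<oplus>\<^sub>e \<beta>) \<in> P (sum_list (map w js) + wt N w \<beta>)"
  using assms
proof (induction js)
  case Nil then show ?case by (simp add: subspace_0[OF subspace_P])
next
  case (Cons j js)
  let ?\<gamma> = "cnt js \<oplus>\<^sub>e \<beta>"
  have j: "j < N" "set js \<subseteq> {..<N}" using Cons.prems by auto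
  have e: "cnt (j # js) \<oplus>\<^sub>e \<beta> = ?\<gamma>(j := Suc (?\<gamma> j))" by (rule ext) simp
  have 1: "z j * (prod_list (map z js) * zmon \<beta> - zmon ?\<gamma>) \<in> P (w j + (sum_list (map w js) + wt N w \<beta>))"
    using Cons.IH[OF j(2)] z_F[OF j(1)] by (rule F_P_mult[rotated])
  have "wt N w ?\<gamma> = sum_list (map w js) + wt N w \<beta>" by (simp add: wt_add wt_cnt[OF j(2)])
  then have 2: "z j * zmon ?\<gamma> - zmon (?\<gamma>(j := Suc (?\<gamma> j))) \<in> P (w j + (sum_list (map w js) + wt N w \<beta>))"
    using z_zmon[OF j(1), of ?\<gamma>] by simp
  have "prod_list (map z (j # js)) * zmon \<beta> - zmon (cnt (j # js) \<oplus>\<^sub>e \<beta>) =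
     z j * (prod_list (map z js) * zmon \<beta> - zmon ?\<gamma>) + (z j * zmon ?\<gamma> - zmon (?\<gamma>(j := Suc (?\<gamma> j))))"
    by (simp only: e list.map prod_list.Cons right_diff_distrib mult.assoc) (simp del: fun_upd_apply)
  then show ?case using subspace_add[OF subspace_P 1 2] by (simp only: list.map sum_list.Cons add.assoc)
qed

text \<open>
  By induction on the degree: modulo lower degree, an element is a combination of words, and a
  word is the ordered monomial with the same letters.
\<close>

lemma F_span_zmon: "F i \<subseteq> span {zmon \<alpha> | \<alpha>. \<alpha> \<in> exps N \<and> wt N w \<alpha> \<le> i}"
proof (induction i rule: less_induct)
  case (less i)
  let ?S = "span {zmon \<alpha> | \<alpha>. \<alpha> \<in> exps N \<and> wt N w \<alpha> \<le> i}"
  have P: "P i \<subseteq> ?S"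
  proof (cases i)
    case 0 then show ?thesis by (simp add: prev_def span_zero)
  next
    case (Suc k)
    have "F k \<subseteq> span {zmon \<alpha> | \<alpha>. \<alpha> \<in> exps N \<and> wt N w \<alpha> \<le> k}" using less Suc by simp
    also have "\<dots> \<subseteq> ?S" by (rule span_mono) (use Suc in auto)
    finally show ?thesis using Suc by (simp add: prev_def)
  qed
  show ?case
  proof
    fix x assume x: "x \<in> F i"
    obtain m where m: "m \<in> span (words ((\<lambda>j. (z j, w j)) ` {..<N}) i)" "x - m \<in> P i" using gen[OF x] by blast
    have "words ((\<lambda>j. (z j, w j)) ` {..<N}) i \<subseteq> ?S"
    proof
      fix v assume "v \<in> words ((\<lambda>j. (z j, w j)) ` {..<N}) i"
      then obtain ws where ws: "v = prod_list (map fst ws)" "set ws \<subseteq> (\<lambda>j. (z j, w j)) ` {..<N}" "sum_list (map snd ws) = i"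
        by (auto simp: words_def)
      have "\<exists>js. set js \<subseteq> {..<N} \<and> ws = map (\<lambda>j. (z j, w j)) js"
        using ws(2)
      proof (induction ws)
        case (Cons a ws)
        then obtain js j where "set js \<subseteq> {..<N}" "ws = map (\<lambda>j. (z j, w j)) js" "j < N" "a = (z j, w j)" by auto
        then show ?case by (intro exI[of _ "j # js"]) auto
      qed simp
      then obtain js where js: "set js \<subseteq> {..<N}" "ws = map (\<lambda>j. (z j, w j)) js" by blast
      have v: "v = prod_list (map z js)" and i: "sum_list (map w js) = i" using ws js(2) by (simp_all add: o_def)
      have "v - zmon (cnt js) \<in> P i" using word_zmon[OF js(1), of "\<lambda>_. 0"] v i by (simp add: zmon_zero wt_zero)
      then have 1: "v - zmon (cnt js) \<in> ?S" using P by blast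
      have 2: "zmon (cnt js) \<in> ?S" using cnt_exps[OF js(1)] wt_cnt[OF js(1)] i by (intro span_base) auto
      from span_add[OF 1 2] show "v \<in> ?S" by simp
    qed
    then have "m \<in> ?S" using m(1) span_minimal[OF _ subspace_span] by blast
    moreover have "x - m \<in> ?S" using m(2) P by blast
    ultimately show "x \<in> ?S" using span_add[of m _ "x - m"] by simp
  qed
qed

lemma F_eq_span_zmon: "F i = span {zmon \<alpha> | \<alpha>. \<alpha> \<in> exps N \<and> wt N w \<alpha> \<le> i}"
proof
  show "span {zmon \<alpha> | \<alpha>. \<alpha> \<in> exps N \<and> wt N w \<alpha> \<le> i} \<subseteq> F i"
  proof (rule span_minimal[OF _ subspace_F], safe)
    fix \<alpha> assume "wt N w \<alpha> \<le> i"
    then show "zmon \<alpha> \<in> F i" using zmon_F[of \<alpha>] F_mono[of "wt N w \<alpha>" i] by blast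
  qed
qed (rule F_span_zmon)

lemma zmon_zmon:
  assumes "\<alpha> \<in> exps N"
  shows "zmon \<alpha> * zmon \<beta> - zmon (\<alpha> \<oplus>\<^sub>e \<beta>) \<in>
    span {zmon \<gamma> | \<gamma>. \<gamma> \<in> exps N \<and> wt N w \<gamma> < wt N w \<alpha> + wt N w \<beta>}"
proof -
  define js where "js = concat (map (\<lambda>j. replicate (\<alpha> j) j) [0..<N])"
  have set: "set js \<subseteq> {..<N}" by (auto simp: js_def)
  have prod: "prod_list (map z js) = zmon \<alpha>"
  proof -
    have "prod_list (map z (concat (map (\<lambda>j. replicate (\<alpha> j) j) xs))) = prod_list (map (\<lambda>j. z j ^ \<alpha> j) xs)" for xs
      by (induction xs) auto
    then show ?thesis by (simp add: js_def zmon_def)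
  qed
  have cnt_app: "cnt (xs @ ys) i = cnt xs i + cnt ys i" for xs ys i by (induction xs) auto
  have cnt_rep: "cnt (replicate k j) i = (if i = j then k else 0)" for k j i by (induction k) auto
  have cnt: "cnt js = \<alpha>"
  proof
    fix i
    have "cnt (concat (map (\<lambda>j. replicate (\<alpha> j) j) xs)) i = (if i \<in> set xs then \<alpha> i else 0)" if "distinct xs" for xs
      using that by (induction xs) (auto simp: cnt_app cnt_rep)
    from this[of "[0..<N]"] show "cnt js i = \<alpha> i" using assms by (auto simp: js_def exps_def)
  qed
  have "zmon \<alpha> * zmon \<beta> - zmon (\<alpha> \<oplus>\<^sub>e \<beta>) \<in> P (wt N w \<alpha> + wt N w \<beta>)"
    using word_zmon[OF set, of \<beta>] prod cnt wt_cnt[OF set] by simp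
  also have "P (wt N w \<alpha> + wt N w \<beta>) \<subseteq> span {zmon \<gamma> | \<gamma>. \<gamma> \<in> exps N \<and> wt N w \<gamma> < wt N w \<alpha> + wt N w \<beta>}"
  proof (cases "wt N w \<alpha> + wt N w \<beta>")
    case 0 then show ?thesis by (simp add: prev_def span_zero)
  next
    case (Suc k) then show ?thesis unfolding Suc by (simp add: prev_def F_eq_span_zmon less_Suc_eq_le)
  qed
  finally show ?thesis .
qed

end

lemma (in central_algebra) somewhat_commutative_filtered:
  assumes "somewhat_commutative ring_of_type_algebra (range \<phi>)"
  shows "\<exists>F N z w. commutatively_filtered \<phi> F N z w"
proof -
  obtain F where F: "fin_dim_filtration AA (range \<phi>) F" "cring (gr_ring AA F)"
      "fin_gen_algebra (gr_ring AA F) (gr_scalar AA F ` range \<phi>)"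
    using assms by (auto simp: somewhat_commutative_def)
  interpret filtered_algebra \<phi> F by unfold_locales (rule F)
  obtain Z where Z: "finite Z" "\<forall>(z,d)\<in>Z. z \<in> F d" "\<forall>i. \<forall>x\<in>F i. \<exists>m\<in>span (words Z i). x - m \<in> P i"
    using graded_generators[OF F(2,3)] by blast
  obtain xs where xs: "set xs = Z" using finite_list[OF Z(1)] by blast
  have im: "(\<lambda>j. (fst (xs ! j), snd (xs ! j))) ` {..<length xs} = Z"
    using xs by (force simp: set_conv_nth)
  have "commutatively_filtered \<phi> F (length xs) (\<lambda>j. fst (xs ! j)) (\<lambda>j. snd (xs ! j))"
    by unfold_locales (use commutator[OF F(2)] Z(2,3) xs im nth_mem in \<open>fastforce+\<close>)
  then show ?thesis by blast
qed

section \<open>Standard filtrations\<close>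

text \<open>
  The space in which the function \<open>nu\<close> looks for \<open>1\<close>.
\<close>

definition sandwich :: "('a, 'b) ring_scheme \<Rightarrow> 'a set \<Rightarrow> 'a set \<Rightarrow> nat \<Rightarrow> 'a \<Rightarrow> 'a set" where
  "sandwich R k S j b =
     lin_span R k {x \<otimes>\<^bsub>R\<^esub> b \<otimes>\<^bsub>R\<^esub> y | x y. x \<in> std_filt R k S j \<and> y \<in> std_filt R k S j}"

locale central_subring = ring R for R (structure) +
  fixes k
  assumes k_sub: "subring k R" and k_central: "c \<in> k \<Longrightarrow> x \<in> carrier R \<Longrightarrow> c \<otimes> x = x \<otimes> c"
begin

lemma k_carrier: "c \<in> k \<Longrightarrow> c \<in> carrier R"
  using subringE(1)[OF k_sub] by blast

lemma subalgebraD: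
  assumes "subalgebra k V R"
  shows "V \<subseteq> carrier R" "\<zero> \<in> V" "x \<in> V \<Longrightarrow> y \<in> V \<Longrightarrow> x \<oplus> y \<in> V"
    "x \<in> V \<Longrightarrow> \<ominus> x \<in> V" "c \<in> k \<Longrightarrow> x \<in> V \<Longrightarrow> c \<otimes> x \<in> V"
proof -
  interpret subalgebra k V R by (rule assms)
  show "V \<subseteq> carrier R" "\<zero> \<in> V" "x \<in> V \<Longrightarrow> y \<in> V \<Longrightarrow> x \<oplus> y \<in> V"
    "x \<in> V \<Longrightarrow> \<ominus> x \<in> V" "c \<in> k \<Longrightarrow> x \<in> V \<Longrightarrow> c \<otimes> x \<in> V"
    using subgroup.subset[OF subgroup_axioms] subgroup.one_closed[OF subgroup_axioms]
      subgroup.m_closed[OF subgroup_axioms] subgroup.m_inv_closed[OF subgroup_axioms] smult_closed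
    by (auto simp: a_inv_def)
qed

lemma subalgebraI:
  assumes "V \<subseteq> carrier R" "\<zero> \<in> V" "\<And>x y. x \<in> V \<Longrightarrow> y \<in> V \<Longrightarrow> x \<oplus> y \<in> V"
    "\<And>c x. c \<in> k \<Longrightarrow> x \<in> V \<Longrightarrow> c \<otimes> x \<in> V"
  shows "subalgebra k V R"
proof (intro subalgebra.intro subgroup.intro subalgebra_axioms.intro)
  show "inv\<^bsub>add_monoid R\<^esub> x \<in> V" if "x \<in> V" for x
  proof -
    have "\<ominus> \<one> \<in> k" using subringE(3,5)[OF k_sub] by blast
    then have "\<ominus> \<one> \<otimes> x \<in> V" using assms(4) that by blast
    then show ?thesis using assms(1) that l_minus[of \<one> x] by (auto simp: a_inv_def)
  qed
qed (use assms in auto)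

lemma subalgebra_left_mult:
  assumes V: "subalgebra k V R" and x: "x \<in> carrier R"
  shows "subalgebra k {y \<in> carrier R. x \<otimes> y \<in> V} R"
proof (rule subalgebraI)
  fix c y assume c: "c \<in> k" and y: "y \<in> {y \<in> carrier R. x \<otimes> y \<in> V}"
  have "x \<otimes> (c \<otimes> y) = c \<otimes> (x \<otimes> y)"
    using y x k_carrier[OF c] k_central[OF c x] m_assoc[of x c y] m_assoc[of c x y] by simp
  then show "c \<otimes> y \<in> {y \<in> carrier R. x \<otimes> y \<in> V}"
    using y k_carrier[OF c] subalgebraD(5)[OF V c] by auto
qed (use x subalgebraD(2,3)[OF V] in \<open>auto simp: r_distr\<close>)

lemma subalgebra_right_mult:
  assumes V: "subalgebra k V R" and y: "y \<in> carrier R"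
  shows "subalgebra k {x \<in> carrier R. x \<otimes> y \<in> V} R"
  by (rule subalgebraI) (use y k_carrier subalgebraD(2,3,5)[OF V] in \<open>auto simp: l_distr m_assoc\<close>)

lemma left_ideal_subalgebra: "left_ideal I R \<Longrightarrow> subalgebra k I R"
proof -
  assume "left_ideal I R"
  then have I: "subgroup I (add_monoid R)" "\<And>x y. x \<in> carrier R \<Longrightarrow> y \<in> I \<Longrightarrow> x \<otimes> y \<in> I"
    by (auto simp: left_ideal_def)
  show ?thesis
    by (rule subalgebraI)
      (use subgroup.subset[OF I(1)] subgroup.one_closed[OF I(1)] subgroup.m_closed[OF I(1)] I(2) k_carrier in auto)
qed

lemma subalgebra_k: "subalgebra k k R"
  by (rule subalgebraI) (use subringE[OF k_sub] in auto)

lemma lin_span_subalgebra: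
  assumes "S \<subseteq> carrier R" shows "subalgebra k (lin_span R k S) R"
proof (rule subalgebraI)
  have c: "subalgebra k (carrier R) R" by (rule subalgebraI) (use k_carrier in auto)
  then show "lin_span R k S \<subseteq> carrier R" using assms by (auto simp: lin_span_def)
qed (auto simp: lin_span_def dest: subalgebraD)

lemma lin_span_incl: "S \<subseteq> lin_span R k S"
  by (auto simp: lin_span_def)

lemma lin_span_min: "subalgebra k V R \<Longrightarrow> S \<subseteq> V \<Longrightarrow> lin_span R k S \<subseteq> V"
  by (auto simp: lin_span_def)

lemma lin_span_carrier: "S \<subseteq> carrier R \<Longrightarrow> lin_span R k S \<subseteq> carrier R"
  using subalgebraD(1)[OF lin_span_subalgebra] .

context
  fixes S assumes S: "S \<subseteq> carrier R"
begin

lemma step_carrier: "lin_span R k (insert \<one> S) \<subseteq> carrier R"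
  using S by (intro lin_span_carrier) auto

lemma std_filt_subalgebra: "subalgebra k (std_filt R k S i) R"
proof (induction i)
  case 0 then show ?case by (simp add: subalgebra_k)
next
  case (Suc i)
  show ?case unfolding std_filt.simps
    by (rule lin_span_subalgebra) (use subalgebraD(1)[OF Suc] step_carrier in auto)
qed

lemma std_filt_carrier: "std_filt R k S i \<subseteq> carrier R"
  using subalgebraD(1)[OF std_filt_subalgebra] .

lemma std_filt_closed: "x \<in> std_filt R k S i \<Longrightarrow> x \<in> carrier R"
  using std_filt_carrier by blast

lemma std_filt_step: "x \<in> std_filt R k S i \<Longrightarrow> y \<in> lin_span R k (insert \<one> S) \<Longrightarrow> x \<otimes> y \<in> std_filt R k S (Suc i)"
  unfolding std_filt.simps by (rule lin_span_incl[THEN subsetD]) auto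

lemma std_filt_Suc: "std_filt R k S i \<subseteq> std_filt R k S (Suc i)"
proof
  fix x assume x: "x \<in> std_filt R k S i"
  have "x \<otimes> \<one> \<in> std_filt R k S (Suc i)"
    by (rule std_filt_step[OF x]) (use lin_span_incl[of "insert \<one> S"] in auto)
  moreover have "x \<otimes> \<one> = x" using x std_filt_carrier by (intro r_one) blast
  ultimately show "x \<in> std_filt R k S (Suc i)" by metis
qed

lemma std_filt_mono: "i \<le> j \<Longrightarrow> std_filt R k S i \<subseteq> std_filt R k S j"
  using lift_Suc_mono_le[of "std_filt R k S" i j] std_filt_Suc by blast

lemma std_filt_monoD: "i \<le> j \<Longrightarrow> x \<in> std_filt R k S i \<Longrightarrow> x \<in> std_filt R k S j"
  using std_filt_mono by blast

lemma std_filt_mult: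
  assumes x: "x \<in> std_filt R k S i" and y: "y \<in> std_filt R k S j"
  shows "x \<otimes> y \<in> std_filt R k S (i + j)"
  using y
proof (induction j arbitrary: y)
  case 0
  then have y: "y \<in> k" by simp
  have "x \<in> carrier R" using x std_filt_carrier by blast
  then show ?case using k_central[OF y, of x] subalgebraD(5)[OF std_filt_subalgebra y x] by simp
next
  case (Suc j)
  note sa = std_filt_subalgebra[of "i + Suc j"]
  have xc: "x \<in> carrier R" using x std_filt_carrier by blast
  let ?V = "{y \<in> carrier R. x \<otimes> y \<in> std_filt R k S (i + Suc j)}"
  have "subalgebra k ?V R" by (rule subalgebra_left_mult[OF sa xc])
  moreover have "x \<otimes> (a \<otimes> b) \<in> std_filt R k S (i + Suc j)"
    if "a \<in> std_filt R k S j" "b \<in> lin_span R k (insert \<one> S)" for a b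
  proof -
    have "(x \<otimes> a) \<otimes> b \<in> std_filt R k S (Suc (i + j))" by (rule std_filt_step[OF Suc.IH[OF that(1)] that(2)])
    then show ?thesis using xc that std_filt_carrier step_carrier by (auto simp: m_assoc subset_iff)
  qed
  then have "{a \<otimes> b |a b. a \<in> std_filt R k S j \<and> b \<in> lin_span R k (insert \<one> S)} \<subseteq> ?V"
    using std_filt_carrier step_carrier by blast
  ultimately have "std_filt R k S (Suc j) \<subseteq> ?V" unfolding std_filt.simps by (rule lin_span_min)
  then show ?case using Suc.prems by blast
qed

lemma std_filt_one: "\<one> \<in> std_filt R k S i"
  using std_filt_mono[of 0 i] subringE(3)[OF k_sub] by auto

lemma std_filt_gen: "S \<subseteq> std_filt R k S 1"
proof
  fix s assume s: "s \<in> S"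
  have "\<one> \<otimes> s \<in> std_filt R k S (Suc 0)"
    using lin_span_incl[of "insert \<one> S"] s by (intro std_filt_step[OF std_filt_one]) auto
  then show "s \<in> std_filt R k S 1" using s S by auto
qed

lemma std_filt_exhaust:
  assumes gen: "generate_ring R (k \<union> S) = carrier R" and x: "x \<in> carrier R"
  shows "\<exists>i. x \<in> std_filt R k S i"
proof -
  have "x \<in> generate_ring R (k \<union> S)" using gen x by simp
  then show ?thesis
  proof (induction rule: generate_ring.induct)
    case one then show ?case using std_filt_one by blast
  next
    case (incl h)
    have "h \<in> std_filt R k S 1"
    proof (cases "h \<in> k")
      case True
      then have "h \<in> std_filt R k S 0" by simp
      then show ?thesis using std_filt_mono[of 0 1] by auto
    next
      case False
      then show ?thesis using incl std_filt_gen by blast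
    qed
    then show ?case by blast
  next
    case (a_inv h) then show ?case using subalgebraD(4)[OF std_filt_subalgebra] by blast
  next
    case (eng_add g h)
    then obtain i j where "g \<in> std_filt R k S i" "h \<in> std_filt R k S j" by blast
    then have "g \<in> std_filt R k S (max i j)" "h \<in> std_filt R k S (max i j)"
      using std_filt_mono[of i "max i j"] std_filt_mono[of j "max i j"] by auto
    then show ?case using subalgebraD(3)[OF std_filt_subalgebra] by blast
  next
    case (eng_mult g h) then show ?case using std_filt_mult by blast
  qed
qed

lemma sandwich_min:
  "subalgebra k V R \<Longrightarrow> (\<And>x y. x \<in> std_filt R k S j \<Longrightarrow> y \<in> std_filt R k S j \<Longrightarrow> x \<otimes> b \<otimes> y \<in> V) \<Longrightarrow>
    sandwich R k S j b \<subseteq> V"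
  unfolding sandwich_def by (rule lin_span_min) auto

lemma sandwich_incl:
  "x \<in> std_filt R k S j \<Longrightarrow> y \<in> std_filt R k S j \<Longrightarrow> x \<otimes> b \<otimes> y \<in> sandwich R k S j b"
  unfolding sandwich_def by (intro lin_span_incl[THEN subsetD]) blast

context
  fixes b assumes b: "b \<in> carrier R"
begin

lemma sandwich_subalgebra: "subalgebra k (sandwich R k S j b) R"
  unfolding sandwich_def by (rule lin_span_subalgebra) (use b std_filt_closed in auto)

lemma sandwich_mono: "i \<le> j \<Longrightarrow> sandwich R k S i b \<subseteq> sandwich R k S j b"
  by (rule sandwich_min[OF sandwich_subalgebra], rule sandwich_incl) (use std_filt_monoD in auto)

lemma sandwich_base: "b \<in> sandwich R k S 0 b"
  using sandwich_incl[OF std_filt_one std_filt_one, of b 0] b by simp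

lemma sandwich_left:
  assumes c: "c \<in> std_filt R k S i" and s: "s \<in> sandwich R k S j b"
  shows "c \<otimes> s \<in> sandwich R k S (i + j) b"
proof -
  have cc: "c \<in> carrier R" by (rule std_filt_closed[OF c])
  have "sandwich R k S j b \<subseteq> {s \<in> carrier R. c \<otimes> s \<in> sandwich R k S (i + j) b}"
  proof (rule sandwich_min[OF subalgebra_left_mult[OF sandwich_subalgebra cc]])
    fix x y assume xy: "x \<in> std_filt R k S j" "y \<in> std_filt R k S j"
    have "(c \<otimes> x) \<otimes> b \<otimes> y \<in> sandwich R k S (i + j) b"
      using std_filt_mult[OF c xy(1)] std_filt_monoD[OF _ xy(2), of "i + j"] by (intro sandwich_incl) auto
    then show "x \<otimes> b \<otimes> y \<in> {s \<in> carrier R. c \<otimes> s \<in> sandwich R k S (i + j) b}"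
      using cc b xy[THEN std_filt_closed] by (simp add: m_assoc)
  qed
  then show ?thesis using s by blast
qed

lemma sandwich_right:
  assumes c: "c \<in> std_filt R k S i" and s: "s \<in> sandwich R k S j b"
  shows "s \<otimes> c \<in> sandwich R k S (i + j) b"
proof -
  have cc: "c \<in> carrier R" by (rule std_filt_closed[OF c])
  have "sandwich R k S j b \<subseteq> {s \<in> carrier R. s \<otimes> c \<in> sandwich R k S (i + j) b}"
  proof (rule sandwich_min[OF subalgebra_right_mult[OF sandwich_subalgebra cc]])
    fix x y assume xy: "x \<in> std_filt R k S j" "y \<in> std_filt R k S j"
    have "x \<otimes> b \<otimes> (y \<otimes> c) \<in> sandwich R k S (i + j) b"
      using std_filt_mult[OF xy(2) c] std_filt_monoD[OF _ xy(1), of "i + j"]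
      by (intro sandwich_incl) (auto simp: add.commute)
    then show "x \<otimes> b \<otimes> y \<in> {s \<in> carrier R. s \<otimes> c \<in> sandwich R k S (i + j) b}"
      using cc b xy[THEN std_filt_closed] by (simp add: m_assoc)
  qed
  then show ?thesis using s by blast
qed

text \<open>
  The comparison of the two filter dimensions: if \<open>1\<close> lies in the sandwich of \<open>b\<close>, then it lies
  in the left ideal generated by the products of \<open>b\<close> with the same piece.
\<close>

lemma sandwich_subset_left_ideal:
  assumes I: "left_ideal I R" and b_I: "\<And>y. y \<in> std_filt R k S j \<Longrightarrow> b \<otimes> y \<in> I"
  shows "sandwich R k S j b \<subseteq> I"
proof (rule sandwich_min[OF left_ideal_subalgebra[OF I]])
  fix x y assume xy: "x \<in> std_filt R k S j" "y \<in> std_filt R k S j"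
  have "x \<otimes> (b \<otimes> y) \<in> I" using I b_I[OF xy(2)] std_filt_closed[OF xy(1)] by (simp add: left_ideal_def)
  then show "x \<otimes> b \<otimes> y \<in> I" using b xy[THEN std_filt_closed] by (simp add: m_assoc)
qed

end

text \<open>
  Any multiplicative filtration by subspaces dominates a standard one after multiplying the
  index by a constant, which orders of growth do not see.
\<close>

lemma std_filt_le:
  assumes V: "\<And>i. subalgebra k (V i) R" and mult: "\<And>i j x y. x \<in> V i \<Longrightarrow> y \<in> V j \<Longrightarrow> x \<otimes> y \<in> V (i + j)"
    and k: "k \<subseteq> V 0" and c: "insert \<one> S \<subseteq> V c"
  shows "std_filt R k S i \<subseteq> V (c * i)"
proof (induction i)
  case 0 then show ?case using k by simp
next
  case (Suc i)
  have "lin_span R k (insert \<one> S) \<subseteq> V c" using V c by (rule lin_span_min)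
  then have "x \<otimes> y \<in> V (c * Suc i)" if "x \<in> std_filt R k S i" "y \<in> lin_span R k (insert \<one> S)" for x y
    using mult[of x "c * i" y c] Suc that by (auto simp: add.commute)
  then show ?case unfolding std_filt.simps by (intro lin_span_min V) auto
qed

end

end

section \<open>Orders of growth\<close>

lemma growth_nonneg: "growth f \<ge> 0"
  unfolding growth_def by (rule INF_greatest) auto

lemma growth_less_D:
  assumes "growth f < ereal s"
  shows "\<forall>\<^sub>F i in sequentially. real (f i) \<le> real i powr s" and "0 \<le> s"
proof -
  obtain r where r: "0 \<le> r" "\<forall>\<^sub>F i in sequentially. real (f i) \<le> real i powr r" "r < s"
    using assms unfolding growth_def by (auto simp: INF_less_iff)
  then show "0 \<le> s" by simp
  have "\<forall>\<^sub>F i in sequentially. 1 \<le> i" by (rule eventually_ge_at_top)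
  with r(2) show "\<forall>\<^sub>F i in sequentially. real (f i) \<le> real i powr s"
  proof eventually_elim
    case (elim i)
    have "real i powr r \<le> real i powr s" using elim(2) r(3) by (intro powr_mono) auto
    then show ?case using elim(1) by linarith
  qed
qed

lemma eventually_powr_gt:
  assumes "e > 0" shows "\<forall>\<^sub>F i in sequentially. C < real i powr e"
proof -
  define b where "b = (\<bar>C\<bar> + 1) powr (1 / e)"
  have "\<forall>\<^sub>F i in sequentially. nat \<lceil>b\<rceil> \<le> i" by (rule eventually_ge_at_top)
  then show ?thesis
  proof eventually_elim
    case (elim i)
    have "C < b powr e" using assms by (simp add: b_def powr_powr)
    also have "\<dots> \<le> real i powr e" using assms elim by (intro powr_mono2) (auto simp: b_def)
    finally show ?case .
  qed
qed

lemma powr_exponent_le: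
  assumes "\<forall>\<^sub>F k in sequentially. real (k + 1) powr a \<le> C * real (k + 1) powr b"
  shows "a \<le> b"
proof (rule ccontr)
  assume "\<not> a \<le> b"
  then have ab: "a - b > 0" by simp
  have "\<forall>\<^sub>F k in sequentially. C < real (k + 1) powr (a - b)"
    using eventually_powr_gt[OF ab, of C] by (subst (asm) eventually_sequentially_Suc[symmetric]) simp
  with assms have "\<forall>\<^sub>F k in sequentially. False"
  proof eventually_elim
    case (elim k)
    have "C * real (k + 1) powr b < real (k + 1) powr (a - b) * real (k + 1) powr b"
      using elim(2) by (intro mult_strict_right_mono) auto
    also have "\<dots> = real (k + 1) powr a" by (simp add: powr_add[symmetric])
    finally show ?case using elim(1) by simp
  qed
  then show False by simp
qed

lemma growth_le_of_bound:
  assumes "\<And>i. f i \<le> C * (i + 1) ^ n"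
  shows "growth f \<le> ereal (real n)"
proof (rule ereal_le_epsilon2)
  fix e :: real assume e: "e > 0"
  have "\<forall>\<^sub>F i in sequentially. real (C * 2 ^ n) < real i powr e" by (rule eventually_powr_gt[OF e])
  moreover have "\<forall>\<^sub>F i in sequentially. 1 \<le> i" by (rule eventually_ge_at_top)
  ultimately have "\<forall>\<^sub>F i in sequentially. real (f i) \<le> real i powr (real n + e)"
  proof eventually_elim
    case (elim i)
    have "real (f i) \<le> real (C * (i + 1) ^ n)" using assms[of i] by (simp only: of_nat_le_iff)
    also have "\<dots> \<le> real (C * (2 * i) ^ n)" using elim(2) by (intro of_nat_mono mult_left_mono power_mono) auto
    also have "\<dots> = real (C * 2 ^ n) * real i powr real n" using elim(2) by (simp add: power_mult_distrib powr_realpow)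
    also have "\<dots> \<le> real i powr e * real i powr real n" using elim(1) by (intro mult_right_mono) auto
    also have "\<dots> = real i powr (real n + e)" by (simp add: powr_add mult.commute)
    finally show ?case .
  qed
  then have "growth f \<le> ereal (real n + e)" unfolding growth_def using e by (intro INF_lower) auto
  then show "growth f \<le> ereal (real n) + ereal e" by simp
qed

text \<open>
  On the multiples of \<open>c\<close>, a bound by the power \<open>r\<close> only changes by the constant \<open>c\<^sup>r\<close>.
\<close>

lemma growth_ge_of_bound:
  assumes "\<And>k. (k + 1) ^ n \<le> f (c * (k + 1))" and c: "c \<ge> 1"
  shows "ereal (real n) \<le> growth f"
  unfolding growth_def
proof (rule INF_greatest)
  fix r assume "r \<in> {r. 0 \<le> r \<and> (\<forall>\<^sub>F i in sequentially. real (f i) \<le> real i powr r)}"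
  then have ev: "\<forall>\<^sub>F i in sequentially. real (f i) \<le> real i powr r" by simp
  have "filterlim (\<lambda>k. c * (k + 1)) at_top sequentially"
    by (rule filterlim_at_top_mono[OF filterlim_ident]) (use c in \<open>auto intro!: always_eventually simp: trans_le_add2\<close>)
  then have "\<forall>\<^sub>F k in sequentially. real (f (c * (k + 1))) \<le> real (c * (k + 1)) powr r"
    using ev by (rule eventually_compose_filterlim[rotated])
  then have "\<forall>\<^sub>F k in sequentially. real (k + 1) powr real n \<le> real c powr r * real (k + 1) powr r"
  proof eventually_elim
    case (elim k)
    have "real (k + 1) powr real n = real ((k + 1) ^ n)" by (simp add: powr_realpow del: of_nat_Suc of_nat_add)
    also have "\<dots> \<le> real (f (c * (k + 1)))" using assms(1)[of k] by (simp only: of_nat_le_iff)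
    also note elim
    also have "real (c * (k + 1)) powr r = real c powr r * real (k + 1) powr r"
      by (simp only: of_nat_mult powr_mult)
    finally show ?case .
  qed
  then show "ereal (real n) \<le> ereal r" using powr_exponent_le by simp
qed

section \<open>The growth of a somewhat commutative algebra\<close>

lemma finite_in_chain:
  fixes V :: "nat \<Rightarrow> 'x set"
  assumes fin: "finite T" and mono: "\<And>i j. i \<le> j \<Longrightarrow> V i \<subseteq> V j" and ex: "\<And>x. x \<in> T \<Longrightarrow> \<exists>i. x \<in> V i"
  shows "\<exists>c. \<forall>x\<in>T. x \<in> V c"
  using fin ex
proof (induction T rule: finite_induct)
  case (insert x T)
  then obtain c d where "\<forall>x\<in>T. x \<in> V c" "x \<in> V d" by (metis insertCI)
  then show ?case using mono[of c "max c d"] mono[of d "max c d"] by (intro exI[of _ "max c d"]) auto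
qed auto

context central_algebra
begin

sublocale alg: central_subring AA "range \<phi>"
proof (intro central_subring.intro central_subring_axioms.intro ring_rta)
  show "subring (range \<phi>) AA" using subfield_range by (rule subfieldE(1))
qed (auto simp: \<phi>_central)

lemma subspace_std_filt: "subspace (std_filt AA (range \<phi>) S i)"
  using alg.std_filt_subalgebra[of S i] by (simp add: subalgebra_iff_subspace)

end

context commutatively_filtered
begin

sublocale act: monomial_action "\<lambda>c a. \<phi> c * a" N w "\<lambda>\<alpha> v. zmon \<alpha> * v"
proof unfold_locales
  fix \<alpha> \<beta> u v c
  show "zmon (\<lambda>_. 0) * v = v" by (simp add: zmon_zero)
  show "zmon \<alpha> * (u + v) = zmon \<alpha> * u + zmon \<alpha> * v" by (simp add: distrib_left)
  show "zmon \<alpha> * (\<phi> c * v) = \<phi> c * (zmon \<alpha> * v)" by (metis \<phi>_central mult.assoc)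
  assume a: "\<alpha> \<in> exps N" "\<beta> \<in> exps N"
  let ?T = "{zmon \<gamma> * v | \<gamma>. \<gamma> \<in> exps N \<and> wt N w \<gamma> < wt N w \<alpha> + wt N w \<beta>}"
  have "(zmon \<alpha> * zmon \<beta> - zmon (\<alpha> \<oplus>\<^sub>e \<beta>)) * v \<in> span ?T"
    by (rule span_mult[OF zmon_zmon[OF a(1)], of v "{v}"]) (auto intro: span_base)
  then show "zmon \<alpha> * (zmon \<beta> * v) - zmon (\<alpha> \<oplus>\<^sub>e \<beta>) * v \<in> span ?T"
    by (simp add: algebra_simps)
qed

lemma filt_one: "act.filt 1 i = F i"
  by (simp add: act.filt_def F_eq_span_zmon)

text \<open>
  Ordered monomials are products of the \<open>z j\<close>, and they span the algebra.
\<close>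

lemma alg_generators_z: "alg_generators AA (range \<phi>) (z ` {..<N})"
proof -
  let ?H = "range \<phi> \<union> z ` {..<N}"
  interpret R: ring AA by (rule ring_rta)
  have add: "x + y \<in> generate_ring AA ?H" if "x \<in> generate_ring AA ?H" "y \<in> generate_ring AA ?H" for x y
    using generate_ring.eng_add[OF that] by simp
  have mult: "x * y \<in> generate_ring AA ?H" if "x \<in> generate_ring AA ?H" "y \<in> generate_ring AA ?H" for x y
    using generate_ring.eng_mult[OF that] by simp
  have inc: "x \<in> generate_ring AA ?H" if "x \<in> ?H" for x using that by (rule generate_ring.incl)
  have one: "1 \<in> generate_ring AA ?H" using generate_ring.one[of AA ?H] by simp
  have pw: "x ^ m \<in> generate_ring AA ?H" if "x \<in> generate_ring AA ?H" for x m
    using that by (induction m) (auto intro: one mult)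
  have pl: "prod_list (map (\<lambda>j. z j ^ \<alpha> j) js) \<in> generate_ring AA ?H" if "set js \<subseteq> {..<N}" for \<alpha> js
    using that
  proof (induction js)
    case Nil then show ?case using one by simp
  next
    case (Cons j js)
    then have "z j \<in> generate_ring AA ?H" by (intro inc) auto
    then show ?case using Cons mult[OF pw] by simp
  qed
  have "x \<in> generate_ring AA ?H" if "x \<in> span {zmon \<alpha> | \<alpha>. \<alpha> \<in> exps N \<and> wt N w \<alpha> \<le> i}" for x i
    using that
  proof (induction rule: span_induct_alt)
    case base
    have "\<phi> 0 \<in> ?H" by blast
    from inc[OF this] show ?case by (simp only: \<phi>_zero)
  next
    case (step c a b)
    have "set [0..<N] \<subseteq> {..<N}" by auto
    from pl[OF this] have "a \<in> generate_ring AA ?H" using step(1) by (auto simp: zmon_def)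
    then show ?case using step inc[of "\<phi> c"] by (intro add mult) auto
  qed
  then have "generate_ring AA ?H = UNIV" using F_UN F_span_zmon by blast
  then show ?thesis by (simp add: alg_generators_def)
qed

text \<open>
  The number \<open>n\<close> is the dimension of the staircase of the zero subspace of the algebra, whose
  Hilbert function is that of the filtration \<open>F\<close>. For a lower bound in an arbitrary standard
  filtration, the monomials with exponents in a cube inside an \<open>n\<close>-dimensional orthant are
  linearly independent, and their lengths as words grow linearly with the side of the cube.
\<close>

lemma growth_exponent:
  assumes inf: "\<not> ring.finite_dimension AA (range \<phi>) UNIV"
  shows "\<exists>n C. n \<ge> 1 \<and> (\<forall>i. \<exists>B. finite B \<and> card B \<le> C * (i+1)^n \<and> F i \<subseteq> span B) \<and>
    (\<forall>S. alg_generators AA (range \<phi>) S \<longrightarrow> (\<exists>c\<ge>1. (\<forall>k. (k+1)^n \<le> dim (std_filt AA (range \<phi>) S (c * (k+1)))) \<and>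
        (\<forall>i. std_filt AA (range \<phi>) S i \<subseteq> F (c * i))))"
proof -
  define E where "E = act.stair {0} 1"
  have dimF: "finite {\<alpha> \<in> E. wt N w \<alpha> \<le> i} \<and> dim (F i) = card {\<alpha> \<in> E. wt N w \<alpha> \<le> i}" for i
  proof -
    obtain B where "finite B" "F i \<subseteq> span B" using F_fin by blast
    then have B: "finite B" "act.filt 1 i \<subseteq> span B" by (simp_all add: filt_one)
    have "dim {0} = 0" using dim_le_card[of "{0}" "{}"] by simp
    then show ?thesis using act.filt_dim[OF subspace_single_0 B] subspace_0[OF subspace_F, of i]
      by (simp add: E_def filt_one)
  qed
  have sp: "zmon \<alpha> \<in> span (zmon ` {\<beta> \<in> E. wt N w \<beta> \<le> wt N w \<alpha>})" if "\<alpha> \<in> exps N" for \<alpha>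
    using act.stair_spans[OF subspace_single_0 that order_refl, of 1] by (simp add: E_def)
  interpret E: staircase N w E
    by unfold_locales (use act.stair_down_closed[OF act.stable_zero] dimF in \<open>auto simp: E_def\<close>)
  have "E \<noteq> {}" "infinite E"
  proof -
    show infE: "infinite E"
    proof
      assume fin: "finite E"
      have "F i \<subseteq> span (zmon ` E)" for i
        unfolding F_eq_span_zmon
      proof (rule span_minimal[OF _ subspace_span], safe)
        fix \<alpha> assume "\<alpha> \<in> exps N"
        from sp[OF this] show "zmon \<alpha> \<in> span (zmon ` E)" by (rule span_mono[THEN subsetD, rotated]) auto
      qed
      then have U: "UNIV \<subseteq> span (zmon ` E)" using F_UN by blast
      show False using inf dim_eq(2)[OF subspace_UNIV finite_imageI[OF fin] U] by blast
    qed
    then show "E \<noteq> {}" by auto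
  qed
  then obtain n C \<beta> S0 where n: "S0 \<subseteq> {..<N}" "card S0 = n" "orthant \<beta> S0 \<subseteq> E"
     "\<And>i. card {\<alpha>\<in>E. wt N w \<alpha> \<le> i} \<le> C * (i+1)^n" "n \<ge> 1"
    using E.dimension_exists by blast
  have R1: "\<exists>B. finite B \<and> card B \<le> C * (i+1)^n \<and> F i \<subseteq> span B" for i
  proof -
    obtain B where B: "B \<subseteq> F i" "independent B" "F i \<subseteq> span B" "card B = dim (F i)" using basis_exists by blast
    obtain B0 where "finite B0" "F i \<subseteq> span B0" using F_fin by blast
    then have "finite B" using independent_span_bound B(1,2) by blast
    then show ?thesis using B(3,4) dimF[of i] n(4)[of i] by (intro exI[of _ B]) simp
  qed
  have "\<exists>c\<ge>1. (\<forall>k. (k+1)^n \<le> dim (std_filt AA (range \<phi>) S (c * (k+1)))) \<and>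
        (\<forall>i. std_filt AA (range \<phi>) S i \<subseteq> F (c * i))" if S: "alg_generators AA (range \<phi>) S" for S
  proof -
    let ?s = "std_filt AA (range \<phi>) S"
    have gen: "generate_ring AA (range \<phi> \<union> S) = carrier AA" and finS: "finite S"
      using S by (auto simp: alg_generators_def)
    obtain c1 where c1: "\<forall>x\<in>insert 1 S. x \<in> F c1"
      using finite_in_chain[of "insert 1 S" F] finS F_mono F_UN by blast
    have le: "?s i \<subseteq> F (c1 * i)" for i
    proof (rule alg.std_filt_le)
      show "range \<phi> \<subseteq> F 0" using subspace_scale[OF subspace_F F_one] by auto
    qed (use c1 F_mult subspace_F subalgebra_iff_subspace in auto)
    have smono: "?s i \<subseteq> ?s j" if "i \<le> j" for i j by (rule alg.std_filt_mono[OF _ that]) simp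
    obtain c2 where c2: "\<forall>x\<in>z ` {..<N}. x \<in> ?s c2"
      using finite_in_chain[of "z ` {..<N}" ?s] smono alg.std_filt_exhaust[OF _ gen] by auto
    have smult: "x * y \<in> ?s (i + j)" if "x \<in> ?s i" "y \<in> ?s j" for x y i j
      using alg.std_filt_mult[OF _ that] by simp
    have s1: "1 \<in> ?s i" for i using alg.std_filt_one[of S i] by simp
    have pw: "x ^ m \<in> ?s (c2 * m)" if "x \<in> ?s c2" for x m
    proof (induction m)
      case 0 then show ?case using s1[of 0] by simp
    next
      case (Suc m) then show ?case using smult[OF that Suc] by simp
    qed
    have pl: "prod_list (map (\<lambda>j. z j ^ \<alpha> j) js) \<in> ?s (c2 * sum_list (map \<alpha> js))" if "set js \<subseteq> {..<N}" for \<alpha> js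
      using that
    proof (induction js)
      case Nil then show ?case using s1[of 0] by simp
    next
      case (Cons j js)
      then show ?case using smult[OF pw[of "z j" "\<alpha> j"], of _ "c2 * sum_list (map \<alpha> js)"] c2 by (simp add: distrib_left)
    qed
    have zs: "zmon \<alpha> \<in> ?s (c2 * wt N (\<lambda>_. 1) \<alpha>)" for \<alpha>
      using pl[of "[0..<N]" \<alpha>] by (simp add: zmon_def wt_def interv_sum_list_conv_sum_set_nat atLeast0LessThan subset_iff)
    obtain c3 where c3: "\<And>k. \<exists>Y \<subseteq> {\<alpha>\<in>orthant \<beta> S0. wt N (\<lambda>_. 1) \<alpha> \<le> c3 * (k+1)}. finite Y \<and> card Y = (k+1) ^ card S0"
      using orthant_box[OF n(1), of \<beta> "\<lambda>_. 1"] by blast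
    define c where "c = max (max c1 1) (c2 * c3)"
    have lower: "(k+1)^n \<le> dim (?s (c * (k+1)))" for k
    proof -
      obtain Y where Y: "Y \<subseteq> {\<alpha>\<in>orthant \<beta> S0. wt N (\<lambda>_. 1) \<alpha> \<le> c3 * (k+1)}" "finite Y" "card Y = (k+1)^n"
        using c3[of k] n(2) by blast
      have XE: "Y \<subseteq> act.stair {0} 1" using Y(1) n(3) by (auto simp: E_def)
      have ind: "independent (zmon ` Y)" "card (zmon ` Y) = card Y"
        using act.stair_independent[OF subspace_single_0 independent_empty, of Y 1] XE Y(2) by auto
      have "zmon ` Y \<subseteq> ?s (c * (k+1))"
      proof (rule image_subsetI)
        fix \<alpha> assume "\<alpha> \<in> Y"
        then have "wt N (\<lambda>_. 1) \<alpha> \<le> c3 * (k+1)" using Y(1) by auto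
        then have "c2 * wt N (\<lambda>_. 1) \<alpha> \<le> c2 * c3 * (k+1)" by (simp only: mult.assoc mult_le_mono2)
        also have "\<dots> \<le> c * (k+1)" by (simp add: c_def del: mult_Suc_right)
        finally show "zmon \<alpha> \<in> ?s (c * (k+1))" using zs[of \<alpha>] smono by blast
      qed
      then have sub: "zmon ` Y \<subseteq> span (?s (c * (k+1)))" using span_superset by blast
      obtain B where "finite B" "?s (c * (k+1)) \<subseteq> span B" using le[of "c * (k+1)"] F_fin[of "c1 * (c * (k+1))"] by blast
      then show ?thesis using card_le_dim_of_independent[OF ind(1) sub] ind(2) Y(3) by simp
    qed
    have "?s i \<subseteq> F (c * i)" for i
    proof -
      have "c1 \<le> c" by (simp add: c_def)
      then show ?thesis using le[of i] F_mono[OF mult_le_mono1, of c1 c i] by blast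
    qed
    moreover have "c \<ge> 1" by (simp add: c_def)
    ultimately show ?thesis using lower by blast
  qed
  note R2 = this
  show ?thesis
    by (rule exI[of _ n], rule exI[of _ C]) (rule conjI[OF n(5) conjI[OF allI[OF R1] allI[OF impI[OF R2]]]])
qed

lemma gk_dim_eq:
  assumes up: "\<And>i. \<exists>B. finite B \<and> card B \<le> C * (i+1)^n \<and> F i \<subseteq> span B"
    and lower: "\<And>k. (k+1)^n \<le> dim (std_filt AA (range \<phi>) (some_generators AA (range \<phi>)) (c * (k+1)))"
    and upper: "\<And>i. std_filt AA (range \<phi>) (some_generators AA (range \<phi>)) i \<subseteq> F (c * i)" and c: "c \<ge> 1"
  shows "gk_dim AA (range \<phi>) = ereal (real n)"
proof -
  let ?s = "std_filt AA (range \<phi>) (some_generators AA (range \<phi>))"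
  have d: "ring.dim AA (range \<phi>) (?s i) = dim (?s i)" for i
  proof -
    obtain B where "finite B" "?s i \<subseteq> span B" using upper[of i] F_fin[of "c * i"] by blast
    then show ?thesis using subspace_std_filt by (intro dim_eq) auto
  qed
  have "dim (?s i) \<le> (C * (c+1)^n) * (i + 1)^n" for i
  proof -
    obtain B where B: "finite B" "card B \<le> C * (c * i+1)^n" "F (c * i) \<subseteq> span B" using up by blast
    have "dim (?s i) \<le> card B" by (rule dim_le_card) (use upper[of i] B in auto)
    also have "\<dots> \<le> C * ((c+1) * (i+1))^n" using B(2) by (rule order_trans) (intro mult_left_mono power_mono, auto)
    finally show ?thesis by (simp only: power_mult_distrib mult.assoc)
  qed
  then have "growth (\<lambda>i. dim (?s i)) \<le> ereal (real n)" by (rule growth_le_of_bound)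
  moreover have "ereal (real n) \<le> growth (\<lambda>i. dim (?s i))" using lower c by (rule growth_ge_of_bound)
  ultimately show ?thesis by (simp add: gk_dim_def d)
qed

end

section \<open>Commuting elements of the quotient division ring\<close>

definition xmon :: "'d::monoid_mult list \<Rightarrow> (nat \<Rightarrow> nat) \<Rightarrow> 'd" where
  "xmon xs e = prod_list (map (\<lambda>j. xs ! j ^ e j) [0..<length xs])"

lemma xmon_Nil: "xmon [] e = 1"
  by (simp add: xmon_def)

lemma xmon_Cons: "xmon (x # xs) e = x ^ e 0 * xmon xs (\<lambda>j. e (Suc j))"
proof -
  have "[0..<length (x # xs)] = 0 # map Suc [0..<length xs]"
    by (simp add: upt_conv_Cons map_Suc_upt del: upt_Suc)
  then show ?thesis by (simp add: xmon_def o_def del: upt_Suc)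
qed

lemma rpow_right_mult: "rpow (map (\<lambda>x v. v * x) xs) e v = v * xmon xs e"
proof (induction xs arbitrary: e v)
  case Nil then show ?case by (simp add: xmon_Nil)
next
  case (Cons x xs)
  have "((\<lambda>v. v * x) ^^ k) v = v * x ^ k" for k by (induction k) (simp_all add: power_commutes mult.assoc)
  then show ?case using Cons by (simp add: xmon_Cons mult.assoc)
qed

locale fraction_ring = commutatively_filtered \<phi> F N z w
  for \<phi> :: "'k::field \<Rightarrow> 'a::ring_1_no_zero_divisors" and F N z w +
  fixes \<iota> :: "'a \<Rightarrow> 'd::division_ring"
  assumes quotient: "quotient_division_ring \<iota>"
begin

lemma \<iota>_add: "\<iota> (a + b) = \<iota> a + \<iota> b" and \<iota>_mult: "\<iota> (a * b) = \<iota> a * \<iota> b" and \<iota>_one: "\<iota> 1 = 1"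
  and \<iota>_inj: "inj \<iota>"
  using quotient by (auto simp: quotient_division_ring_def ring_hom_def)

lemma \<iota>_zero: "\<iota> 0 = 0" using \<iota>_add[of 0 0] by simp

lemma \<iota>_diff: "\<iota> (a - b) = \<iota> a - \<iota> b" using \<iota>_add[of "a - b" b] by simp

lemma \<iota>_eq_0_iff: "\<iota> a = 0 \<longleftrightarrow> a = 0" using \<iota>_inj \<iota>_zero by (metis injD)

lemma fraction: "\<exists>s a. s \<noteq> 0 \<and> d = inverse (\<iota> s) * \<iota> a"
  using quotient by (auto simp: quotient_division_ring_def)

definition \<kappa> :: "'k \<Rightarrow> 'd" where "\<kappa> c = \<iota> (\<phi> c)"

sublocale D: central_algebra \<kappa>
proof unfold_locales
  fix c d :: 'k and x :: 'd
  show "\<kappa> (c + d) = \<kappa> c + \<kappa> d" by (simp add: \<kappa>_def \<phi>_add \<iota>_add)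
  show "\<kappa> (c * d) = \<kappa> c * \<kappa> d" by (simp add: \<kappa>_def \<phi>_mult \<iota>_mult)
  show "\<kappa> 1 = 1" by (simp add: \<kappa>_def \<phi>_one \<iota>_one)
  obtain s a where s: "s \<noteq> 0" "x = inverse (\<iota> s) * \<iota> a" using fraction by blast
  have com: "\<iota> (\<phi> c) * \<iota> b = \<iota> b * \<iota> (\<phi> c)" for b using \<phi>_central[of c b] \<iota>_mult by metis
  have nz: "\<iota> s \<noteq> 0" using s(1) \<iota>_eq_0_iff by blast
  have "\<iota> (\<phi> c) * inverse (\<iota> s) = inverse (\<iota> s) * (\<iota> s * \<iota> (\<phi> c)) * inverse (\<iota> s)"
    using nz by (simp add: mult.assoc[symmetric])
  also have "\<dots> = inverse (\<iota> s) * \<iota> (\<phi> c) * (\<iota> s * inverse (\<iota> s))" by (simp add: com[symmetric] mult.assoc)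
  also have "\<dots> = inverse (\<iota> s) * \<iota> (\<phi> c)" using nz by simp
  finally have "\<iota> (\<phi> c) * x = x * \<iota> (\<phi> c)" unfolding s(2) using com[of a] by (metis mult.assoc)
  then show "\<kappa> c * x = x * \<kappa> c" by (simp add: \<kappa>_def)
qed

lemma \<iota>_span: "x \<in> span S \<Longrightarrow> (\<And>s. s \<in> S \<Longrightarrow> \<iota> s * v \<in> W) \<Longrightarrow> D.subspace W \<Longrightarrow> \<iota> x * v \<in> W"
proof (induction rule: span_induct_alt)
  case base then show ?case by (simp add: \<iota>_zero D.subspace_0)
next
  case (step c s x)
  have "\<iota> (\<phi> c * s + x) * v = \<kappa> c * (\<iota> s * v) + \<iota> x * v"
    by (simp add: \<kappa>_def \<iota>_add \<iota>_mult distrib_right mult.assoc)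
  then show ?case using step by (simp only: D.subspace_add D.subspace_scale)
qed

sublocale Dact: monomial_action "\<lambda>c v. \<kappa> c * v" N w "\<lambda>\<alpha> v. \<iota> (zmon \<alpha>) * v"
proof unfold_locales
  fix \<alpha> \<beta> u v c
  show "\<iota> (zmon (\<lambda>_. 0)) * v = v" by (simp add: zmon_zero \<iota>_one)
  show "\<iota> (zmon \<alpha>) * (u + v) = \<iota> (zmon \<alpha>) * u + \<iota> (zmon \<alpha>) * v" by (simp add: distrib_left)
  show "\<iota> (zmon \<alpha>) * (\<kappa> c * v) = \<kappa> c * (\<iota> (zmon \<alpha>) * v)" by (metis D.\<phi>_central mult.assoc)
  assume a: "\<alpha> \<in> exps N" "\<beta> \<in> exps N"
  let ?T = "{\<iota> (zmon \<gamma>) * v | \<gamma>. \<gamma> \<in> exps N \<and> wt N w \<gamma> < wt N w \<alpha> + wt N w \<beta>}"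
  have "\<iota> (zmon \<alpha> * zmon \<beta> - zmon (\<alpha> \<oplus>\<^sub>e \<beta>)) * v \<in> D.span ?T"
    by (rule \<iota>_span[OF zmon_zmon[OF a(1)]]) (auto intro: D.span_base)
  then show "\<iota> (zmon \<alpha>) * (\<iota> (zmon \<beta>) * v) - \<iota> (zmon (\<alpha> \<oplus>\<^sub>e \<beta>)) * v \<in> D.span ?T"
    by (simp add: \<iota>_mult \<iota>_diff left_diff_distrib mult.assoc)
qed

text \<open>
  The stable subspaces of the division ring are its submodules over the algebra.
\<close>

lemma stable_left_ideal: "Dact.stable Y \<Longrightarrow> v \<in> Y \<Longrightarrow> \<iota> a * v \<in> Y"
proof -
  assume Y: "Dact.stable Y" and v: "v \<in> Y"
  obtain i where "a \<in> span {zmon \<alpha> | \<alpha>. \<alpha> \<in> exps N \<and> wt N w \<alpha> \<le> i}" using F_UN F_eq_span_zmon by blast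
  then show "\<iota> a * v \<in> Y"
    by (rule \<iota>_span) (use Y v in \<open>auto simp: Dact.stable_def\<close>)
qed

text \<open>
  The algebra acts on its division ring from the left and commutes with right multiplications,
  so the elements of \<open>xs\<close> can be adjoined one after the other. What remains to be checked is
  that every nonzero submodule \<open>Y\<close> contains some \<open>v' \<noteq> 0\<close> with \<open>v' x\<close> in \<open>Y\<close>. Given a nonzero
  \<open>v\<close> in \<open>Y\<close>, write \<open>v x v\<^sup>-\<^sup>1 = s\<^sup>-\<^sup>1 a\<close> as a fraction; then \<open>v' = s v\<close> satisfies \<open>v' x = a v\<close>.
\<close>

theorem bounded_growth_with_commuting_elements:
  assumes n: "n \<ge> 1" and up: "\<And>i. \<exists>B. finite B \<and> card B \<le> C * (i+1)^n \<and> F i \<subseteq> span B"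
    and comm: "\<And>x y. x \<in> set xs \<Longrightarrow> y \<in> set xs \<Longrightarrow> x * y = y * x"
  shows "\<exists>u C'. u \<noteq> 0 \<and> (\<forall>i. \<exists>B. finite B \<and> card B \<le> C' * (i+1)^n \<and>
    (\<forall>l a e. a \<in> F l \<and> l + (\<Sum>j<length xs. e j) \<le> i \<longrightarrow> \<iota> a * u * xmon xs e \<in> D.span B))"
proof -
  let ?Rs = "map (\<lambda>x v. v * x) xs"
  have "\<exists>u' C'. u' \<noteq> 0 \<and> (\<forall>i. \<exists>B. finite B \<and> card B \<le> C' * (i+1)^n \<and>
     (\<forall>\<alpha> e. \<alpha> \<in> exps N \<and> wt N w \<alpha> + (\<Sum>j<length ?Rs. e j) \<le> i \<longrightarrow> rpow ?Rs e (\<iota> (zmon \<alpha>) * u') \<in> D.span B))"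
  proof (rule iterated_extension[OF Dact.monomial_action_axioms n, of 1 C])
    fix i
    obtain B where B: "finite B" "card B \<le> C * (i+1)^n" "F i \<subseteq> span B" using up by blast
    have "Dact.filt 1 i \<subseteq> D.span (\<iota> ` B)"
      unfolding Dact.filt_def
    proof (rule D.span_minimal, safe)
      fix \<alpha> assume "wt N w \<alpha> \<le> i"
      then have "zmon \<alpha> \<in> span B" using zmon_F[of \<alpha>] F_mono B(3) by blast
      then show "\<iota> (zmon \<alpha>) * 1 \<in> D.span (\<iota> ` B)"
        by (rule \<iota>_span) (auto intro: D.span_base)
    qed
    moreover have "card (\<iota> ` B) \<le> C * (i+1)^n" using card_image_le[OF B(1), of \<iota>] B(2) by linarith
    ultimately show "\<exists>B. finite B \<and> card B \<le> C * (i+1)^n \<and> Dact.filt 1 i \<subseteq> D.span B" using B(1) by blast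
  next
    fix R R' :: "'d \<Rightarrow> 'd" and v \<alpha> assume R: "R \<in> set ?Rs"
    then obtain x where x: "x \<in> set xs" "R = (\<lambda>v. v * x)" by auto
    show "Vector_Spaces.linear (\<lambda>c v. \<kappa> c * v) (\<lambda>c v. \<kappa> c * v) R"
      unfolding x(2) Vector_Spaces.linear_iff by (simp add: D.vector_space_axioms distrib_right mult.assoc)
    show "R (\<iota> (zmon \<alpha>) * v) = \<iota> (zmon \<alpha>) * R v" by (simp add: x(2) mult.assoc)
    show "R (R' v) = R' (R v)" if "R' \<in> set ?Rs"
    proof -
      obtain y where y: "y \<in> set xs" "R' = (\<lambda>v. v * y)" using \<open>R' \<in> set ?Rs\<close> by auto
      then show ?thesis using comm[OF x(1) y(1)] by (simp add: x(2) mult.assoc)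
    qed
    fix Y assume Y: "Dact.stable Y" "Y \<noteq> {0}"
    have "0 \<in> Y" using Dact.stable_subspace[OF Y(1)] D.subspace_0 by blast
    then obtain v where v: "v \<in> Y" "v \<noteq> 0" using Y(2) by auto
    obtain s a where s: "s \<noteq> 0" "v * x * inverse v = inverse (\<iota> s) * \<iota> a" using fraction by blast
    have nz: "\<iota> s \<noteq> 0" using s(1) \<iota>_eq_0_iff by blast
    have "\<iota> s * v * x = \<iota> s * (v * x * inverse v) * v" using v(2) by (simp add: mult.assoc)
    also have "\<dots> = \<iota> a * v" unfolding s(2) using nz by (simp add: mult.assoc[symmetric])
    finally have "R (\<iota> s * v) \<in> Y" using stable_left_ideal[OF Y(1) v(1)] by (simp add: x(2))
    moreover have "\<iota> s * v \<in> Y" "\<iota> s * v \<noteq> 0" using stable_left_ideal[OF Y(1) v(1)] nz v(2) by auto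
    ultimately show "\<exists>v\<in>Y. v \<noteq> 0 \<and> R v \<in> Y" by blast
  qed simp
  then obtain u C' where u: "u \<noteq> 0" and B: "\<And>i. \<exists>B. finite B \<and> card B \<le> C' * (i+1)^n \<and>
     (\<forall>\<alpha> e. \<alpha> \<in> exps N \<and> wt N w \<alpha> + (\<Sum>j<length xs. e j) \<le> i \<longrightarrow> \<iota> (zmon \<alpha>) * u * xmon xs e \<in> D.span B)"
    unfolding rpow_right_mult length_map by blast
  have "\<exists>B. finite B \<and> card B \<le> C' * (i+1)^n \<and>
    (\<forall>l a e. a \<in> F l \<and> l + (\<Sum>j<length xs. e j) \<le> i \<longrightarrow> \<iota> a * u * xmon xs e \<in> D.span B)" for i
  proof -
    obtain B0 where B0: "finite B0" "card B0 \<le> C' * (i+1)^n"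
      "\<And>\<alpha> e. \<alpha> \<in> exps N \<Longrightarrow> wt N w \<alpha> + (\<Sum>j<length xs. e j) \<le> i \<Longrightarrow> \<iota> (zmon \<alpha>) * u * xmon xs e \<in> D.span B0"
      using B[of i] by blast
    have "\<iota> a * (u * xmon xs e) \<in> D.span B0" if a: "a \<in> F l" and le: "l + (\<Sum>j<length xs. e j) \<le> i" for l a e
      using a unfolding F_eq_span_zmon
    proof (rule \<iota>_span)
      fix s assume "s \<in> {zmon \<alpha> |\<alpha>. \<alpha> \<in> exps N \<and> wt N w \<alpha> \<le> l}"
      then obtain \<alpha> where "s = zmon \<alpha>" "\<alpha> \<in> exps N" "wt N w \<alpha> \<le> l" by blast
      then show "\<iota> s * (u * xmon xs e) \<in> D.span B0" using B0(3)[of \<alpha> e] le by (simp add: mult.assoc)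
    qed simp
    then show ?thesis using B0(1,2) unfolding mult.assoc by blast
  qed
  then show ?thesis using u by blast
qed

end

section \<open>Rational functions of algebraically independent elements\<close>

lemma prod_list_ones: "prod_list (map (\<lambda>_. 1) ys) = (1 :: 'd::monoid_mult)"
  by (induction ys) auto

locale subfield_elements =
  fixes \<psi> :: "'k::field \<Rightarrow> 'd::division_ring" and xs :: "'d list" and L :: "'d set"
  assumes hom_add: "\<psi> (c + d) = \<psi> c + \<psi> d" and hom_mult: "\<psi> (c * d) = \<psi> c * \<psi> d" and hom_one: "\<psi> 1 = 1"
    and hom_L: "\<psi> c \<in> L" and xs_L: "set xs \<subseteq> L"
    and L_add: "x \<in> L \<Longrightarrow> y \<in> L \<Longrightarrow> x + y \<in> L" and L_mult: "x \<in> L \<Longrightarrow> y \<in> L \<Longrightarrow> x * y \<in> L"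
    and L_inverse: "x \<in> L \<Longrightarrow> x \<noteq> 0 \<Longrightarrow> inverse x \<in> L"
    and L_comm: "x \<in> L \<Longrightarrow> y \<in> L \<Longrightarrow> x * y = y * x"
    and indep: "alg_independent \<psi> xs"
begin

lemma hom_zero: "\<psi> 0 = 0" using hom_add[of 0 0] by simp

lemma L_one: "1 \<in> L" using hom_L[of 1] hom_one by simp

lemma L_zero: "0 \<in> L" using hom_L[of 0] hom_zero by simp

lemma L_power: "x \<in> L \<Longrightarrow> x ^ i \<in> L"
  by (induction i) (auto simp: L_one L_mult)

lemma L_prod_list: "set ys \<subseteq> L \<Longrightarrow> prod_list ys \<in> L"
  by (induction ys) (auto simp: L_one L_mult)

lemma L_sum: "(\<And>i. i \<in> I \<Longrightarrow> f i \<in> L) \<Longrightarrow> sum f I \<in> L"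
  by (induction I rule: infinite_finite_induct) (auto simp: L_zero L_add)

lemma xmon_L: "xmon xs e \<in> L"
  unfolding xmon_def by (rule L_prod_list) (use xs_L in \<open>auto intro!: L_power\<close>)

lemma xmon_add: "xmon xs (\<lambda>j. e j + f j) = xmon xs e * xmon xs f"
proof -
  have "prod_list (map (\<lambda>j. xs ! j ^ (e j + f j)) js) =
      prod_list (map (\<lambda>j. xs ! j ^ e j) js) * prod_list (map (\<lambda>j. xs ! j ^ f j) js)"
    if "set js \<subseteq> {..<length xs}" for js
    using that
  proof (induction js)
    case (Cons j js)
    have x: "xs ! j \<in> L" using Cons.prems xs_L by auto
    have "xs ! i \<in> L" if "i \<in> set js" for i
    proof -
      have "i < length xs" using Cons.prems that by auto
      then show ?thesis using xs_L by (meson nth_mem subsetD)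
    qed
    then have p: "prod_list (map (\<lambda>j. xs ! j ^ e j) js) \<in> L"
      by (intro L_prod_list) (auto intro!: L_power)
    let ?A = "xs ! j ^ e j" and ?B = "xs ! j ^ f j"
    let ?P = "prod_list (map (\<lambda>j. xs ! j ^ e j) js)" and ?Q = "prod_list (map (\<lambda>j. xs ! j ^ f j) js)"
    have swap: "?B * ?P = ?P * ?B" by (rule L_comm[OF L_power[OF x] p])
    have "?A * ?B * (?P * ?Q) = ?A * ((?B * ?P) * ?Q)" by (simp only: mult.assoc)
    also have "\<dots> = ?A * ?P * (?B * ?Q)" by (simp only: swap mult.assoc)
    finally have "?A * ?B * (?P * ?Q) = ?A * ?P * (?B * ?Q)" .
    then show ?case using Cons by (simp add: power_add)
  qed simp
  from this[of "[0..<length xs]"] show ?thesis by (simp add: xmon_def atLeast0LessThan)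
qed

abbreviation ev :: "'k mpoly \<Rightarrow> 'd" where "ev \<equiv> eval_mpoly \<psi> xs"

lemma ev_alt: "ev p = (\<Sum>e\<in>Poly_Mapping.keys p. \<psi> (Poly_Mapping.lookup p e) * xmon xs (Poly_Mapping.lookup e))"
  by (simp add: eval_mpoly_def xmon_def)

lemma ev_superset:
  assumes "finite I" "Poly_Mapping.keys p \<subseteq> I"
  shows "ev p = (\<Sum>e\<in>I. \<psi> (Poly_Mapping.lookup p e) * xmon xs (Poly_Mapping.lookup e))"
  unfolding ev_alt
  by (rule sum.mono_neutral_left[OF assms]) (simp add: in_keys_iff hom_zero)

lemma ev_add: "ev (p + q) = ev p + ev q"
proof -
  let ?I = "Poly_Mapping.keys p \<union> Poly_Mapping.keys q"
  have "ev (p + q) = (\<Sum>e\<in>?I. \<psi> (Poly_Mapping.lookup (p + q) e) * xmon xs (Poly_Mapping.lookup e))"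
    by (rule ev_superset) (use keys_add[of p q] in auto)
  also have "\<dots> = ev p + ev q"
    using ev_superset[of ?I p] ev_superset[of ?I q]
    by (simp add: lookup_add hom_add distrib_right sum.distrib)
  finally show ?thesis .
qed

lemma ev_zero: "ev 0 = 0" by (simp add: ev_alt)

lemma ev_sum: "finite I \<Longrightarrow> ev (sum f I) = (\<Sum>i\<in>I. ev (f i))"
  by (induction I rule: finite_induct) (simp_all add: ev_zero ev_add)

lemma ev_single: "ev (Poly_Mapping.single e c) = \<psi> c * xmon xs (Poly_Mapping.lookup e)"
  by (cases "c = 0") (simp_all add: ev_alt hom_zero)

lemma mpoly_as_sum: "p = (\<Sum>e\<in>Poly_Mapping.keys p. Poly_Mapping.single e (Poly_Mapping.lookup p e))"
  for p :: "'k mpoly"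
proof (rule poly_mapping_eqI)
  fix f
  have "Poly_Mapping.lookup (\<Sum>e\<in>Poly_Mapping.keys p. Poly_Mapping.single e (Poly_Mapping.lookup p e)) f
     = (\<Sum>e\<in>Poly_Mapping.keys p. if e = f then Poly_Mapping.lookup p f else 0)"
    unfolding lookup_sum by (rule sum.cong) (auto simp: lookup_single when_def)
  then show "Poly_Mapping.lookup p f = Poly_Mapping.lookup (\<Sum>e\<in>Poly_Mapping.keys p. Poly_Mapping.single e (Poly_Mapping.lookup p e)) f"
    by (simp add: in_keys_iff)
qed

lemma ev_mult: "ev (p * q) = ev p * ev q"
proof -
  let ?P = "Poly_Mapping.keys p" and ?Q = "Poly_Mapping.keys q"
  let ?a = "Poly_Mapping.lookup p" and ?b = "Poly_Mapping.lookup q"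
  have "p * q = (\<Sum>e\<in>?P. Poly_Mapping.single e (?a e)) * (\<Sum>f\<in>?Q. Poly_Mapping.single f (?b f))"
    using mpoly_as_sum by metis
  also have "\<dots> = (\<Sum>e\<in>?P. \<Sum>f\<in>?Q. Poly_Mapping.single (e + f) (?a e * ?b f))"
    by (simp add: sum_product mult_single)
  finally have "ev (p * q) = (\<Sum>e\<in>?P. \<Sum>f\<in>?Q. \<psi> (?a e * ?b f) * xmon xs (Poly_Mapping.lookup (e + f)))"
    by (simp add: ev_sum ev_single)
  also have "\<dots> = (\<Sum>e\<in>?P. \<Sum>f\<in>?Q. (\<psi> (?a e) * xmon xs (Poly_Mapping.lookup e)) * (\<psi> (?b f) * xmon xs (Poly_Mapping.lookup f)))"
  proof (intro sum.cong refl)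
    fix e f
    have "xmon xs (Poly_Mapping.lookup (e + f)) = xmon xs (Poly_Mapping.lookup e) * xmon xs (Poly_Mapping.lookup f)"
      by (simp add: lookup_add xmon_add plus_poly_mapping.rep_eq)
    then show "\<psi> (?a e * ?b f) * xmon xs (Poly_Mapping.lookup (e + f)) =
        (\<psi> (?a e) * xmon xs (Poly_Mapping.lookup e)) * (\<psi> (?b f) * xmon xs (Poly_Mapping.lookup f))"
      using L_comm[OF hom_L xmon_L] by (metis hom_mult mult.assoc)
  qed
  also have "\<dots> = ev p * ev q" by (simp add: ev_alt sum_product)
  finally show ?thesis .
qed

lemma ev_L: "ev p \<in> L"
  unfolding ev_alt by (intro L_sum L_mult hom_L xmon_L)

lemma ev_one: "ev 1 = 1"
proof -
  have "ev (Poly_Mapping.single 0 1) = 1"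
    unfolding ev_single using hom_one by (simp add: xmon_def zero_poly_mapping.rep_eq prod_list_ones)
  then show ?thesis by (simp only: single_one)
qed

lemma ev_nonzero: "in_vars (length xs) p \<Longrightarrow> p \<noteq> 0 \<Longrightarrow> ev p \<noteq> 0"
  using indep by (auto simp: alg_independent_def)

end

lemma in_vars_add: "in_vars m p \<Longrightarrow> in_vars m q \<Longrightarrow> in_vars m (p + q)"
  using keys_add[of p q] by (auto simp: in_vars_def)

lemma in_vars_mult: "in_vars m p \<Longrightarrow> in_vars m q \<Longrightarrow> in_vars m (p * q)"
proof -
  assume a: "in_vars m p" "in_vars m q"
  have "Poly_Mapping.keys (e + f) \<subseteq> {..<m}" if "Poly_Mapping.keys e \<subseteq> {..<m}" "Poly_Mapping.keys f \<subseteq> {..<m}" for e f :: "nat \<Rightarrow>\<^sub>0 nat"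
    using keys_add[of e f] that by blast
  then show ?thesis using a keys_mult[of p q] unfolding in_vars_def by blast
qed

lemma in_vars_single: "Poly_Mapping.keys e \<subseteq> {..<m} \<Longrightarrow> in_vars m (Poly_Mapping.single e c)"
  by (auto simp: in_vars_def)

lemma in_vars_zero: "in_vars m 0" by (simp add: in_vars_def)

lemma in_vars_one: "in_vars m (1 :: 'k::field mpoly)"
  using in_vars_single[of 0 m "1 :: 'k"] unfolding single_one by simp

lemma in_vars_sum: "(\<And>i. i \<in> I \<Longrightarrow> in_vars m (f i)) \<Longrightarrow> in_vars m (sum f I)"
  by (induction I rule: infinite_finite_induct) (auto simp: in_vars_zero in_vars_add)

lemma in_vars_uminus: "in_vars m p \<Longrightarrow> in_vars m (- p)" for p :: "'k::field mpoly"
  by (auto simp: in_vars_def in_keys_iff)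

definition ratfun :: "nat \<Rightarrow> 'k::field mpoly fract set" where
  "ratfun m = {Fract p q | p q. in_vars m p \<and> in_vars m q \<and> q \<noteq> 0}"

lemma ratfun_poly: "in_vars m p \<Longrightarrow> Fract p 1 \<in> ratfun m"
  unfolding ratfun_def using in_vars_one by (metis (mono_tags, lifting) mem_Collect_eq one_neq_zero)

lemma ratfun_add: "x \<in> ratfun m \<Longrightarrow> y \<in> ratfun m \<Longrightarrow> x + y \<in> ratfun m"
proof -
  assume "x \<in> ratfun m" "y \<in> ratfun m"
  then obtain p q p' q' where a: "x = Fract p q" "y = Fract p' q'" "in_vars m p" "in_vars m q" "q \<noteq> 0"
    "in_vars m p'" "in_vars m q'" "q' \<noteq> 0" by (auto simp: ratfun_def)
  then have "x + y = Fract (p * q' + p' * q) (q * q')" by simp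
  moreover have "in_vars m (p * q' + p' * q)" "in_vars m (q * q')" "q * q' \<noteq> 0"
    using a by (auto intro!: in_vars_add in_vars_mult)
  ultimately show ?thesis unfolding ratfun_def by blast
qed

lemma ratfun_mult: "x \<in> ratfun m \<Longrightarrow> y \<in> ratfun m \<Longrightarrow> x * y \<in> ratfun m"
proof -
  assume "x \<in> ratfun m" "y \<in> ratfun m"
  then obtain p q p' q' where a: "x = Fract p q" "y = Fract p' q'" "in_vars m p" "in_vars m q" "q \<noteq> 0"
    "in_vars m p'" "in_vars m q'" "q' \<noteq> 0" by (auto simp: ratfun_def)
  then have "x * y = Fract (p * p') (q * q')" by simp
  moreover have "in_vars m (p * p')" "in_vars m (q * q')" "q * q' \<noteq> 0"
    using a by (auto intro!: in_vars_mult)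
  ultimately show ?thesis unfolding ratfun_def by blast
qed

lemma ratfun_inverse: "x \<in> ratfun m \<Longrightarrow> x \<noteq> 0 \<Longrightarrow> inverse x \<in> ratfun m"
proof -
  assume x: "x \<in> ratfun m" "x \<noteq> 0"
  then obtain p q where a: "x = Fract p q" "in_vars m p" "in_vars m q" "q \<noteq> 0" by (auto simp: ratfun_def)
  have "p \<noteq> 0" using x(2) a(1) by (auto simp: fract_collapse)
  then show ?thesis using a by (auto simp: ratfun_def)
qed

lemma ratfun_const: "rat_const c \<in> ratfun m"
  unfolding rat_const_def by (intro ratfun_poly in_vars_single) simp

lemma ratfun_one: "1 \<in> ratfun m"
  using ratfun_poly[OF in_vars_one] by (simp add: One_fract_def)

lemma ratfun_zero: "0 \<in> ratfun m"
  using ratfun_poly[OF in_vars_zero] by (simp add: Zero_fract_def)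

lemma ratfun_uminus: "x \<in> ratfun m \<Longrightarrow> - x \<in> ratfun m" for x :: "'k::field mpoly fract"
proof -
  assume x: "x \<in> ratfun m"
  have "- 1 = Fract (- 1 :: 'k mpoly) 1" by (simp add: One_fract_def)
  then have "(- 1 :: 'k mpoly fract) \<in> ratfun m" using ratfun_poly[OF in_vars_uminus[OF in_vars_one]] by metis
  from ratfun_mult[OF this x] show ?thesis by simp
qed

context subfield_elements
begin

text \<open>
  The value of a fraction of polynomials at \<open>xs\<close>. It does not depend on the fraction by which a
  rational function is represented, and algebraic independence makes it a homomorphism on the
  functions of the first \<open>length xs\<close> indeterminates.
\<close>

definition rat_ev :: "'k mpoly fract \<Rightarrow> 'd" where
  "rat_ev r = (SOME d. \<exists>p q. in_vars (length xs) p \<and> in_vars (length xs) q \<and> q \<noteq> 0 \<and>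
     r = Fract p q \<and> d = ev p * inverse (ev q))"

lemma rat_ev_Fract:
  assumes "in_vars (length xs) p" "in_vars (length xs) q" "q \<noteq> 0"
  shows "rat_ev (Fract p q) = ev p * inverse (ev q)"
  unfolding rat_ev_def
proof (rule some_equality)
  show "\<exists>p' q'. in_vars (length xs) p' \<and> in_vars (length xs) q' \<and> q' \<noteq> 0 \<and>
      Fract p q = Fract p' q' \<and> ev p * inverse (ev q) = ev p' * inverse (ev q')"
    using assms by blast
  fix d assume "\<exists>p' q'. in_vars (length xs) p' \<and> in_vars (length xs) q' \<and> q' \<noteq> 0 \<and>
      Fract p q = Fract p' q' \<and> d = ev p' * inverse (ev q')"
  then obtain p' q' where a: "in_vars (length xs) p'" "in_vars (length xs) q'" "q' \<noteq> 0"
      "Fract p q = Fract p' q'" "d = ev p' * inverse (ev q')" by blast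
  have eq: "p * q' = p' * q" using a(3,4) assms(3) by (simp add: eq_fract)
  have nz: "ev q \<noteq> 0" "ev q' \<noteq> 0" using ev_nonzero assms a by auto
  have "ev p * ev q' = ev p' * ev q" using eq ev_mult by metis
  moreover have "inverse (ev q) * inverse (ev q') = inverse (ev q') * inverse (ev q)"
    by (intro L_comm L_inverse ev_L nz)
  moreover have "ev q' * inverse (ev q) = inverse (ev q) * ev q'" by (intro L_comm L_inverse ev_L nz)
  ultimately have "ev p' * inverse (ev q') = ev p * inverse (ev q)"
    using nz by (metis (no_types, opaque_lifting) mult.assoc mult.right_neutral right_inverse)
  then show "d = ev p * inverse (ev q)" using a(5) by simp
qed

lemma rat_ev_L: "r \<in> ratfun (length xs) \<Longrightarrow> rat_ev r \<in> L"
  by (auto simp: ratfun_def rat_ev_Fract ev_nonzero intro!: L_mult L_inverse ev_L)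

lemma rat_ev_poly: "in_vars (length xs) p \<Longrightarrow> rat_ev (Fract p 1) = ev p"
  using rat_ev_Fract[OF _ in_vars_one one_neq_zero, of p] by (simp add: ev_one)

lemma rat_ev_mult:
  assumes "r \<in> ratfun (length xs)" "s \<in> ratfun (length xs)"
  shows "rat_ev (r * s) = rat_ev r * rat_ev s"
proof -
  obtain p q p' q' where a: "r = Fract p q" "s = Fract p' q'" "in_vars (length xs) p" "in_vars (length xs) q" "q \<noteq> 0"
    "in_vars (length xs) p'" "in_vars (length xs) q'" "q' \<noteq> 0" using assms by (auto simp: ratfun_def)
  have nz: "ev q \<noteq> 0" "ev q' \<noteq> 0" using ev_nonzero a by auto
  have "rat_ev (r * s) = ev p * ev p' * inverse (ev q * ev q')"
    using a by (simp add: rat_ev_Fract in_vars_mult ev_mult)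
  also have "inverse (ev q * ev q') = inverse (ev q') * inverse (ev q)" using nz by (simp add: nonzero_inverse_mult_distrib)
  also have "ev p * ev p' * (inverse (ev q') * inverse (ev q)) = ev p * ((ev p' * inverse (ev q')) * inverse (ev q))"
    by (simp add: mult.assoc)
  also have "(ev p' * inverse (ev q')) * inverse (ev q) = inverse (ev q) * (ev p' * inverse (ev q'))"
    by (intro L_comm L_mult L_inverse ev_L nz)
  finally show ?thesis using a by (simp add: rat_ev_Fract mult.assoc)
qed

lemma rat_ev_add:
  assumes "r \<in> ratfun (length xs)" "s \<in> ratfun (length xs)"
  shows "rat_ev (r + s) = rat_ev r + rat_ev s"
proof -
  obtain p q p' q' where a: "r = Fract p q" "s = Fract p' q'" "in_vars (length xs) p" "in_vars (length xs) q" "q \<noteq> 0"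
    "in_vars (length xs) p'" "in_vars (length xs) q'" "q' \<noteq> 0" using assms by (auto simp: ratfun_def)
  have nz: "ev q \<noteq> 0" "ev q' \<noteq> 0" using ev_nonzero a by auto
  have inv: "inverse (ev q * ev q') = inverse (ev q') * inverse (ev q)" using nz by (simp add: nonzero_inverse_mult_distrib)
  have 1: "ev p * ev q' * (inverse (ev q') * inverse (ev q)) = ev p * inverse (ev q)"
    using nz by (metis mult.assoc mult.left_neutral right_inverse)
  have "ev q * (inverse (ev q') * inverse (ev q)) = inverse (ev q') * (ev q * inverse (ev q))"
    using L_comm[OF ev_L L_inverse[OF ev_L nz(2)], of q] by (metis mult.assoc)
  then have 2: "ev p' * ev q * (inverse (ev q') * inverse (ev q)) = ev p' * inverse (ev q')"
    using nz by (simp add: mult.assoc)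
  have "rat_ev (r + s) = (ev p * ev q' + ev p' * ev q) * (inverse (ev q') * inverse (ev q))"
    using a by (simp add: rat_ev_Fract in_vars_mult in_vars_add ev_mult ev_add inv)
  also have "\<dots> = rat_ev r + rat_ev s" using a by (simp add: distrib_right 1 2 rat_ev_Fract)
  finally show ?thesis .
qed

lemma rat_ev_one: "rat_ev 1 = 1"
  using rat_ev_poly[OF in_vars_one] by (simp add: One_fract_def ev_one)

lemma rat_ev_const: "rat_ev (rat_const c) = \<psi> c"
proof -
  have "xmon xs (Poly_Mapping.lookup (0 :: nat \<Rightarrow>\<^sub>0 nat)) = 1"
    by (simp add: xmon_def zero_poly_mapping.rep_eq prod_list_ones)
  then show ?thesis unfolding rat_const_def using rat_ev_poly[OF in_vars_single[of 0 "length xs" c]] by (simp add: ev_single)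
qed

lemma rat_ev_nonzero: "r \<in> ratfun (length xs) \<Longrightarrow> r \<noteq> 0 \<Longrightarrow> rat_ev r \<noteq> 0"
  using rat_ev_mult[of r "inverse r"] ratfun_inverse[of r "length xs"] rat_ev_one by force

end

section \<open>Extension of scalars to rational functions\<close>

lemma rat_fun_field_simps [simp]:
  "carrier (rat_fun_field m) = ratfun m"
  "x \<otimes>\<^bsub>rat_fun_field m\<^esub> y = x * y"
  "\<one>\<^bsub>rat_fun_field m\<^esub> = 1"
  "x \<oplus>\<^bsub>rat_fun_field m\<^esub> y = x + y"
  by (simp_all add: rat_fun_field_def ratfun_def ring_of_type_algebra_def)

text \<open>
  Representatives of elements of the tensor product.
\<close>

type_synonym ('k, 'a) formal_sum = "'k mpoly fract \<times> 'a \<Rightarrow>\<^sub>0 int"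

text \<open>
  The algebra \<open>B\<close> obtained by extending the scalars to the rational functions in \<open>m\<close>
  indeterminates, the image \<open>k\<close> of these functions, and the formal sums modulo the relations by
  which it is given.
\<close>

locale scalar_extension = central_algebra \<phi> for \<phi> :: "'k::field \<Rightarrow> 'a::ring_1" +
  fixes m :: nat
begin

abbreviation FR :: "('k, 'a) formal_sum ring" where
  "FR \<equiv> free_ring (rat_fun_field m) AA"

abbreviation rel :: "('k, 'a) formal_sum set" where
  "rel \<equiv> tensor_relations ring_of_type_algebra (rat_fun_field m) AA rat_const \<phi>"

abbreviation B :: "('k, 'a) formal_sum set ring" where
  "B \<equiv> rat_tensor m \<phi>"

abbreviation k :: "('k, 'a) formal_sum set set" where
  "k \<equiv> rat_tensor_scalars m \<phi>"

text \<open>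
  The product as an operation on the whole type, so that its laws hold without membership
  conditions.
\<close>

definition frmul :: "('k, 'a) formal_sum \<Rightarrow> ('k, 'a) formal_sum \<Rightarrow> ('k, 'a) formal_sum" where
  "frmul f g = frag_extend (\<lambda>(q, a). frag_extend (\<lambda>(q', a'). frag_of (q * q', a * a')) g) f"

lemma FR_simps [simp]:
  "f \<otimes>\<^bsub>FR\<^esub> g = frmul f g" "\<one>\<^bsub>FR\<^esub> = frag_of (1, 1)" "\<zero>\<^bsub>FR\<^esub> = 0" "f \<oplus>\<^bsub>FR\<^esub> g = f + g"
  by (simp_all add: free_ring_def frmul_def)

lemma FR_carrier: "f \<in> carrier FR \<longleftrightarrow> Poly_Mapping.keys f \<subseteq> ratfun m \<times> UNIV"
  by (simp add: free_ring_def)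

lemma FR_of: "q \<in> ratfun m \<Longrightarrow> frag_of (q, a) \<in> carrier FR"
  by (simp add: FR_carrier)

lemma FR_diff: "f \<in> carrier FR \<Longrightarrow> g \<in> carrier FR \<Longrightarrow> f - g \<in> carrier FR"
  unfolding FR_carrier using keys_diff[of f g] by blast

lemma FR_add: "f \<in> carrier FR \<Longrightarrow> g \<in> carrier FR \<Longrightarrow> f + g \<in> carrier FR"
  unfolding FR_carrier using keys_add[of f g] by blast

lemma FR_zero: "0 \<in> carrier FR" by (simp add: FR_carrier)

lemma FR_uminus: "f \<in> carrier FR \<Longrightarrow> - f \<in> carrier FR"
  by (simp add: FR_carrier)

lemma FR_induct [consumes 1, case_names zero of diff]:
  assumes "f \<in> carrier FR" "P 0" "\<And>q a. q \<in> ratfun m \<Longrightarrow> P (frag_of (q, a))"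
    "\<And>f g. P f \<Longrightarrow> P g \<Longrightarrow> P (f - g)"
  shows "P f"
  using assms(1) unfolding FR_carrier
  by (induction f rule: frag_induction) (use assms(2-4) in auto)

lemma frmul_of_of: "frmul (frag_of (q, a)) (frag_of (q', a')) = frag_of (q * q', a * a')"
  by (simp add: frmul_def)

lemma frmul_diff_left: "frmul (f - g) h = frmul f h - frmul g h"
  by (simp add: frmul_def frag_extend_diff)

lemma frmul_zero_left: "frmul 0 h = 0"
  by (simp add: frmul_def)

lemma frag_UNIV_induct:
  assumes "P 0" "\<And>x. P (frag_of x)" "\<And>f g. P f \<Longrightarrow> P g \<Longrightarrow> P (f - g)"
  shows "P f"
  by (rule frag_induction[of f UNIV P]) (use assms in auto)

lemma frmul_diff_right: "frmul f (g - h) = frmul f g - frmul f h"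
proof (induction f rule: frag_UNIV_induct)
  case 1 then show ?case by (simp add: frmul_def)
next
  case (2 x) then show ?case by (cases x) (simp add: frmul_def frag_extend_diff)
next
  case (3 f g) then show ?case by (simp add: frmul_diff_left)
qed

lemma frmul_zero_right: "frmul f 0 = 0"
  using frmul_diff_right[of f 0 0] by simp

lemma frmul_add_left: "frmul (f + g) h = frmul f h + frmul g h"
  by (simp add: frmul_def frag_extend_add)

lemma frmul_add_right: "frmul f (g + h) = frmul f g + frmul f h"
  using frmul_diff_right[of f "g + h" h] by (simp add: algebra_simps)

lemma frmul_assoc: "frmul (frmul f g) h = frmul f (frmul g h)"
proof (induction f rule: frag_UNIV_induct)
  case (2 x)
  show ?case
  proof (induction g rule: frag_UNIV_induct)
    case (2 y)
    show ?case
      by (induction h rule: frag_UNIV_induct; cases x; cases y)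
        (auto simp: frmul_of_of frmul_zero_right frmul_diff_right mult.assoc)
  qed (simp_all add: frmul_zero_left frmul_zero_right frmul_diff_left frmul_diff_right)
qed (simp_all add: frmul_zero_left frmul_diff_left)

lemma frmul_one_left: "frmul (frag_of (1, 1)) g = g"
proof (induction g rule: frag_UNIV_induct)
  case (2 x) then show ?case by (cases x) (simp add: frmul_of_of)
qed (simp_all add: frmul_zero_right frmul_diff_right)

lemma frmul_one_right: "frmul g (frag_of (1, 1)) = g"
proof (induction g rule: frag_UNIV_induct)
  case (2 x) then show ?case by (cases x) (simp add: frmul_of_of)
qed (simp_all add: frmul_zero_left frmul_diff_left)

lemma frmul_closed: "f \<in> carrier FR \<Longrightarrow> g \<in> carrier FR \<Longrightarrow> frmul f g \<in> carrier FR"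
proof (induction f rule: FR_induct)
  case (of q a)
  from of(2) show ?case
    by (induction g rule: FR_induct)
      (auto simp: frmul_of_of frmul_zero_right frmul_diff_right FR_zero intro!: FR_of FR_diff ratfun_mult of(1))
qed (auto simp: frmul_zero_left frmul_diff_left FR_zero intro: FR_diff)

lemma ring_FR: "ring FR"
proof (rule ringI)
  show "abelian_group FR"
  proof (rule abelian_groupI)
    show "\<exists>y\<in>carrier FR. y \<oplus>\<^bsub>FR\<^esub> x = \<zero>\<^bsub>FR\<^esub>" if "x \<in> carrier FR" for x
      using FR_uminus[OF that] by (intro bexI[of _ "- x"]) auto
  qed (auto simp: FR_add FR_zero)
  show "monoid FR"
    by (rule monoidI) (auto simp: frmul_closed frmul_assoc frmul_one_left frmul_one_right intro!: FR_of ratfun_one)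
qed (auto simp: frmul_add_left frmul_add_right)

lemma FR_minus: "f \<in> carrier FR \<Longrightarrow> \<ominus>\<^bsub>FR\<^esub> f = - f"
proof -
  interpret F: ring FR by (rule ring_FR)
  assume "f \<in> carrier FR"
  then show ?thesis using F.minus_equality[of "- f" f] FR_uminus by simp
qed

definition gens :: "('k, 'a) formal_sum set" where
  "gens = {frag_of (q + q', a) - frag_of (q, a) - frag_of (q', a) | q q' a. q \<in> ratfun m \<and> q' \<in> ratfun m}
    \<union> {frag_of (q, a + a') - frag_of (q, a) - frag_of (q, a') | q a a'. q \<in> ratfun m}
    \<union> {frag_of (q * rat_const c, a) - frag_of (q, \<phi> c * a) | q c a. q \<in> ratfun m}"

lemma rel_eq: "rel = generate (add_monoid FR) gens"
  by (simp add: tensor_relations_def gens_def)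

lemma gensI:
  "q \<in> ratfun m \<Longrightarrow> q' \<in> ratfun m \<Longrightarrow> frag_of (q + q', a) - frag_of (q, a) - frag_of (q', a) \<in> gens"
  "q \<in> ratfun m \<Longrightarrow> frag_of (q, a + a') - frag_of (q, a) - frag_of (q, a') \<in> gens"
  "q \<in> ratfun m \<Longrightarrow> frag_of (q * rat_const c, a) - frag_of (q, \<phi> c * a) \<in> gens"
  unfolding gens_def by blast+

lemma gens_carrier: "gens \<subseteq> carrier FR"
  unfolding gens_def by (auto intro!: FR_diff FR_of ratfun_add ratfun_mult ratfun_const)

lemma rel_subgroup: "subgroup rel (add_monoid FR)"
proof -
  interpret F: ring FR by (rule ring_FR)
  show ?thesis unfolding rel_eq by (rule F.add.generate_is_subgroup) (use gens_carrier in auto)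
qed

lemma rel_carrier: "rel \<subseteq> carrier FR"
  using subgroup.subset[OF rel_subgroup] by simp

lemma rel_zero: "0 \<in> rel"
  using subgroup.one_closed[OF rel_subgroup] by simp

lemma rel_add: "f \<in> rel \<Longrightarrow> g \<in> rel \<Longrightarrow> f + g \<in> rel"
  using subgroup.m_closed[OF rel_subgroup] by simp

lemma rel_uminus: "f \<in> rel \<Longrightarrow> - f \<in> rel"
  using subgroup.m_inv_closed[OF rel_subgroup, of f] FR_minus[of f] rel_carrier by (auto simp: a_inv_def)

lemma rel_diff: "f \<in> rel \<Longrightarrow> g \<in> rel \<Longrightarrow> f - g \<in> rel"
  using rel_add[OF _ rel_uminus, of f g] by simp

lemma rel_gens: "g \<in> gens \<Longrightarrow> g \<in> rel"
  unfolding rel_eq by (rule generate.incl)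

lemma rel_induct [consumes 1, case_names zero gens uminus add]:
  assumes f: "f \<in> rel" and "P 0" "\<And>g. g \<in> gens \<Longrightarrow> P g" "\<And>f. P f \<Longrightarrow> P (- f)" "\<And>f g. P f \<Longrightarrow> P g \<Longrightarrow> P (f + g)"
  shows "P f"
proof -
  have "f \<in> generate (add_monoid FR) gens" using f by (simp add: rel_eq)
  then have "f \<in> carrier FR \<and> P f"
  proof (induction rule: generate.induct)
    case (inv h)
    then have h: "h \<in> carrier FR" using gens_carrier by blast
    then have "inv\<^bsub>add_monoid FR\<^esub> h = - h" using FR_minus[OF h] by (simp add: a_inv_def)
    then show ?case using assms(3,4) inv FR_uminus[OF h] by simp
  qed (use assms gens_carrier FR_zero FR_add in auto)
  then show ?thesis by blast
qed

text \<open>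
  Multiplication by a pure tensor maps defining relations to defining relations of the same
  kind.
\<close>

lemma gens_mult: 
  assumes g: "g \<in> gens" and q: "q0 \<in> ratfun m"
  shows "frmul (frag_of (q0, a0)) g \<in> gens" "frmul g (frag_of (q0, a0)) \<in> gens"
proof -
  from g consider (1) q q' a where "g = frag_of (q + q', a) - frag_of (q, a) - frag_of (q', a)" "q \<in> ratfun m" "q' \<in> ratfun m"
    | (2) q a a' where "g = frag_of (q, a + a') - frag_of (q, a) - frag_of (q, a')" "q \<in> ratfun m"
    | (3) q c a where "g = frag_of (q * rat_const c, a) - frag_of (q, \<phi> c * a)" "q \<in> ratfun m"
    unfolding gens_def by blast
  then have "frmul (frag_of (q0, a0)) g \<in> gens \<and> frmul g (frag_of (q0, a0)) \<in> gens"
  proof cases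
    case 1
    have "frmul (frag_of (q0, a0)) g = frag_of (q0 * q + q0 * q', a0 * a) - frag_of (q0 * q, a0 * a) - frag_of (q0 * q', a0 * a)"
      "frmul g (frag_of (q0, a0)) = frag_of (q * q0 + q' * q0, a * a0) - frag_of (q * q0, a * a0) - frag_of (q' * q0, a * a0)"
      by (simp_all add: 1(1) frmul_diff_left frmul_diff_right frmul_of_of distrib_left distrib_right)
    then show ?thesis using 1(2,3) q by (simp only:) (intro conjI gensI ratfun_mult)
  next
    case 2
    have "frmul (frag_of (q0, a0)) g = frag_of (q0 * q, a0 * a + a0 * a') - frag_of (q0 * q, a0 * a) - frag_of (q0 * q, a0 * a')"
      "frmul g (frag_of (q0, a0)) = frag_of (q * q0, a * a0 + a' * a0) - frag_of (q * q0, a * a0) - frag_of (q * q0, a' * a0)"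
      by (simp_all add: 2(1) frmul_diff_left frmul_diff_right frmul_of_of distrib_left distrib_right)
    then show ?thesis using 2(2) q by (simp only:) (intro conjI gensI ratfun_mult)
  next
    case 3
    have "a0 * (\<phi> c * a) = \<phi> c * (a0 * a)" by (metis \<phi>_central mult.assoc)
    then have "frmul (frag_of (q0, a0)) g = frag_of ((q0 * q) * rat_const c, a0 * a) - frag_of (q0 * q, \<phi> c * (a0 * a))"
      by (simp add: 3(1) frmul_diff_right frmul_of_of mult.assoc)
    moreover have "frmul g (frag_of (q0, a0)) = frag_of ((q * q0) * rat_const c, a * a0) - frag_of (q * q0, \<phi> c * (a * a0))"
      by (simp add: 3(1) frmul_diff_left frmul_of_of mult.assoc mult.commute[of "rat_const c" q0])
    ultimately show ?thesis using 3(2) q by (simp only:) (intro conjI gensI ratfun_mult)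
  qed
  then show "frmul (frag_of (q0, a0)) g \<in> gens" "frmul g (frag_of (q0, a0)) \<in> gens" by auto
qed

lemma rel_ideal: "ideal rel FR"
proof (rule idealI[OF ring_FR rel_subgroup])
  fix r x assume r: "r \<in> rel" and x: "x \<in> carrier FR"
  have neg: "frmul f (- g) = - frmul f g" "frmul (- g) f = - frmul g f" for f g
    using frmul_diff_right[of f 0 g] frmul_diff_left[of 0 g f] by (simp_all add: frmul_zero_right frmul_zero_left)
  from x have "frmul x r \<in> rel \<and> frmul r x \<in> rel"
  proof (induction x rule: FR_induct)
    case zero then show ?case by (simp add: frmul_zero_left frmul_zero_right rel_zero)
  next
    case (of q a)
    from r show ?case
    proof (induction r rule: rel_induct)
      case (gens g) then show ?case using gens_mult[OF gens of] rel_gens by blast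
    next
      case (add f g) then show ?case by (simp add: frmul_add_left frmul_add_right rel_add)
    qed (simp_all add: frmul_zero_left frmul_zero_right neg rel_zero rel_uminus)
  next
    case (diff f g) then show ?case by (auto simp: frmul_diff_left frmul_diff_right intro: rel_diff)
  qed
  then show "x \<otimes>\<^bsub>FR\<^esub> r \<in> rel" "r \<otimes>\<^bsub>FR\<^esub> x \<in> rel" by auto
qed

lemma B_eq: "B = FR Quot rel"
  by (simp add: rat_tensor_def tensor_algebra_def)

sublocale B: ring B
  unfolding B_eq by (rule ideal.quotient_is_ring[OF rel_ideal])

definition \<pi> :: "('k, 'a) formal_sum \<Rightarrow> ('k, 'a) formal_sum set" where
  "\<pi> f = rel +>\<^bsub>FR\<^esub> f"

lemma \<pi>_mem: "g \<in> \<pi> f \<longleftrightarrow> (\<exists>r\<in>rel. g = r + f)"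
  by (auto simp: \<pi>_def a_r_coset_def r_coset_def)

lemma \<pi>_hom: "\<pi> \<in> ring_hom FR B"
proof -
  have "(+>\<^bsub>FR\<^esub>) rel \<in> ring_hom FR B" unfolding B_eq by (rule ideal.rcos_ring_hom[OF rel_ideal])
  then show ?thesis by (simp add: \<pi>_def[abs_def])
qed

lemma \<pi>_closed: "f \<in> carrier FR \<Longrightarrow> \<pi> f \<in> carrier B"
  using ring_hom_closed[OF \<pi>_hom] .

lemma \<pi>_add: "f \<in> carrier FR \<Longrightarrow> g \<in> carrier FR \<Longrightarrow> \<pi> (f + g) = \<pi> f \<oplus>\<^bsub>B\<^esub> \<pi> g"
  using ring_hom_add[OF \<pi>_hom, of f g] by simp

lemma \<pi>_mult: "f \<in> carrier FR \<Longrightarrow> g \<in> carrier FR \<Longrightarrow> \<pi> (frmul f g) = \<pi> f \<otimes>\<^bsub>B\<^esub> \<pi> g"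
  using ring_hom_mult[OF \<pi>_hom, of f g] by simp

lemma \<pi>_one: "\<pi> (frag_of (1, 1)) = \<one>\<^bsub>B\<^esub>"
  using ring_hom_one[OF \<pi>_hom] by simp

lemma \<pi>_zero: "\<pi> 0 = \<zero>\<^bsub>B\<^esub>"
  using ring_hom_zero[OF \<pi>_hom ring_FR B.ring_axioms] by simp

lemma \<pi>_surj: "b \<in> carrier B \<Longrightarrow> \<exists>f\<in>carrier FR. b = \<pi> f"
  unfolding B_eq \<pi>_def by (auto simp: FactRing_def A_RCOSETS_def')

lemma \<pi>_eqI: "f - g \<in> rel \<Longrightarrow> \<pi> f = \<pi> g"
proof -
  assume r: "f - g \<in> rel"
  show ?thesis
  proof (rule subset_antisym; rule subsetI)
    fix h assume "h \<in> \<pi> f"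
    then obtain s where "s \<in> rel" "h = s + f" using \<pi>_mem by blast
    then show "h \<in> \<pi> g" using rel_add[OF _ r, of s] unfolding \<pi>_mem by (intro bexI[of _ "s + (f - g)"]) auto
  next
    fix h assume "h \<in> \<pi> g"
    then obtain s where "s \<in> rel" "h = s + g" using \<pi>_mem by blast
    then show "h \<in> \<pi> f" using rel_diff[OF _ r, of s] unfolding \<pi>_mem by (intro bexI[of _ "s - (f - g)"]) auto
  qed
qed

definition tens :: "'k mpoly fract \<Rightarrow> 'a \<Rightarrow> ('k, 'a) formal_sum set" where
  "tens q a = \<pi> (frag_of (q, a))"

lemma tens_closed: "q \<in> ratfun m \<Longrightarrow> tens q a \<in> carrier B"
  unfolding tens_def by (intro \<pi>_closed FR_of)

lemma tens_add_left:
  assumes "q \<in> ratfun m" "q' \<in> ratfun m" shows "tens (q + q') a = tens q a \<oplus>\<^bsub>B\<^esub> tens q' a"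
proof -
  have "frag_of (q + q', a) - frag_of (q, a) - frag_of (q', a) \<in> rel"
    by (rule rel_gens) (use assms in \<open>auto simp: gens_def\<close>)
  then have "\<pi> (frag_of (q + q', a)) = \<pi> (frag_of (q, a) + frag_of (q', a))" by (intro \<pi>_eqI) (simp add: algebra_simps)
  then show ?thesis using assms by (simp add: tens_def \<pi>_add FR_of)
qed

lemma tens_add_right:
  assumes "q \<in> ratfun m" shows "tens q (a + a') = tens q a \<oplus>\<^bsub>B\<^esub> tens q a'"
proof -
  have "frag_of (q, a + a') - frag_of (q, a) - frag_of (q, a') \<in> rel"
    by (rule rel_gens) (use assms in \<open>auto simp: gens_def\<close>)
  then have "\<pi> (frag_of (q, a + a')) = \<pi> (frag_of (q, a) + frag_of (q, a'))" by (intro \<pi>_eqI) (simp add: algebra_simps)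
  then show ?thesis using assms by (simp add: tens_def \<pi>_add FR_of)
qed

lemma tens_balance:
  assumes "q \<in> ratfun m" shows "tens (q * rat_const c) a = tens q (\<phi> c * a)"
proof -
  have "frag_of (q * rat_const c, a) - frag_of (q, \<phi> c * a) \<in> rel"
    by (rule rel_gens) (use assms in \<open>auto simp: gens_def\<close>)
  then show ?thesis unfolding tens_def by (rule \<pi>_eqI)
qed

lemma tens_mult: "q \<in> ratfun m \<Longrightarrow> q' \<in> ratfun m \<Longrightarrow> tens q a \<otimes>\<^bsub>B\<^esub> tens q' a' = tens (q * q') (a * a')"
  unfolding tens_def by (simp add: \<pi>_mult[symmetric] FR_of frmul_of_of)

lemma tens_one: "tens 1 1 = \<one>\<^bsub>B\<^esub>"
  by (simp add: tens_def \<pi>_one)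

lemma tens_zero_left: "tens 0 a = \<zero>\<^bsub>B\<^esub>"
  using tens_add_left[of 0 0 a] tens_closed[of 0 a] ratfun_zero[of m]
  by (metis B.add.r_cancel_one' add_0)

lemma tens_zero_right: "q \<in> ratfun m \<Longrightarrow> tens q 0 = \<zero>\<^bsub>B\<^esub>"
  using tens_add_right[of q 0 0] tens_closed[of q 0] by (metis B.add.r_cancel_one' add_0)

lemma tens_uminus: "q \<in> ratfun m \<Longrightarrow> \<ominus>\<^bsub>B\<^esub> tens q a = tens (- q) a"
proof -
  assume q: "q \<in> ratfun m"
  have "tens (- q) a \<oplus>\<^bsub>B\<^esub> tens q a = \<zero>\<^bsub>B\<^esub>"
    using tens_add_left[OF ratfun_uminus[OF q] q, of a] tens_zero_left[of a] by simp
  then show ?thesis by (rule B.minus_equality) (intro tens_closed q ratfun_uminus)+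
qed

text \<open>
  Sums of pure tensors suffice, since a sign can be moved into the left factor.
\<close>

lemma tensor_induct [consumes 1, case_names tens add]:
  assumes b: "b \<in> carrier B" and tens: "\<And>q a. q \<in> ratfun m \<Longrightarrow> P (tens q a)"
    and add: "\<And>x y. x \<in> carrier B \<Longrightarrow> y \<in> carrier B \<Longrightarrow> P x \<Longrightarrow> P y \<Longrightarrow> P (x \<oplus>\<^bsub>B\<^esub> y)"
  shows "P b"
proof -
  obtain f where f: "f \<in> carrier FR" "b = \<pi> f" using \<pi>_surj[OF b] by blast
  have neg: "\<pi> (- f) = \<ominus>\<^bsub>B\<^esub> \<pi> f" if "f \<in> carrier FR" for f
    using \<pi>_add[OF FR_uminus[OF that] that] \<pi>_zero that by (intro B.minus_equality[symmetric]) (auto intro: \<pi>_closed FR_uminus)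
  from f(1) have "f \<in> carrier FR \<and> P (\<pi> f) \<and> P (\<pi> (- f))"
  proof (induction f rule: FR_induct)
    case zero
    have "P (\<pi> 0)" using tens[OF ratfun_zero, of 0] by (simp add: tens_zero_left \<pi>_zero)
    then show ?case by (simp add: FR_zero)
  next
    case (of q a)
    have "\<pi> (- frag_of (q, a)) = tens (- q) a" using neg[OF FR_of[OF of]] tens_uminus[OF of] by (simp add: tens_def)
    then show ?case using tens[OF of] tens[OF ratfun_uminus[OF of]] FR_of[OF of] by (simp add: tens_def)
  next
    case (diff f g)
    have "\<pi> (f - g) = \<pi> f \<oplus>\<^bsub>B\<^esub> \<pi> (- g)" using \<pi>_add[of f "- g"] diff FR_uminus by simp
    moreover have "\<pi> (- (f - g)) = \<pi> g \<oplus>\<^bsub>B\<^esub> \<pi> (- f)" using \<pi>_add[of g "- f"] diff FR_uminus by simp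
    ultimately show ?case using diff add \<pi>_closed FR_uminus FR_diff by simp
  qed
  then show ?thesis using f(2) by blast
qed

lemma k_eq: "k = (\<lambda>q. tens q 1) ` ratfun m"
  by (simp add: rat_tensor_scalars_def tensor_scalars_def tens_def \<pi>_def)

sublocale std: central_subring B k
proof (intro central_subring.intro central_subring_axioms.intro B.ring_axioms)
  show "subring k B"
    unfolding k_eq
  proof (rule B.subringI)
    show "(\<lambda>q. tens q 1) ` ratfun m \<subseteq> carrier B" by (auto intro: tens_closed)
    show "\<one>\<^bsub>B\<^esub> \<in> (\<lambda>q. tens q 1) ` ratfun m" using tens_one ratfun_one by (metis image_eqI)
  next
    fix h assume "h \<in> (\<lambda>q. tens q 1) ` ratfun m"
    then obtain q where "h = tens q 1" "q \<in> ratfun m" by blast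
    then show "\<ominus>\<^bsub>B\<^esub> h \<in> (\<lambda>q. tens q 1) ` ratfun m" by (simp only: tens_uminus) (intro imageI ratfun_uminus)
  next
    fix h1 h2 assume "h1 \<in> (\<lambda>q. tens q 1) ` ratfun m" "h2 \<in> (\<lambda>q. tens q 1) ` ratfun m"
    then obtain q1 q2 where q: "h1 = tens q1 1" "h2 = tens q2 1" "q1 \<in> ratfun m" "q2 \<in> ratfun m" by auto
    then show "h1 \<otimes>\<^bsub>B\<^esub> h2 \<in> (\<lambda>q. tens q 1) ` ratfun m" by (simp add: tens_mult ratfun_mult)
    have "h1 \<oplus>\<^bsub>B\<^esub> h2 = tens (q1 + q2) 1" using q tens_add_left by simp
    then show "h1 \<oplus>\<^bsub>B\<^esub> h2 \<in> (\<lambda>q. tens q 1) ` ratfun m" using ratfun_add q by blast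
  qed
  fix c x assume "c \<in> k" and x: "x \<in> carrier B"
  then obtain q where q: "c = tens q 1" "q \<in> ratfun m" by (auto simp: k_eq)
  from x show "c \<otimes>\<^bsub>B\<^esub> x = x \<otimes>\<^bsub>B\<^esub> c"
  proof (induction x rule: tensor_induct)
    case (tens r a) then show ?case using q by (simp add: tens_mult mult.commute)
  next
    case (add x y) then show ?case using q tens_closed by (simp add: B.l_distr B.r_distr)
  qed
qed

definition extend :: "'a set \<Rightarrow> ('k, 'a) formal_sum set set" where
  "extend V = lin_span B k (tens 1 ` V)"

lemma tens_img_carrier: "tens 1 ` V \<subseteq> carrier B"
  using tens_closed[OF ratfun_one] by blast

lemma extend_subalgebra: "subalgebra k (extend V) B"
  unfolding extend_def by (rule std.lin_span_subalgebra[OF tens_img_carrier])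

lemma extend_carrier: "extend V \<subseteq> carrier B"
  using std.subalgebraD(1)[OF extend_subalgebra] .

lemma tens_extend: "q \<in> ratfun m \<Longrightarrow> a \<in> V \<Longrightarrow> tens q a \<in> extend V"
proof -
  assume q: "q \<in> ratfun m" and a: "a \<in> V"
  have "tens 1 a \<in> extend V" unfolding extend_def using std.lin_span_incl a by blast
  then have "tens q 1 \<otimes>\<^bsub>B\<^esub> tens 1 a \<in> extend V" using q by (intro std.subalgebraD(5)[OF extend_subalgebra]) (auto simp: k_eq)
  then show ?thesis using q by (simp add: tens_mult ratfun_one)
qed

lemma extend_min: "subalgebra k U B \<Longrightarrow> (\<And>a. a \<in> V \<Longrightarrow> tens 1 a \<in> U) \<Longrightarrow> extend V \<subseteq> U"
  unfolding extend_def by (rule std.lin_span_min) auto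

lemma extend_mono: "V \<subseteq> V' \<Longrightarrow> extend V \<subseteq> extend V'"
  by (rule extend_min[OF extend_subalgebra]) (auto intro: tens_extend ratfun_one)

lemma k_tens: "c \<in> k \<Longrightarrow> \<exists>q\<in>ratfun m. c = tens q 1"
  by (auto simp: k_eq)

lemma extend_mult:
  assumes "\<And>a b. a \<in> V \<Longrightarrow> b \<in> V' \<Longrightarrow> a * b \<in> V''" and x: "x \<in> extend V" and y: "y \<in> extend V'"
  shows "x \<otimes>\<^bsub>B\<^esub> y \<in> extend V''"
proof -
  have t: "tens 1 a \<in> carrier B" for a by (rule tens_closed[OF ratfun_one])
  have yc: "y \<in> carrier B" using y extend_carrier by blast
  have "tens 1 a \<otimes>\<^bsub>B\<^esub> y \<in> extend V''" if a: "a \<in> V" for a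
  proof -
    have "extend V' \<subseteq> {y \<in> carrier B. tens 1 a \<otimes>\<^bsub>B\<^esub> y \<in> extend V''}"
      by (rule extend_min[OF std.subalgebra_left_mult[OF extend_subalgebra t]])
        (use assms(1)[OF a] t in \<open>auto simp: tens_mult ratfun_one intro!: tens_extend\<close>)
    then show ?thesis using y by blast
  qed
  then have "extend V \<subseteq> {x \<in> carrier B. x \<otimes>\<^bsub>B\<^esub> y \<in> extend V''}"
    by (intro extend_min[OF std.subalgebra_right_mult[OF extend_subalgebra yc]]) (use t in auto)
  then show ?thesis using x by blast
qed

text \<open>
  The combinations of \<open>E\<close> with coefficients on the left form a subspace that contains all
  \<open>1 \<otimes> a\<close> with \<open>a\<close> in \<open>V\<close>.
\<close>

lemma extend_span:
  assumes E: "finite E" "V \<subseteq> span E" and x: "x \<in> extend V"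
  shows "\<exists>f. (\<forall>e. f e \<in> ratfun m) \<and> x = (\<Oplus>\<^bsub>B\<^esub>e\<in>E. tens (f e) e)"
proof -
  let ?U = "{x. \<exists>f. (\<forall>e. f e \<in> ratfun m) \<and> x = (\<Oplus>\<^bsub>B\<^esub>e\<in>E. tens (f e) e)}"
  have U: "subalgebra k ?U B"
  proof (rule std.subalgebraI)
    show "?U \<subseteq> carrier B" by (auto intro!: B.finsum_closed simp: tens_closed)
    have "(\<Oplus>\<^bsub>B\<^esub>e\<in>E. tens 0 e) = \<zero>\<^bsub>B\<^esub>" by (simp add: tens_zero_left)
    then show "\<zero>\<^bsub>B\<^esub> \<in> ?U" by (intro CollectI exI[of _ "\<lambda>_. 0"]) (simp add: ratfun_zero)
  next
    fix x y assume "x \<in> ?U" "y \<in> ?U"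
    then obtain f g where fg: "\<forall>e. f e \<in> ratfun m" "\<forall>e. g e \<in> ratfun m"
       "x = (\<Oplus>\<^bsub>B\<^esub>e\<in>E. tens (f e) e)" "y = (\<Oplus>\<^bsub>B\<^esub>e\<in>E. tens (g e) e)" by blast
    have "x \<oplus>\<^bsub>B\<^esub> y = (\<Oplus>\<^bsub>B\<^esub>e\<in>E. tens (f e) e \<oplus>\<^bsub>B\<^esub> tens (g e) e)"
      unfolding fg(3,4) by (rule B.finsum_addf[symmetric]) (use fg tens_closed in auto)
    then have "x \<oplus>\<^bsub>B\<^esub> y = (\<Oplus>\<^bsub>B\<^esub>e\<in>E. tens (f e + g e) e)" using fg(1,2) by (simp add: tens_add_left)
    then show "x \<oplus>\<^bsub>B\<^esub> y \<in> ?U" using fg(1,2) by (intro CollectI exI[of _ "\<lambda>e. f e + g e"]) (simp add: ratfun_add)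
  next
    fix c x assume "c \<in> k" "x \<in> ?U"
    then obtain q f where q: "c = tens q 1" "q \<in> ratfun m" and f: "\<forall>e. f e \<in> ratfun m"
       "x = (\<Oplus>\<^bsub>B\<^esub>e\<in>E. tens (f e) e)" using k_tens by blast
    have "c \<otimes>\<^bsub>B\<^esub> x = (\<Oplus>\<^bsub>B\<^esub>e\<in>E. c \<otimes>\<^bsub>B\<^esub> tens (f e) e)"
      unfolding f(2) by (rule B.finsum_rdistr) (use E f q tens_closed in auto)
    also have "\<dots> = (\<Oplus>\<^bsub>B\<^esub>e\<in>E. tens (q * f e) e)" using q f(1) by (simp add: tens_mult)
    finally show "c \<otimes>\<^bsub>B\<^esub> x \<in> ?U" using f(1) q(2) by (intro CollectI exI[of _ "\<lambda>e. q * f e"]) (simp add: ratfun_mult)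
  qed
  have gen: "tens 1 e \<in> ?U" if e: "e \<in> E" for e
  proof -
    have "(\<Oplus>\<^bsub>B\<^esub>e'\<in>E. tens (if e' = e then 1 else 0) e') = (\<Oplus>\<^bsub>B\<^esub>e'\<in>E. if e = e' then tens 1 e' else \<zero>\<^bsub>B\<^esub>)"
      by (rule B.finsum_cong') (auto simp: tens_zero_left tens_closed ratfun_one)
    also have "\<dots> = tens 1 e" using e E(1) by (intro B.finsum_singleton) (auto simp: tens_closed ratfun_one)
    finally show ?thesis by (intro CollectI exI[of _ "\<lambda>e'. if e' = e then 1 else 0"]) (simp add: ratfun_one ratfun_zero)
  qed
  have "tens 1 a \<in> ?U" if "a \<in> span E" for a
    using that
  proof (induction rule: span_induct_alt)
    case base then show ?case using std.subalgebraD(2)[OF U] tens_zero_right[OF ratfun_one] by simp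
  next
    case (step c e y)
    have "tens 1 (\<phi> c * e) = tens (rat_const c) 1 \<otimes>\<^bsub>B\<^esub> tens 1 e"
      using tens_balance[OF ratfun_one, of c e] by (simp add: tens_mult ratfun_one ratfun_const)
    also have "\<dots> \<in> ?U" by (rule std.subalgebraD(5)[OF U _ gen[OF step(1)]]) (auto simp: k_eq ratfun_const)
    finally have "tens 1 (\<phi> c * e) \<in> ?U" .
    from std.subalgebraD(3)[OF U this step(2)] show ?case using tens_add_right[OF ratfun_one, of "\<phi> c * e" y] by simp
  qed
  then have "extend V \<subseteq> ?U" using E(2) by (intro extend_min[OF U]) blast
  then show ?thesis using x by blast
qed

end

section \<open>Density of the multiplications of a central simple algebra\<close>

text \<open>
  The ring of additive maps generated by left and right multiplications. For a central simple
  algebra it is dense in the ring of all linear maps, in the sense of the theorem \<open>density\<close>.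
\<close>

inductive_set mult_maps :: "('a::ring_1 \<Rightarrow> 'a) set" where
  ident: "(\<lambda>x. x) \<in> mult_maps"
| zero: "(\<lambda>x. 0) \<in> mult_maps"
| plus: "f \<in> mult_maps \<Longrightarrow> g \<in> mult_maps \<Longrightarrow> (\<lambda>x. f x + g x) \<in> mult_maps"
| left: "f \<in> mult_maps \<Longrightarrow> (\<lambda>x. a * f x) \<in> mult_maps"
| right: "f \<in> mult_maps \<Longrightarrow> (\<lambda>x. f x * a) \<in> mult_maps"

lemma mult_maps_uminus: "f \<in> mult_maps \<Longrightarrow> (\<lambda>x. - f x) \<in> mult_maps"
  using mult_maps.left[of f "- 1"] by simp

lemma mult_maps_diff: "f \<in> mult_maps \<Longrightarrow> g \<in> mult_maps \<Longrightarrow> (\<lambda>x. f x - g x) \<in> mult_maps"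
  using mult_maps.plus[OF _ mult_maps_uminus, of f g] by simp

lemma mult_maps_sum: "finite I \<Longrightarrow> (\<And>i. i \<in> I \<Longrightarrow> f i \<in> mult_maps) \<Longrightarrow> (\<lambda>x. \<Sum>i\<in>I. f i x) \<in> mult_maps"
  by (induction I rule: finite_induct) (auto intro: mult_maps.zero mult_maps.plus)

locale central_simple_algebra = central_algebra \<phi> for \<phi> :: "'k::field \<Rightarrow> 'a::ring_1" +
  assumes simple: "simple_ring (ring_of_type_algebra :: 'a ring)" and centre: "centre ring_of_type_algebra = range \<phi>"
begin

lemma simple_ideal:
  fixes I :: "'a set"
  assumes "\<And>x y. x \<in> I \<Longrightarrow> y \<in> I \<Longrightarrow> x + y \<in> I" "\<And>x a. x \<in> I \<Longrightarrow> a * x \<in> I" "\<And>x a. x \<in> I \<Longrightarrow> x * a \<in> I"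
    and ne: "x \<in> I" "x \<noteq> 0"
  shows "1 \<in> I"
proof -
  interpret R: ring AA by (rule ring_rta)
  have z: "0 \<in> I" using assms(2)[OF ne(1), of 0] by simp
  have neg: "- y \<in> I" if "y \<in> I" for y using assms(2)[OF that, of "- 1"] by simp
  have "ideal I AA"
  proof (rule idealI[OF ring_rta])
    show "subgroup I (add_monoid AA)"
    proof (rule subgroup.intro)
      show "inv\<^bsub>add_monoid AA\<^esub> y \<in> I" if "y \<in> I" for y
        using neg[OF that] rta_uminus[of y] by (simp add: a_inv_def)
    qed (use assms(1) z in auto)
  qed (use assms(2,3) in auto)
  then have "I = {0} \<or> I = UNIV" using simple by (simp add: simple_ring_def)
  then show ?thesis using ne by auto
qed

text \<open>
  By induction there are maps \<open>h y\<close> dual to the elements \<open>y\<close> of \<open>S - {x}\<close>. The values at \<open>x\<close> of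
  the maps that vanish on \<open>S - {x}\<close> form an ideal, and by simplicity it contains \<open>1\<close> unless it
  is zero. In the latter case, subtracting from any map \<open>\<theta>\<close> the sum of the \<open>\<theta> y * h y\<close> gives
  \<open>\<theta> x = \<Sum> \<theta> y * h y x\<close>. Applied to right translates of the \<open>h y\<close>, this says that the
  coefficients \<open>h y x\<close> are central, so they are scalars. Applied to the identity, it expresses
  \<open>x\<close> by the other elements of \<open>S\<close>, a contradiction.
\<close>

theorem density:
  assumes "finite S" "independent S" "x \<in> S"
  shows "\<exists>\<theta>\<in>mult_maps. \<theta> x = 1 \<and> (\<forall>y\<in>S - {x}. \<theta> y = 0)"
  using assms
proof (induction "card S" arbitrary: S x rule: less_induct)
  case less
  let ?T = "S - {x}"
  have fT: "finite ?T" using less.prems(1) by simp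
  have ind: "independent ?T" using less.prems(2) by (rule independent_mono) auto
  have "card ?T < card S" using less.prems(1,3) by (rule card_Diff1_less)
  then have "\<forall>y\<in>?T. \<exists>\<theta>\<in>mult_maps. \<theta> y = 1 \<and> (\<forall>z\<in>?T - {y}. \<theta> z = 0)"
    using less.hyps[OF _ fT ind] by blast
  then obtain h where h: "\<And>y. y \<in> ?T \<Longrightarrow> h y \<in> mult_maps" "\<And>y. y \<in> ?T \<Longrightarrow> h y y = 1"
    "\<And>y z. y \<in> ?T \<Longrightarrow> z \<in> ?T - {y} \<Longrightarrow> h y z = 0" by metis
  have delta: "h y z = (if z = y then 1 else 0)" if "y \<in> ?T" "z \<in> ?T" for y z
    using h(2)[OF that(1)] h(3)[OF that(1), of z] that(2) by auto
  let ?I = "{\<theta> x | \<theta>. \<theta> \<in> mult_maps \<and> (\<forall>y\<in>?T. \<theta> y = 0)}"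
  show ?case
  proof (cases "?I \<subseteq> {0}")
    case False
    then obtain v where v: "v \<in> ?I" "v \<noteq> 0" by blast
    have "1 \<in> ?I"
    proof (rule simple_ideal[OF _ _ _ v])
      fix a b assume "a \<in> ?I" "b \<in> ?I"
      then obtain f g where "a = f x" "b = g x" "f \<in> mult_maps" "g \<in> mult_maps" "\<forall>y\<in>?T. f y = 0" "\<forall>y\<in>?T. g y = 0" by blast
      then show "a + b \<in> ?I" by (intro CollectI exI[of _ "\<lambda>x. f x + g x"]) (auto intro: mult_maps.plus)
    next
      fix a c assume "a \<in> ?I"
      then obtain f where f: "a = f x" "f \<in> mult_maps" "\<forall>y\<in>?T. f y = 0" by blast
      then show "c * a \<in> ?I" by (intro CollectI exI[of _ "\<lambda>x. c * f x"]) (auto intro: mult_maps.left)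
      show "a * c \<in> ?I" using f by (intro CollectI exI[of _ "\<lambda>x. f x * c"]) (auto intro: mult_maps.right)
    qed
    then obtain f where "1 = f x" "f \<in> mult_maps" "\<forall>y\<in>?T. f y = 0" by blast
    then show ?thesis by (intro bexI[of _ f]) auto
  next
    case True
    have zero: "\<theta> x = 0" if "\<theta> \<in> mult_maps" "\<And>y. y \<in> ?T \<Longrightarrow> \<theta> y = 0" for \<theta> using True that by blast
    have left: "\<theta> x = (\<Sum>y\<in>?T. \<theta> y * h y x)" if t: "\<theta> \<in> mult_maps" for \<theta>
    proof -
      let ?g = "\<lambda>v. \<theta> v - (\<Sum>y\<in>?T. \<theta> y * h y v)"
      have "?g \<in> mult_maps"
        by (intro mult_maps_diff t mult_maps_sum fT mult_maps.left h(1))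
      moreover have "?g z = 0" if z: "z \<in> ?T" for z
      proof -
        have "(\<Sum>y\<in>?T. \<theta> y * h y z) = (\<Sum>y\<in>?T. if z = y then \<theta> y else 0)"
          by (rule sum.cong) (use delta z in auto)
        also have "\<dots> = \<theta> z" using fT z by simp
        finally show ?thesis by simp
      qed
      ultimately have "?g x = 0" by (rule zero)
      then show ?thesis by simp
    qed
    have central: "h y x \<in> range \<phi>" if y: "y \<in> ?T" for y
    proof -
      have "a * h y x = h y x * a" for a
      proof -
        have "(\<lambda>v. h y v * a) \<in> mult_maps" by (rule mult_maps.right[OF h(1)[OF y]])
        from left[OF this] have "h y x * a = (\<Sum>z\<in>?T. h y z * a * h z x)" .
        also have "\<dots> = (\<Sum>z\<in>?T. if y = z then a * h z x else 0)"
          by (rule sum.cong) (use delta[OF y] in auto)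
        also have "\<dots> = a * h y x" using fT y by simp
        finally show ?thesis by simp
      qed
      then have "h y x \<in> centre AA" by (simp add: centre_def)
      then show ?thesis using centre by simp
    qed
    have "x = (\<Sum>y\<in>?T. y * h y x)" using left[OF mult_maps.ident] .
    also have "\<dots> \<in> span ?T"
    proof (rule span_sum)
      fix y assume y: "y \<in> ?T"
      obtain c where "h y x = \<phi> c" using central[OF y] by blast
      then show "y * h y x \<in> span ?T" using \<phi>_central[of c y] span_scale[OF span_base[OF y], of c] by simp
    qed
    finally show ?thesis using less.prems(2,3) by (auto simp: dependent_def)
  qed
qed

end

context scalar_extension
begin

text \<open>
  The element \<open>\<Sum> f e \<otimes> \<theta> e\<close>. With \<open>\<theta>\<close> the identity and \<open>E\<close> linearly independent, it is the
  general element of the tensor product.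
\<close>

definition comb :: "'a set \<Rightarrow> ('a \<Rightarrow> 'k mpoly fract) \<Rightarrow> ('a \<Rightarrow> 'a) \<Rightarrow> ('k, 'a) formal_sum set" where
  "comb E f \<theta> = (\<Oplus>\<^bsub>B\<^esub>e\<in>E. tens (f e) (\<theta> e))"

lemma comb_closed: "(\<And>e. f e \<in> ratfun m) \<Longrightarrow> comb E f \<theta> \<in> carrier B"
  unfolding comb_def by (rule B.finsum_closed) (auto intro: tens_closed)

lemma comb_left:
  assumes "finite E" "\<And>e. f e \<in> ratfun m"
  shows "comb E f (\<lambda>e. a * \<theta> e) = tens 1 a \<otimes>\<^bsub>B\<^esub> comb E f \<theta>"
proof -
  have "tens 1 a \<otimes>\<^bsub>B\<^esub> comb E f \<theta> = (\<Oplus>\<^bsub>B\<^esub>e\<in>E. tens 1 a \<otimes>\<^bsub>B\<^esub> tens (f e) (\<theta> e))"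
    unfolding comb_def by (rule B.finsum_rdistr) (use assms tens_closed[OF ratfun_one] tens_closed in auto)
  then show ?thesis using assms by (simp add: comb_def tens_mult ratfun_one)
qed

lemma comb_right:
  assumes "finite E" "\<And>e. f e \<in> ratfun m"
  shows "comb E f (\<lambda>e. \<theta> e * a) = comb E f \<theta> \<otimes>\<^bsub>B\<^esub> tens 1 a"
proof -
  have "comb E f \<theta> \<otimes>\<^bsub>B\<^esub> tens 1 a = (\<Oplus>\<^bsub>B\<^esub>e\<in>E. tens (f e) (\<theta> e) \<otimes>\<^bsub>B\<^esub> tens 1 a)"
    unfolding comb_def by (rule B.finsum_ldistr) (use assms tens_closed[OF ratfun_one] tens_closed in auto)
  then show ?thesis using assms by (simp add: comb_def tens_mult ratfun_one)
qed

lemma comb_plus: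
  assumes "\<And>e. f e \<in> ratfun m"
  shows "comb E f (\<lambda>e. \<theta> e + \<theta>' e) = comb E f \<theta> \<oplus>\<^bsub>B\<^esub> comb E f \<theta>'"
  unfolding comb_def using assms by (simp add: tens_add_right B.finsum_addf tens_closed)

lemma comb_zero: "(\<And>e. f e \<in> ratfun m) \<Longrightarrow> comb E f (\<lambda>e. 0) = \<zero>\<^bsub>B\<^esub>"
  by (simp add: comb_def tens_zero_right)

lemma comb_delta:
  assumes "finite E" "\<And>e. f e \<in> ratfun m" "x \<in> E" "\<theta> x = 1" "\<And>y. y \<in> E - {x} \<Longrightarrow> \<theta> y = 0"
  shows "comb E f \<theta> = tens (f x) 1"
proof -
  have "comb E f \<theta> = (\<Oplus>\<^bsub>B\<^esub>e\<in>E. if x = e then tens (f e) 1 else \<zero>\<^bsub>B\<^esub>)"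
    unfolding comb_def by (rule B.finsum_cong') (use assms in \<open>auto simp: tens_zero_right tens_closed B.zero_closed\<close>)
  also have "\<dots> = tens (f x) 1" using assms(1,2,3) by (intro B.finsum_singleton) (auto intro: tens_closed)
  finally show ?thesis .
qed

context
  fixes S
  assumes S: "alg_generators B k S"
begin

lemma S_carrier: "S \<subseteq> carrier B" and S_gen: "generate_ring B (k \<union> S) = carrier B" and S_finite: "finite S"
  using S by (auto simp: alg_generators_def)

lemmas std_filt_closed = std.std_filt_closed[OF S_carrier]
lemmas std_filt_monoD = std.std_filt_monoD[OF S_carrier]
lemmas sandwich_subalgebra = std.sandwich_subalgebra[OF S_carrier]
lemmas sandwich_mono = std.sandwich_mono[OF S_carrier]
lemmas sandwich_base = std.sandwich_base[OF S_carrier]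
lemmas sandwich_left = std.sandwich_left[OF S_carrier]
lemmas sandwich_right = std.sandwich_right[OF S_carrier]

text \<open>
  A map built from multiplications, extended to \<open>B\<close>, carries \<open>b\<close> into a sandwich of \<open>b\<close>. The
  index \<open>j\<close> depends on the multipliers, but not on the coefficients \<open>f\<close>.
\<close>

lemma mult_map_sandwich:
  assumes E: "finite E" and t: "\<theta> \<in> mult_maps"
  shows "\<exists>j. \<forall>f. (\<forall>e. f e \<in> ratfun m) \<longrightarrow> comb E f \<theta> \<in> sandwich B k S j (comb E f (\<lambda>e. e))"
  using t
proof (induction rule: mult_maps.induct)
  case ident
  show ?case by (intro exI[of _ 0] allI impI sandwich_base comb_closed) auto
next
  case zero
  show ?case using std.subalgebraD(2)[OF sandwich_subalgebra[OF comb_closed]] by (intro exI[of _ 0]) (simp add: comb_zero)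
next
  case (plus g h)
  then obtain i j where i: "\<And>f. \<forall>e. f e \<in> ratfun m \<Longrightarrow> comb E f g \<in> sandwich B k S i (comb E f (\<lambda>e. e))"
    and j: "\<And>f. \<forall>e. f e \<in> ratfun m \<Longrightarrow> comb E f h \<in> sandwich B k S j (comb E f (\<lambda>e. e))" by blast
  show ?case
  proof (intro exI allI impI)
    fix f :: "'a \<Rightarrow> 'k mpoly fract" assume f: "\<forall>e. f e \<in> ratfun m"
    have c: "comb E f (\<lambda>e. e) \<in> carrier B" using f by (intro comb_closed) auto
    have "comb E f g \<in> sandwich B k S (max i j) (comb E f (\<lambda>e. e))" "comb E f h \<in> sandwich B k S (max i j) (comb E f (\<lambda>e. e))"
      using i[OF f] j[OF f] sandwich_mono[OF c, of i "max i j"] sandwich_mono[OF c, of j "max i j"] by auto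
    then show "comb E f (\<lambda>x. g x + h x) \<in> sandwich B k S (max i j) (comb E f (\<lambda>e. e))"
      using f std.subalgebraD(3)[OF sandwich_subalgebra[OF c]] by (simp add: comb_plus)
  qed
next
  case (left g a)
  then obtain i where i: "\<And>f. \<forall>e. f e \<in> ratfun m \<Longrightarrow> comb E f g \<in> sandwich B k S i (comb E f (\<lambda>e. e))" by blast
  obtain j where j: "tens 1 a \<in> std_filt B k S j" using std.std_filt_exhaust[OF S_carrier S_gen] tens_closed[OF ratfun_one] by blast
  show ?case
    by (intro exI[of _ "j + i"] allI impI) (use E j in \<open>simp add: comb_left sandwich_left[OF comb_closed _ i]\<close>)
next
  case (right g a)
  then obtain i where i: "\<And>f. \<forall>e. f e \<in> ratfun m \<Longrightarrow> comb E f g \<in> sandwich B k S i (comb E f (\<lambda>e. e))" by blast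
  obtain j where j: "tens 1 a \<in> std_filt B k S j" using std.std_filt_exhaust[OF S_carrier S_gen] tens_closed[OF ratfun_one] by blast
  show ?case
    by (intro exI[of _ "j + i"] allI impI) (use E j in \<open>simp add: comb_right sandwich_right[OF comb_closed _ i]\<close>)
qed

end

end

section \<open>The action on the division ring\<close>

text \<open>
  The tensor product of the algebra and the rational functions acts on the division ring: the
  algebra acts from the left, and the indeterminates act from the right through the commuting
  elements \<open>xs\<close>.
\<close>

locale division_ring_setting = fraction_ring \<phi> F N z w \<iota> + central_simple_algebra \<phi> +
    subfield_elements "\<iota> \<circ> \<phi>" xs L + scalar_extension \<phi> "length xs"
  for \<phi> :: "'k::field \<Rightarrow> 'a::ring_1_no_zero_divisors" and F N z w
    and \<iota> :: "'a \<Rightarrow> 'd::division_ring" and xs L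
begin

text \<open>
  The action of formal sums; it vanishes on the relations by lemma \<open>Act_rel\<close>.
\<close>

definition Act :: "('k, 'a) formal_sum \<Rightarrow> 'd \<Rightarrow> 'd" where
  "Act f v = (\<Sum>x\<in>Poly_Mapping.keys f. of_int (Poly_Mapping.lookup f x) * (\<iota> (snd x) * v * rat_ev (fst x)))"

lemma Act_superset:
  assumes "finite I" "Poly_Mapping.keys f \<subseteq> I"
  shows "Act f v = (\<Sum>x\<in>I. of_int (Poly_Mapping.lookup f x) * (\<iota> (snd x) * v * rat_ev (fst x)))"
  unfolding Act_def by (rule sum.mono_neutral_left[OF assms]) (simp add: in_keys_iff)

lemma Act_diff: "Act (f - g) v = Act f v - Act g v"
proof -
  let ?I = "Poly_Mapping.keys f \<union> Poly_Mapping.keys g"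
  have "Act (f - g) v = (\<Sum>x\<in>?I. of_int (Poly_Mapping.lookup (f - g) x) * (\<iota> (snd x) * v * rat_ev (fst x)))"
    by (rule Act_superset) (use keys_diff[of f g] in auto)
  also have "\<dots> = Act f v - Act g v"
    using Act_superset[of ?I f v] Act_superset[of ?I g v]
    by (simp add: lookup_minus left_diff_distrib sum_subtractf)
  finally show ?thesis .
qed

lemma Act_zero: "Act 0 v = 0" by (simp add: Act_def)

lemma Act_uminus: "Act (- f) v = - Act f v"
  using Act_diff[of 0 f v] by (simp add: Act_zero)

lemma Act_add: "Act (f + g) v = Act f v + Act g v"
  using Act_diff[of f "- g" v] by (simp add: Act_uminus)

lemma Act_of: "Act (frag_of (q, a)) v = \<iota> a * v * rat_ev q"
  by (simp add: Act_def)

lemma Act_frmul: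
  assumes f: "f \<in> carrier FR" and g: "g \<in> carrier FR"
  shows "Act (frmul f g) v = Act f (Act g v)"
  using f
proof (induction f rule: FR_induct)
  case zero then show ?case by (simp add: frmul_zero_left Act_zero)
next
  case (of q a)
  from g show ?case
  proof (induction g rule: FR_induct)
    case zero then show ?case by (simp add: frmul_zero_right Act_zero Act_of)
  next
    case (of q' a')
    have "rat_ev (q * q') = rat_ev q' * rat_ev q"
      using rat_ev_mult[OF of \<open>q \<in> ratfun (length xs)\<close>] by (simp add: mult.commute)
    then show ?case by (simp add: frmul_of_of Act_of \<iota>_mult mult.assoc)
  next
    case (diff f g)
    then show ?case by (simp add: frmul_diff_right Act_diff Act_of left_diff_distrib right_diff_distrib)
  qed
next
  case (diff f g) then show ?case by (simp add: frmul_diff_left Act_diff)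
qed

lemma Act_rel: "f \<in> rel \<Longrightarrow> Act f v = 0"
proof (induction f rule: rel_induct)
  case (gens g)
  from gens consider (1) q q' a where "g = frag_of (q + q', a) - frag_of (q, a) - frag_of (q', a)" "q \<in> ratfun (length xs)" "q' \<in> ratfun (length xs)"
    | (2) q a a' where "g = frag_of (q, a + a') - frag_of (q, a) - frag_of (q, a')" "q \<in> ratfun (length xs)"
    | (3) q c a where "g = frag_of (q * rat_const c, a) - frag_of (q, \<phi> c * a)" "q \<in> ratfun (length xs)"
    unfolding gens_def by blast
  then show ?case
  proof cases
    case 1 then show ?thesis by (simp add: Act_diff Act_of rat_ev_add distrib_left)
  next
    case 2 then show ?thesis by (simp add: Act_diff Act_of \<iota>_add distrib_right)
  next
    case 3
    have "rat_ev (q * rat_const c) = rat_ev q * \<kappa> c" using 3(2) by (simp add: rat_ev_mult ratfun_const rat_ev_const \<kappa>_def)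
    moreover have "\<iota> (\<phi> c * a) = \<kappa> c * \<iota> a" by (simp add: \<iota>_mult \<kappa>_def)
    moreover have "\<iota> a * v * (rat_ev q * \<kappa> c) = \<kappa> c * \<iota> a * v * rat_ev q"
      using D.\<phi>_central[of c "\<iota> a * v * rat_ev q"] by (simp add: mult.assoc)
    ultimately show ?thesis by (simp add: 3(1) Act_diff Act_of)
  qed
qed (simp_all add: Act_zero Act_uminus Act_add)

text \<open>
  Elements of the tensor product are cosets, and all members of a coset act in the same way, so
  that annihilation can be required of all of them.
\<close>

definition kills :: "('k, 'a) formal_sum set \<Rightarrow> 'd \<Rightarrow> bool" where
  "kills b v \<longleftrightarrow> (\<forall>f\<in>b. Act f v = 0)"

lemma kills_\<pi>: "kills (\<pi> f) v \<longleftrightarrow> Act f v = 0"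
proof
  assume "kills (\<pi> f) v"
  moreover have "f \<in> \<pi> f" unfolding \<pi>_mem using rel_zero by (intro bexI[of _ 0]) auto
  ultimately show "Act f v = 0" by (simp add: kills_def)
next
  assume "Act f v = 0"
  then show "kills (\<pi> f) v" by (auto simp: kills_def \<pi>_mem Act_add Act_rel)
qed

lemma kills_tens: "kills (tens q a) v \<longleftrightarrow> \<iota> a * v * rat_ev q = 0"
  by (simp add: tens_def kills_\<pi> Act_of)

lemma kills_zero: "kills \<zero>\<^bsub>B\<^esub> v"
  using kills_\<pi>[of 0 v] by (simp add: \<pi>_zero Act_zero)

lemma kills_one: "kills \<one>\<^bsub>B\<^esub> v \<Longrightarrow> v = 0"
  using kills_tens[of 1 1 v] by (simp add: tens_one \<iota>_one rat_ev_one)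

lemma kills_add:
  assumes "b \<in> carrier B" "c \<in> carrier B" "kills b v" "kills c v"
  shows "kills (b \<oplus>\<^bsub>B\<^esub> c) v"
proof -
  obtain f g where "f \<in> carrier FR" "g \<in> carrier FR" "b = \<pi> f" "c = \<pi> g" using \<pi>_surj assms(1,2) by meson
  then show ?thesis using assms(3,4) by (simp add: kills_\<pi> \<pi>_add[symmetric] Act_add)
qed

lemma kills_mult:
  assumes "b \<in> carrier B" "c \<in> carrier B" "kills c v"
  shows "kills (b \<otimes>\<^bsub>B\<^esub> c) v"
proof -
  obtain f g where f: "f \<in> carrier FR" "g \<in> carrier FR" "b = \<pi> f" "c = \<pi> g" using \<pi>_surj assms(1,2) by meson
  have "Act f 0 = 0" by (simp add: Act_def)
  then show ?thesis using assms(3) f by (simp add: kills_\<pi> \<pi>_mult[symmetric] Act_frmul)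
qed

lemma kills_mult_tens:
  assumes "b \<in> carrier B"
  shows "kills (b \<otimes>\<^bsub>B\<^esub> tens 1 a) v \<longleftrightarrow> kills b (\<iota> a * v)"
proof -
  obtain f where f: "f \<in> carrier FR" "b = \<pi> f" using \<pi>_surj assms by meson
  then show ?thesis by (simp add: tens_def kills_\<pi> \<pi>_mult[symmetric] FR_of ratfun_one Act_frmul Act_of rat_ev_one)
qed

lemma kills_comb:
  assumes "finite E" "\<And>e. f e \<in> ratfun (length xs)" "(\<Sum>e\<in>E. \<iota> e * v * rat_ev (f e)) = 0"
  shows "kills (comb E f (\<lambda>e. e)) v"
proof -
  have P: "(\<Sum>e\<in>E. frag_of (f e, e)) \<in> carrier FR \<and> \<pi> (\<Sum>e\<in>E. frag_of (f e, e)) = comb E f (\<lambda>e. e) \<and>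
     Act (\<Sum>e\<in>E. frag_of (f e, e)) v = (\<Sum>e\<in>E. \<iota> e * v * rat_ev (f e))"
    using assms(1)
  proof (induction E rule: finite_induct)
    case empty then show ?case by (simp add: FR_zero \<pi>_zero comb_def Act_zero)
  next
    case (insert e E)
    have "comb (insert e E) f (\<lambda>e. e) = tens (f e) e \<oplus>\<^bsub>B\<^esub> comb E f (\<lambda>e. e)"
      unfolding comb_def by (rule B.finsum_insert) (use insert assms(2) tens_closed in auto)
    moreover have "Act (\<Sum>e\<in>insert e E. frag_of (f e, e)) v = (\<Sum>e\<in>insert e E. \<iota> e * v * rat_ev (f e))"
      unfolding sum.insert[OF insert(1,2)] Act_add Act_of using insert(3) by (simp only:)
    moreover have "frag_of (f e, e) \<in> carrier FR" by (rule FR_of[OF assms(2)])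
    ultimately show ?case using insert(3) unfolding sum.insert[OF insert(1,2)]
      by (simp only: FR_add \<pi>_add tens_def simp_thms)
  qed
  have "kills (\<pi> (\<Sum>e\<in>E. frag_of (f e, e))) v"
    unfolding kills_\<pi> using P assms(3) by (simp only:)
  then show ?thesis using P by (simp only:)
qed

lemma left_ideal_kills: "left_ideal {b \<in> carrier B. kills b v} B"
  unfolding left_ideal_def
proof (intro conjI ballI)
  have neg: "kills (\<ominus>\<^bsub>B\<^esub> b) v" if b: "b \<in> carrier B" "kills b v" for b
  proof -
    have "(\<ominus>\<^bsub>B\<^esub> \<one>\<^bsub>B\<^esub>) \<otimes>\<^bsub>B\<^esub> b = \<ominus>\<^bsub>B\<^esub> b" using b(1) by (simp add: B.l_minus)
    then show ?thesis using kills_mult[OF _ b, of "\<ominus>\<^bsub>B\<^esub> \<one>\<^bsub>B\<^esub>"] by simp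
  qed
  show "subgroup {b \<in> carrier B. kills b v} (add_monoid B)"
  proof (rule subgroup.intro)
    fix b assume "b \<in> {b \<in> carrier B. kills b v}"
    then show "inv\<^bsub>add_monoid B\<^esub> b \<in> {b \<in> carrier B. kills b v}"
      using neg[of b] B.a_inv_closed[of b] by (simp add: a_inv_def)
  qed (use kills_add kills_zero in auto)
qed (use kills_mult in auto)

lemma kills_extend:
  assumes b: "b \<in> carrier B" and k: "\<And>a. a \<in> V \<Longrightarrow> kills b (\<iota> a * u)" and y: "y \<in> extend V"
  shows "kills (b \<otimes>\<^bsub>B\<^esub> y) u"
proof -
  have "extend V \<subseteq> {y \<in> carrier B. b \<otimes>\<^bsub>B\<^esub> y \<in> {c \<in> carrier B. kills c u}}"
    by (rule extend_min[OF std.subalgebra_left_mult[OF std.left_ideal_subalgebra[OF left_ideal_kills] b]])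
      (use b k tens_closed[OF ratfun_one] kills_mult_tens[OF b] in auto)
  then show ?thesis using y by blast
qed

text \<open>
  A basis of the algebra stays independent over the rational functions. A product of
  multiplications that maps \<open>e\<close> to \<open>1\<close> and the other elements of \<open>E\<close> to \<open>0\<close> turns the
  combination into \<open>f e \<otimes> 1\<close>, and this tensor acts on the division ring as a nonzero element of
  \<open>L\<close>.
\<close>

lemma comb_nonzero:
  assumes S: "alg_generators B k S" and E: "finite E" "independent E" and f: "\<And>e. f e \<in> ratfun (length xs)"
    and e: "e \<in> E" "f e \<noteq> 0"
  shows "comb E f (\<lambda>e. e) \<noteq> \<zero>\<^bsub>B\<^esub>"
proof
  assume z: "comb E f (\<lambda>e. e) = \<zero>\<^bsub>B\<^esub>"
  obtain \<theta> where t: "\<theta> \<in> mult_maps" "\<theta> e = 1" "\<forall>y\<in>E - {e}. \<theta> y = 0" using density[OF E e(1)] by blast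
  obtain j where "comb E f \<theta> \<in> sandwich B k S j \<zero>\<^bsub>B\<^esub>" using mult_map_sandwich[OF S E(1) t(1)] f z by metis
  moreover have "subalgebra k {\<zero>\<^bsub>B\<^esub>} B" by (rule std.subalgebraI) (use std.k_carrier in auto)
  then have "sandwich B k S j \<zero>\<^bsub>B\<^esub> \<subseteq> {\<zero>\<^bsub>B\<^esub>}"
    by (rule std.sandwich_min[OF S_carrier[OF S]]) (use std_filt_closed[OF S] in auto)
  ultimately have "comb E f \<theta> = \<zero>\<^bsub>B\<^esub>" by blast
  moreover have "comb E f \<theta> = tens (f e) 1" by (rule comb_delta[where f = f and x = e and \<theta> = \<theta>, OF E(1) f e(1) t(2)]) (use t(3) in auto)
  ultimately have "kills (tens (f e) 1) 1" using kills_zero by metis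
  then show False using rat_ev_nonzero[OF f e(2)] by (simp add: kills_tens \<iota>_one)
qed

lemma std_filt_extend:
  assumes S: "alg_generators B k S"
  shows "\<exists>c. \<forall>i. std_filt B k S i \<subseteq> extend (F (c * i))"
proof -
  have mono: "extend (F i) \<subseteq> extend (F j)" if "i \<le> j" for i j using F_mono[OF that] by (rule extend_mono)
  have ex: "\<exists>i. b \<in> extend (F i)" if "b \<in> carrier B" for b
    using that
  proof (induction b rule: tensor_induct)
    case (tens q a) then show ?case using F_UN[of a] tens_extend by blast
  next
    case (add x y)
    then obtain i j where "x \<in> extend (F i)" "y \<in> extend (F j)" by blast
    then have "x \<in> extend (F (max i j))" "y \<in> extend (F (max i j))" using mono[of i "max i j"] mono[of j "max i j"] by auto
    then show ?case using std.subalgebraD(3)[OF extend_subalgebra] by blast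
  qed
  have "finite (insert \<one>\<^bsub>B\<^esub> S)" using S_finite[OF S] by simp
  then obtain c where c: "\<forall>x\<in>insert \<one>\<^bsub>B\<^esub> S. x \<in> extend (F c)"
    using finite_in_chain[of "insert \<one>\<^bsub>B\<^esub> S" "\<lambda>i. extend (F i)"] mono ex S_carrier[OF S] by blast
  have "std_filt B k S i \<subseteq> extend (F (c * i))" for i
  proof (rule std.std_filt_le[OF S_carrier[OF S] extend_subalgebra])
    show "x \<otimes>\<^bsub>B\<^esub> y \<in> extend (F (i + j))" if "x \<in> extend (F i)" "y \<in> extend (F j)" for i j x y
      by (rule extend_mult[OF _ that]) (rule F_mult)
    show "k \<subseteq> extend (F 0)" unfolding k_eq using tens_extend F_one by blast
  qed (use c in auto)
  then show ?thesis by blast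
qed

text \<open>
  The minimum in the definition of the filter dimension exists. The \<open>i\<close>-th piece of the standard
  filtration is contained in the span, over the rational functions, of a finite set \<open>E\<close> that is
  independent over the ground field. For each of the finitely many \<open>x\<close> in \<open>E\<close>, a map that
  singles out \<open>x\<close> yields an index that serves all elements with nonzero coefficient at \<open>x\<close>,
  whatever their coefficients are.
\<close>

lemma unit_reached:
  assumes S: "alg_generators B k S"
  shows "\<exists>j. \<forall>a\<in>std_filt B k S i - {\<zero>\<^bsub>B\<^esub>}. \<one>\<^bsub>B\<^esub> \<in> sandwich B k S j a"
proof -
  obtain c where c: "\<And>i. std_filt B k S i \<subseteq> extend (F (c * i))" using std_filt_extend[OF S] by blast
  obtain E where E: "E \<subseteq> F (c * i)" "independent E" "F (c * i) \<subseteq> span E" using maximal_independent_subset by blast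
  obtain B0 where "finite B0" "F (c * i) \<subseteq> span B0" using F_fin by blast
  then have finE: "finite E" using independent_span_bound E(1,2) by blast
  have "\<exists>j. \<forall>f. (\<forall>e. f e \<in> ratfun (length xs)) \<longrightarrow> tens (f x) 1 \<in> sandwich B k S j (comb E f (\<lambda>e. e))" if x: "x \<in> E" for x
  proof -
    obtain \<theta> where t: "\<theta> \<in> mult_maps" "\<theta> x = 1" "\<forall>y\<in>E - {x}. \<theta> y = 0" using density[OF finE E(2) x] by blast
    obtain j where j: "\<And>f. (\<forall>e. f e \<in> ratfun (length xs)) \<Longrightarrow> comb E f \<theta> \<in> sandwich B k S j (comb E f (\<lambda>e. e))"
      using mult_map_sandwich[OF S finE t(1)] by blast
    have "comb E f \<theta> = tens (f x) 1" if "\<forall>e. f e \<in> ratfun (length xs)" for f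
      by (rule comb_delta[where f = f and x = x and \<theta> = \<theta>, OF finE _ x t(2)]) (use that t(3) in auto)
    then show ?thesis using j by metis
  qed
  then obtain j where j: "\<And>x f. x \<in> E \<Longrightarrow> (\<forall>e. f e \<in> ratfun (length xs)) \<Longrightarrow> tens (f x) 1 \<in> sandwich B k S (j x) (comb E f (\<lambda>e. e))"
    by metis
  define J where "J = (\<Sum>x\<in>E. j x)"
  have "\<one>\<^bsub>B\<^esub> \<in> sandwich B k S J a" if a: "a \<in> std_filt B k S i - {\<zero>\<^bsub>B\<^esub>}" for a
  proof -
    have "a \<in> extend (F (c * i))" using a c by blast
    then obtain f where f: "\<forall>e. f e \<in> ratfun (length xs)" "a = comb E f (\<lambda>e. e)"
      using extend_span[OF finE E(3)] unfolding comb_def by blast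
    have ac: "a \<in> carrier B" using f comb_closed by blast
    have "\<exists>x\<in>E. f x \<noteq> 0"
    proof (rule ccontr)
      assume "\<not> ?thesis"
      then have "a = (\<Oplus>\<^bsub>B\<^esub>e\<in>E. \<zero>\<^bsub>B\<^esub>)" unfolding f(2) comb_def by (intro B.finsum_cong') (auto simp: tens_zero_left)
      then show False using a by simp
    qed
    then obtain x where x: "x \<in> E" "f x \<noteq> 0" by blast
    have fx: "f x \<in> ratfun (length xs)" "inverse (f x) \<in> ratfun (length xs)" using f(1) ratfun_inverse x(2) by auto
    have "j x \<le> J" unfolding J_def by (rule member_le_sum[OF x(1) _ finE]) simp
    then have "tens (f x) 1 \<in> sandwich B k S J a" using j[OF x(1) f(1)] sandwich_mono[OF S ac] f(2) by blast
    then have "tens (inverse (f x)) 1 \<otimes>\<^bsub>B\<^esub> tens (f x) 1 \<in> sandwich B k S J a"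
      using std.subalgebraD(5)[OF sandwich_subalgebra[OF S ac]] fx(2) by (simp add: k_eq)
    then show ?thesis using fx x(2) by (simp add: tens_mult tens_one)
  qed
  then show ?thesis by blast
qed

lemma nu_lam_spec:
  assumes S: "alg_generators B k S" and a: "a \<in> std_filt B k S i - {\<zero>\<^bsub>B\<^esub>}"
  shows "\<one>\<^bsub>B\<^esub> \<in> sandwich B k S (nu B k S i) a"
    and "\<one>\<^bsub>B\<^esub> \<in> left_ideal_gen B {a \<otimes>\<^bsub>B\<^esub> y | y. y \<in> std_filt B k S (lam B k S i)}"
proof -
  obtain j where j: "\<forall>a\<in>std_filt B k S i - {\<zero>\<^bsub>B\<^esub>}. \<one>\<^bsub>B\<^esub> \<in> sandwich B k S j a" using unit_reached[OF S] by blast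
  have "\<forall>a\<in>std_filt B k S i - {\<zero>\<^bsub>B\<^esub>}. \<one>\<^bsub>B\<^esub> \<in> sandwich B k S (nu B k S i) a"
    unfolding nu_def sandwich_def by (rule LeastI_ex) (use j in \<open>auto simp: sandwich_def\<close>)
  then show "\<one>\<^bsub>B\<^esub> \<in> sandwich B k S (nu B k S i) a" using a by blast
  have sub: "sandwich B k S j a \<subseteq> left_ideal_gen B {a \<otimes>\<^bsub>B\<^esub> y | y. y \<in> std_filt B k S j}"
    if a: "a \<in> std_filt B k S i - {\<zero>\<^bsub>B\<^esub>}" for a
    unfolding left_ideal_gen_def
  proof (rule Inter_greatest)
    have ac: "a \<in> carrier B" using a std_filt_closed[OF S] by blast
    fix I assume "I \<in> {I. left_ideal I B \<and> {a \<otimes>\<^bsub>B\<^esub> y | y. y \<in> std_filt B k S j} \<subseteq> I}"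
    then show "sandwich B k S j a \<subseteq> I"
      by (intro std.sandwich_subset_left_ideal[OF S_carrier[OF S] ac]) auto
  qed
  have "\<forall>a\<in>std_filt B k S i - {\<zero>\<^bsub>B\<^esub>}. \<one>\<^bsub>B\<^esub> \<in> left_ideal_gen B {a \<otimes>\<^bsub>B\<^esub> y | y. y \<in> std_filt B k S (lam B k S i)}"
    unfolding lam_def by (rule LeastI_ex[where P = "\<lambda>j. \<forall>a\<in>std_filt B k S i - {\<zero>\<^bsub>B\<^esub>}. \<one>\<^bsub>B\<^esub> \<in> left_ideal_gen B {a \<otimes>\<^bsub>B\<^esub> y | y. y \<in> std_filt B k S j}"])
      (use j sub in blast)
  then show "\<one>\<^bsub>B\<^esub> \<in> left_ideal_gen B {a \<otimes>\<^bsub>B\<^esub> y | y. y \<in> std_filt B k S (lam B k S i)}" using a by blast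
qed

text \<open>
  If \<open>b\<close> annihilates the vectors obtained from \<open>u\<close> by the piece of degree \<open>\<nu> i\<close>, then the left
  ideal generated by the products of \<open>b\<close> with this piece annihilates \<open>u\<close>. By definition of \<open>\<nu>\<close>
  it contains \<open>1\<close>.
\<close>

lemma faithful:
  assumes S: "alg_generators B k S" and b: "b \<in> std_filt B k S i - {\<zero>\<^bsub>B\<^esub>}"
    and \<nu>: "\<nu> = nu B k S \<or> \<nu> = lam B k S"
    and V: "std_filt B k S (\<nu> i) \<subseteq> extend V" and kill: "\<And>a. a \<in> V \<Longrightarrow> kills b (\<iota> a * u)"
  shows "u = 0"
proof -
  have bc: "b \<in> carrier B" using b std_filt_closed[OF S] by blast
  let ?I = "{c \<in> carrier B. kills c u}"
  have I: "b \<otimes>\<^bsub>B\<^esub> y \<in> ?I" if "y \<in> std_filt B k S (\<nu> i)" for y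
    using kills_extend[OF bc kill, of V y] that V std_filt_closed[OF S] bc by auto
  have "\<one>\<^bsub>B\<^esub> \<in> ?I"
    using \<nu>
  proof
    assume n: "\<nu> = nu B k S"
    have "sandwich B k S (\<nu> i) b \<subseteq> ?I"
      by (rule std.sandwich_subset_left_ideal[OF S_carrier[OF S] bc left_ideal_kills]) (rule I)
    then show ?thesis using nu_lam_spec(1)[OF S b] n by blast
  next
    assume n: "\<nu> = lam B k S"
    have "left_ideal_gen B {b \<otimes>\<^bsub>B\<^esub> y | y. y \<in> std_filt B k S (\<nu> i)} \<subseteq> ?I"
      unfolding left_ideal_gen_def by (rule Inter_lower) (use left_ideal_kills I in blast)
    then show ?thesis using nu_lam_spec(2)[OF S b] n by blast
  qed
  then show ?thesis using kills_one by blast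
qed

end

section \<open>The filter inequality\<close>

lemma homogeneous_system:
  fixes g :: "'e \<Rightarrow> 'j \<Rightarrow> 'k::field"
  assumes "finite I" "finite J" "card I < card J"
  shows "\<exists>c. (\<exists>j\<in>J. c j \<noteq> 0) \<and> (\<forall>i\<in>I. (\<Sum>j\<in>J. c j * g i j) = 0)"
  using assms
proof (induction I arbitrary: J g rule: finite_induct)
  case empty
  then obtain j where "j \<in> J" by fastforce
  then show ?case by (intro exI[of _ "\<lambda>_. 1"]) auto
next
  case (insert i I)
  show ?case
  proof (cases "\<forall>j\<in>J. g i j = 0")
    case True
    obtain c where "\<exists>j\<in>J. c j \<noteq> 0" "\<forall>i\<in>I. (\<Sum>j\<in>J. c j * g i j) = 0"
      using insert.IH[OF insert.prems(1), of g] insert.prems(2) insert.hyps by auto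
    then show ?thesis using True by (intro exI[of _ c]) auto
  next
    case False
    then obtain j0 where j0: "j0 \<in> J" "g i j0 \<noteq> 0" by blast
    let ?J = "J - {j0}"
    define h where "h i' j = g i' j - g i' j0 / g i j0 * g i j" for i' j
    have "card I < card ?J" using insert.prems insert.hyps j0 by simp
    then obtain c where c: "\<exists>j\<in>?J. c j \<noteq> 0" "\<forall>i'\<in>I. (\<Sum>j\<in>?J. c j * h i' j) = 0"
      using insert.IH[of ?J h] insert.prems by auto
    define d where "d = (\<lambda>j. if j = j0 then - (\<Sum>j\<in>?J. c j * g i j) / g i j0 else c j)"
    have split: "(\<Sum>j\<in>J. d j * g i' j) = d j0 * g i' j0 + (\<Sum>j\<in>?J. c j * g i' j)" for i'
    proof -
      have "(\<Sum>j\<in>J. d j * g i' j) = d j0 * g i' j0 + (\<Sum>j\<in>?J. d j * g i' j)"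
        using insert.prems(1) j0(1) by (rule sum.remove)
      also have "(\<Sum>j\<in>?J. d j * g i' j) = (\<Sum>j\<in>?J. c j * g i' j)" by (rule sum.cong) (auto simp: d_def)
      finally show ?thesis .
    qed
    have "(\<Sum>j\<in>J. d j * g i j) = 0" unfolding split using j0(2) by (simp add: d_def)
    moreover have "(\<Sum>j\<in>J. d j * g i' j) = 0" if "i' \<in> I" for i'
    proof -
      define r where "r = g i' j0 / g i j0"
      have "0 = (\<Sum>j\<in>?J. c j * h i' j)" using c(2) that by simp
      also have "\<dots> = (\<Sum>j\<in>?J. c j * g i' j - c j * g i j * r)"
        unfolding h_def r_def[symmetric] by (rule sum.cong) (simp_all add: right_diff_distrib mult_ac)
      also have "\<dots> = (\<Sum>j\<in>?J. c j * g i' j) - (\<Sum>j\<in>?J. c j * g i j) * (g i' j0 / g i j0)"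
        by (simp only: sum_subtractf sum_distrib_right r_def)
      finally show ?thesis unfolding split by (simp add: d_def)
    qed
    moreover have "\<exists>j\<in>J. d j \<noteq> 0" using c(1) by (auto simp: d_def)
    ultimately show ?thesis by (intro exI[of _ d]) auto
  qed
qed

context vector_space
begin

text \<open>
  In coordinates with respect to \<open>B\<close>, the required relations are \<open>card T * card B\<close> linear
  equations for \<open>card J\<close> unknowns.
\<close>

lemma common_relation:
  assumes fin: "finite J" "finite T" "finite B" and sp: "\<And>t j. t \<in> T \<Longrightarrow> j \<in> J \<Longrightarrow> f t j \<in> span B"
    and card: "card T * card B < card J"
  shows "\<exists>c. (\<exists>j\<in>J. c j \<noteq> 0) \<and> (\<forall>t\<in>T. (\<Sum>j\<in>J. scale (c j) (f t j)) = 0)"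
proof -
  have "\<exists>g. f t j = (\<Sum>b\<in>B. scale (g b) b)" if "t \<in> T" "j \<in> J" for t j
    using sp[OF that] unfolding span_finite[OF fin(3)] by blast
  then obtain g where g: "\<And>t j. t \<in> T \<Longrightarrow> j \<in> J \<Longrightarrow> f t j = (\<Sum>b\<in>B. scale (g t j b) b)" by metis
  have "card (T \<times> B) < card J" using card by (simp add: card_cartesian_product)
  then obtain c where c: "\<exists>j\<in>J. c j \<noteq> 0" "\<forall>i\<in>T \<times> B. (\<Sum>j\<in>J. c j * (case i of (t, b) \<Rightarrow> g t j b)) = 0"
    using homogeneous_system[of "T \<times> B" J "\<lambda>i j. case i of (t, b) \<Rightarrow> g t j b"] fin by auto
  have "(\<Sum>j\<in>J. scale (c j) (f t j)) = 0" if t: "t \<in> T" for t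
  proof -
    have "(\<Sum>j\<in>J. scale (c j) (f t j)) = (\<Sum>j\<in>J. \<Sum>b\<in>B. scale (c j * g t j b) b)"
      using g[OF t] by (simp add: scale_sum_right)
    also have "\<dots> = (\<Sum>b\<in>B. \<Sum>j\<in>J. scale (c j * g t j b) b)" by (rule sum.swap)
    also have "\<dots> = (\<Sum>b\<in>B. scale (\<Sum>j\<in>J. c j * g t j b) b)" by (simp add: scale_sum_left)
    also have "\<dots> = 0" using c(2) t by (intro sum.neutral) auto
    finally show ?thesis .
  qed
  then show ?thesis using c(1) by blast
qed

end

text \<open>
  The exponents in \<open>m\<close> variables whose entries are at most \<open>d\<close>.
\<close>

definition box :: "nat \<Rightarrow> nat \<Rightarrow> (nat \<Rightarrow>\<^sub>0 nat) set" where
  "box m d = (\<lambda>g. Abs_poly_mapping (\<lambda>i. if i < m then g i else 0)) ` (PiE {..<m} (\<lambda>_. {..d}))"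

lemma lookup_box_Abs: "Poly_Mapping.lookup (Abs_poly_mapping (\<lambda>i. if i < m then g i else 0)) = (\<lambda>i. if i < m then g i else (0::nat))"
  for m :: nat
proof -
  have "finite {i. (if i < m then g i else (0::nat)) \<noteq> 0}"
    by (rule finite_subset[of _ "{..<m}"]) (auto split: if_splits)
  then show ?thesis by (rule lookup_Abs_poly_mapping)
qed

lemma card_box: "card (box m d) = (d + 1) ^ m" and finite_box: "finite (box m d)"
proof -
  have "inj_on (\<lambda>g. Abs_poly_mapping (\<lambda>i. if i < m then g i else (0::nat))) (PiE {..<m} (\<lambda>_. {..d}))"
  proof (rule inj_onI)
    fix g h assume g: "g \<in> PiE {..<m} (\<lambda>_. {..d})" and h: "h \<in> PiE {..<m} (\<lambda>_. {..d})"
      and eq: "Abs_poly_mapping (\<lambda>i. if i < m then g i else 0) = Abs_poly_mapping (\<lambda>i. if i < m then h i else 0)"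
    have "(if i < m then g i else 0) = (if i < m then h i else 0)" for i
      using arg_cong[OF eq, of "\<lambda>e. Poly_Mapping.lookup e i"] by (simp add: lookup_box_Abs)
    then show "g = h" using g h by (intro PiE_ext[of g "{..<m}" "\<lambda>_. {..d}" h]) (auto split: if_splits, metis)
  qed
  then show "card (box m d) = (d + 1) ^ m" unfolding box_def by (simp add: card_image card_PiE)
  show "finite (box m d)" unfolding box_def by (intro finite_imageI finite_PiE) auto
qed

lemma box_lookup:
  assumes "e \<in> box m d"
  shows "Poly_Mapping.lookup e i = 0 \<or> i < m" "Poly_Mapping.lookup e i \<le> d"
proof -
  obtain g where g: "g \<in> PiE {..<m} (\<lambda>_. {..d})" "e = Abs_poly_mapping (\<lambda>i. if i < m then g i else 0)"
    using assms unfolding box_def by blast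
  have "Poly_Mapping.lookup e = (\<lambda>i. if i < m then g i else 0)" unfolding g(2) by (rule lookup_box_Abs)
  then show "Poly_Mapping.lookup e i = 0 \<or> i < m" "Poly_Mapping.lookup e i \<le> d"
    using g(1) by (simp_all add: PiE_iff)
qed

lemma box_keys: "e \<in> box m d \<Longrightarrow> Poly_Mapping.keys e \<subseteq> {..<m}"
  using box_lookup(1)[of e m d] by (metis in_keys_iff lessThan_iff subsetI)

lemma box_sum_le: "e \<in> box m d \<Longrightarrow> (\<Sum>j<m. Poly_Mapping.lookup e j) \<le> m * d"
  using sum_mono[of "{..<m}" "Poly_Mapping.lookup e" "\<lambda>_. d"] box_lookup(2)[of e m d] by simp

definition poly_of :: "nat \<Rightarrow> nat \<Rightarrow> ((nat \<Rightarrow>\<^sub>0 nat) \<Rightarrow> 'k::field) \<Rightarrow> 'k mpoly" where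
  "poly_of m d c = (\<Sum>e\<in>box m d. Poly_Mapping.single e (c e))"

lemma in_vars_poly_of: "in_vars m (poly_of m d c)"
  unfolding poly_of_def by (intro in_vars_sum in_vars_single box_keys)

lemma lookup_poly_of: "e \<in> box m d \<Longrightarrow> Poly_Mapping.lookup (poly_of m d c) e = c e"
proof -
  assume e: "e \<in> box m d"
  have "Poly_Mapping.lookup (poly_of m d c) e = (\<Sum>f\<in>box m d. if f = e then c f else 0)"
    unfolding poly_of_def lookup_sum by (rule sum.cong) (auto simp: lookup_single when_def)
  then show ?thesis using e finite_box by simp
qed

context division_ring_setting
begin

abbreviation m :: nat where "m \<equiv> length xs"

lemma rat_ev_poly_of: "rat_ev (Fract (poly_of m d c) 1) = (\<Sum>e\<in>box m d. \<kappa> (c e) * xmon xs (Poly_Mapping.lookup e))"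
  using rat_ev_poly[OF in_vars_poly_of] by (simp add: poly_of_def ev_sum finite_box ev_single \<kappa>_def)

lemma ev_poly_of: "ev (poly_of m d c) = (\<Sum>e\<in>box m d. \<kappa> (c e) * xmon xs (Poly_Mapping.lookup e))"
  by (simp add: poly_of_def ev_sum finite_box ev_single \<kappa>_def)

lemma alg_generators_tens:
  assumes S: "alg_generators AA (range \<phi>) S"
  shows "alg_generators B k (tens 1 ` S)"
proof -
  let ?H = "k \<union> tens 1 ` S"
  let ?g = "generate_ring B ?H"
  have Hc: "?H \<subseteq> carrier B" using std.k_carrier tens_closed[OF ratfun_one] by auto
  have gc: "?g \<subseteq> carrier B" using B.generate_ring_in_carrier[OF Hc] by blast
  have kg: "tens q 1 \<in> ?g" if "q \<in> ratfun m" for q by (rule generate_ring.incl) (use that in \<open>auto simp: k_eq\<close>)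
  have "tens 1 a \<in> ?g" for a
  proof -
    have "a \<in> generate_ring AA (range \<phi> \<union> S)" using S by (simp add: alg_generators_def)
    then show ?thesis
    proof (induction rule: generate_ring.induct)
      case one then show ?case using generate_ring.one[of B ?H] by (simp add: tens_one)
    next
      case (incl h)
      show ?case
      proof (cases "h \<in> S")
        case True then show ?thesis by (intro generate_ring.incl) auto
      next
        case False
        then obtain c where "h = \<phi> c" using incl by auto
        then have "tens 1 h = tens (rat_const c) 1" using tens_balance[OF ratfun_one, of c 1] by simp
        then show ?thesis using kg[OF ratfun_const] by simp
      qed
    next
      case (a_inv h)
      have "tens 1 (- h) \<oplus>\<^bsub>B\<^esub> tens 1 h = \<zero>\<^bsub>B\<^esub>"
        using tens_add_right[OF ratfun_one, of "- h" h] by (simp add: tens_zero_right[OF ratfun_one])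
      then have "\<ominus>\<^bsub>B\<^esub> tens 1 h = tens 1 (- h)" by (rule B.minus_equality) (intro tens_closed ratfun_one)+
      then show ?case using generate_ring.a_inv[OF a_inv.IH] by simp
    next
      case (eng_add g h) then show ?case using generate_ring.eng_add[of "tens 1 g" B ?H "tens 1 h"] by (simp add: tens_add_right ratfun_one)
    next
      case (eng_mult g h) then show ?case using generate_ring.eng_mult[of "tens 1 g" B ?H "tens 1 h"] by (simp add: tens_mult ratfun_one)
    qed
  qed
  then have tg: "tens q a \<in> ?g" if "q \<in> ratfun m" for q a
    using generate_ring.eng_mult[OF kg[OF that], of "tens 1 a"] that by (simp add: tens_mult ratfun_one)
  have "b \<in> ?g" if b: "b \<in> carrier B" for b
    using b by (induction b rule: tensor_induct) (auto intro: tg generate_ring.eng_add)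
  then have "?g = carrier B" using gc by blast
  then show ?thesis using S tens_closed[OF ratfun_one] by (auto simp: alg_generators_def)
qed

lemma std_filt_tens:
  assumes S: "alg_generators B k S" and SA: "alg_generators AA (range \<phi>) SA"
  shows "\<exists>c\<ge>1. \<forall>i. \<forall>a\<in>std_filt AA (range \<phi>) SA i. \<forall>q\<in>ratfun m. tens q a \<in> std_filt B k S (c * i)"
proof -
  let ?V = "\<lambda>i. {a. tens 1 a \<in> std_filt B k S i}"
  have ex: "\<exists>i. a \<in> ?V i" for a
    using std.std_filt_exhaust[OF S_carrier[OF S] S_gen[OF S] tens_closed[OF ratfun_one]] by blast
  have mono: "?V i \<subseteq> ?V j" if "i \<le> j" for i j using std_filt_monoD[OF S that] by blast
  have "finite (insert 1 SA)" using SA by (simp add: alg_generators_def)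
  then obtain c' where c': "\<forall>x\<in>insert 1 SA. x \<in> ?V c'"
    using finite_in_chain[of "insert 1 SA" ?V] mono ex by blast
  define c where "c = Suc c'"
  have c: "\<forall>x\<in>insert 1 SA. x \<in> ?V c" using c' mono[of c' c] by (auto simp: c_def)
  note sb = std.std_filt_subalgebra[OF S_carrier[OF S]]
  have tphi: "tens 1 (\<phi> d * a) = tens (rat_const d) 1 \<otimes>\<^bsub>B\<^esub> tens 1 a" for d a
    using tens_balance[OF ratfun_one, of d a] by (simp add: tens_mult ratfun_one ratfun_const)
  have sub: "subspace (?V i)" for i
  proof (rule subspaceI)
    show "0 \<in> ?V i" using std.subalgebraD(2)[OF sb[of i]] by (simp add: tens_zero_right[OF ratfun_one])
    show "x + y \<in> ?V i" if "x \<in> ?V i" "y \<in> ?V i" for x y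
      using std.subalgebraD(3)[OF sb[of i], of "tens 1 x" "tens 1 y"] that by (simp add: tens_add_right[OF ratfun_one])
    show "\<phi> d * x \<in> ?V i" if "x \<in> ?V i" for d x
      using std.subalgebraD(5)[OF sb[of i], of "tens (rat_const d) 1" "tens 1 x"] that by (simp add: tphi k_eq ratfun_const)
  qed
  have one: "1 \<in> ?V i" for i using std.std_filt_one[OF S_carrier[OF S]] by (simp add: tens_one)
  have le: "std_filt AA (range \<phi>) SA i \<subseteq> ?V (c * i)" for i
  proof (rule alg.std_filt_le)
    show "subalgebra (range \<phi>) (?V i) AA" for i using sub subalgebra_iff_subspace by simp
    show "x \<otimes>\<^bsub>AA\<^esub> y \<in> ?V (i + j)" if "x \<in> ?V i" "y \<in> ?V j" for i j x y
      using std.std_filt_mult[OF S_carrier[OF S], of "tens 1 x" i "tens 1 y" j] that by (simp add: tens_mult ratfun_one)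
    have "tens 1 (\<phi> d) \<in> k" for d
      using tens_balance[OF ratfun_one, of d 1] ratfun_const by (auto simp: k_eq)
    then show "range \<phi> \<subseteq> ?V 0" by auto
    show "insert \<one>\<^bsub>AA\<^esub> SA \<subseteq> ?V c" using c by auto
  qed simp
  have "tens q a \<in> std_filt B k S (c * i)" if "a \<in> std_filt AA (range \<phi>) SA i" "q \<in> ratfun m" for a q i
  proof -
    have "tens 1 a \<in> std_filt B k S (c * i)" using le that(1) by blast
    then have "tens q 1 \<otimes>\<^bsub>B\<^esub> tens 1 a \<in> std_filt B k S (c * i)"
      using std.subalgebraD(5)[OF sb] that(2) by (simp add: k_eq)
    then show ?thesis using that(2) by (simp add: tens_mult ratfun_one)
  qed
  moreover have "c \<ge> 1" by (simp add: c_def)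
  ultimately show ?thesis by blast
qed

lemma comb_in_subalgebra:
  assumes V: "subalgebra k V B" and E: "finite E" and t: "\<And>e. e \<in> E \<Longrightarrow> tens (f e) e \<in> V"
  shows "comb E f (\<lambda>e. e) \<in> V"
  using E t unfolding comb_def
proof (induction E rule: finite_induct)
  case empty then show ?case using std.subalgebraD(2)[OF V] by simp
next
  case (insert x E)
  have "tens (f e) e \<in> carrier B" if "e \<in> insert x E" for e using insert.prems[OF that] std.subalgebraD(1)[OF V] by blast
  then have "(\<Oplus>\<^bsub>B\<^esub>e\<in>insert x E. tens (f e) e) = tens (f x) x \<oplus>\<^bsub>B\<^esub> (\<Oplus>\<^bsub>B\<^esub>e\<in>E. tens (f e) e)"
    using insert.hyps by (intro B.finsum_insert) auto
  then show ?case using insert std.subalgebraD(3)[OF V] by simp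
qed

text \<open>
  Clearing denominators, this is right linear independence over the field of rational functions
  in \<open>xs\<close>.
\<close>

definition rank_indep :: "'d set \<Rightarrow> bool" where
  "rank_indep T \<longleftrightarrow> (\<forall>f. (\<forall>t\<in>T. in_vars m (f t)) \<and> (\<Sum>t\<in>T. t * ev (f t)) = 0 \<longrightarrow> (\<forall>t\<in>T. f t = 0))"

text \<open>
  The products of the elements of \<open>T\<close> with the \<open>(d + 1)\<^sup>m\<close> monomials in \<open>xs\<close> are linearly
  independent over the ground field.
\<close>

lemma rank_indep_card:
  assumes T: "rank_indep T" "finite T" and B: "finite B0"
    and sp: "\<And>t e. t \<in> T \<Longrightarrow> e \<in> box m d \<Longrightarrow> t * xmon xs (Poly_Mapping.lookup e) \<in> D.span B0"
  shows "card T * (d + 1) ^ m \<le> card B0"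
proof (rule ccontr)
  assume "\<not> ?thesis"
  then have "card {()} * card B0 < card (T \<times> box m d)" by (simp add: card_cartesian_product card_box)
  then obtain c where c: "\<exists>j\<in>T \<times> box m d. c j \<noteq> 0"
      "(\<Sum>j\<in>T \<times> box m d. \<kappa> (c j) * (fst j * xmon xs (Poly_Mapping.lookup (snd j)))) = 0"
    using D.common_relation[of "T \<times> box m d" "{()}" B0 "\<lambda>_ j. fst j * xmon xs (Poly_Mapping.lookup (snd j))"]
      T(2) B finite_box sp by fastforce
  define f where "f t = poly_of m d (\<lambda>e. c (t, e))" for t
  have "(\<Sum>t\<in>T. t * ev (f t)) = (\<Sum>t\<in>T. \<Sum>e\<in>box m d. \<kappa> (c (t, e)) * (t * xmon xs (Poly_Mapping.lookup e)))"
  proof (rule sum.cong[OF refl])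
    fix t
    have "t * (\<kappa> a * v) = \<kappa> a * (t * v)" for a v by (metis D.\<phi>_central mult.assoc)
    then show "t * ev (f t) = (\<Sum>e\<in>box m d. \<kappa> (c (t, e)) * (t * xmon xs (Poly_Mapping.lookup e)))"
      by (simp add: f_def ev_poly_of sum_distrib_left)
  qed
  also have "\<dots> = 0" using c(2) unfolding sum.cartesian_product by (simp add: case_prod_unfold)
  finally have "(\<Sum>t\<in>T. t * ev (f t)) = 0" .
  moreover have "\<forall>t\<in>T. in_vars m (f t)" by (simp add: f_def in_vars_poly_of)
  ultimately have "\<forall>t\<in>T. f t = 0" using T(1) unfolding rank_indep_def by blast
  then have "c (t, e) = 0" if "t \<in> T" "e \<in> box m d" for t e
    using lookup_poly_of[OF that(2), of "\<lambda>e. c (t, e)"] that(1) by (simp add: f_def)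
  then show False using c(1) by auto
qed

text \<open>
  Sums of the form \<open>\<Sum> h e * v * \<rho> e\<close> are right linear in \<open>v\<close> over the polynomials in \<open>xs\<close>, since
  \<open>\<rho>\<close> takes values in the commutative field \<open>L\<close>. If they vanish on a maximal independent family,
  then they vanish on everything that depends on it.
\<close>

lemma rank_indep_transfer:
  assumes T: "finite T" "rank_indep T" and max: "v \<notin> T \<Longrightarrow> \<not> rank_indep (insert v T)"
    and E: "\<And>e. \<rho> e \<in> L"
    and zero: "\<And>t. t \<in> T \<Longrightarrow> (\<Sum>e\<in>E. h e * t * \<rho> e) = 0"
  shows "(\<Sum>e\<in>E. h e * v * \<rho> e) = 0"
proof (cases "v \<in> T")
  case False
  then obtain f where f: "\<forall>t\<in>insert v T. in_vars m (f t)" "(\<Sum>t\<in>insert v T. t * ev (f t)) = 0" "\<exists>t\<in>insert v T. f t \<noteq> 0"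
    using max unfolding rank_indep_def by blast
  have sum: "v * ev (f v) + (\<Sum>t\<in>T. t * ev (f t)) = 0" using f(2) False T(1) by simp
  have fv: "f v \<noteq> 0"
  proof
    assume z: "f v = 0"
    then have "(\<Sum>t\<in>T. t * ev (f t)) = 0" using sum by (simp add: ev_zero)
    then show False using T(2) f(1,3) z unfolding rank_indep_def by blast
  qed
  have nz: "ev (f v) \<noteq> 0" using ev_nonzero fv f(1) by simp
  have com: "\<rho> e * ev p = ev p * \<rho> e" for e p by (rule L_comm[OF E ev_L])
  have "(\<Sum>e\<in>E. h e * v * \<rho> e) * ev (f v) = (\<Sum>e\<in>E. h e * (v * ev (f v)) * \<rho> e)"
    by (simp add: sum_distrib_right mult.assoc com)
  also have "v * ev (f v) = - (\<Sum>t\<in>T. t * ev (f t))" using sum by (simp add: eq_neg_iff_add_eq_0)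
  also have "(\<Sum>e\<in>E. h e * - (\<Sum>t\<in>T. t * ev (f t)) * \<rho> e) = - (\<Sum>e\<in>E. \<Sum>t\<in>T. h e * t * \<rho> e * ev (f t))"
    by (simp add: sum_distrib_left sum_distrib_right sum_negf mult.assoc com)
  also have "(\<Sum>e\<in>E. \<Sum>t\<in>T. h e * t * \<rho> e * ev (f t)) = (\<Sum>t\<in>T. (\<Sum>e\<in>E. h e * t * \<rho> e) * ev (f t))"
    by (subst sum.swap) (simp add: sum_distrib_right)
  also have "(\<Sum>t\<in>T. (\<Sum>e\<in>E. h e * t * \<rho> e) * ev (f t)) = 0" using zero by simp
  finally have "(\<Sum>e\<in>E. h e * v * \<rho> e) * ev (f v) = 0" by (simp only: minus_zero)
  then show ?thesis using nz mult_eq_0_iff by blast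
qed (use zero in auto)

text \<open>
  Let \<open>u\<close> be a vector for which the products of \<open>F\<^sub>d u\<close> with the monomials in \<open>xs\<close> of degree at
  most \<open>d\<close> in each variable span a space of dimension \<open>O(d\<^sup>n)\<close> over the ground field. As there
  are \<open>(d + 1)\<^sup>m\<close> monomials, the rank of \<open>F\<^sub>d u\<close> over the polynomials in \<open>xs\<close> is \<open>O(d\<^sup>n\<^sup>-\<^sup>m)\<close>.

  Consider elements \<open>b = \<Sum> p\<^sub>e \<otimes> e\<close> of \<open>B\<close>, where \<open>e\<close> runs through a basis of the \<open>i\<close>-th piece of
  the algebra and the \<open>p\<^sub>e\<close> are polynomials with exponents at most \<open>d\<close>. They lie in a piece of
  degree \<open>c1 * i\<close> of the standard filtration of \<open>B\<close>. Let \<open>l\<close> be a degree such that \<open>F\<^sub>l\<close> spans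
  the piece of degree \<open>\<nu> (c1 * i)\<close> over the rational functions. By lemma \<open>faithful\<close> no \<open>b \<noteq> 0\<close>
  annihilates \<open>F\<^sub>l u\<close>. On the other hand, \<open>b\<close> annihilates \<open>F\<^sub>l u\<close> as soon as it annihilates a
  maximal independent family in it, which has \<open>O(l\<^sup>n\<^sup>-\<^sup>m)\<close> elements, and for each of them the
  condition amounts to \<open>O(d\<^sup>n)\<close> linear equations between the coefficients, provided that \<open>d\<close> is
  at least \<open>l\<close> plus the degree of the basis. The number of coefficients is \<open>(d + 1)\<^sup>m\<close> times the
  dimension of the \<open>i\<close>-th piece, so this dimension is \<open>O(l\<^sup>n\<^sup>-\<^sup>m d\<^sup>n\<^sup>-\<^sup>m)\<close>.
\<close>

theorem filter_inequality:
  assumes n: "n \<ge> 1" and up: "\<And>i. \<exists>B. finite B \<and> card B \<le> C * (i+1)^n \<and> F i \<subseteq> span B"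
    and S: "alg_generators B k S" and SA: "alg_generators AA (range \<phi>) SA"
    and c0: "\<And>i. std_filt AA (range \<phi>) SA i \<subseteq> F (c0 * i)"
  shows "m \<le> n" and "\<exists>C1 c1 c2. c1 \<ge> 1 \<and> (\<forall>\<nu> i. \<nu> = nu B k S \<or> \<nu> = lam B k S \<longrightarrow>
     dim (std_filt AA (range \<phi>) SA i) \<le> C1 * (c2 * \<nu> (c1 * i) + 1)^(n-m) * (c0 * i + c2 * \<nu> (c1 * i) + 1)^(n-m))"
proof -
  have xc: "x * y = y * x" if "x \<in> set xs" "y \<in> set xs" for x y using L_comm xs_L that by blast
  have "\<exists>u C'. u \<noteq> 0 \<and> (\<forall>i. \<exists>B. finite B \<and> card B \<le> C' * (i+1)^n \<and>
    (\<forall>l a e. a \<in> F l \<and> l + (\<Sum>j<length xs. e j) \<le> i \<longrightarrow> \<iota> a * u * xmon xs e \<in> D.span B))"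
    by (rule bounded_growth_with_commuting_elements[OF n up xc])
  then obtain u C' where u: "u \<noteq> 0" and C': "\<And>i. \<exists>B. finite B \<and> card B \<le> C' * (i+1)^n \<and>
    (\<forall>l a e. a \<in> F l \<and> l + (\<Sum>j<length xs. e j) \<le> i \<longrightarrow> \<iota> a * u * xmon xs e \<in> D.span B)"
    by (elim exE conjE) (rule that, assumption, erule spec)
  \<comment> \<open>exponents at most \<open>d\<close> in \<open>m\<close> variables have total degree at most \<open>m * d\<close>\<close>
  define Q where "Q = C' * (m + 1)^n"
  have C'': "\<exists>B. finite B \<and> card B \<le> Q * (d+1)^n \<and>
    (\<forall>a\<in>F d. \<forall>e\<in>box m d. \<iota> a * u * xmon xs (Poly_Mapping.lookup e) \<in> D.span B)" for d
  proof -
    obtain B0 where B0: "finite B0" "card B0 \<le> C' * (d + m * d + 1)^n"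
      "\<And>l a e. a \<in> F l \<Longrightarrow> l + (\<Sum>j<length xs. e j) \<le> d + m * d \<Longrightarrow> \<iota> a * u * xmon xs e \<in> D.span B0"
      using C'[of "d + m * d"] by blast
    have "C' * (d + m * d + 1)^n \<le> C' * ((m + 1) * (d + 1))^n" by (intro mult_left_mono power_mono) auto
    also have "\<dots> = Q * (d + 1)^n" by (simp only: Q_def power_mult_distrib mult.assoc)
    finally have "card B0 \<le> Q * (d+1)^n" using B0(2) by simp
    moreover have "\<iota> a * u * xmon xs (Poly_Mapping.lookup e) \<in> D.span B0" if "a \<in> F d" "e \<in> box m d" for a e
      using B0(3)[OF that(1)] box_sum_le[OF that(2)] by simp
    ultimately show ?thesis using B0(1) by blast
  qed
  have rank: "card T * (d+1)^m \<le> Q * (d+1)^n" if T: "rank_indep T" "finite T" "T \<subseteq> {\<iota> a * u | a. a \<in> F d}" for T d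
  proof -
    obtain B0 where B0: "finite B0" "card B0 \<le> Q * (d+1)^n"
      "\<forall>a\<in>F d. \<forall>e\<in>box m d. \<iota> a * u * xmon xs (Poly_Mapping.lookup e) \<in> D.span B0"
      using C'' by blast
    have "card T * (d+1)^m \<le> card B0" by (rule rank_indep_card[OF T(1,2) B0(1)]) (use T(3) B0(3) in auto)
    then show ?thesis using B0(2) by simp
  qed
  have ru: "rank_indep {u}"
    unfolding rank_indep_def using u ev_nonzero by auto
  \<comment> \<open>the rank of \<open>F\<^sub>d u\<close> is at least \<open>1\<close>, which already forces \<open>m \<le> n\<close>\<close>
  have "(d+1)^m \<le> Q * (d+1)^n" for d
    using rank[OF ru, of d] F_one F_mono[of 0 d] \<iota>_one by force
  then have "\<forall>\<^sub>F d in sequentially. real (d + 1) powr real m \<le> real Q * real (d + 1) powr real n"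
  proof (intro always_eventually allI)
    fix d
    have "real ((d+1)^m) \<le> real (Q * (d+1)^n)" using \<open>\<And>d. (d+1)^m \<le> Q * (d+1)^n\<close> by (simp only: of_nat_le_iff)
    then show "real (d + 1) powr real m \<le> real Q * real (d + 1) powr real n"
      by (simp add: powr_realpow del: of_nat_Suc of_nat_add)
  qed
  from powr_exponent_le[OF this] show mn: "m \<le> n" by simp
  have rank': "card T \<le> Q * (d+1)^(n-m)" if T: "rank_indep T" "finite T" "T \<subseteq> {\<iota> a * u | a. a \<in> F d}" for T d
  proof -
    have "(d+1)^n = (d+1)^(n-m) * (d+1)^m" using mn by (simp add: power_add[symmetric])
    then have "card T * (d+1)^m \<le> (Q * (d+1)^(n-m)) * (d+1)^m" using rank[OF T] by (simp only: mult.assoc)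
    then show ?thesis by simp
  qed
  obtain c1 where c1: "c1 \<ge> 1" "\<And>i a q. a \<in> std_filt AA (range \<phi>) SA i \<Longrightarrow> q \<in> ratfun m \<Longrightarrow> tens q a \<in> std_filt B k S (c1 * i)"
    using std_filt_tens[OF S SA] by blast
  obtain c2 where c2: "\<And>i. std_filt B k S i \<subseteq> extend (F (c2 * i))" using std_filt_extend[OF S] by blast
  have "dim (std_filt AA (range \<phi>) SA i) \<le> Q * Q * (c2 * \<nu> (c1 * i) + 1)^(n-m) * (c0 * i + c2 * \<nu> (c1 * i) + 1)^(n-m)"
    if \<nu>: "\<nu> = nu B k S \<or> \<nu> = lam B k S" for \<nu> i
  proof -
    define l where "l = c2 * \<nu> (c1 * i)"
    define d where "d = c0 * i + l"
    let ?A = "std_filt AA (range \<phi>) SA i"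
    obtain E where E: "E \<subseteq> ?A" "independent E" "?A \<subseteq> span E" "card E = dim ?A" using basis_exists by blast
    obtain B1 where "finite B1" "F (c0 * i) \<subseteq> span B1" using F_fin by blast
    then have finE: "finite E" using independent_span_bound[OF _ E(2)] E(1) c0[of i] by blast
    \<comment> \<open>a maximal independent family in the piece of degree \<open>l\<close>\<close>
    let ?P = "\<lambda>T. rank_indep T \<and> finite T \<and> T \<subseteq> {\<iota> a * u | a. a \<in> F l}"
    have P0: "?P {}" by (simp add: rank_indep_def)
    have bd: "\<forall>T. ?P T \<longrightarrow> card T < Q * (l+1)^(n-m) + 1" using rank' by (simp add: less_Suc_eq_le)
    have "\<exists>T. ?P T \<and> (\<forall>T'. ?P T' \<longrightarrow> card T' \<le> card T)"
      by (rule Lattices_Big.ex_has_greatest_nat[of ?P "{}" card, OF P0 bd])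
    then obtain T where T: "?P T" "\<And>T'. ?P T' \<Longrightarrow> card T' \<le> card T" by blast
    have maxT: "\<not> rank_indep (insert v T)" if v: "v \<notin> T" "v \<in> {\<iota> a * u | a. a \<in> F l}" for v
    proof
      assume "rank_indep (insert v T)"
      then have "card (insert v T) \<le> card T" using T v(2) by (intro T(2)) auto
      then show False using v(1) T(1) by simp
    qed
    \<comment> \<open>otherwise there are more coefficients than equations, and a nonzero \<open>b\<close>
      annihilates \<open>F l u\<close>\<close>
    have key: "card E * (d+1)^m \<le> card T * (Q * (d+1)^n)"
    proof (rule ccontr)
      assume neg: "\<not> ?thesis"
      obtain B0 where B0: "finite B0" "card B0 \<le> Q * (d+1)^n"
        "\<forall>a\<in>F d. \<forall>e\<in>box m d. \<iota> a * u * xmon xs (Poly_Mapping.lookup e) \<in> D.span B0"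
        using C'' by blast
      have "card T * card B0 \<le> card T * (Q * (d+1)^n)" using B0(2) by simp
      also have "\<dots> < card E * (d+1)^m" using neg by (simp only: not_le)
      finally have lt: "card T * card B0 < card (E \<times> box m d)" by (simp only: card_cartesian_product card_box)
      have sp: "\<iota> (fst j) * t * xmon xs (Poly_Mapping.lookup (snd j)) \<in> D.span B0" if t: "t \<in> T" and j: "j \<in> E \<times> box m d" for t j
      proof -
        obtain a where a: "t = \<iota> a * u" "a \<in> F l" using T(1) t by blast
        have "fst j * a \<in> F d" unfolding d_def using j E(1) c0[of i] a(2) by (intro F_mult) auto
        then show ?thesis using B0(3) j a(1) by (auto simp: \<iota>_mult mult.assoc)
      qed
      obtain c where c: "\<exists>j\<in>E \<times> box m d. c j \<noteq> 0"
        "\<forall>t\<in>T. (\<Sum>j\<in>E \<times> box m d. \<kappa> (c j) * (\<iota> (fst j) * t * xmon xs (Poly_Mapping.lookup (snd j)))) = 0"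
        using D.common_relation[of "E \<times> box m d" T B0 "\<lambda>t j. \<iota> (fst j) * t * xmon xs (Poly_Mapping.lookup (snd j))"]
          finE finite_box T(1) B0(1) sp lt by blast
      define p where "p e = poly_of m d (\<lambda>f. c (e, f))" for e
      define f where "f e = Fract (p e) 1" for e
      have fr: "f e \<in> ratfun m" for e unfolding f_def p_def by (intro ratfun_poly in_vars_poly_of)
      have zero: "(\<Sum>e\<in>E. \<iota> e * t * rat_ev (f e)) = 0" if t: "t \<in> T" for t
      proof -
        have "(\<Sum>e\<in>E. \<iota> e * t * rat_ev (f e)) = (\<Sum>e\<in>E. \<Sum>g\<in>box m d. \<kappa> (c (e, g)) * (\<iota> e * t * xmon xs (Poly_Mapping.lookup g)))"
        proof (rule sum.cong[OF refl])
          fix e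
          have "\<iota> e * t * (\<kappa> a * v) = \<kappa> a * (\<iota> e * t * v)" for a v by (metis D.\<phi>_central mult.assoc)
          then show "\<iota> e * t * rat_ev (f e) = (\<Sum>g\<in>box m d. \<kappa> (c (e, g)) * (\<iota> e * t * xmon xs (Poly_Mapping.lookup g)))"
            unfolding f_def p_def rat_ev_poly_of by (simp add: sum_distrib_left)
        qed
        also have "\<dots> = 0" using c(2) t unfolding sum.cartesian_product by (simp add: case_prod_unfold)
        finally show ?thesis .
      qed
      have kill: "kills (comb E f (\<lambda>e. e)) (\<iota> a * u)" if a: "a \<in> F l" for a
      proof (rule kills_comb[OF finE fr])
        show "(\<Sum>e\<in>E. \<iota> e * (\<iota> a * u) * rat_ev (f e)) = 0"
        proof (rule rank_indep_transfer[where T = T])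
          show "\<not> rank_indep (insert (\<iota> a * u) T)" if "\<iota> a * u \<notin> T" using maxT[OF that] a by blast
        qed (use T(1) rat_ev_L[OF fr] zero in auto)
      qed
      obtain e g where eg: "e \<in> E" "g \<in> box m d" "c (e, g) \<noteq> 0" using c(1) by auto
      have "p e \<noteq> 0" using lookup_poly_of[OF eg(2), of "\<lambda>f. c (e, f)"] eg(3) by (auto simp: p_def)
      then have fe: "f e \<noteq> 0" by (simp add: f_def Zero_fract_def eq_fract)
      have "comb E f (\<lambda>e. e) \<in> std_filt B k S (c1 * i)"
        by (rule comb_in_subalgebra[OF std.std_filt_subalgebra[OF S_carrier[OF S]] finE]) (use c1(2) fr E(1) in blast)
      moreover have "comb E f (\<lambda>e. e) \<noteq> \<zero>\<^bsub>B\<^esub>" by (rule comb_nonzero[where f = f and e = e and E = E, OF S finE E(2) fr eg(1) fe])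
      ultimately have b: "comb E f (\<lambda>e. e) \<in> std_filt B k S (c1 * i) - {\<zero>\<^bsub>B\<^esub>}" by blast
      have "u = 0" by (rule faithful[OF S b \<nu>, of "F l" u]) (use c2 kill in \<open>auto simp: l_def\<close>)
      then show False using u by simp
    qed
    have "(d+1)^n = (d+1)^(n-m) * (d+1)^m" using mn by (simp add: power_add[symmetric])
    then have "card E * (d+1)^m \<le> (card T * (Q * (d+1)^(n-m))) * (d+1)^m" using key by (simp only: mult.assoc)
    then have "card E \<le> card T * (Q * (d+1)^(n-m))" by simp
    also have "\<dots> \<le> (Q * (l+1)^(n-m)) * (Q * (d+1)^(n-m))" using rank'[of T l] T(1) by (intro mult_right_mono) auto
    finally show ?thesis unfolding E(4) l_def d_def by (simp only: mult_ac)
  qed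
  then show "\<exists>C1 c1 c2. c1 \<ge> 1 \<and> (\<forall>\<nu> i. \<nu> = nu B k S \<or> \<nu> = lam B k S \<longrightarrow>
     dim (std_filt AA (range \<phi>) SA i) \<le> C1 * (c2 * \<nu> (c1 * i) + 1)^(n-m) * (c0 * i + c2 * \<nu> (c1 * i) + 1)^(n-m))"
    using c1(1) by blast
qed

end

section \<open>Transcendence degrees of subfields\<close>

text \<open>
  For every \<open>s\<close> above the order of growth of \<open>\<nu>\<close>, the two factors on the right grow at most like
  the powers \<open>p * s\<close> and \<open>p * max s 1\<close> of \<open>k\<close>; then \<open>s\<close> tends to \<open>f\<close>.
\<close>

lemma exponent_le_of_growth:
  fixes \<nu> :: "nat \<Rightarrow> nat" and C1 c c0 c2 n p :: nat and f :: real
  assumes bound: "\<And>k. (k+1)^n \<le> C1 * (c2 * \<nu> (c * (k+1)) + 1)^p * (c0 * (k+1) + c2 * \<nu> (c * (k+1)) + 1)^p"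
    and c: "c \<ge> 1" and growth: "growth \<nu> \<le> ereal f"
  shows "real n \<le> real p * (f + max f 1)"
proof (rule field_le_epsilon)
  fix \<epsilon> :: real assume \<epsilon>: "\<epsilon> > 0"
  define e where "e = \<epsilon> / (2 * (real p + 1))"
  have e: "e > 0" using \<epsilon> by (simp add: e_def)
  define s where "s = f + e"
  have gs: "growth \<nu> < ereal s" using growth e by (auto simp: s_def intro: le_less_trans)
  have s0: "0 \<le> s" by (rule growth_less_D(2)[OF gs])
  define M where "M = max s 1"
  define D where "D = real c2 * real c powr s"
  have D0: "D \<ge> 0" by (simp add: D_def)
  have lim: "filterlim (\<lambda>k. c * (k + 1)) at_top sequentially"
    by (rule filterlim_at_top_mono[OF filterlim_ident]) (use c in \<open>auto intro!: always_eventually simp: trans_le_add2\<close>)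
  have "\<forall>\<^sub>F k in sequentially. real (\<nu> (c * (k + 1))) \<le> real (c * (k + 1)) powr s"
    using filterlim_iff[THEN iffD1, OF lim] growth_less_D(1)[OF gs] by blast
  then have "\<forall>\<^sub>F k in sequentially. real (k + 1) powr real n
      \<le> (real C1 * (D + 1)^p * (real c0 + D + 1)^p) * real (k + 1) powr (real p * (s + M))"
  proof eventually_elim
    case (elim k)
    define t where "t = real (k + 1)"
    have t: "t \<ge> 1" by (simp add: t_def)
    have ts: "t powr s \<ge> 1" using t s0 by (rule ge_one_powr_ge_zero)
    have tM: "t powr s \<le> t powr M" "t \<le> t powr M" "1 \<le> t powr M"
      using powr_mono[of s M t] powr_mono[of 1 M t] powr_mono[of 0 M t] t by (auto simp: M_def)
    have c2: "real c2 * real (\<nu> (c * (k + 1))) \<le> D * t powr s"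
    proof -
      have "real (\<nu> (c * (k + 1))) \<le> real c powr s * t powr s"
        using elim by (simp only: t_def of_nat_mult powr_mult of_nat_0_le_iff)
      then have "real c2 * real (\<nu> (c * (k + 1))) \<le> real c2 * (real c powr s * t powr s)" by (rule mult_left_mono) simp
      then show ?thesis by (simp only: D_def mult.assoc)
    qed
    have a: "real c2 * real (\<nu> (c * (k + 1))) + 1 \<le> (D + 1) * t powr s"
      using c2 ts by (simp add: algebra_simps)
    have "real c0 * t \<le> real c0 * t powr M" "D * t powr s \<le> D * t powr M"
      using tM D0 by (auto intro: mult_left_mono)
    then have b: "real c0 * t + real c2 * real (\<nu> (c * (k + 1))) + 1 \<le> (real c0 + D + 1) * t powr M"
      using c2 tM(3) unfolding distrib_right by linarith
    have "real ((k+1)^n) \<le> real (C1 * (c2 * \<nu> (c * (k+1)) + 1)^p * (c0 * (k+1) + c2 * \<nu> (c * (k+1)) + 1)^p)"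
      using bound[of k] by (simp only: of_nat_le_iff)
    also have "\<dots> = real C1 * (real c2 * real (\<nu> (c * (k+1))) + 1)^p * (real c0 * t + real c2 * real (\<nu> (c * (k + 1))) + 1)^p"
      by (simp only: of_nat_mult of_nat_power of_nat_add of_nat_1 t_def)
    also have "\<dots> \<le> real C1 * ((D + 1) * t powr s)^p * ((real c0 + D + 1) * t powr M)^p"
      using a b t D0 by (intro mult_mono power_mono) (auto intro!: mult_nonneg_nonneg add_nonneg_nonneg)
    also have "\<dots> = (real C1 * (D + 1)^p * (real c0 + D + 1)^p) * ((t powr s * t powr M) ^ p)"
      by (simp only: power_mult_distrib mult_ac)
    also have "(t powr s * t powr M) ^ p = t powr (real p * (s + M))"
      using t by (simp add: powr_add[symmetric] powr_realpow[symmetric] powr_powr mult.commute add.commute)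
    finally have "real ((k+1)^n) \<le> (real C1 * (D + 1)^p * (real c0 + D + 1)^p) * t powr (real p * (s + M))" .
    moreover have "real ((k+1)^n) = t powr real n" using t by (simp add: t_def powr_realpow)
    ultimately show ?case by (simp only: t_def)
  qed
  then have "real n \<le> real p * (s + M)" by (rule powr_exponent_le)
  also have "\<dots> \<le> real p * (f + max f 1 + 2 * e)" using e by (intro mult_left_mono) (auto simp: s_def M_def)
  also have "\<dots> \<le> real p * (f + max f 1) + \<epsilon>"
  proof -
    have "real p * (2 * e) \<le> (real p + 1) * (2 * e)" using e by (intro mult_right_mono) auto
    also have "\<dots> = \<epsilon>" by (simp add: e_def field_simps)
    finally show ?thesis by (simp add: distrib_left)
  qed
  finally show "real n \<le> real p * (f + max f 1) + \<epsilon>" .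
qed

lemma ereal_bound_of_exponent:
  fixes f :: ereal and m n :: nat
  assumes mn: "m \<le> n" and f: "f \<ge> 0"
    and real: "\<And>r. f = ereal r \<Longrightarrow> real n \<le> real (n - m) * (r + max r 1)"
  shows "ereal (real m) \<le> ereal (real n) * (1 - 1 / (f + max f 1))"
proof (cases f)
  case (real r)
  then have r: "r \<ge> 0" using f by simp
  define h where "h = r + max r 1"
  have h: "h \<ge> 1" using r by (auto simp: h_def max_def)
  have "real n \<le> (real n - real m) * h" using assms(3)[OF real] mn by (simp add: h_def of_nat_diff)
  then have "real m \<le> real n * (1 - 1 / h)" using h by (simp add: field_simps)
  moreover have "f + max f 1 = ereal h" by (cases "r \<le> 1") (auto simp: real h_def one_ereal_def max_def)
  moreover have "1 / ereal h = ereal (1 / h)" using h by (simp add: one_ereal_def)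
  ultimately show ?thesis by (simp add: one_ereal_def)
next
  case PInf
  then show ?thesis using mn by simp
next
  case MInf
  then show ?thesis using f by simp
qed

theorem theorem1p7:
  fixes \<phi> :: "'k::field \<Rightarrow> 'a::ring_1_no_zero_divisors"
    and \<iota> :: "'a \<Rightarrow> 'd::division_ring"
    and L :: "'d set"
  defines "A \<equiv> (ring_of_type_algebra :: 'a ring)"
    and "D \<equiv> (ring_of_type_algebra :: 'd ring)"
  assumes algebra: "\<phi> \<in> ring_hom ring_of_type_algebra A"
    and central: "range \<phi> = centre A"
    and simple: "simple_ring A"
    and somewhat_comm: "somewhat_commutative A (range \<phi>)"
    and infinite_dim: "\<not> ring.finite_dimension A (range \<phi>) (carrier A)"
    and quotient: "quotient_division_ring \<iota>"
    and subfield: "subfield L D"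
    and contains: "range (\<iota> \<circ> \<phi>) \<subseteq> L"
    and dim: "d = filter_dim \<or> d = left_filter_dim"
  shows "trdeg (\<iota> \<circ> \<phi>) L \<le>
    gk_dim A (range \<phi>) * (1 - 1 / (max_dim d \<phi> + max (max_dim d \<phi>) 1))"
proof -
  have centre: "centre (ring_of_type_algebra :: 'a ring) = range \<phi>" using central by (simp add: A_def)
  interpret central_simple_algebra \<phi>
  proof
    show "\<phi> (c + e) = \<phi> c + \<phi> e" "\<phi> (c * e) = \<phi> c * \<phi> e" for c e
      using ring_hom_add[OF algebra] ring_hom_mult[OF algebra] by (simp_all add: A_def)
    show "\<phi> 1 = 1" using ring_hom_one[OF algebra] by (simp add: A_def)
    have "\<phi> c \<in> centre (ring_of_type_algebra :: 'a ring)" for c using centre by blast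
    then show "\<phi> c * x = x * \<phi> c" for c x by (simp add: centre_def)
    show "simple_ring (ring_of_type_algebra :: 'a ring)" using simple by (simp add: A_def)
    show "centre (ring_of_type_algebra :: 'a ring) = range \<phi>" by (rule centre)
  qed
  have A: "A = AA" by (simp add: A_def)
  obtain F :: "nat \<Rightarrow> 'a set" and N z w where "commutatively_filtered \<phi> F N z w"
    using somewhat_commutative_filtered somewhat_comm unfolding A_def by blast
  then interpret CF: commutatively_filtered \<phi> F N z w .
  obtain n C where n: "n \<ge> 1" and up: "\<And>i. \<exists>B. finite B \<and> card B \<le> C * (i+1)^n \<and> F i \<subseteq> span B"
    and gr: "\<And>S. alg_generators AA (range \<phi>) S \<Longrightarrow> \<exists>c\<ge>1. (\<forall>k. (k+1)^n \<le> dim (std_filt AA (range \<phi>) S (c * (k+1)))) \<and>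
        (\<forall>i. std_filt AA (range \<phi>) S i \<subseteq> F (c * i))"
    using CF.growth_exponent infinite_dim unfolding A_def rta_simps by metis
  define SA where "SA = some_generators AA (range \<phi>)"
  have SA: "alg_generators AA (range \<phi>) SA"
    unfolding SA_def some_generators_def by (rule someI[of _ "z ` {..<N}"]) (rule CF.alg_generators_z)
  obtain c where c: "c \<ge> 1" and lower: "\<And>k. (k+1)^n \<le> dim (std_filt AA (range \<phi>) SA (c * (k+1)))"
    and upper: "\<And>i. std_filt AA (range \<phi>) SA i \<subseteq> F (c * i)"
    using gr[OF SA] by blast
  have gk: "gk_dim AA (range \<phi>) = ereal (real n)"
    by (rule CF.gk_dim_eq[OF up _ _ c]) (use lower upper in \<open>simp_all add: SA_def\<close>)
  define dm where "dm m = d (rat_tensor m \<phi>) (rat_tensor_scalars m \<phi>)" for m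
  have dm_nonneg: "dm m \<ge> 0" for m
    using dim by (auto simp: dm_def filter_dim_def left_filter_dim_def growth_nonneg)
  \<comment> \<open>the Gelfand--Kirillov dimension is the integer \<open>n\<close>, so the maximum is over
    \<open>m \<le> n\<close> and is attained\<close>
  have max: "max_dim d \<phi> = Max (dm ` {..n})"
    unfolding max_dim_def gk dm_def by (rule arg_cong[where f = Max]) auto
  have dm_le: "dm m \<le> max_dim d \<phi>" if "m \<le> n" for m
    unfolding max using that by (intro Max_ge) auto
  have max_nonneg: "max_dim d \<phi> \<ge> 0" using dm_le[of 0] dm_nonneg[of 0] by (meson le0 order_trans)
  interpret R: ring "ring_of_type_algebra :: 'd ring" by (rule ring_rta)
  have sf: "subfield L (ring_of_type_algebra :: 'd ring)" using subfield by (simp add: D_def)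
  show ?thesis
    unfolding A gk trdeg_def
  proof (rule SUP_least)
    fix xs assume "xs \<in> {xs. set xs \<subseteq> L \<and> alg_independent (\<iota> \<circ> \<phi>) xs}"
    then have xs: "set xs \<subseteq> L" "alg_independent (\<iota> \<circ> \<phi>) xs" by simp_all
    let ?m = "length xs"
    have \<iota>: "\<iota> (a + b) = \<iota> a + \<iota> b" "\<iota> (a * b) = \<iota> a * \<iota> b" "\<iota> 1 = 1" for a b
      using quotient by (auto simp: quotient_division_ring_def ring_hom_def)
    have comm_L: "x * y = y * x" if "x \<in> L" "y \<in> L" for x y
      using subfieldE(4)[OF sf] that by simp
    have inv_L: "inverse x \<in> L" if x: "x \<in> L" "x \<noteq> 0" for x
    proof -
      have "x \<in> L - {\<zero>\<^bsub>ring_of_type_algebra\<^esub>}" using x by simp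
      then obtain y where y: "y \<in> L" "x * y = 1"
        using subfield.subfield_Units[OF sf] unfolding Units_def by auto
      then show ?thesis using inverse_unique[of x y] x(2) by simp
    qed
    interpret division_ring_setting \<phi> F N z w \<iota> xs L
    proof (intro division_ring_setting.intro fraction_ring.intro fraction_ring_axioms.intro
        subfield_elements.intro scalar_extension.intro)
      show "commutatively_filtered \<phi> F N z w" "central_simple_algebra \<phi>" "central_algebra \<phi>" by unfold_locales
      show "quotient_division_ring \<iota>" by (rule quotient)
      show "(\<iota> \<circ> \<phi>) (x + y) = (\<iota> \<circ> \<phi>) x + (\<iota> \<circ> \<phi>) y" "(\<iota> \<circ> \<phi>) (x * y) = (\<iota> \<circ> \<phi>) x * (\<iota> \<circ> \<phi>) y"
        "(\<iota> \<circ> \<phi>) 1 = 1" for x y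
        by (simp_all add: \<phi>_add \<phi>_mult \<phi>_one \<iota>)
      show "(\<iota> \<circ> \<phi>) x \<in> L" for x using contains by blast
      show "x + y \<in> L" if "x \<in> L" "y \<in> L" for x y using subringE(7)[OF subfieldE(1)[OF sf]] that by simp
      show "x * y \<in> L" if "x \<in> L" "y \<in> L" for x y using subringE(6)[OF subfieldE(1)[OF sf]] that by simp
    qed (use xs comm_L inv_L in auto)
    define S where "S = some_generators B k"
    have S: "alg_generators B k S"
      unfolding S_def some_generators_def by (rule someI) (rule alg_generators_tens[OF SA])
    have mn: "?m \<le> n" by (rule filter_inequality(1)[OF n up S SA upper])
    obtain C1 c1 c2 where c1: "c1 \<ge> 1" and ineq: "\<And>\<nu> i. \<nu> = nu B k S \<or> \<nu> = lam B k S \<Longrightarrow>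
        dim (std_filt AA (range \<phi>) SA i) \<le> C1 * (c2 * \<nu> (c1 * i) + 1)^(n-?m) * (c * i + c2 * \<nu> (c1 * i) + 1)^(n-?m)"
      using filter_inequality(2)[OF n up S SA upper] by blast
    obtain \<nu> where \<nu>: "\<nu> = nu B k S \<or> \<nu> = lam B k S" "dm ?m = growth \<nu>"
      using dim
    proof
      assume "d = filter_dim"
      then show ?thesis using that[of "nu B k S"] by (simp add: dm_def filter_dim_def S_def)
    next
      assume "d = left_filter_dim"
      then show ?thesis using that[of "lam B k S"] by (simp add: dm_def left_filter_dim_def S_def)
    qed
    show "ereal (real ?m) \<le> ereal (real n) * (1 - 1 / (max_dim d \<phi> + max (max_dim d \<phi>) 1))"
    proof (rule ereal_bound_of_exponent[OF mn max_nonneg])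
      fix r assume r: "max_dim d \<phi> = ereal r"
      show "real n \<le> real (n - ?m) * (r + max r 1)"
      proof (rule exponent_le_of_growth)
        show "growth \<nu> \<le> ereal r" using dm_le[OF mn] by (simp add: \<nu>(2) r)
        show "1 \<le> c1 * c" using c c1 by simp
        show "(k+1)^n \<le> C1 * (c2 * \<nu> (c1 * c * (k+1)) + 1)^(n-?m)
            * (c * c * (k+1) + c2 * \<nu> (c1 * c * (k+1)) + 1)^(n-?m)" for k
        proof -
          have "(k+1)^n \<le> dim (std_filt AA (range \<phi>) SA (c * (k+1)))" by (rule lower)
          also have "\<dots> \<le> C1 * (c2 * \<nu> (c1 * (c * (k+1))) + 1)^(n-?m)
             * (c * (c * (k+1)) + c2 * \<nu> (c1 * (c * (k+1))) + 1)^(n-?m)" by (rule ineq[OF \<nu>(1)])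
          finally show ?thesis by (simp only: mult.assoc)
        qed
      qed
    qed
  qed
qed

end
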